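(* The foliations on the weighted projective plane $\mathbb{P}(1,2,3)$ induced by the reduced Chazy IV, V and VI equations $$\text{(IV)}\quad x'''=3xx''+3(x')^2-3x^2x',$$ $$\text{(V)}\quad x'''=2xx''+4(x')^2-2x^2x',$$ $$\text{(VI)}\quad x'''=xx''+5(x')^2-x^2x'$$ are birationally equivalent to the foliations $\mathcal{F}_3$, $\mathcal{F}_4$ and $\mathcal{F}_6$, respectively.
   Context: All foliations are singular holomorphic foliations by curves on complex surfaces. Two foliated surfaces are birationally equivalent if there is a birational map between the surfaces taking one foliation to the other. Foliations induced by the Chazy equations: $\mathbb{P}(1,2,3)$ is the quotient of $\mathbb{C}^3\setminus\{0\}$ by the $\mathbb{C}^*$-action $(x,y,z)\mapsto(\lambda x,\lambda^2y,\lambda^3z)$. Each of the equations has the form $x'''=P(x,x',x'')$, with $P(\lambda x,\lambda^2y,\lambda^3z)=\lambda^4P(x,y,z)$, and corresponds to the vector field $W=y\,\partial/\partial x+z\,\partial/\partial y+P(x,y,z)\,\partial/\partial z$ on $\mathbb{C}^3$. The action multiplies $W$ by constants, so the foliation of $\mathbb{C}^3$ by the trajectories of $W$ is preserved and induces a foliation on $\mathbb{P}(1,2,3)$. Special quotient foliations: let $\omega$ be a primitive cubic root of unity and $\mathrm{i}=\sqrt{-1}$. $\mathcal{F}_3$ (Brunella's very special foliation): let $\mathcal{E}_3$ be the foliation on $\mathbb{P}^2$ given by $\omega^2YZ\,\mathrm{d}X+\omega XZ\,\mathrm{d}Y+XY\,\mathrm{d}Z=0$; it is preserved by $T_3(X:Y:Z)=(Z:X:Y)$.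 $\mathcal{F}_3$ is the foliation induced by $\mathcal{E}_3$ on the minimal desingularization of $\mathbb{P}^2/\langle T_3\rangle$. $\mathcal{F}_4$ (Santos): let $\mathcal{E}_4$ be the foliation on $\mathbb{P}^1\times\mathbb{P}^1$ given in the affine chart $(X,Y)$ by $Y\,\mathrm{d}X-\mathrm{i}X\,\mathrm{d}Y=0$; it is preserved by the order-four automorphism $T_4(X,Y)=(Y,1/X)$. $\mathcal{F}_4$ is the foliation induced by $\mathcal{E}_4$ on the minimal desingularization of $(\mathbb{P}^1\times\mathbb{P}^1)/\langle T_4\rangle$. $\mathcal{F}_6$ (Santos): let $\mathrm{Bl}_3(\mathbb{P}^2)$ be the blow-up of $\mathbb{P}^2$ at the three points $(1:0:0)$, $(0:1:0)$, $(0:0:1)$, and $\mathcal{E}_6$ the transform of $\mathcal{E}_3$ on it. With $Q(X:Y:Z)=(YZ:ZX:XY)$, the birational map $T_3\circ Q$ induces an order-six biholomorphism $T_6$ of $\mathrm{Bl}_3(\mathbb{P}^2)$ preserving $\mathcal{E}_6$. $\mathcal{F}_6$ is the foliation induced by $\mathcal{E}_6$ on the minimal desingularization of $\mathrm{Bl}_3(\mathbb{P}^2)/\langle T_6\rangle$. *)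

theory Defs
  imports "HOL-Analysis.Analysis"
begin

section \<open>Varieties as spaces with functions\<close>

text \<open>
  Complex algebraic varieties are treated as sets of points with the Zariski topology and the sheaf
  of regular complex-valued functions.  Only the values of \<open>f\<close> on \<open>U\<close> matter for \<open>f \<in> reg X U\<close>.
\<close>

record 'a variety =
  zar :: "'a topology"
  reg :: "'a set \<Rightarrow> ('a \<Rightarrow> complex) set"

abbreviation points :: "('a, 'm) variety_scheme \<Rightarrow> 'a set" where
  "points X \<equiv> topspace (zar X)"

definition morphism :: "'a variety \<Rightarrow> 'b variety \<Rightarrow> ('a \<Rightarrow> 'b) \<Rightarrow> bool" where
  "morphism X Y \<phi> \<longleftrightarrow> continuous_map (zar X) (zar Y) \<phi> \<and>
     (\<forall>V f. openin (zar Y) V \<and> f \<in> reg Y V \<longrightarrow> f \<circ> \<phi> \<in> reg X {p \<in> points X. \<phi> p \<in> V})"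

definition inverse_isomorphisms ::
  "'a variety \<Rightarrow> 'b variety \<Rightarrow> ('a \<Rightarrow> 'b) \<Rightarrow> ('b \<Rightarrow> 'a) \<Rightarrow> bool" where
  "inverse_isomorphisms X Y \<phi> \<psi> \<longleftrightarrow> morphism X Y \<phi> \<and> morphism Y X \<psi> \<and>
     (\<forall>p\<in>points X. \<psi> (\<phi> p) = p) \<and> (\<forall>q\<in>points Y. \<phi> (\<psi> q) = q)"

text \<open>The subvariety structure on an open or closed (or locally closed) subset.\<close>

definition subvariety :: "'a variety \<Rightarrow> 'a set \<Rightarrow> 'a variety" where
  "subvariety X S = \<lparr>zar = subtopology (zar X) S,
     reg = (\<lambda>U. {f. \<forall>p\<in>U. \<exists>V g. openin (zar X) V \<and> p \<in> V \<and> g \<in> reg X V \<and>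
                      (\<forall>q\<in>U \<inter> V. f q = g q)})\<rparr>"

text \<open>
  Geometric quotient by an equivalence relation (always the orbit relation of a group action here):
  quotient topology, and functions whose pull-back to the invariant open set upstairs is regular.
  Points of the quotient are the orbits.
\<close>

definition quotient_open :: "'a variety \<Rightarrow> 'a rel \<Rightarrow> 'a set set \<Rightarrow> bool" where
  "quotient_open X r U \<longleftrightarrow> U \<subseteq> points X // r \<and> openin (zar X) {p \<in> points X. r `` {p} \<in> U}"

lemma istopology_quotient_open: "istopology (quotient_open X r)"
proof -
  have "quotient_open X r (S \<inter> T)" if "quotient_open X r S" "quotient_open X r T" for S T
  proof -
    have "{p \<in> points X. r `` {p} \<in> S \<inter> T} =
          {p \<in> points X. r `` {p} \<in> S} \<inter> {p \<in> points X. r `` {p} \<in> T}" by blast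
    then show ?thesis using that by (auto simp: quotient_open_def intro: openin_Int)
  qed
  moreover have "quotient_open X r (\<Union>\<K>)" if "\<forall>K\<in>\<K>. quotient_open X r K" for \<K>
  proof -
    have "{p \<in> points X. r `` {p} \<in> \<Union>\<K>} = (\<Union>K\<in>\<K>. {p \<in> points X. r `` {p} \<in> K})" by blast
    moreover have "openin (zar X) (\<Union>K\<in>\<K>. {p \<in> points X. r `` {p} \<in> K})"
      using that by (intro openin_Union) (auto simp: quotient_open_def)
    ultimately show ?thesis using that by (auto simp: quotient_open_def)
  qed
  ultimately show ?thesis by (auto simp: istopology_def)
qed

definition quotient_variety :: "'a variety \<Rightarrow> 'a rel \<Rightarrow> 'a set variety" where
  "quotient_variety X r = \<lparr>zar = topology (quotient_open X r),
     reg = (\<lambda>U. {f. (\<lambda>p. f (r `` {p})) \<in> reg X {p \<in> points X. r `` {p} \<in> U}})\<rparr>"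

text \<open>Orbit relation of the cyclic group generated by an automorphism \<open>T\<close> of finite order.\<close>

definition cyclic_rel :: "'a variety \<Rightarrow> ('a \<Rightarrow> 'a) \<Rightarrow> 'a rel" where
  "cyclic_rel X T = {(p, (T ^^ k) p) | p k. p \<in> points X}"

section \<open>Affine and projective spaces\<close>

inductive_set polyfun :: "nat \<Rightarrow> (complex list \<Rightarrow> complex) set" for n where
  const: "(\<lambda>p. c) \<in> polyfun n"
| coord: "i < n \<Longrightarrow> (\<lambda>p. p ! i) \<in> polyfun n"
| add: "f \<in> polyfun n \<Longrightarrow> g \<in> polyfun n \<Longrightarrow> (\<lambda>p. f p + g p) \<in> polyfun n"
| mult: "f \<in> polyfun n \<Longrightarrow> g \<in> polyfun n \<Longrightarrow> (\<lambda>p. f p * g p) \<in> polyfun n"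

definition affine_open :: "nat \<Rightarrow> complex list set \<Rightarrow> bool" where
  "affine_open n U \<longleftrightarrow> (\<exists>A \<subseteq> polyfun n. U = {p. length p = n \<and> (\<exists>f\<in>A. f p \<noteq> 0)})"

lemma istopology_affine_open: "istopology (affine_open n)"
proof -
  have "affine_open n (S \<inter> T)" if S: "affine_open n S" and T: "affine_open n T" for S T
  proof -
    obtain A B where A: "A \<subseteq> polyfun n" "S = {p. length p = n \<and> (\<exists>f\<in>A. f p \<noteq> 0)}"
      and B: "B \<subseteq> polyfun n" "T = {p. length p = n \<and> (\<exists>f\<in>B. f p \<noteq> 0)}"
      using S T by (auto simp: affine_open_def)
    let ?C = "(\<lambda>(f, g) p. f p * g p) ` (A \<times> B)"
    have C: "?C \<subseteq> polyfun n"
    proof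
      fix h assume "h \<in> ?C"
      then obtain f g where h: "h = (\<lambda>p. f p * g p)" and "f \<in> A" "g \<in> B"
        by (elim imageE SigmaE) simp
      then show "h \<in> polyfun n" unfolding h using A(1) B(1) by (intro polyfun.mult) blast+
    qed
    have "(\<exists>h\<in>?C. h p \<noteq> 0) \<longleftrightarrow> (\<exists>f\<in>A. f p \<noteq> 0) \<and> (\<exists>g\<in>B. g p \<noteq> 0)" for p
      by simp
    then have "S \<inter> T = {p. length p = n \<and> (\<exists>f\<in>?C. f p \<noteq> 0)}"
      unfolding A(2) B(2) by blast
    with C show ?thesis unfolding affine_open_def by (intro exI[of _ ?C] conjI)
  qed
  moreover have "affine_open n (\<Union>\<K>)" if K: "\<forall>K\<in>\<K>. affine_open n K" for \<K>
  proof -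
    define A where "A K = (SOME A. A \<subseteq> polyfun n \<and>
      K = {p. length p = n \<and> (\<exists>f\<in>A. f p \<noteq> 0)})" for K
    have A: "A K \<subseteq> polyfun n \<and> K = {p. length p = n \<and> (\<exists>f\<in>A K. f p \<noteq> 0)}"
      if "K \<in> \<K>" for K
      unfolding A_def using K[rule_format, OF that] unfolding affine_open_def by (rule someI_ex)
    let ?B = "\<Union>K\<in>\<K>. A K"
    have B: "?B \<subseteq> polyfun n" using A by (intro UN_least) blast
    have "p \<in> K \<longleftrightarrow> length p = n \<and> (\<exists>f\<in>A K. f p \<noteq> 0)" if "K \<in> \<K>" for p K
      using arg_cong[OF conjunct2[OF A[OF that]], of "\<lambda>S. p \<in> S"] by (simp only: mem_Collect_eq)
    then have "\<Union>\<K> = {p. length p = n \<and> (\<exists>f\<in>?B. f p \<noteq> 0)}" by blast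
    with B show ?thesis unfolding affine_open_def by (intro exI[of _ ?B] conjI)
  qed
  ultimately show ?thesis by (auto simp: istopology_def)
qed

definition affine_space :: "nat \<Rightarrow> complex list variety" where
  "affine_space n = \<lparr>zar = topology (affine_open n),
     reg = (\<lambda>U. {f. \<forall>p\<in>U. \<exists>V g h. affine_open n V \<and> p \<in> V \<and> g \<in> polyfun n \<and> h \<in> polyfun n \<and>
                      (\<forall>q\<in>U \<inter> V. h q \<noteq> 0 \<and> f q = g q / h q)})\<rparr>"

definition punctured_space :: "nat \<Rightarrow> complex list variety" where
  "punctured_space n =
     subvariety (affine_space n) {p. length p = n \<and> p \<noteq> replicate n 0}"

definition weighted_rel :: "nat list \<Rightarrow> complex list rel" where
  "weighted_rel ws = {(p, map2 (\<lambda>w x. c ^ w * x) ws p) | c p.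
     c \<noteq> 0 \<and> p \<in> points (punctured_space (length ws))}"

definition weighted_space :: "nat list \<Rightarrow> complex list set variety" where
  "weighted_space ws = quotient_variety (punctured_space (length ws)) (weighted_rel ws)"

abbreviation projective_space :: "nat \<Rightarrow> complex list set variety" where
  "projective_space n \<equiv> weighted_space (replicate (Suc n) 1)"

text \<open>
  The product of the projective spaces of dimensions \<open>m - 1\<close> and \<open>n - 1\<close>, as the quotient of the
  product of the two punctured spaces by independent scalings of the first \<open>m\<close> and of the last
  \<open>n\<close> coordinates.
\<close>

definition bipunctured_space :: "nat \<Rightarrow> nat \<Rightarrow> complex list variety" where
  "bipunctured_space m n = subvariety (affine_space (m + n))
     {p. length p = m + n \<and> take m p \<noteq> replicate m 0 \<and> drop m p \<noteq> replicate n 0}"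

definition biscaling_rel :: "nat \<Rightarrow> nat \<Rightarrow> complex list rel" where
  "biscaling_rel m n =
     {(p, map ((*) c) (take m p) @ map ((*) d) (drop m p)) | c d p.
        c \<noteq> 0 \<and> d \<noteq> 0 \<and> p \<in> points (bipunctured_space m n)}"

definition biprojective_space :: "nat \<Rightarrow> nat \<Rightarrow> complex list set variety" where
  "biprojective_space m n = quotient_variety (bipunctured_space m n) (biscaling_rel m n)"

section \<open>Vector fields and foliations\<close>

text \<open>
  Vector fields on \<open>U\<close> are the derivations of the structure sheaf over \<open>U\<close>.  The locality condition
  allows one map \<open>v\<close> to act on the sections over all open subsets of \<open>U\<close>; \<open>v f x\<close> is meaningful
  for \<open>f\<close> regular near \<open>x \<in> U\<close>.
\<close>

definition vector_field ::
  "'a variety \<Rightarrow> 'a set \<Rightarrow> (('a \<Rightarrow> complex) \<Rightarrow> 'a \<Rightarrow> complex) \<Rightarrow> bool" where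
  "vector_field X U v \<longleftrightarrow> openin (zar X) U \<and>
     (\<forall>V f g. openin (zar X) V \<and> V \<subseteq> U \<and> f \<in> reg X V \<and> g \<in> reg X V \<longrightarrow>
        v f \<in> reg X V \<and>
        (\<forall>x\<in>V. v (\<lambda>y. f y + g y) x = v f x + v g x) \<and>
        (\<forall>x\<in>V. v (\<lambda>y. f y * g y) x = f x * v g x + g x * v f x) \<and>
        (\<forall>c. \<forall>x\<in>V. v (\<lambda>y. c) x = 0) \<and>
        ((\<forall>x\<in>V. f x = g x) \<longrightarrow> (\<forall>x\<in>V. v f x = v g x)))"

text \<open>
  A foliation is represented by its tangent sheaf, the saturated rank-one subsheaf of the tangent
  sheaf that sends \<open>U\<close> to the set of all vector fields on \<open>U\<close> that are tangent to the foliation.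
\<close>

type_synonym 'a foliation = "'a set \<Rightarrow> (('a \<Rightarrow> complex) \<Rightarrow> 'a \<Rightarrow> complex) set"

text \<open>Derivative of \<open>f\<close> at \<open>p\<close> in the direction \<open>w\<close>.\<close>

definition dir_deriv :: "(complex list \<Rightarrow> complex) \<Rightarrow> complex list \<Rightarrow> complex list \<Rightarrow> complex" where
  "dir_deriv f p w = deriv (\<lambda>t. f (map2 (\<lambda>a b. a + t * b) p w)) 0"

text \<open>
  The foliation of an open subset \<open>X\<close> of an affine space by the trajectories of the vector field \<open>W\<close>:
  the vector fields everywhere linearly dependent with \<open>W\<close>.
\<close>

definition trajectory_foliation ::
  "complex list variety \<Rightarrow> (complex list \<Rightarrow> complex list) \<Rightarrow> complex list foliation" where
  "trajectory_foliation X W U = {v. vector_field X U v \<and>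
     (\<forall>p\<in>U. \<forall>N f g. openin (zar X) N \<and> p \<in> N \<and> f \<in> reg X N \<and> g \<in> reg X N \<longrightarrow>
        v f p * dir_deriv g p (W p) = v g p * dir_deriv f p (W p))}"

text \<open>
  The foliation on \<open>X\<close> defined by the 1-form with coefficient list \<open>\<alpha>\<close> on \<open>D\<close>, where
  \<open>\<iota>\<close> is a submersion from \<open>D\<close> to \<open>X\<close> with dense image (an affine chart, or the projection of a
  punctured space to a projective space): at \<open>\<iota> p\<close>, the values of \<open>v\<close> are images under the
  differential of \<open>\<iota>\<close> of vectors \<open>w\<close> at \<open>p\<close> annihilated by \<open>\<alpha> p\<close>.
\<close>

definition form_foliation ::
  "'a variety \<Rightarrow> complex list set \<Rightarrow> (complex list \<Rightarrow> 'a) \<Rightarrow> (complex list \<Rightarrow> complex list)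
     \<Rightarrow> 'a foliation" where
  "form_foliation X D \<iota> \<alpha> U = {v. vector_field X U v \<and>
     (\<forall>p\<in>D. \<iota> p \<in> U \<longrightarrow>
        (\<exists>w. length w = length p \<and> (\<Sum>i<length p. \<alpha> p ! i * w ! i) = 0 \<and>
             (\<forall>N f. openin (zar X) N \<and> \<iota> p \<in> N \<and> f \<in> reg X N \<longrightarrow>
                v f (\<iota> p) = dir_deriv (f \<circ> \<iota>) p w)))}"

text \<open>
  Foliations induced through a morphism \<open>q\<close> from \<open>X\<close> to \<open>Y\<close>: on \<open>Y\<close> from \<open>E\<close> on \<open>X\<close>, when \<open>q\<close> is a
  quotient map by a group preserving \<open>E\<close>, and on \<open>X\<close> from \<open>F\<close> on \<open>Y\<close>, when \<open>q\<close> is birational.  In both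
  cases the sections are the vector fields linearly dependent, via the differential of \<open>q\<close>, with
  those of the given foliation.
\<close>

definition pushforward_foliation ::
  "'a variety \<Rightarrow> 'b variety \<Rightarrow> ('a \<Rightarrow> 'b) \<Rightarrow> 'a foliation \<Rightarrow> 'b foliation" where
  "pushforward_foliation X Y q E U = {v. vector_field Y U v \<and>
     (\<forall>V w p. openin (zar X) V \<and> w \<in> E V \<and> p \<in> V \<and> q p \<in> U \<longrightarrow>
        (\<forall>N f g. openin (zar Y) N \<and> q p \<in> N \<and> f \<in> reg Y N \<and> g \<in> reg Y N \<longrightarrow>
           v f (q p) * w (g \<circ> q) p = v g (q p) * w (f \<circ> q) p))}"

definition pullback_foliation ::
  "'a variety \<Rightarrow> 'b variety \<Rightarrow> ('a \<Rightarrow> 'b) \<Rightarrow> 'b foliation \<Rightarrow> 'a foliation" where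
  "pullback_foliation X Y q F U = {v. vector_field X U v \<and>
     (\<forall>V w p. openin (zar Y) V \<and> w \<in> F V \<and> p \<in> U \<and> q p \<in> V \<longrightarrow>
        (\<forall>N f g. openin (zar Y) N \<and> q p \<in> N \<and> f \<in> reg Y N \<and> g \<in> reg Y N \<longrightarrow>
           v (f \<circ> q) p * w g (q p) = v (g \<circ> q) p * w f (q p)))}"

text \<open>The foliation induced on the quotient by \<open>r\<close>.\<close>

definition quotient_foliation :: "'a variety \<Rightarrow> 'a rel \<Rightarrow> 'a foliation \<Rightarrow> 'a set foliation" where
  "quotient_foliation X r E =
     pushforward_foliation X (quotient_variety X r) (\<lambda>p. r `` {p}) E"

section \<open>Birational equivalence and desingularization\<close>

definition dense_open :: "'a variety \<Rightarrow> 'a set \<Rightarrow> bool" where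
  "dense_open X U \<longleftrightarrow> openin (zar X) U \<and> zar X closure_of U = points X"

text \<open>
  The inverse birational maps \<open>\<phi>\<close> and \<open>\<psi>\<close> are isomorphisms between dense open subsets \<open>U\<close> and \<open>V\<close>, and
  transport the vector fields tangent to \<open>F\<close> to those tangent to \<open>G\<close>.
\<close>

definition birationally_equivalent ::
  "'a variety \<Rightarrow> 'a foliation \<Rightarrow> 'b variety \<Rightarrow> 'b foliation \<Rightarrow> bool" where
  "birationally_equivalent X F Y G \<longleftrightarrow>
     (\<exists>U V \<phi> \<psi>. dense_open X U \<and> dense_open Y V \<and>
        inverse_isomorphisms (subvariety X U) (subvariety Y V) \<phi> \<psi> \<and>
        (\<forall>W w. W \<subseteq> V \<and> vector_field Y W w \<longrightarrow>
           (w \<in> G W \<longleftrightarrow> (\<lambda>f. w (f \<circ> \<psi>) \<circ> \<phi>) \<in> F {p \<in> U. \<phi> p \<in> W})))"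

text \<open>
  Nonsingularity of a (two-dimensional) variety: the maximal ideal of the local ring at every point
  \<open>x\<close> is generated by two elements.
\<close>

definition nonsingular_surface :: "'a variety \<Rightarrow> bool" where
  "nonsingular_surface X \<longleftrightarrow> (\<forall>x\<in>points X.
     \<exists>U s t. openin (zar X) U \<and> x \<in> U \<and> s \<in> reg X U \<and> t \<in> reg X U \<and> s x = 0 \<and> t x = 0 \<and>
       (\<forall>V f. openin (zar X) V \<and> x \<in> V \<and> f \<in> reg X V \<and> f x = 0 \<longrightarrow>
          (\<exists>N a b. openin (zar X) N \<and> x \<in> N \<and> N \<subseteq> U \<inter> V \<and> a \<in> reg X N \<and> b \<in> reg X N \<and>
             (\<forall>y\<in>N. f y = a y * s y + b y * t y))))"

text \<open>
  A desingularization of a projective surface \<open>X\<close> is a nonsingular projective surface \<open>S\<close>, embedded in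
  some projective space, with a birational morphism to \<open>X\<close>.  Properness of \<open>\<pi>\<close> is automatic,
  and irreducibility and dimension two are inherited from \<open>X\<close> by birationality.
\<close>

definition desingularization ::
  "'a variety \<Rightarrow> nat \<Rightarrow> complex list set set \<Rightarrow> (complex list set \<Rightarrow> 'a) \<Rightarrow> bool" where
  "desingularization X n S \<pi> \<longleftrightarrow>
     closedin (zar (projective_space n)) S \<and>
     nonsingular_surface (subvariety (projective_space n) S) \<and>
     morphism (subvariety (projective_space n) S) X \<pi> \<and>
     (\<exists>U V \<psi>. dense_open (subvariety (projective_space n) S) U \<and> dense_open X V \<and>
        inverse_isomorphisms (subvariety (subvariety (projective_space n) S) U)
          (subvariety X V) \<pi> \<psi>)"

text \<open>Minimality: every desingularization factors through the given one.\<close>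

definition minimal_desingularization ::
  "'a variety \<Rightarrow> nat \<Rightarrow> complex list set set \<Rightarrow> (complex list set \<Rightarrow> 'a) \<Rightarrow> bool" where
  "minimal_desingularization X n S \<pi> \<longleftrightarrow> desingularization X n S \<pi> \<and>
     (\<forall>m S' \<pi>'. desingularization X m S' \<pi>' \<longrightarrow>
        (\<exists>\<rho>. morphism (subvariety (projective_space m) S') (subvariety (projective_space n) S) \<rho> \<and>
             (\<forall>x\<in>S'. \<pi>' x = \<pi> (\<rho> x))))"

section \<open>Foliations induced by the Chazy equations\<close>

text \<open>\<open>(x, y, z)\<close> stands for \<open>(x, x', x'')\<close>.\<close>

definition chazy_IV :: "complex \<Rightarrow> complex \<Rightarrow> complex \<Rightarrow> complex" where
  "chazy_IV x y z = 3 * x * z + 3 * y\<^sup>2 - 3 * x\<^sup>2 * y"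

definition chazy_V :: "complex \<Rightarrow> complex \<Rightarrow> complex \<Rightarrow> complex" where
  "chazy_V x y z = 2 * x * z + 4 * y\<^sup>2 - 2 * x\<^sup>2 * y"

definition chazy_VI :: "complex \<Rightarrow> complex \<Rightarrow> complex \<Rightarrow> complex" where
  "chazy_VI x y z = x * z + 5 * y\<^sup>2 - x\<^sup>2 * y"

definition equation_field ::
  "(complex \<Rightarrow> complex \<Rightarrow> complex \<Rightarrow> complex) \<Rightarrow> complex list \<Rightarrow> complex list" where
  "equation_field P p = [p ! 1, p ! 2, P (p ! 0) (p ! 1) (p ! 2)]"

abbreviation P123 :: "complex list set variety" where
  "P123 \<equiv> weighted_space [1, 2, 3]"

definition equation_foliation ::
  "(complex \<Rightarrow> complex \<Rightarrow> complex \<Rightarrow> complex) \<Rightarrow> complex list set foliation" where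
  "equation_foliation P = quotient_foliation (punctured_space 3) (weighted_rel [1, 2, 3])
     (trajectory_foliation (punctured_space 3) (equation_field P))"

section \<open>The special quotient foliations\<close>

text \<open>
  Points of the spaces below are sets of vectors of homogeneous coordinates, and the automorphisms
  act by taking images of these sets.
\<close>

abbreviation P2 :: "complex list set variety" where
  "P2 \<equiv> weighted_space [1, 1, 1]"

definition E3 :: "complex \<Rightarrow> complex list set foliation" where
  "E3 \<omega> = form_foliation P2 (points (punctured_space 3)) (\<lambda>p. weighted_rel [1, 1, 1] `` {p})
     (\<lambda>p. [\<omega>\<^sup>2 * p ! 1 * p ! 2, \<omega> * p ! 0 * p ! 2, p ! 0 * p ! 1])"

definition T3 :: "complex list set \<Rightarrow> complex list set" where
  "T3 P = (\<lambda>p. [p ! 2, p ! 0, p ! 1]) ` P"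

abbreviation X3 :: "complex list set set variety" where
  "X3 \<equiv> quotient_variety P2 (cyclic_rel P2 T3)"

definition F3 ::
  "complex \<Rightarrow> nat \<Rightarrow> complex list set set \<Rightarrow> (complex list set \<Rightarrow> complex list set set)
     \<Rightarrow> complex list set foliation" where
  "F3 \<omega> n S \<pi> = pullback_foliation (subvariety (projective_space n) S) X3 \<pi>
     (quotient_foliation P2 (cyclic_rel P2 T3) (E3 \<omega>))"

text \<open>
  On the product of two projective lines, with homogeneous coordinates \<open>[X\<^sub>0, X\<^sub>1, Y\<^sub>0, Y\<^sub>1]\<close>, the affine
  coordinates are \<open>X = X\<^sub>0 / X\<^sub>1\<close> and \<open>Y = Y\<^sub>0 / Y\<^sub>1\<close>.
\<close>

abbreviation P1P1 :: "complex list set variety" where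
  "P1P1 \<equiv> biprojective_space 2 2"

definition chart4 :: "complex list \<Rightarrow> complex list set" where
  "chart4 p = biscaling_rel 2 2 `` {[p ! 0, 1, p ! 1, 1]}"

definition E4 :: "complex list set foliation" where
  "E4 = form_foliation P1P1 {p. length p = 2} chart4 (\<lambda>p. [p ! 1, - \<i> * p ! 0])"

definition T4 :: "complex list set \<Rightarrow> complex list set" where
  "T4 P = (\<lambda>p. [p ! 2, p ! 3, p ! 1, p ! 0]) ` P"

abbreviation X4 :: "complex list set set variety" where
  "X4 \<equiv> quotient_variety P1P1 (cyclic_rel P1P1 T4)"

definition F4 ::
  "nat \<Rightarrow> complex list set set \<Rightarrow> (complex list set \<Rightarrow> complex list set set)
     \<Rightarrow> complex list set foliation" where
  "F4 n S \<pi> = pullback_foliation (subvariety (projective_space n) S) X4 \<pi>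
     (quotient_foliation P1P1 (cyclic_rel P1P1 T4) E4)"

text \<open>
  The blow-up of the plane at the three coordinate points is the closure in the product of two planes
  of the graph of the quadratic map \<open>Q\<close>, whose components generate the ideal of the three points.
  With homogeneous coordinates \<open>[X, Y, Z, A, B, C]\<close> it has the equations \<open>X A = Y B = Z C\<close>,
  and the blow-down map is the first projection.
\<close>

definition quadratic_map :: "complex list set \<Rightarrow> complex list set" where
  "quadratic_map P = (\<lambda>p. [p ! 1 * p ! 2, p ! 2 * p ! 0, p ! 0 * p ! 1]) ` P"

definition Bl3 :: "complex list set variety" where
  "Bl3 = subvariety (biprojective_space 3 3)
     {P \<in> points (biprojective_space 3 3).
        \<forall>p\<in>P. p ! 0 * p ! 3 = p ! 1 * p ! 4 \<and> p ! 1 * p ! 4 = p ! 2 * p ! 5}"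

definition blow_down :: "complex list set \<Rightarrow> complex list set" where
  "blow_down P = take 3 ` P"

definition E6 :: "complex \<Rightarrow> complex list set foliation" where
  "E6 \<omega> = pullback_foliation Bl3 P2 blow_down (E3 \<omega>)"

text \<open>
  Since \<open>Q\<close> is an involution commuting with \<open>T3\<close>, the composition of \<open>T3\<close> and \<open>Q\<close> lifts to the graph
  of \<open>Q\<close> by exchanging the two factors and applying \<open>T3\<close> to both.
\<close>

definition T6 :: "complex list set \<Rightarrow> complex list set" where
  "T6 P = (\<lambda>p. [p ! 5, p ! 3, p ! 4, p ! 2, p ! 0, p ! 1]) ` P"

lemma blow_down_T6:
  assumes P: "P \<in> points Bl3" and p: "p \<in> P" "p ! 0 * p ! 1 * p ! 2 \<noteq> 0"
  shows "blow_down (T6 P) = T3 (quadratic_map (blow_down P))"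
proof -
  let ?B = "points (bipunctured_space 3 3)" and ?r = "biscaling_rel 3 3"
  have BB: "?B \<subseteq> {p. length p = 6 \<and> take 3 p \<noteq> replicate 3 0 \<and> drop 3 p \<noteq> replicate 3 0}"
    by (auto simp: bipunctured_space_def subvariety_def)
  have "points (biprojective_space 3 3) \<subseteq> ?B // ?r"
    using openin_topspace[of "zar (biprojective_space 3 3)"]
    by (simp add: biprojective_space_def quotient_variety_def istopology_quotient_open
        quotient_open_def)
  moreover have "P \<in> points (biprojective_space 3 3)"
    and eqs: "\<forall>p\<in>P. p ! 0 * p ! 3 = p ! 1 * p ! 4 \<and> p ! 1 * p ! 4 = p ! 2 * p ! 5"
    using P by (auto simp: Bl3_def subvariety_def)
  ultimately obtain s where s: "s \<in> ?B" "P = ?r `` {s}" by (auto elim!: quotientE)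
  obtain x y z a b c where sl: "s = [x, y, z, a, b, c]"
    using s(1) BB by (auto simp: length_Suc_conv eval_nat_numeral)
  have Pe: "P = {[k * x, k * y, k * z, l * a, l * b, l * c] | k l. k \<noteq> 0 \<and> l \<noteq> 0}"
    using s(1) unfolding s(2) sl by (fastforce simp: biscaling_rel_def)
  have "s \<in> P" unfolding Pe sl by (auto intro!: exI[of _ 1])
  then have e: "x * a = y * b" "y * b = z * c" using eqs sl by force+
  have nz: "x \<noteq> 0" "y \<noteq> 0" "z \<noteq> 0" using p unfolding Pe by auto
  have "\<not> (a = 0 \<and> b = 0 \<and> c = 0)" using s(1) BB sl by (auto simp: eval_nat_numeral)
  then have a: "a \<noteq> 0" using e nz by auto
  define d where "d = x * a / (x * y * z)"
  have d: "d \<noteq> 0" "a = d * (y * z)" "b = d * (z * x)" "c = d * (x * y)"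
    using nz a e by (auto simp: d_def field_simps)
  have "blow_down (T6 P) = {[l * c, l * a, l * b] | l. l \<noteq> 0}"
  proof -
    have "blow_down (T6 P) = (\<lambda>p. [p ! 5, p ! 3, p ! 4]) ` P"
      by (simp add: blow_down_def T6_def image_image)
    also have "\<dots> = {[l * c, l * a, l * b] | l. l \<noteq> 0}" (is "?L = ?R")
    proof (intro equalityI subsetI)
      fix q assume "q \<in> ?L"
      then obtain k l where "l \<noteq> 0"
        "q = (\<lambda>p. [p ! 5, p ! 3, p ! 4]) [k * x, k * y, k * z, l * a, l * b, l * c]"
        unfolding Pe by blast
      then show "q \<in> ?R" by (intro CollectI exI[of _ l]) (simp add: eval_nat_numeral)
    next
      fix q assume "q \<in> ?R"
      then obtain l where l: "l \<noteq> 0" "q = [l * c, l * a, l * b]" by blast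
      then have "[1 * x, 1 * y, 1 * z, l * a, l * b, l * c] \<in> P"
        unfolding Pe by (intro CollectI exI[of _ 1] exI[of _ l]) simp
      then show "q \<in> ?L" by (rule rev_image_eqI) (simp add: l eval_nat_numeral)
    qed
    finally show ?thesis .
  qed
  also have "\<dots> = {[l * (x * y), l * (y * z), l * (z * x)] | l. l \<noteq> 0}" (is "?L = ?R")
  proof (intro equalityI subsetI)
    fix q assume "q \<in> ?L"
    then obtain l where "l \<noteq> 0" "q = [l * c, l * a, l * b]" by blast
    then show "q \<in> ?R" using d(1) by (auto simp: d(2-) intro!: exI[of _ "l * d"])
  next
    fix q assume "q \<in> ?R"
    then obtain l where "l \<noteq> 0" "q = [l * (x * y), l * (y * z), l * (z * x)]" by blast
    then show "q \<in> ?L" using d(1) by (auto simp: d(2-) intro!: exI[of _ "l / d"])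
  qed
  also have "\<dots> = {[k * x * (k * y), k * y * (k * z), k * z * (k * x)] | k. k \<noteq> 0}" (is "_ = ?R")
  proof (intro equalityI subsetI)
    fix q assume "q \<in> {[l * (x * y), l * (y * z), l * (z * x)] | l. l \<noteq> 0}"
    then obtain l where l: "l \<noteq> 0" "q = [l * (x * y), l * (y * z), l * (z * x)]" by blast
    have "l = csqrt l * csqrt l" by (metis power2_csqrt power2_eq_square)
    with l show "q \<in> ?R" by (intro CollectI exI[of _ "csqrt l"]) (auto simp: algebra_simps)
  next
    fix q assume "q \<in> ?R"
    then obtain k where "k \<noteq> 0" "q = [k * x * (k * y), k * y * (k * z), k * z * (k * x)]" by blast
    then show "q \<in> {[l * (x * y), l * (y * z), l * (z * x)] | l. l \<noteq> 0}"
      by (intro CollectI exI[of _ "k * k"]) (auto simp: algebra_simps)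
  qed
  also have "\<dots> = T3 (quadratic_map (blow_down P))"
  proof -
    have "T3 (quadratic_map (blow_down P)) =
        (\<lambda>p. [p ! 0 * p ! 1, p ! 1 * p ! 2, p ! 2 * p ! 0]) ` P"
      by (simp add: blow_down_def T3_def quadratic_map_def image_image)
    also have "\<dots> = ?R" (is "?L = _")
    proof (intro equalityI subsetI)
      fix q assume "q \<in> ?L"
      then obtain k l where "k \<noteq> 0" "q = (\<lambda>p. [p ! 0 * p ! 1, p ! 1 * p ! 2, p ! 2 * p ! 0])
          [k * x, k * y, k * z, l * a, l * b, l * c]"
        unfolding Pe by blast
      then show "q \<in> ?R" by (intro CollectI exI[of _ k]) (simp add: eval_nat_numeral)
    next
      fix q assume "q \<in> ?R"
      then obtain k where k: "k \<noteq> 0" "q = [k * x * (k * y), k * y * (k * z), k * z * (k * x)]" by blast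
      then have "[k * x, k * y, k * z, 1 * a, 1 * b, 1 * c] \<in> P"
        unfolding Pe by (intro CollectI exI[of _ k] exI[of _ 1]) simp
      then show "q \<in> ?L" by (rule rev_image_eqI) (simp add: k eval_nat_numeral)
    qed
    finally show ?thesis by simp
  qed
  finally show ?thesis .
qed

abbreviation X6 :: "complex list set set variety" where
  "X6 \<equiv> quotient_variety Bl3 (cyclic_rel Bl3 T6)"

definition F6 ::
  "complex \<Rightarrow> nat \<Rightarrow> complex list set set \<Rightarrow> (complex list set \<Rightarrow> complex list set set)
     \<Rightarrow> complex list set foliation" where
  "F6 \<omega> n S \<pi> = pullback_foliation (subvariety (projective_space n) S) X6 \<pi>
     (quotient_foliation Bl3 (cyclic_rel Bl3 T6) (E6 \<omega>))"

end

theory Submission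
  imports Defs
begin

text \<open>
  The substitution \<open>x = - u' / u\<close> turns each reduced Chazy equation into a relation between the successive
  derivatives \<open>u, u\<^sub>1, u\<^sub>2, \<dots>\<close> of \<open>u\<close>. In the chart \<open>s = x' / x\<^sup>2\<close>, \<open>t = x'' / x\<^sup>3\<close> of the weighted plane one has
  \<open>s = 1 - m\<close> and \<open>t = n + 2 - 3 m\<close>, with \<open>m = u u\<^sub>2 / u\<^sub>1\<^sup>2\<close> and \<open>n = u\<^sup>2 u\<^sub>3 / u\<^sub>1\<^sup>3\<close>.

  The torus foliation is generated by an invariant vector field, which the automorphism \<open>T\<close>
  multiplies by a root of unity. For a suitable \<open>T\<close>-invariant sum \<open>u\<close> of monomials, the derivatives \<open>u\<^sub>j\<close>
  are eigenvectors of \<open>T\<close>, \<open>(s, t)\<close> is \<open>T\<close>-invariant, and \<open>u\<close> satisfies the relation. The ratio \<open>b = u / u\<^sub>1\<close>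
  generates the function field of the torus over that of the \<open>(s, t)\<close>-plane, with an equation \<open>b\<^sup>k = R(s, t)\<close> where
  \<open>k\<close> is the order of \<open>T\<close>. Thus an open part of the quotient is the open part \<open>R \<noteq> 0\<close> of the plane, on which
  both foliations are generated by the same vector field.
\<close>


section \<open>Polynomial functions\<close>

text \<open>Cleared of denominators, the relations are \<open>u u4 = u1 u3\<close> for IV,
  \<open>u u4 = 2 u1 u3 - u2^2\<close> for V and \<open>u u4 = 3 u1 u3 - 2 u2^2\<close> for VI. The
  first says that \<open>u3 / u\<close> is constant, and the second implies that
  \<open>u4 / u\<close> is, which suggests sums of exponentials with roots of unity as exponents.
  The torus supplies them: the sections \<open>X, Y, Z\<close> of the plane, the four products
  \<open>X_a Y_b\<close> of the two lines, and the six boundary monomials of the anticanonical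
  hexagon of the blown-up plane are eigenvectors of the invariant field, their eigenvalues are the
  third, fourth and sixth roots of unity up to a common factor, and \<open>T\<close> permutes them
  cyclically. The derivatives of \<open>u\<close> are then finite Fourier sums of these monomials,
  and the formulas for the sections invert the transform, with the derivatives expressed by
  \<open>m\<close>, \<open>n\<close> and \<open>b\<close>. The obstacle is that \<open>b\<close> is
  not a function of \<open>s\<close> and \<open>t\<close>: the map from the plane to the quotient
  involves the choice of a root. Different roots lie in one orbit, so the map is well defined; its
  regularity needs a descent from functions of \<open>s, t, b\<close> to functions of
  \<open>s, t\<close>.\<close>

lemma polyfun_uminus: "f \<in> polyfun n \<Longrightarrow> (\<lambda>p. - f p) \<in> polyfun n"
  using polyfun.mult[OF polyfun.const[of "-1"]] by simp

lemma polyfun_diff: "f \<in> polyfun n \<Longrightarrow> g \<in> polyfun n \<Longrightarrow> (\<lambda>p. f p - g p) \<in> polyfun n"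
  using polyfun.add[OF _ polyfun_uminus] by simp

lemma polyfun_power: "f \<in> polyfun n \<Longrightarrow> (\<lambda>p. f p ^ k) \<in> polyfun n"
  by (induction k) (auto intro: polyfun.const polyfun.mult)

lemma polyfun_sum: "(\<And>i. i \<in> I \<Longrightarrow> f i \<in> polyfun n) \<Longrightarrow> (\<lambda>p. \<Sum>i\<in>I. f i p) \<in> polyfun n"
  by (induction I rule: infinite_finite_induct) (auto intro: polyfun.const polyfun.add)

lemmas polyfun_intros = polyfun.const polyfun.coord polyfun.add polyfun.mult
  polyfun_uminus polyfun_diff polyfun_power polyfun_sum

lemma polyfun_compose:
  assumes "f \<in> polyfun n" "\<And>i. i < n \<Longrightarrow> (\<lambda>p. \<sigma> p ! i) \<in> polyfun m"
  shows "(\<lambda>p. f (\<sigma> p)) \<in> polyfun m"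
  using assms(1) by induction (auto intro: polyfun_intros assms(2))

text \<open>The gradient of \<open>f\<close> at \<open>p\<close>, characterized by the chain rule for differentiable curves through \<open>p\<close>.\<close>

definition gradient_at :: "nat \<Rightarrow> (complex list \<Rightarrow> complex) \<Rightarrow> complex list \<Rightarrow> (nat \<Rightarrow> complex) \<Rightarrow> bool" where
  "gradient_at n f p L \<longleftrightarrow> (\<forall>c c'. c 0 = p \<and> (\<forall>\<^sub>F t in nhds 0. length (c t) = n) \<and>
     (\<forall>i<n. ((\<lambda>t. c t ! i) has_field_derivative c' i) (at 0)) \<longrightarrow>
     ((\<lambda>t. f (c t)) has_field_derivative (\<Sum>i<n. L i * c' i)) (at 0))"

lemma gradient_atD:
  "gradient_at n f p L \<Longrightarrow> c 0 = p \<Longrightarrow> \<forall>\<^sub>F t in nhds 0. length (c t) = n \<Longrightarrow>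
    (\<And>i. i < n \<Longrightarrow> ((\<lambda>t. c t ! i) has_field_derivative c' i) (at 0)) \<Longrightarrow>
    ((\<lambda>t. f (c t)) has_field_derivative (\<Sum>i<n. L i * c' i)) (at 0)"
  by (simp add: gradient_at_def)

lemma gradient_at_const: "gradient_at n (\<lambda>p. c) p (\<lambda>i. 0)"
  by (simp add: gradient_at_def)

lemma gradient_at_coord: "j < n \<Longrightarrow> gradient_at n (\<lambda>p. p ! j) p (\<lambda>i. if i = j then 1 else 0)"
  by (simp add: gradient_at_def if_distrib[of "\<lambda>x. x * _"] cong: if_cong)

lemma gradient_at_add:
  assumes "gradient_at n f p F" "gradient_at n g p G"
  shows "gradient_at n (\<lambda>p. f p + g p) p (\<lambda>i. F i + G i)"
  unfolding gradient_at_def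
proof (intro allI impI; elim conjE)
  fix c c' assume c: "c 0 = p" "\<forall>\<^sub>F t in nhds 0. length (c t) = n"
    "\<forall>i<n. ((\<lambda>t. c t ! i) has_field_derivative c' i) (at (0::complex))"
  have e: "(\<Sum>i<n. (F i + G i) * c' i) = (\<Sum>i<n. F i * c' i) + (\<Sum>i<n. G i * c' i)"
    by (simp add: distrib_right sum.distrib)
  show "((\<lambda>t. f (c t) + g (c t)) has_field_derivative (\<Sum>i<n. (F i + G i) * c' i)) (at 0)"
    unfolding e by (rule DERIV_add[OF gradient_atD[OF assms(1)] gradient_atD[OF assms(2)]]) (use c in simp)+
qed

lemma gradient_at_mult:
  assumes "gradient_at n f p F" "gradient_at n g p G"
  shows "gradient_at n (\<lambda>p. f p * g p) p (\<lambda>i. F i * g p + G i * f p)"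
  unfolding gradient_at_def
proof (intro allI impI; elim conjE)
  fix c c' assume c: "c 0 = p" "\<forall>\<^sub>F t in nhds 0. length (c t) = n"
    "\<forall>i<n. ((\<lambda>t. c t ! i) has_field_derivative c' i) (at (0::complex))"
  have e: "(\<Sum>i<n. (F i * g p + G i * f p) * c' i) =
      (\<Sum>i<n. F i * c' i) * g (c 0) + (\<Sum>i<n. G i * c' i) * f (c 0)"
    by (simp add: sum_distrib_right sum_distrib_left sum.distrib algebra_simps c(1))
  show "((\<lambda>t. f (c t) * g (c t)) has_field_derivative (\<Sum>i<n. (F i * g p + G i * f p) * c' i)) (at 0)"
    unfolding e by (rule DERIV_mult[OF gradient_atD[OF assms(1)] gradient_atD[OF assms(2)]]) (use c in simp)+
qed

text \<open>The entries of the gradient have to be polynomial functions of the point, not only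
  numbers at each point: the derivative of a regular function along a polynomial field is then again
  locally a fraction of polynomials.\<close>

lemma polyfun_gradient:
  "f \<in> polyfun n \<Longrightarrow> \<exists>G. (\<forall>i<n. G i \<in> polyfun n) \<and> (\<forall>p. gradient_at n f p (\<lambda>i. G i p))"
proof (induction rule: polyfun.induct)
  case (const c)
  show ?case by (rule exI[of _ "\<lambda>i p. 0"]) (auto intro: polyfun.const gradient_at_const)
next
  case (coord j)
  then show ?case
    by (intro exI[of _ "\<lambda>i p. if i = j then 1 else 0"]) (auto intro: polyfun.const gradient_at_coord)
next
  case (add f g)
  then obtain F G where "\<forall>i<n. F i \<in> polyfun n" "\<forall>p. gradient_at n f p (\<lambda>i. F i p)"
    "\<forall>i<n. G i \<in> polyfun n" "\<forall>p. gradient_at n g p (\<lambda>i. G i p)"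
    by blast
  then show ?case
    by (intro exI[of _ "\<lambda>i p. F i p + G i p"]) (simp add: polyfun.add gradient_at_add)
next
  case (mult f g)
  then obtain F G where "\<forall>i<n. F i \<in> polyfun n" "\<forall>p. gradient_at n f p (\<lambda>i. F i p)"
    "\<forall>i<n. G i \<in> polyfun n" "\<forall>p. gradient_at n g p (\<lambda>i. G i p)"
    by blast
  then show ?case using mult.hyps
    by (intro exI[of _ "\<lambda>i p. F i p * g p + G i p * f p"])
      (auto simp: polyfun.add polyfun.mult intro: gradient_at_mult)
qed

text \<open>Restriction to a line reduces questions in \<open>n\<close> variables to one variable:
  finiteness of roots gives irreducibility, and continuity in \<open>t\<close> keeps short segments
  inside open sets.\<close>

lemma polyfun_line:
  assumes "f \<in> polyfun n" "length p = n" "length w = n"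
  obtains P where "\<And>t. f (map2 (\<lambda>a b. a + t * b) p w) = poly P t"
proof -
  have "\<exists>P. \<forall>t. f (map2 (\<lambda>a b. a + t * b) p w) = poly P t"
    using assms(1)
  proof induction
    case (const c)
    show ?case by (rule exI[of _ "[:c:]"]) simp
  next
    case (coord i)
    then show ?case using assms(2,3) by (intro exI[of _ "[:p ! i, w ! i:]"]) simp
  next
    case (add f g)
    then show ?case by (metis poly_add)
  next
    case (mult f g)
    then show ?case by (metis poly_mult)
  qed
  then show thesis using that by blast
qed

text \<open>On the line from \<open>p\<close> to \<open>q\<close> both functions become nonzero
  polynomials in \<open>t\<close>, one by its value at 0 and the other by its value at 1, so the
  product has finitely many roots. This is the source of the irreducibility of all spaces
  below.\<close>

lemma polyfun_no_zero_divisors: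
  assumes f: "f \<in> polyfun n" "length p = n" "f p \<noteq> 0" and g: "g \<in> polyfun n" "length q = n" "g q \<noteq> 0"
  obtains r where "length r = n" "f r \<noteq> 0" "g r \<noteq> 0"
proof -
  define w where "w = map2 (\<lambda>a b. b - a) p q"
  have w: "length w = n" using f g by (simp add: w_def)
  define l where "l t = map2 (\<lambda>a b. a + t * b) p w" for t :: complex
  have l: "l 0 = p" "l 1 = q" "length (l t) = n" for t
    using f(2) g(2) by (auto simp: l_def w_def intro!: nth_equalityI)
  obtain P where P: "\<And>t. f (l t) = poly P t" using polyfun_line[OF f(1,2) w] unfolding l_def by blast
  obtain Q where Q: "\<And>t. g (l t) = poly Q t" using polyfun_line[OF g(1) f(2) w] unfolding l_def by blast
  have "P * Q \<noteq> 0" using P[of 0] Q[of 1] f(3) g(3) by (auto simp: l)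
  then have "finite {t. poly (P * Q) t = 0}" by (rule poly_roots_finite)
  then obtain t where "poly (P * Q) t \<noteq> 0"
    using infinite_UNIV_char_0[where 'a=complex] by (metis (mono_tags) finite_subset mem_Collect_eq subsetI)
  then show thesis using that[of "l t"] l(3) P Q by simp
qed

section \<open>Affine spaces\<close>

lemma openin_affine: "openin (zar (affine_space n)) = affine_open n"
  by (simp add: affine_space_def istopology_affine_open)

lemma affine_open_basic: "e \<in> polyfun n \<Longrightarrow> affine_open n {p. length p = n \<and> e p \<noteq> 0}"
  unfolding affine_open_def by (rule exI[of _ "{e}"]) auto

lemma affine_open_basis:
  assumes "affine_open n U" "p \<in> U"
  obtains e where "e \<in> polyfun n" "e p \<noteq> 0" "\<And>q. length q = n \<Longrightarrow> e q \<noteq> 0 \<Longrightarrow> q \<in> U"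
  using assms unfolding affine_open_def by blast

lemma affine_openI:
  assumes "\<And>p. p \<in> U \<Longrightarrow> length p = n"
    "\<And>p. p \<in> U \<Longrightarrow> \<exists>e\<in>polyfun n. e p \<noteq> 0 \<and> (\<forall>q. length q = n \<and> e q \<noteq> 0 \<longrightarrow> q \<in> U)"
  shows "affine_open n U"
  unfolding affine_open_def
  by (rule exI[of _ "{e \<in> polyfun n. \<forall>q. length q = n \<and> e q \<noteq> 0 \<longrightarrow> q \<in> U}"]) (use assms in blast)

lemma affine_open_length: "affine_open n U \<Longrightarrow> p \<in> U \<Longrightarrow> length p = n"
  by (auto simp: affine_open_def)

lemma points_affine [simp]: "points (affine_space n) = {p. length p = n}"
proof -
  have "affine_open n {p. length p = n}"
    using affine_open_basic[OF polyfun.const[of 1]] by simp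
  then have "{p. length p = n} \<subseteq> points (affine_space n)"
    using openin_subset[of "zar (affine_space n)"] by (simp add: openin_affine)
  moreover have "affine_open n (points (affine_space n))"
    using openin_topspace[of "zar (affine_space n)"] by (simp add: openin_affine)
  ultimately show ?thesis using affine_open_length by blast
qed

lemma affine_open_Int: "affine_open n U \<Longrightarrow> affine_open n V \<Longrightarrow> affine_open n (U \<inter> V)"
  using openin_Int[of "zar (affine_space n)"] by (simp add: openin_affine)

lemma affine_irreducible:
  assumes "affine_open n U" "affine_open n V" "U \<noteq> {}" "V \<noteq> {}"
  shows "U \<inter> V \<noteq> {}"
proof -
  obtain p q where pq: "p \<in> U" "q \<in> V" using assms by blast
  obtain e where e: "e \<in> polyfun n" "e p \<noteq> 0" "\<And>q. length q = n \<Longrightarrow> e q \<noteq> 0 \<Longrightarrow> q \<in> U"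
    using affine_open_basis[OF assms(1) pq(1)] by blast
  obtain d where d: "d \<in> polyfun n" "d q \<noteq> 0" "\<And>q. length q = n \<Longrightarrow> d q \<noteq> 0 \<Longrightarrow> q \<in> V"
    using affine_open_basis[OF assms(2) pq(2)] by blast
  obtain r where "length r = n" "e r \<noteq> 0" "d r \<noteq> 0"
    using polyfun_no_zero_divisors[OF e(1) _ e(2) d(1) _ d(2)] pq assms(1,2)
    by (metis affine_open_length)
  then show ?thesis using e(3) d(3) by blast
qed

lemma reg_affineI:
  assumes "\<And>p. p \<in> U \<Longrightarrow> \<exists>V g h. affine_open n V \<and> p \<in> V \<and> g \<in> polyfun n \<and> h \<in> polyfun n \<and>
                      (\<forall>q\<in>U \<inter> V. h q \<noteq> 0 \<and> f q = g q / h q)"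
  shows "f \<in> reg (affine_space n) U"
  using assms by (simp add: affine_space_def)

lemma reg_affineD:
  assumes "f \<in> reg (affine_space n) U" "p \<in> U"
  obtains V g h where "affine_open n V" "p \<in> V" "g \<in> polyfun n" "h \<in> polyfun n"
    "\<And>q. q \<in> U \<Longrightarrow> q \<in> V \<Longrightarrow> h q \<noteq> 0 \<and> f q = g q / h q"
  using assms by (force simp: affine_space_def)

text \<open>Intersecting with a basic open set leaves three polynomials: \<open>e\<close> marks a
  neighbourhood on which both membership in \<open>U\<close> and the formula \<open>g / h\<close>
  hold. Later arguments compute with these alone.\<close>

lemma reg_affine_basic:
  assumes "f \<in> reg (affine_space n) U" "affine_open n U" "p \<in> U"
  obtains e g h where "e \<in> polyfun n" "g \<in> polyfun n" "h \<in> polyfun n" "e p \<noteq> 0"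
    "\<And>q. length q = n \<Longrightarrow> e q \<noteq> 0 \<Longrightarrow> q \<in> U \<and> h q \<noteq> 0 \<and> f q = g q / h q"
proof -
  obtain V g h where V: "affine_open n V" "p \<in> V" "g \<in> polyfun n" "h \<in> polyfun n"
    "\<And>q. q \<in> U \<Longrightarrow> q \<in> V \<Longrightarrow> h q \<noteq> 0 \<and> f q = g q / h q"
    using reg_affineD[OF assms(1,3)] by blast
  obtain e where "e \<in> polyfun n" "e p \<noteq> 0" "\<And>q. length q = n \<Longrightarrow> e q \<noteq> 0 \<Longrightarrow> q \<in> U \<inter> V"
    using affine_open_basis[OF affine_open_Int[OF assms(2) V(1)]] V(2) assms(3) by blast
  then show thesis using that V(3-) by (metis IntE)
qed

lemma polyfun_reg: "f \<in> polyfun n \<Longrightarrow> f \<in> reg (affine_space n) U"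
  if "\<And>p. p \<in> U \<Longrightarrow> length p = n"
proof (rule reg_affineI)
  fix p assume "f \<in> polyfun n" "p \<in> U"
  then show "\<exists>V g h. affine_open n V \<and> p \<in> V \<and> g \<in> polyfun n \<and> h \<in> polyfun n \<and>
                      (\<forall>q\<in>U \<inter> V. h q \<noteq> 0 \<and> f q = g q / h q)"
    using that affine_open_basic[OF polyfun.const[of 1 n]] polyfun.const[of 1 n]
    by (intro exI[of _ "{p. length p = n}"] exI[of _ f] exI[of _ "\<lambda>p. 1"]) simp
qed

section \<open>Sheaves of rings\<close>

text \<open>
  The locality clause covers gluing, restriction to smaller open sets and independence of the values
  outside \<open>U\<close>.
\<close>

definition ringed :: "'a variety \<Rightarrow> bool" where
  "ringed X \<longleftrightarrow>
     (\<forall>U f. openin (zar X) U \<and>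
        (\<forall>p\<in>U. \<exists>V g. openin (zar X) V \<and> p \<in> V \<and> g \<in> reg X V \<and> (\<forall>q\<in>U \<inter> V. f q = g q)) \<longrightarrow>
        f \<in> reg X U) \<and>
     (\<forall>U c. openin (zar X) U \<longrightarrow> (\<lambda>p. c) \<in> reg X U) \<and>
     (\<forall>U f g. openin (zar X) U \<and> f \<in> reg X U \<and> g \<in> reg X U \<longrightarrow>
        (\<lambda>p. f p + g p) \<in> reg X U \<and> (\<lambda>p. f p * g p) \<in> reg X U) \<and>
     (\<forall>U f. openin (zar X) U \<and> f \<in> reg X U \<longrightarrow>
        openin (zar X) {p \<in> U. f p \<noteq> 0} \<and> (\<lambda>p. 1 / f p) \<in> reg X {p \<in> U. f p \<noteq> 0})"

lemma
  assumes "ringed X"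
  shows ringed_local: "\<And>U f. openin (zar X) U \<Longrightarrow>
        (\<And>p. p \<in> U \<Longrightarrow> \<exists>V g. openin (zar X) V \<and> p \<in> V \<and> g \<in> reg X V \<and> (\<forall>q\<in>U \<inter> V. f q = g q)) \<Longrightarrow>
        f \<in> reg X U"
    and ringed_const: "\<And>U c. openin (zar X) U \<Longrightarrow> (\<lambda>p. c) \<in> reg X U"
    and ringed_add: "\<And>U f g. openin (zar X) U \<Longrightarrow> f \<in> reg X U \<Longrightarrow> g \<in> reg X U \<Longrightarrow> (\<lambda>p. f p + g p) \<in> reg X U"
    and ringed_mult: "\<And>U f g. openin (zar X) U \<Longrightarrow> f \<in> reg X U \<Longrightarrow> g \<in> reg X U \<Longrightarrow> (\<lambda>p. f p * g p) \<in> reg X U"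
    and ringed_open: "\<And>U f. openin (zar X) U \<Longrightarrow> f \<in> reg X U \<Longrightarrow> openin (zar X) {p \<in> U. f p \<noteq> 0}"
    and ringed_inverse: "\<And>U f. openin (zar X) U \<Longrightarrow> f \<in> reg X U \<Longrightarrow> (\<lambda>p. 1 / f p) \<in> reg X {p \<in> U. f p \<noteq> 0}"
proof -
  note r = assms[unfolded ringed_def]
  note r1 = r[THEN conjunct1, rule_format] and r2 = r[THEN conjunct2, THEN conjunct1, rule_format]
    and r3 = r[THEN conjunct2, THEN conjunct2, THEN conjunct1, rule_format]
    and r4 = r[THEN conjunct2, THEN conjunct2, THEN conjunct2, rule_format]
  show "f \<in> reg X U" if "openin (zar X) U"
    "\<And>p. p \<in> U \<Longrightarrow> \<exists>V g. openin (zar X) V \<and> p \<in> V \<and> g \<in> reg X V \<and> (\<forall>q\<in>U \<inter> V. f q = g q)" for U f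
    by (rule r1) (use that in simp)
  show "(\<lambda>p. c) \<in> reg X U" if "openin (zar X) U" for U c by (rule r2) (fact that)
  show "(\<lambda>p. f p + g p) \<in> reg X U" "(\<lambda>p. f p * g p) \<in> reg X U"
    if "openin (zar X) U" "f \<in> reg X U" "g \<in> reg X U" for U f g using r3[of U f g] that by simp_all
  show "openin (zar X) {p \<in> U. f p \<noteq> 0}" "(\<lambda>p. 1 / f p) \<in> reg X {p \<in> U. f p \<noteq> 0}"
    if "openin (zar X) U" "f \<in> reg X U" for U f using r4[of U f] that by simp_all
qed

lemma ringed_restrict:
  "ringed X \<Longrightarrow> openin (zar X) V \<Longrightarrow> f \<in> reg X V \<Longrightarrow> openin (zar X) U \<Longrightarrow> U \<subseteq> V \<Longrightarrow>
    (\<And>p. p \<in> U \<Longrightarrow> g p = f p) \<Longrightarrow> g \<in> reg X U"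
  by (rule ringed_local) blast+

lemma ringed_divide:
  assumes "ringed X" "openin (zar X) U" "f \<in> reg X U" "g \<in> reg X U" "\<And>p. p \<in> U \<Longrightarrow> g p \<noteq> 0"
  shows "(\<lambda>p. f p / g p) \<in> reg X U"
proof -
  have "{p \<in> U. g p \<noteq> 0} = U" using assms by blast
  with ringed_inverse[OF assms(1,2,4)] have "(\<lambda>p. 1 / g p) \<in> reg X U" by simp
  from ringed_mult[OF assms(1-3) this] show ?thesis by simp
qed

lemma ringed_polyfun:
  assumes "ringed X" "openin (zar X) U" "f \<in> polyfun n" "\<And>i. i < n \<Longrightarrow> (\<lambda>x. F x ! i) \<in> reg X U"
  shows "(\<lambda>x. f (F x)) \<in> reg X U"
  using assms(3) by induction
    (auto intro: ringed_const ringed_add ringed_mult assms)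

lemma ringed_affine_space: "ringed (affine_space n)"
  unfolding ringed_def openin_affine
proof (intro conjI allI impI; (elim conjE)?)
  fix U f
  assume U: "affine_open n U" and *: "\<forall>p\<in>U. \<exists>V g. affine_open n V \<and> p \<in> V \<and> g \<in> reg (affine_space n) V
    \<and> (\<forall>q\<in>U \<inter> V. f q = g q)"
  show "f \<in> reg (affine_space n) U"
  proof (rule reg_affineI)
    fix p assume "p \<in> U"
    with * obtain V g where V: "affine_open n V" "p \<in> V" "g \<in> reg (affine_space n) V" "\<forall>q\<in>U \<inter> V. f q = g q" by blast
    obtain W a b where "affine_open n W" "p \<in> W" "a \<in> polyfun n" "b \<in> polyfun n"
      "\<And>q. q \<in> V \<Longrightarrow> q \<in> W \<Longrightarrow> b q \<noteq> 0 \<and> g q = a q / b q"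
      using reg_affineD[OF V(3,2)] by blast
    then show "\<exists>V g h. affine_open n V \<and> p \<in> V \<and> g \<in> polyfun n \<and> h \<in> polyfun n \<and>
                      (\<forall>q\<in>U \<inter> V. h q \<noteq> 0 \<and> f q = g q / h q)"
      using V by (intro exI[of _ "V \<inter> W"] exI[of _ a] exI[of _ b]) (auto intro: affine_open_Int)
  qed
next
  fix U c assume "affine_open n U"
  then show "(\<lambda>p. c) \<in> reg (affine_space n) U" by (intro polyfun_reg polyfun.const) (rule affine_open_length)
next
  fix U f g assume U: "affine_open n U" and f: "f \<in> reg (affine_space n) U" and g: "g \<in> reg (affine_space n) U"
  have *: "\<exists>V a b c d. affine_open n V \<and> p \<in> V \<and> a \<in> polyfun n \<and> b \<in> polyfun n \<and> c \<in> polyfun n \<and> d \<in> polyfun n \<and>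
     (\<forall>q\<in>U \<inter> V. b q \<noteq> 0 \<and> f q = a q / b q \<and> d q \<noteq> 0 \<and> g q = c q / d q)" if p: "p \<in> U" for p
  proof -
    obtain V a b where V: "affine_open n V" "p \<in> V" "a \<in> polyfun n" "b \<in> polyfun n"
      "\<And>q. q \<in> U \<Longrightarrow> q \<in> V \<Longrightarrow> b q \<noteq> 0 \<and> f q = a q / b q" using reg_affineD[OF f p] by blast
    obtain W c d where W: "affine_open n W" "p \<in> W" "c \<in> polyfun n" "d \<in> polyfun n"
      "\<And>q. q \<in> U \<Longrightarrow> q \<in> W \<Longrightarrow> d q \<noteq> 0 \<and> g q = c q / d q" using reg_affineD[OF g p] by blast
    show ?thesis using V W affine_open_Int[OF V(1) W(1)] by blast
  qed
  show "(\<lambda>p. f p + g p) \<in> reg (affine_space n) U"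
  proof (rule reg_affineI)
    fix p assume "p \<in> U"
    from *[OF this] obtain V a b c d where V: "affine_open n V" "p \<in> V" "a \<in> polyfun n" "b \<in> polyfun n" "c \<in> polyfun n" "d \<in> polyfun n"
      "\<forall>q\<in>U \<inter> V. b q \<noteq> 0 \<and> f q = a q / b q \<and> d q \<noteq> 0 \<and> g q = c q / d q" by blast
    show "\<exists>V k h. affine_open n V \<and> p \<in> V \<and> k \<in> polyfun n \<and> h \<in> polyfun n \<and>
                      (\<forall>q\<in>U \<inter> V. h q \<noteq> 0 \<and> f q + g q = k q / h q)"
      by (rule exI[of _ V], rule exI[of _ "\<lambda>p. a p * d p + c p * b p"], rule exI[of _ "\<lambda>p. b p * d p"])
        (use V in \<open>auto intro!: polyfun_intros simp: add_frac_eq\<close>)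
  qed
  show "(\<lambda>p. f p * g p) \<in> reg (affine_space n) U"
  proof (rule reg_affineI)
    fix p assume "p \<in> U"
    from *[OF this] obtain V a b c d where V: "affine_open n V" "p \<in> V" "a \<in> polyfun n" "b \<in> polyfun n" "c \<in> polyfun n" "d \<in> polyfun n"
      "\<forall>q\<in>U \<inter> V. b q \<noteq> 0 \<and> f q = a q / b q \<and> d q \<noteq> 0 \<and> g q = c q / d q" by blast
    show "\<exists>V k h. affine_open n V \<and> p \<in> V \<and> k \<in> polyfun n \<and> h \<in> polyfun n \<and>
                      (\<forall>q\<in>U \<inter> V. h q \<noteq> 0 \<and> f q * g q = k q / h q)"
      by (rule exI[of _ V], rule exI[of _ "\<lambda>p. a p * c p"], rule exI[of _ "\<lambda>p. b p * d p"])
        (use V in \<open>auto intro!: polyfun_intros\<close>)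
  qed
next
  fix U f assume U: "affine_open n U" and f: "f \<in> reg (affine_space n) U"
  show "affine_open n {p \<in> U. f p \<noteq> 0}"
  proof (rule affine_openI)
    fix p assume p: "p \<in> {p \<in> U. f p \<noteq> 0}"
    obtain e g h where e: "e \<in> polyfun n" "g \<in> polyfun n" "h \<in> polyfun n" "e p \<noteq> 0"
      "\<And>q. length q = n \<Longrightarrow> e q \<noteq> 0 \<Longrightarrow> q \<in> U \<and> h q \<noteq> 0 \<and> f q = g q / h q"
      using reg_affine_basic[OF f U, of p] p by blast
    have "g p \<noteq> 0" using e(5)[of p] e(4) p affine_open_length[OF U] by auto
    then show "\<exists>e\<in>polyfun n. e p \<noteq> 0 \<and> (\<forall>q. length q = n \<and> e q \<noteq> 0 \<longrightarrow> q \<in> {p \<in> U. f p \<noteq> 0})"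
      using e by (intro bexI[of _ "\<lambda>p. e p * g p"]) (auto intro: polyfun.mult)
  qed (use U in \<open>auto simp: affine_open_length\<close>)
  show "(\<lambda>p. 1 / f p) \<in> reg (affine_space n) {p \<in> U. f p \<noteq> 0}"
  proof (rule reg_affineI)
    fix p assume p: "p \<in> {p \<in> U. f p \<noteq> 0}"
    obtain V a b where "affine_open n V" "p \<in> V" "a \<in> polyfun n" "b \<in> polyfun n"
      "\<And>q. q \<in> U \<Longrightarrow> q \<in> V \<Longrightarrow> b q \<noteq> 0 \<and> f q = a q / b q" using reg_affineD[OF f, of p] p by blast
    then show "\<exists>V g h. affine_open n V \<and> p \<in> V \<and> g \<in> polyfun n \<and> h \<in> polyfun n \<and>
                      (\<forall>q\<in>{p \<in> U. f p \<noteq> 0} \<inter> V. h q \<noteq> 0 \<and> 1 / f q = g q / h q)"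
      by (intro exI[of _ V] exI[of _ b] exI[of _ a]) auto
  qed
qed

section \<open>Open and closed subvarieties\<close>

lemma zar_subvariety: "zar (subvariety X S) = subtopology (zar X) S"
  by (simp add: subvariety_def)

lemma points_subvariety: "points (subvariety X S) = points X \<inter> S"
  by (simp add: zar_subvariety)

lemma reg_subvarietyI:
  assumes "\<And>p. p \<in> U \<Longrightarrow> \<exists>V g. openin (zar X) V \<and> p \<in> V \<and> g \<in> reg X V \<and> (\<forall>q\<in>U \<inter> V. f q = g q)"
  shows "f \<in> reg (subvariety X S) U"
  using assms by (simp add: subvariety_def)

lemma reg_subvarietyD:
  assumes "f \<in> reg (subvariety X S) U" "p \<in> U"
  obtains V g where "openin (zar X) V" "p \<in> V" "g \<in> reg X V" "\<And>q. q \<in> U \<Longrightarrow> q \<in> V \<Longrightarrow> f q = g q"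
  using assms by (force simp: subvariety_def)

text \<open>Glueing turns the local extensions in the definition of \<open>subvariety\<close> into
  one regular function, so that functions on an open part can be handled on the ambient
  variety.\<close>

lemma reg_subvariety_open:
  assumes "ringed X" "openin (zar X) U"
  shows "reg (subvariety X S) U = reg X U"
proof (intro equalityI subsetI)
  fix f assume f: "f \<in> reg (subvariety X S) U"
  show "f \<in> reg X U" using assms
    by (rule ringed_local) (metis reg_subvarietyD[OF f] IntE)
next
  fix f assume "f \<in> reg X U"
  then show "f \<in> reg (subvariety X S) U" using assms(2) by (intro reg_subvarietyI) blast
qed

lemma openin_subvariety_open:
  "openin (zar X) S \<Longrightarrow> openin (zar (subvariety X S)) U \<longleftrightarrow> openin (zar X) U \<and> U \<subseteq> S"
  by (simp add: zar_subvariety openin_open_subtopology)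

lemma ringed_subvariety:
  assumes X: "ringed X"
  shows "ringed (subvariety X S)"
  unfolding ringed_def
proof (intro conjI allI impI; (elim conjE)?)
  let ?Y = "subvariety X S"
  note op = zar_subvariety openin_subtopology
  show "f \<in> reg ?Y U" if U: "openin (zar ?Y) U" and
    *: "\<forall>p\<in>U. \<exists>V g. openin (zar ?Y) V \<and> p \<in> V \<and> g \<in> reg ?Y V \<and> (\<forall>q\<in>U \<inter> V. f q = g q)" for U f
  proof (rule reg_subvarietyI)
    fix p assume p: "p \<in> U"
    with * obtain V g where V: "openin (zar ?Y) V" "p \<in> V" "g \<in> reg ?Y V" "\<forall>q\<in>U \<inter> V. f q = g q" by blast
    obtain V' where V': "openin (zar X) V'" "V = V' \<inter> S" using V(1) by (auto simp: op)
    have US: "U \<subseteq> S" using U by (auto simp: op)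
    obtain W h where W: "openin (zar X) W" "p \<in> W" "h \<in> reg X W" "\<And>q. q \<in> V \<Longrightarrow> q \<in> W \<Longrightarrow> g q = h q"
      using reg_subvarietyD[OF V(3,2)] by blast
    have o: "openin (zar X) (W \<inter> V')" using W V' by blast
    have "h \<in> reg X (W \<inter> V')" by (rule ringed_restrict[OF X W(1,3) o]) auto
    moreover have "\<forall>q\<in>U \<inter> (W \<inter> V'). f q = h q" using V(4) W(4) V'(2) US by auto
    moreover have "p \<in> W \<inter> V'" using V(2) V'(2) W(2) by blast
    ultimately show "\<exists>V g. openin (zar X) V \<and> p \<in> V \<and> g \<in> reg X V \<and> (\<forall>q\<in>U \<inter> V. f q = g q)"
      using o by blast
  qed
  show "(\<lambda>p. c) \<in> reg ?Y U" if "openin (zar ?Y) U" for U c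
  proof (rule reg_subvarietyI)
    fix p assume "p \<in> U"
    moreover obtain U' where "openin (zar X) U'" "U = U' \<inter> S" using \<open>openin (zar ?Y) U\<close> by (auto simp: op)
    ultimately show "\<exists>V g. openin (zar X) V \<and> p \<in> V \<and> g \<in> reg X V \<and> (\<forall>q\<in>U \<inter> V. c = g q)"
      using ringed_const[OF X] by (intro exI[of _ U'] exI[of _ "\<lambda>p. c"]) blast
  qed
  have two: "\<exists>V a b. openin (zar X) V \<and> p \<in> V \<and> a \<in> reg X V \<and> b \<in> reg X V \<and> (\<forall>q\<in>U \<inter> V. f q = a q \<and> g q = b q)"
    if f: "f \<in> reg ?Y U" and g: "g \<in> reg ?Y U" and p: "p \<in> U" for U f g p
  proof -
    obtain V a where V: "openin (zar X) V" "p \<in> V" "a \<in> reg X V" "\<And>q. q \<in> U \<Longrightarrow> q \<in> V \<Longrightarrow> f q = a q"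
      using reg_subvarietyD[OF f p] by blast
    obtain W b where W: "openin (zar X) W" "p \<in> W" "b \<in> reg X W" "\<And>q. q \<in> U \<Longrightarrow> q \<in> W \<Longrightarrow> g q = b q"
      using reg_subvarietyD[OF g p] by blast
    have o: "openin (zar X) (V \<inter> W)" using V W by blast
    have "a \<in> reg X (V \<inter> W)" by (rule ringed_restrict[OF X V(1,3) o]) auto
    moreover have "b \<in> reg X (V \<inter> W)" by (rule ringed_restrict[OF X W(1,3) o]) auto
    moreover have "p \<in> V \<inter> W" "\<forall>q\<in>U \<inter> (V \<inter> W). f q = a q \<and> g q = b q" using V W by auto
    ultimately show ?thesis using o by blast
  qed
  show "(\<lambda>p. f p + g p) \<in> reg ?Y U" if "openin (zar ?Y) U" "f \<in> reg ?Y U" "g \<in> reg ?Y U" for U f g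
  proof (rule reg_subvarietyI)
    fix p assume "p \<in> U"
    from two[OF that(2,3) this] obtain V a b where
      V: "openin (zar X) V" "p \<in> V" "a \<in> reg X V" "b \<in> reg X V" "\<forall>q\<in>U \<inter> V. f q = a q \<and> g q = b q" by blast
    then show "\<exists>V h. openin (zar X) V \<and> p \<in> V \<and> h \<in> reg X V \<and> (\<forall>q\<in>U \<inter> V. f q + g q = h q)"
      by (intro exI[of _ V] exI[of _ "\<lambda>p. a p + b p"]) (auto intro: ringed_add[OF X])
  qed
  show "(\<lambda>p. f p * g p) \<in> reg ?Y U" if "openin (zar ?Y) U" "f \<in> reg ?Y U" "g \<in> reg ?Y U" for U f g
  proof (rule reg_subvarietyI)
    fix p assume "p \<in> U"
    from two[OF that(2,3) this] obtain V a b where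
      V: "openin (zar X) V" "p \<in> V" "a \<in> reg X V" "b \<in> reg X V" "\<forall>q\<in>U \<inter> V. f q = a q \<and> g q = b q" by blast
    then show "\<exists>V h. openin (zar X) V \<and> p \<in> V \<and> h \<in> reg X V \<and> (\<forall>q\<in>U \<inter> V. f q * g q = h q)"
      by (intro exI[of _ V] exI[of _ "\<lambda>p. a p * b p"]) (auto intro: ringed_mult[OF X])
  qed
  show "openin (zar ?Y) {p \<in> U. f p \<noteq> 0}" if U: "openin (zar ?Y) U" and f: "f \<in> reg ?Y U" for U f
  proof (subst openin_subopen, intro ballI)
    fix p assume p: "p \<in> {p \<in> U. f p \<noteq> 0}"
    obtain V a where V: "openin (zar X) V" "p \<in> V" "a \<in> reg X V" "\<And>q. q \<in> U \<Longrightarrow> q \<in> V \<Longrightarrow> f q = a q"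
      using reg_subvarietyD[OF f, of p] p by blast
    obtain U' where U': "openin (zar X) U'" "U = U' \<inter> S" using U by (auto simp: op)
    let ?W = "{q \<in> V. a q \<noteq> 0} \<inter> U'"
    have "openin (zar X) ?W" using ringed_open[OF X V(1,3)] U'(1) by blast
    then have "openin (zar ?Y) (?W \<inter> S)" by (auto simp: op)
    moreover have "p \<in> ?W \<inter> S" "?W \<inter> S \<subseteq> {p \<in> U. f p \<noteq> 0}" using p V U' by auto
    ultimately show "\<exists>T. openin (zar ?Y) T \<and> p \<in> T \<and> T \<subseteq> {p \<in> U. f p \<noteq> 0}" by blast
  qed
  show "(\<lambda>p. 1 / f p) \<in> reg ?Y {p \<in> U. f p \<noteq> 0}" if f: "f \<in> reg ?Y U" for U f
  proof (rule reg_subvarietyI)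
    fix p assume p: "p \<in> {p \<in> U. f p \<noteq> 0}"
    obtain V a where V: "openin (zar X) V" "p \<in> V" "a \<in> reg X V" "\<And>q. q \<in> U \<Longrightarrow> q \<in> V \<Longrightarrow> f q = a q"
      using reg_subvarietyD[OF f, of p] p by blast
    show "\<exists>V g. openin (zar X) V \<and> p \<in> V \<and> g \<in> reg X V \<and> (\<forall>q\<in>{p \<in> U. f p \<noteq> 0} \<inter> V. 1 / f q = g q)"
      by (rule exI[of _ "{q \<in> V. a q \<noteq> 0}"], rule exI[of _ "\<lambda>q. 1 / a q"])
        (use ringed_open[OF X V(1,3)] ringed_inverse[OF X V(1,3)] V p in auto)
  qed
qed

section \<open>Quotients by equivalence relations\<close>

lemma openin_quotient_variety:
  "openin (zar (quotient_variety X r)) U \<longleftrightarrow>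
     U \<subseteq> points X // r \<and> openin (zar X) {p \<in> points X. r `` {p} \<in> U}"
  by (simp add: quotient_variety_def istopology_quotient_open quotient_open_def)

lemma points_quotient_variety: "points (quotient_variety X r) = points X // r"
proof -
  have "{p \<in> points X. r `` {p} \<in> points X // r} = points X" by (auto intro: quotientI)
  then have "openin (zar (quotient_variety X r)) (points X // r)"
    by (simp add: openin_quotient_variety)
  from openin_subset[OF this] show ?thesis
    using openin_topspace[of "zar (quotient_variety X r)"] unfolding openin_quotient_variety by blast
qed

lemma reg_quotient_variety:
  "f \<in> reg (quotient_variety X r) U \<longleftrightarrow> (\<lambda>p. f (r `` {p})) \<in> reg X {p \<in> points X. r `` {p} \<in> U}"
  by (simp add: quotient_variety_def)

lemma ringed_quotient_variety:
  assumes X: "ringed X"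
  shows "ringed (quotient_variety X r)"
  unfolding ringed_def reg_quotient_variety
proof (intro conjI allI impI; (elim conjE)?)
  let ?Y = "quotient_variety X r"
  let ?pre = "\<lambda>U. {p \<in> points X. r `` {p} \<in> U}"
  have pre: "openin (zar X) (?pre U)" if "openin (zar ?Y) U" for U using that by (simp add: openin_quotient_variety)
  show "(\<lambda>p. f (r `` {p})) \<in> reg X (?pre U)" if U: "openin (zar ?Y) U" and
    *: "\<forall>p\<in>U. \<exists>V g. openin (zar ?Y) V \<and> p \<in> V \<and> (\<lambda>p. g (r `` {p})) \<in> reg X (?pre V) \<and> (\<forall>q\<in>U \<inter> V. f q = g q)" for U f
  proof (rule ringed_local[OF X pre[OF U]])
    fix p assume p: "p \<in> ?pre U"
    then obtain V g where V: "openin (zar ?Y) V" "r `` {p} \<in> V" "(\<lambda>p. g (r `` {p})) \<in> reg X (?pre V)"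
      "\<forall>q\<in>U \<inter> V. f q = g q" using * by blast
    then show "\<exists>V g. openin (zar X) V \<and> p \<in> V \<and> g \<in> reg X V \<and> (\<forall>q\<in>?pre U \<inter> V. f (r `` {q}) = g q)"
      using p by (intro exI[of _ "?pre V"] exI[of _ "\<lambda>p. g (r `` {p})"]) (auto intro: pre)
  qed
  show "(\<lambda>p. c) \<in> reg X (?pre U)" if "openin (zar ?Y) U" for U c
    by (rule ringed_const[OF X pre[OF that]])
  show "(\<lambda>p. f (r `` {p}) + g (r `` {p})) \<in> reg X (?pre U)"
    if "openin (zar ?Y) U" "(\<lambda>p. f (r `` {p})) \<in> reg X (?pre U)" "(\<lambda>p. g (r `` {p})) \<in> reg X (?pre U)" for U f g
    by (rule ringed_add[OF X pre[OF that(1)] that(2,3)])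
  show "(\<lambda>p. f (r `` {p}) * g (r `` {p})) \<in> reg X (?pre U)"
    if "openin (zar ?Y) U" "(\<lambda>p. f (r `` {p})) \<in> reg X (?pre U)" "(\<lambda>p. g (r `` {p})) \<in> reg X (?pre U)" for U f g
    by (rule ringed_mult[OF X pre[OF that(1)] that(2,3)])
  have e: "{p \<in> points X. r `` {p} \<in> {y \<in> U. f y \<noteq> 0}} = {p \<in> ?pre U. f (r `` {p}) \<noteq> 0}"
    for U :: "'a set set" and f :: "'a set \<Rightarrow> complex" by blast
  show "openin (zar ?Y) {p \<in> U. f p \<noteq> 0}"
    if "openin (zar ?Y) U" "(\<lambda>p. f (r `` {p})) \<in> reg X (?pre U)" for U f
    using that(1) ringed_open[OF X pre[OF that(1)] that(2)] unfolding openin_quotient_variety e by blast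
  show "(\<lambda>p. 1 / f (r `` {p})) \<in> reg X (?pre {p \<in> U. f p \<noteq> 0})"
    if "openin (zar ?Y) U" "(\<lambda>p. f (r `` {p})) \<in> reg X (?pre U)" for U f
    unfolding e by (rule ringed_inverse[OF X pre[OF that(1)] that(2)])
qed

section \<open>The structure sheaves of the concrete spaces\<close>

lemma ringed_punctured_space: "ringed (punctured_space n)"
  unfolding punctured_space_def by (intro ringed_subvariety ringed_affine_space)

lemma ringed_weighted_space: "ringed (weighted_space ws)"
  unfolding weighted_space_def by (intro ringed_quotient_variety ringed_punctured_space)

lemma ringed_biprojective_space: "ringed (biprojective_space m n)"
  unfolding biprojective_space_def bipunctured_space_def
  by (intro ringed_quotient_variety ringed_subvariety ringed_affine_space)

section \<open>Morphisms\<close>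

lemma morphism_open: "morphism X Y \<phi> \<Longrightarrow> openin (zar Y) V \<Longrightarrow> openin (zar X) {p \<in> points X. \<phi> p \<in> V}"
  by (simp add: morphism_def continuous_map)

lemma morphism_points: "morphism X Y \<phi> \<Longrightarrow> p \<in> points X \<Longrightarrow> \<phi> p \<in> points Y"
  unfolding morphism_def continuous_map by blast

lemma morphism_reg:
  "morphism X Y \<phi> \<Longrightarrow> openin (zar Y) V \<Longrightarrow> f \<in> reg Y V \<Longrightarrow> f \<circ> \<phi> \<in> reg X {p \<in> points X. \<phi> p \<in> V}"
  by (simp add: morphism_def)

lemma morphismI:
  assumes "\<And>p. p \<in> points X \<Longrightarrow> \<phi> p \<in> points Y"
    "\<And>V. openin (zar Y) V \<Longrightarrow> openin (zar X) {p \<in> points X. \<phi> p \<in> V}"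
    "\<And>V f. openin (zar Y) V \<Longrightarrow> f \<in> reg Y V \<Longrightarrow> f \<circ> \<phi> \<in> reg X {p \<in> points X. \<phi> p \<in> V}"
  shows "morphism X Y \<phi>"
  using assms unfolding morphism_def continuous_map by blast

lemma morphism_compose:
  assumes f: "morphism X Y \<phi>" and g: "morphism Y Z \<psi>"
  shows "morphism X Z (\<psi> \<circ> \<phi>)"
proof (rule morphismI)
  show "(\<psi> \<circ> \<phi>) p \<in> points Z" if "p \<in> points X" for p
    using that morphism_points[OF f] morphism_points[OF g] by simp
  fix V assume V: "openin (zar Z) V"
  have e: "{p \<in> points X. \<phi> p \<in> {q \<in> points Y. \<psi> q \<in> V}} = {p \<in> points X. (\<psi> \<circ> \<phi>) p \<in> V}"
    using morphism_points[OF f] by auto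
  show "openin (zar X) {p \<in> points X. (\<psi> \<circ> \<phi>) p \<in> V}"
    using morphism_open[OF f morphism_open[OF g V]] unfolding e .
  show "h \<circ> (\<psi> \<circ> \<phi>) \<in> reg X {p \<in> points X. (\<psi> \<circ> \<phi>) p \<in> V}" if "h \<in> reg Z V" for h
    using morphism_reg[OF f morphism_open[OF g V] morphism_reg[OF g V that]] unfolding e comp_assoc .
qed

lemma morphism_cong:
  assumes X: "ringed X" and f: "morphism X Y \<phi>" and e: "\<And>p. p \<in> points X \<Longrightarrow> \<psi> p = \<phi> p"
  shows "morphism X Y \<psi>"
proof (rule morphismI)
  show "\<psi> p \<in> points Y" if "p \<in> points X" for p using that morphism_points[OF f] e by simp
  fix V assume V: "openin (zar Y) V"
  have S: "{p \<in> points X. \<psi> p \<in> V} = {p \<in> points X. \<phi> p \<in> V}" using e by auto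
  show o: "openin (zar X) {p \<in> points X. \<psi> p \<in> V}" unfolding S by (rule morphism_open[OF f V])
  show "h \<circ> \<psi> \<in> reg X {p \<in> points X. \<psi> p \<in> V}" if "h \<in> reg Y V" for h
    by (rule ringed_restrict[OF X _ morphism_reg[OF f V that] o]) (use S e o in auto)
qed

lemma morphism_inclusion: "morphism (subvariety X S) X (\<lambda>p. p)" if X: "ringed X"
proof (rule morphismI)
  fix V assume V: "openin (zar X) V"
  have e: "{p \<in> points (subvariety X S). p \<in> V} = V \<inter> S"
    using openin_subset[OF V] by (auto simp: points_subvariety)
  show "openin (zar (subvariety X S)) {p \<in> points (subvariety X S). p \<in> V}"
    unfolding e using V by (auto simp: zar_subvariety openin_subtopology)
  show "f \<circ> (\<lambda>p. p) \<in> reg (subvariety X S) {p \<in> points (subvariety X S). p \<in> V}" if "f \<in> reg X V" for f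
    unfolding e using V that by (intro reg_subvarietyI) auto
qed (simp add: points_subvariety)

lemma morphism_restrict:
  "ringed X \<Longrightarrow> morphism X Y \<phi> \<Longrightarrow> morphism (subvariety X S) Y \<phi>"
  using morphism_compose[OF morphism_inclusion] by (simp add: comp_def)

lemma morphism_into_subvariety:
  assumes X: "ringed X" and Y: "ringed Y" and f: "morphism X Y \<phi>" and S: "\<And>p. p \<in> points X \<Longrightarrow> \<phi> p \<in> S"
  shows "morphism X (subvariety Y S) \<phi>"
proof (rule morphismI)
  show "\<phi> p \<in> points (subvariety Y S)" if "p \<in> points X" for p
    using that S morphism_points[OF f] by (simp add: points_subvariety)
  fix V assume V: "openin (zar (subvariety Y S)) V"
  then obtain V' where V': "openin (zar Y) V'" "V = V' \<inter> S" by (auto simp: zar_subvariety openin_subtopology)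
  have e: "{p \<in> points X. \<phi> p \<in> V} = {p \<in> points X. \<phi> p \<in> V'}" using S V'(2) by auto
  show o: "openin (zar X) {p \<in> points X. \<phi> p \<in> V}" unfolding e by (rule morphism_open[OF f V'(1)])
  show "h \<circ> \<phi> \<in> reg X {p \<in> points X. \<phi> p \<in> V}" if h: "h \<in> reg (subvariety Y S) V" for h
  proof (rule ringed_local[OF X o])
    fix p assume p: "p \<in> {p \<in> points X. \<phi> p \<in> V}"
    obtain W g where W: "openin (zar Y) W" "\<phi> p \<in> W" "g \<in> reg Y W" "\<And>q. q \<in> V \<Longrightarrow> q \<in> W \<Longrightarrow> h q = g q"
      using reg_subvarietyD[OF h, of "\<phi> p"] p by blast
    then show "\<exists>V' g. openin (zar X) V' \<and> p \<in> V' \<and> g \<in> reg X V' \<and>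
        (\<forall>q\<in>{p \<in> points X. \<phi> p \<in> V} \<inter> V'. (h \<circ> \<phi>) q = g q)"
      using p by (intro exI[of _ "{p \<in> points X. \<phi> p \<in> W}"] exI[of _ "g \<circ> \<phi>"])
        (auto intro: morphism_open[OF f] morphism_reg[OF f])
  qed
qed

lemma morphism_quotient: "morphism X (quotient_variety X r) (\<lambda>p. r `` {p})"
  by (rule morphismI)
    (auto simp: points_quotient_variety openin_quotient_variety reg_quotient_variety comp_def intro: quotientI)

text \<open>Polynomials in regular functions are regular and can be inverted where they do not
  vanish; by the local form of regular functions on affine space, this is enough to pull them
  back.\<close>

lemma morphism_affine:
  assumes X: "ringed X" and F: "\<And>x. x \<in> points X \<Longrightarrow> length (F x) = n"
    "\<And>i. i < n \<Longrightarrow> (\<lambda>x. F x ! i) \<in> reg X (points X)"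
  shows "morphism X (affine_space n) F"
proof (rule morphismI; (unfold openin_affine)?)
  have pol: "(\<lambda>x. e (F x)) \<in> reg X (points X)" if "e \<in> polyfun n" for e
    by (rule ringed_polyfun[OF X openin_topspace that F(2)])
  have op: "openin (zar X) {x \<in> points X. e (F x) \<noteq> 0}" if "e \<in> polyfun n" for e
    by (rule ringed_open[OF X openin_topspace pol[OF that]])
  show o: "openin (zar X) {p \<in> points X. F p \<in> V}" if V: "affine_open n V" for V
  proof (subst openin_subopen, intro ballI)
    fix x assume x: "x \<in> {p \<in> points X. F p \<in> V}"
    obtain e where "e \<in> polyfun n" "e (F x) \<noteq> 0" "\<And>q. length q = n \<Longrightarrow> e q \<noteq> 0 \<Longrightarrow> q \<in> V"
      using affine_open_basis[OF V, of "F x"] x by blast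
    then show "\<exists>T. openin (zar X) T \<and> x \<in> T \<and> T \<subseteq> {p \<in> points X. F p \<in> V}"
      using x F(1) by (intro exI[of _ "{x \<in> points X. e (F x) \<noteq> 0}"]) (auto intro: op)
  qed
  show "f \<circ> F \<in> reg X {p \<in> points X. F p \<in> V}" if V: "affine_open n V" and f: "f \<in> reg (affine_space n) V" for V f
  proof (rule ringed_local[OF X o[OF V]])
    fix x assume x: "x \<in> {p \<in> points X. F p \<in> V}"
    obtain e g h where e: "e \<in> polyfun n" "g \<in> polyfun n" "h \<in> polyfun n" "e (F x) \<noteq> 0"
      "\<And>q. length q = n \<Longrightarrow> e q \<noteq> 0 \<Longrightarrow> q \<in> V \<and> h q \<noteq> 0 \<and> f q = g q / h q"
      using reg_affine_basic[OF f V, of "F x"] x by blast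
    let ?W = "{x \<in> points X. e (F x) \<noteq> 0}"
    have "(\<lambda>x. g (F x) / h (F x)) \<in> reg X ?W"
    proof (rule ringed_divide[OF X op[OF e(1)]])
      show "(\<lambda>x. g (F x)) \<in> reg X ?W"
        by (rule ringed_restrict[OF X openin_topspace pol[OF e(2)] op[OF e(1)]]) auto
      show "(\<lambda>x. h (F x)) \<in> reg X ?W"
        by (rule ringed_restrict[OF X openin_topspace pol[OF e(3)] op[OF e(1)]]) auto
    qed (use e(5) F(1) in auto)
    then show "\<exists>V' g. openin (zar X) V' \<and> x \<in> V' \<and> g \<in> reg X V' \<and> (\<forall>q\<in>{p \<in> points X. F p \<in> V} \<inter> V'. (f \<circ> F) q = g q)"
      using e F(1) x by (intro exI[of _ ?W] exI[of _ "\<lambda>x. g (F x) / h (F x)"]) (auto intro: op)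
  qed
qed (use F(1) in simp)

section \<open>Pairs of inverse isomorphisms\<close>

lemma inverse_isomorphismsD:
  assumes "inverse_isomorphisms X Y \<phi> \<psi>"
  shows "morphism X Y \<phi>" "morphism Y X \<psi>" "\<And>p. p \<in> points X \<Longrightarrow> \<psi> (\<phi> p) = p"
    "\<And>q. q \<in> points Y \<Longrightarrow> \<phi> (\<psi> q) = q"
  using assms unfolding inverse_isomorphisms_def by blast+

lemma inverse_isomorphisms_sym:
  "inverse_isomorphisms X Y \<phi> \<psi> \<Longrightarrow> inverse_isomorphisms Y X \<psi> \<phi>"
  unfolding inverse_isomorphisms_def by blast

lemma inverse_isomorphisms_compose:
  assumes 1: "inverse_isomorphisms X Y \<phi> \<psi>" and 2: "inverse_isomorphisms Y Z \<phi>' \<psi>'"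
  shows "inverse_isomorphisms X Z (\<phi>' \<circ> \<phi>) (\<psi> \<circ> \<psi>')"
  unfolding inverse_isomorphisms_def
  using morphism_compose[OF inverse_isomorphismsD(1)[OF 1] inverse_isomorphismsD(1)[OF 2]]
    morphism_compose[OF inverse_isomorphismsD(2)[OF 2] inverse_isomorphismsD(2)[OF 1]]
    inverse_isomorphismsD(3,4)[OF 1] inverse_isomorphismsD(3,4)[OF 2]
    morphism_points[OF inverse_isomorphismsD(1)[OF 1]] morphism_points[OF inverse_isomorphismsD(2)[OF 2]]
  by simp


lemma inverse_isomorphisms_restrict:
  assumes X: "ringed X" and Y: "ringed Y" and iso: "inverse_isomorphisms (subvariety X U) (subvariety Y V) \<phi> \<psi>"
    and U: "U \<subseteq> points X" and V: "V' \<subseteq> V" "V \<subseteq> points Y" and U': "U' = {p \<in> U. \<phi> p \<in> V'}"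
  shows "inverse_isomorphisms (subvariety X U') (subvariety Y V') \<phi> \<psi>"
proof -
  note i = inverse_isomorphismsD[OF iso]
  have pt: "points (subvariety X U) = U" "points (subvariety Y V) = V"
    "points (subvariety X U') = U'" "points (subvariety Y V') = V'"
    using assms by (auto simp: points_subvariety)
  have "morphism (subvariety X U') (subvariety X U) (\<lambda>p. p)"
    using assms by (intro morphism_into_subvariety morphism_inclusion ringed_subvariety) (auto simp: points_subvariety)
  from morphism_compose[OF this i(1)] have "morphism (subvariety X U') (subvariety Y V) \<phi>" by (simp add: comp_def)
  then have "morphism (subvariety X U') Y \<phi>"
    using morphism_compose[OF _ morphism_inclusion[OF Y]] by (fastforce simp: comp_def)
  then have 1: "morphism (subvariety X U') (subvariety Y V') \<phi>"
    using assms by (intro morphism_into_subvariety ringed_subvariety) (auto simp: points_subvariety)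
  have "morphism (subvariety Y V') (subvariety Y V) (\<lambda>p. p)"
    using assms by (intro morphism_into_subvariety morphism_inclusion ringed_subvariety) (auto simp: points_subvariety)
  from morphism_compose[OF this i(2)] have "morphism (subvariety Y V') (subvariety X U) \<psi>" by (simp add: comp_def)
  then have "morphism (subvariety Y V') X \<psi>"
    using morphism_compose[OF _ morphism_inclusion[OF X]] by (fastforce simp: comp_def)
  moreover have "\<psi> q \<in> U'" if "q \<in> V'" for q
    using that V i(4) morphism_points[OF i(2)] unfolding pt U' by auto
  ultimately have 2: "morphism (subvariety Y V') (subvariety X U') \<psi>"
    using assms by (intro morphism_into_subvariety ringed_subvariety) (auto simp: points_subvariety)
  show ?thesis unfolding inverse_isomorphisms_def pt using 1 2 i(3,4) V U' unfolding pt by auto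
qed

section \<open>Descent along cyclic covers of the plane\<close>

text \<open>
  A function on the cover \<open>{(s, t, b). b ^ k = R(s, t)}\<close> of the plane is a combination of
  \<open>1, b, \<dots>, b ^ (k - 1)\<close> with coefficients on the plane.
\<close>

definition cover_functions :: "nat \<Rightarrow> (complex list \<Rightarrow> complex) \<Rightarrow> (complex list \<Rightarrow> complex) set" where
  "cover_functions k R = {h. \<exists>H. (\<forall>j<k. H j \<in> polyfun 2) \<and>
     (\<forall>s t b. b ^ k = R [s, t] \<longrightarrow> h [s, t, b] = (\<Sum>j<k. b ^ j * H j [s, t]))}"

lemma cover_functions_cong:
  "h \<in> cover_functions k R \<Longrightarrow> (\<And>s t b. b ^ k = R [s, t] \<Longrightarrow> g [s, t, b] = h [s, t, b]) \<Longrightarrow>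
    g \<in> cover_functions k R"
  unfolding cover_functions_def mem_Collect_eq by (elim ex_forward conj_forward) simp_all

lemma cover_functions_add:
  assumes "g \<in> cover_functions k R" "h \<in> cover_functions k R"
  shows "(\<lambda>p. g p + h p) \<in> cover_functions k R"
proof -
  obtain G H where "\<forall>j<k. G j \<in> polyfun 2" "\<forall>j<k. H j \<in> polyfun 2"
    "\<forall>s t b. b ^ k = R [s, t] \<longrightarrow> g [s, t, b] = (\<Sum>j<k. b ^ j * G j [s, t])"
    "\<forall>s t b. b ^ k = R [s, t] \<longrightarrow> h [s, t, b] = (\<Sum>j<k. b ^ j * H j [s, t])"
    using assms unfolding cover_functions_def by blast
  then show ?thesis unfolding cover_functions_def
    by (intro CollectI exI[of _ "\<lambda>j p. G j p + H j p"])
      (auto intro: polyfun.add simp: distrib_left sum.distrib)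
qed

lemma cover_functions_base:
  assumes "f \<in> polyfun 2" "k \<ge> 1"
  shows "(\<lambda>p. f [p ! 0, p ! 1]) \<in> cover_functions k R"
proof -
  obtain m where k: "k = Suc m" using assms(2) by (cases k) auto
  have "(\<Sum>j<k. b ^ j * (if j = 0 then f else (\<lambda>p. 0)) q) = f q" for b q
    by (simp add: k sum.lessThan_Suc_shift del: sum.lessThan_Suc)
  then show ?thesis using assms unfolding cover_functions_def
    by (intro CollectI exI[of _ "\<lambda>j. if j = 0 then f else (\<lambda>p. 0)"])
      (auto intro: polyfun.const)
qed

lemma cover_functions_scale:
  assumes "f \<in> polyfun 2" "h \<in> cover_functions k R"
  shows "(\<lambda>p. f [p ! 0, p ! 1] * h p) \<in> cover_functions k R"
proof -
  obtain H where "\<forall>j<k. H j \<in> polyfun 2"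
    "\<forall>s t b. b ^ k = R [s, t] \<longrightarrow> h [s, t, b] = (\<Sum>j<k. b ^ j * H j [s, t])"
    using assms unfolding cover_functions_def by blast
  then show ?thesis using assms(1) unfolding cover_functions_def
    by (intro CollectI exI[of _ "\<lambda>j p. f p * H j p"])
      (auto intro: polyfun.mult simp: sum_distrib_left mult_ac)
qed

text \<open>Multiplication by \<open>b\<close> shifts the coefficients by one place; the top
  coefficient returns to place 0 with the factor \<open>R\<close>, since
  \<open>b ^ k = R\<close>.\<close>

lemma cover_functions_shift:
  assumes R: "R \<in> polyfun 2" and "k \<ge> 1" and "h \<in> cover_functions k R"
  shows "(\<lambda>p. p ! 2 * h p) \<in> cover_functions k R"
proof -
  obtain m where k: "k = Suc m" using assms(2) by (cases k) auto
  obtain H where H: "\<forall>j<k. H j \<in> polyfun 2"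
    "\<forall>s t b. b ^ k = R [s, t] \<longrightarrow> h [s, t, b] = (\<Sum>j<k. b ^ j * H j [s, t])"
    using assms unfolding cover_functions_def by blast
  define G where "G j p = (case j of 0 \<Rightarrow> R p * H m p | Suc i \<Rightarrow> H i p)" for j p
  have "G j \<in> polyfun 2" if "j < k" for j
    using H(1) R that by (cases j) (auto simp: G_def[abs_def] k intro: polyfun.mult)
  moreover have "b * h [s, t, b] = (\<Sum>j<k. b ^ j * G j [s, t])" if b: "b ^ k = R [s, t]" for s t b
  proof -
    have "(\<Sum>j<k. b ^ j * G j [s, t]) = R [s, t] * H m [s, t] + (\<Sum>j<m. b ^ Suc j * H j [s, t])"
      by (simp only: k sum.lessThan_Suc_shift) (simp add: G_def)
    also have "\<dots> = b * (\<Sum>j<k. b ^ j * H j [s, t])"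
      by (simp add: b[symmetric] k sum_distrib_left algebra_simps)
    finally show ?thesis using H(2) b by simp
  qed
  ultimately show ?thesis unfolding cover_functions_def by (auto intro!: exI[of _ G])
qed

lemma polyfun_cover_functions:
  assumes R: "R \<in> polyfun 2" and k: "k \<ge> 1" and "h \<in> polyfun 3"
  shows "h \<in> cover_functions k R"
  using assms(3)
proof induction
  case (const c)
  show ?case using cover_functions_base[OF polyfun.const[of c] k] .
next
  case (coord i)
  then consider "i = 0" | "i = 1" | "i = 2" by linarith
  then show ?case
  proof cases
    case 3
    show ?thesis using cover_functions_shift[OF R k cover_functions_base[OF polyfun.const[of 1] k]] 3 by simp
  next
    case 1
    then show ?thesis using cover_functions_base[OF polyfun.coord[of 0 2] k] by simp
  next
    case 2
    then show ?thesis using cover_functions_base[OF polyfun.coord[of 1 2] k] by simp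
  qed
next
  case (add f g)
  then show ?case by (intro cover_functions_add)
next
  case (mult f g)
  then obtain G where G: "\<forall>j<k. G j \<in> polyfun 2"
    "\<forall>s t b. b ^ k = R [s, t] \<longrightarrow> g [s, t, b] = (\<Sum>j<k. b ^ j * G j [s, t])"
    unfolding cover_functions_def by blast
  \<comment> \<open>Only \<open>g\<close> is expanded in powers of \<open>b\<close>, while
    \<open>f\<close> is kept whole; the product then needs no convolution of coefficients, only
    shifts of \<open>f\<close>, scalings by functions on the plane and sums.\<close>
  have pow: "(\<lambda>p. (p ! 2) ^ j * f p) \<in> cover_functions k R" for j
  proof (induction j)
    case (Suc j)
    then show ?case using cover_functions_shift[OF R k Suc] by (simp add: mult.assoc)
  qed (use mult in simp)
  have sum: "(\<lambda>p. \<Sum>j<m. G j [p ! 0, p ! 1] * ((p ! 2) ^ j * f p)) \<in> cover_functions k R" if "m \<le> k" for m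
    using that
  proof (induction m)
    case 0
    show ?case using cover_functions_base[OF polyfun.const[of 0] k] by simp
  next
    case (Suc m)
    then have "G m \<in> polyfun 2" using G(1) by simp
    from cover_functions_add[OF Suc.IH cover_functions_scale[OF this pow[of m]]] Suc.prems
    show ?case by simp
  qed
  show ?case by (rule cover_functions_cong[OF sum[of k]])
      (use G(2) in \<open>simp_all add: sum_distrib_left mult_ac\<close>)
qed

text \<open>A polynomial in \<open>b\<close> of degree below \<open>k\<close> cannot have all
  \<open>k\<close> distinct roots of \<open>b ^ k = c\<close> among its zeros unless its
  coefficients vanish.\<close>

lemma power_sums_vanish:
  assumes "k \<ge> 1" "c \<noteq> 0" and van: "\<And>b::complex. b ^ k = c \<Longrightarrow> (\<Sum>j<k. b ^ j * a j) = 0" and "j < k"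
  shows "a j = 0"
proof (rule ccontr)
  assume a: "a j \<noteq> 0"
  obtain m where k: "k = Suc m" using assms(1) by (cases k) auto
  have "\<exists>i\<le>m. a i \<noteq> 0" using a assms(4) k by (auto simp: less_Suc_eq_le)
  from polyfun_rootbound[OF this]
  have fin: "finite {z. (\<Sum>i\<le>m. a i * z ^ i) = 0}" and "card {z. (\<Sum>i\<le>m. a i * z ^ i) = 0} \<le> m"
    by blast+
  moreover have "{z. z ^ k = c} \<subseteq> {z. (\<Sum>i\<le>m. a i * z ^ i) = 0}"
    using van by (auto simp: k lessThan_Suc_atMost mult.commute)
  then have "card {z. z ^ k = c} \<le> card {z. (\<Sum>i\<le>m. a i * z ^ i) = 0}" by (rule card_mono[OF fin])
  moreover have "card {z. z ^ k = c} = k" using card_nth_roots[OF assms(2)] assms(1) by simp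
  ultimately show False using k by simp
qed

text \<open>
  If \<open>f \<circ> \<kappa> \<circ> \<sigma> = g / h\<close> with \<open>g\<close> and \<open>h\<close> polynomial in \<open>s, t, b\<close>, then comparing the coefficients of
  the powers of \<open>b\<close> in \<open>f h = g\<close> writes \<open>f\<close> as a quotient of functions on the plane.
\<close>

lemma cover_morphism:
  assumes Y: "ringed Y" and \<kappa>: "morphism (subvariety (affine_space n) \<Omega>) Y \<kappa>" and \<Omega>: "affine_open n \<Omega>"
    and \<O>: "affine_open 2 \<O>" and \<sigma>: "\<And>i. i < n \<Longrightarrow> (\<lambda>p. \<sigma> p ! i) \<in> polyfun 3"
    and R: "R \<in> polyfun 2" "\<And>q. q \<in> \<O> \<Longrightarrow> R q \<noteq> 0" and k: "k \<ge> 1"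
    and lift: "\<And>s t b. [s, t] \<in> \<O> \<Longrightarrow> b ^ k = R [s, t] \<Longrightarrow> \<sigma> [s, t, b] \<in> \<Omega> \<and> \<kappa> (\<sigma> [s, t, b]) = \<psi> [s, t]"
  shows "morphism (subvariety (affine_space 2) \<O>) Y \<psi>"
proof -
  have A: "ringed (affine_space m)" for m by (rule ringed_affine_space)
  have \<Omega>o: "openin (zar (affine_space n)) \<Omega>" and \<O>o: "openin (zar (affine_space 2)) \<O>"
    using \<Omega> \<O> by (simp_all add: openin_affine)
  have pt: "points (subvariety (affine_space n) \<Omega>) = \<Omega>" "points (subvariety (affine_space 2) \<O>) = \<O>"
    using openin_subset[OF \<Omega>o] openin_subset[OF \<O>o] by (auto simp: points_subvariety)
  have root: "\<exists>b. b ^ k = R q" for q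
  proof (cases "R q = 0")
    case False
    then have "card {z. z ^ k = R q} = k" using card_nth_roots k by simp
    then show ?thesis using k by (metis (mono_tags) card.empty empty_Collect_eq not_one_le_zero)
  qed (use k in \<open>auto intro: exI[of _ 0]\<close>)
  have two: "\<exists>s t. q = [s, t]" if "q \<in> \<O>" for q
    using affine_open_length[OF \<O> that] by (auto simp: numeral_2_eq_2 length_Suc_conv)
  have expand: "\<exists>E. (\<forall>j<k. E j \<in> polyfun 2) \<and>
     (\<forall>s t b. b ^ k = R [s, t] \<longrightarrow> e (\<sigma> [s, t, b]) = (\<Sum>j<k. b ^ j * E j [s, t]))" if "e \<in> polyfun n" for e
    using polyfun_cover_functions[OF R(1) k polyfun_compose[OF that \<sigma>]] unfolding cover_functions_def by blast
  show ?thesis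
  proof (rule morphismI; unfold pt)
    show "\<psi> q \<in> points Y" if "q \<in> \<O>" for q
      using two[OF that] root[of q] lift morphism_points[OF \<kappa>] that unfolding pt by metis
  next
    fix V assume V: "openin (zar Y) V"
    have pre: "affine_open n {p \<in> \<Omega>. \<kappa> p \<in> V}"
      using morphism_open[OF \<kappa> V] \<Omega>o unfolding pt
      by (simp add: openin_subvariety_open openin_affine)
    have "affine_open 2 {q \<in> \<O>. \<psi> q \<in> V}"
    proof (rule affine_openI)
      fix q assume q: "q \<in> {q \<in> \<O>. \<psi> q \<in> V}"
      obtain s t where st: "q = [s, t]" using two q by blast
      obtain b where b: "b ^ k = R [s, t]" using root by blast
      have "\<sigma> [s, t, b] \<in> {p \<in> \<Omega>. \<kappa> p \<in> V}" using q lift[OF _ b] unfolding st by auto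
      then obtain e where e: "e \<in> polyfun n" "e (\<sigma> [s, t, b]) \<noteq> 0"
        "\<And>p. length p = n \<Longrightarrow> e p \<noteq> 0 \<Longrightarrow> p \<in> {p \<in> \<Omega>. \<kappa> p \<in> V}"
        using affine_open_basis[OF pre] by blast
      obtain E where E: "\<And>j. j < k \<Longrightarrow> E j \<in> polyfun 2"
        "\<And>s t b. b ^ k = R [s, t] \<Longrightarrow> e (\<sigma> [s, t, b]) = (\<Sum>j<k. b ^ j * E j [s, t])"
        using expand[OF e(1)] by blast
      \<comment> \<open>A nonzero value at one root forces a nonzero coefficient at
        \<open>q\<close>. Its nonvanishing is a condition on the plane alone, and it guarantees
        conversely that some root has a nonzero value.\<close>
      obtain j where j: "j < k" "E j q \<noteq> 0"
        using e(2) unfolding E(2)[OF b] st by (metis (mono_tags, lifting) lessThan_iff mult_eq_0_iff sum.neutral)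
      obtain d where d: "d \<in> polyfun 2" "d q \<noteq> 0" "\<And>r. length r = 2 \<Longrightarrow> d r \<noteq> 0 \<Longrightarrow> r \<in> \<O>"
        using affine_open_basis[OF \<O>] q by blast
      have "r \<in> {q \<in> \<O>. \<psi> q \<in> V}" if r: "length r = 2" "d r * E j r \<noteq> 0" for r
      proof -
        have rO: "r \<in> \<O>" using d(3) r by auto
        obtain s' t' where r': "r = [s', t']" using two[OF rO] by blast
        obtain b' where b': "b' ^ k = R [s', t']" "(\<Sum>j<k. b' ^ j * E j [s', t']) \<noteq> 0"
          using power_sums_vanish[OF k R(2)[OF rO] _ j(1), of "\<lambda>j. E j r"] r(2) unfolding r' by auto
        then have "e (\<sigma> [s', t', b']) \<noteq> 0" by (simp add: E(2))
        with lift[OF _ b'(1)] rO show ?thesis unfolding r'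
          using e(3)[of "\<sigma> [s', t', b']"] affine_open_length[OF \<Omega>] by auto
      qed
      then show "\<exists>e\<in>polyfun 2. e q \<noteq> 0 \<and> (\<forall>r. length r = 2 \<and> e r \<noteq> 0 \<longrightarrow> r \<in> {q \<in> \<O>. \<psi> q \<in> V})"
        using d j E(1) by (intro bexI[of _ "\<lambda>p. d p * E j p"]) (auto intro: polyfun.mult)
    qed (use \<O> affine_open_length in blast)
    then have o: "openin (zar (affine_space 2)) {q \<in> \<O>. \<psi> q \<in> V}" by (simp add: openin_affine)
    then show "openin (zar (subvariety (affine_space 2) \<O>)) {q \<in> \<O>. \<psi> q \<in> V}"
      by (subst openin_subvariety_open[OF \<O>o]) auto
    fix f assume f: "f \<in> reg Y V"
    have f\<kappa>: "f \<circ> \<kappa> \<in> reg (affine_space n) {p \<in> \<Omega>. \<kappa> p \<in> V}"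
      using morphism_reg[OF \<kappa> V f] pre unfolding pt
      by (simp add: reg_subvariety_open[OF A] openin_affine)
    show "f \<circ> \<psi> \<in> reg (subvariety (affine_space 2) \<O>) {q \<in> \<O>. \<psi> q \<in> V}"
      unfolding reg_subvariety_open[OF A o]
    proof (rule reg_affineI)
      fix q assume q: "q \<in> {q \<in> \<O>. \<psi> q \<in> V}"
      obtain s t where st: "q = [s, t]" using two q by blast
      obtain b where b: "b ^ k = R [s, t]" using root by blast
      have p: "\<sigma> [s, t, b] \<in> {p \<in> \<Omega>. \<kappa> p \<in> V}" using q lift[OF _ b] unfolding st by auto
      obtain e g h where e: "e \<in> polyfun n" "g \<in> polyfun n" "h \<in> polyfun n" "e (\<sigma> [s, t, b]) \<noteq> 0"
        "\<And>p. length p = n \<Longrightarrow> e p \<noteq> 0 \<Longrightarrow> p \<in> {p \<in> \<Omega>. \<kappa> p \<in> V} \<and> h p \<noteq> 0 \<and> (f \<circ> \<kappa>) p = g p / h p"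
        using reg_affine_basic[OF f\<kappa> pre p] by blast
      obtain G where G: "\<And>j. j < k \<Longrightarrow> G j \<in> polyfun 2"
        "\<And>s t b. b ^ k = R [s, t] \<Longrightarrow> e (\<sigma> [s, t, b]) * g (\<sigma> [s, t, b]) = (\<Sum>j<k. b ^ j * G j [s, t])"
        using expand[OF polyfun.mult[OF e(1,2)]] by blast
      obtain H where H: "\<And>j. j < k \<Longrightarrow> H j \<in> polyfun 2"
        "\<And>s t b. b ^ k = R [s, t] \<Longrightarrow> e (\<sigma> [s, t, b]) * h (\<sigma> [s, t, b]) = (\<Sum>j<k. b ^ j * H j [s, t])"
        using expand[OF polyfun.mult[OF e(1,3)]] by blast
      have "length (\<sigma> [s, t, b]) = n" using p affine_open_length[OF \<Omega>] by blast
      then have "e (\<sigma> [s, t, b]) * h (\<sigma> [s, t, b]) \<noteq> 0" using e(4,5) by simp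
      then obtain j where j: "j < k" "H j q \<noteq> 0"
        unfolding H(2)[OF b] st by (metis (mono_tags, lifting) lessThan_iff mult_eq_0_iff sum.neutral)
      have key: "f (\<psi> r) * H j r = G j r" if r: "r \<in> {q \<in> \<O>. \<psi> q \<in> V}" for r
      proof -
        obtain s' t' where r': "r = [s', t']" using two r by blast
        have rO: "[s', t'] \<in> \<O>" using r r' by simp
        \<comment> \<open>The value \<open>f (\<psi> r)\<close> is the same for all roots
          \<open>b'\<close> over \<open>r\<close>, so the coefficients of the powers of
          \<open>b'\<close> can be compared one by one.\<close>
        have "(\<Sum>j<k. b' ^ j * (f (\<psi> r) * H j r - G j r)) = 0" if b': "b' ^ k = R r" for b'
        proof -
          let ?p = "\<sigma> [s', t', b']"
          have l: "?p \<in> \<Omega>" "\<kappa> ?p = \<psi> r" using lift[OF rO] b' unfolding r' by auto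
          have "f (\<psi> r) * (e ?p * h ?p) = e ?p * g ?p"
            using e(5)[of ?p] l affine_open_length[OF \<Omega>] by (cases "e ?p = 0") auto
          then show ?thesis using G(2)[of b' s' t'] H(2)[of b' s' t'] b'
            by (simp add: r' right_diff_distrib sum_subtractf sum_distrib_left mult_ac)
        qed
        from power_sums_vanish[OF k R(2) this j(1)] rO r' show ?thesis by simp
      qed
      show "\<exists>V' g h. affine_open 2 V' \<and> q \<in> V' \<and> g \<in> polyfun 2 \<and> h \<in> polyfun 2 \<and>
              (\<forall>q\<in>{q \<in> \<O>. \<psi> q \<in> V} \<inter> V'. h q \<noteq> 0 \<and> (f \<circ> \<psi>) q = g q / h q)"
      proof (intro exI conjI ballI)
        show "affine_open 2 {r. length r = 2 \<and> H j r \<noteq> 0}" by (rule affine_open_basic[OF H(1)[OF j(1)]])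
        show "q \<in> {r. length r = 2 \<and> H j r \<noteq> 0}" using j st by simp
        fix r assume "r \<in> {q \<in> \<O>. \<psi> q \<in> V} \<inter> {r. length r = 2 \<and> H j r \<noteq> 0}"
        then show "H j r \<noteq> 0" "(f \<circ> \<psi>) r = G j r / H j r" using key by (auto simp: nonzero_eq_divide_eq)
      qed (use G H j in auto)
    qed
  qed
qed

section \<open>Directional derivatives and vector fields\<close>

lemma gradient_at_divide:
  assumes f: "gradient_at n g p G" and h: "gradient_at n h p H" "h p \<noteq> 0"
  shows "gradient_at n (\<lambda>p. g p / h p) p (\<lambda>i. (G i * h p - g p * H i) / (h p * h p))"
  unfolding gradient_at_def
proof (intro allI impI; elim conjE)
  fix c c' assume c: "c 0 = p" "\<forall>\<^sub>F t in nhds 0. length (c t) = n"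
    "\<forall>i<n. ((\<lambda>t. c t ! i) has_field_derivative c' i) (at (0::complex))"
  have e: "(\<Sum>i<n. (G i * h p - g p * H i) / (h p * h p) * c' i) =
      ((\<Sum>i<n. G i * c' i) * h (c 0) - g (c 0) * (\<Sum>i<n. H i * c' i)) / (h (c 0) * h (c 0))"
  proof -
    have "(\<Sum>i<n. (G i * h p - g p * H i) / (h p * h p) * c' i) =
        (\<Sum>i<n. (G i * c' i * h p - g p * (H i * c' i)) / (h p * h p))"
      by (intro sum.cong) (auto simp: algebra_simps)
    also have "\<dots> = (\<Sum>i<n. G i * c' i * h p - g p * (H i * c' i)) / (h p * h p)"
      by (rule sum_divide_distrib[symmetric])
    finally show ?thesis
      by (simp only: c(1) sum_distrib_left sum_distrib_right sum_subtractf)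
  qed
  show "((\<lambda>t. g (c t) / h (c t)) has_field_derivative
      (\<Sum>i<n. (G i * h p - g p * H i) / (h p * h p) * c' i)) (at 0)"
    unfolding e by (rule DERIV_divide[OF gradient_atD[OF f] gradient_atD[OF h(1)]]) (use c h in simp)+
qed

text \<open>By continuity, a curve through \<open>p\<close> stays in the locus
  \<open>e \<noteq> 0\<close> for small \<open>t\<close>, so the gradient depends on
  \<open>f\<close> only near \<open>p\<close>.\<close>

lemma gradient_at_cong:
  assumes g: "gradient_at n g p G" and e: "e \<in> polyfun n" "e p \<noteq> 0"
    "\<And>q. length q = n \<Longrightarrow> e q \<noteq> 0 \<Longrightarrow> f q = g q"
  shows "gradient_at n f p G"
  unfolding gradient_at_def
proof (intro allI impI; elim conjE)
  fix c c' assume c: "c 0 = p" "\<forall>\<^sub>F t in nhds 0. length (c t) = n"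
    "\<forall>i<n. ((\<lambda>t. c t ! i) has_field_derivative c' i) (at (0::complex))"
  obtain E where "gradient_at n e p (\<lambda>i. E i p)" using polyfun_gradient[OF e(1)] by blast
  then have "((\<lambda>t. e (c t)) has_field_derivative (\<Sum>i<n. E i p * c' i)) (at 0)"
    by (rule gradient_atD) (use c in simp_all)
  then have "((\<lambda>t. e (c t)) \<longlongrightarrow> e p) (nhds 0)"
    using c(1) by (auto dest!: DERIV_isCont simp: isCont_def tendsto_nhds_iff)
  then have "\<forall>\<^sub>F t in nhds 0. e (c t) \<noteq> 0" using e(2) by (rule tendsto_imp_eventually_ne)
  with c(2) have ev: "\<forall>\<^sub>F t in nhds 0. f (c t) = g (c t)"
    by eventually_elim (use e(3) in blast)
  have "((\<lambda>t. g (c t)) has_field_derivative (\<Sum>i<n. G i * c' i)) (at 0)"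
    by (rule gradient_atD[OF g]) (use c in simp_all)
  then show "((\<lambda>t. f (c t)) has_field_derivative (\<Sum>i<n. G i * c' i)) (at 0)"
    using DERIV_cong_ev[OF refl ev refl] by simp
qed

lemma reg_gradient:
  assumes f: "f \<in> reg (affine_space n) U" "affine_open n U" "p \<in> U"
  shows "\<exists>L. gradient_at n f p L"
proof -
  obtain e g h where e: "e \<in> polyfun n" "g \<in> polyfun n" "h \<in> polyfun n" "e p \<noteq> 0"
      "\<And>q. length q = n \<Longrightarrow> e q \<noteq> 0 \<Longrightarrow> q \<in> U \<and> h q \<noteq> 0 \<and> f q = g q / h q"
    using reg_affine_basic[OF f] by blast
  have len: "length p = n" using affine_open_length[OF f(2,3)] .
  obtain G H where "gradient_at n g p (\<lambda>i. G i p)" "gradient_at n h p (\<lambda>i. H i p)"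
    using polyfun_gradient[OF e(2)] polyfun_gradient[OF e(3)] by blast
  from gradient_at_divide[OF this] have "gradient_at n (\<lambda>p. g p / h p) p (\<lambda>i. (G i p * h p - g p * H i p) / (h p * h p))"
    using e(4,5) len by blast
  from gradient_at_cong[OF this e(1,4)] e(5) show ?thesis by blast
qed

lemma line_derivative:
  "length p = n \<Longrightarrow> length w = n \<Longrightarrow> i < n \<Longrightarrow>
    ((\<lambda>t. map2 (\<lambda>a b. a + t * b) p w ! i) has_field_derivative w ! i) (at (0::complex))"
  by (auto intro!: derivative_eq_intros)

lemma line_0: "length p = length w \<Longrightarrow> map2 (\<lambda>a b. a + 0 * b) p w = (p :: complex list)"
  by (auto intro!: nth_equalityI)

lemma dir_deriv_eqI: "((\<lambda>t. f (map2 (\<lambda>a b. a + t * b) p w)) has_field_derivative d) (at 0) \<Longrightarrow> dir_deriv f p w = d"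
  unfolding dir_deriv_def by (rule DERIV_imp_deriv)

lemma dir_deriv_cong_ev:
  "\<forall>\<^sub>F t in nhds 0. f (map2 (\<lambda>a b. a + t * b) p w) = g (map2 (\<lambda>a b. a + t * b) p w) \<Longrightarrow> dir_deriv f p w = dir_deriv g p w"
  unfolding dir_deriv_def by (rule deriv_cong_ev) auto

lemma eventually_line:
  assumes U: "affine_open n U" "p \<in> U" and w: "length w = n"
  shows "\<forall>\<^sub>F t in nhds 0. map2 (\<lambda>a b. a + t * b) p w \<in> U"
proof -
  have p: "length p = n" using affine_open_length[OF U] .
  obtain e where e: "e \<in> polyfun n" "e p \<noteq> 0" "\<And>q. length q = n \<Longrightarrow> e q \<noteq> 0 \<Longrightarrow> q \<in> U"
    using affine_open_basis[OF U] by blast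
  obtain P where P: "\<And>t. e (map2 (\<lambda>a b. a + t * b) p w) = poly P t" using polyfun_line[OF e(1) p w] by blast
  have "(poly P \<longlongrightarrow> poly P 0) (nhds 0)"
    using poly_isCont[of 0 P] by (simp add: isCont_def tendsto_nhds_iff)
  moreover have "poly P 0 \<noteq> 0" using P[of 0] e(2) line_0[of p w] p w by simp
  ultimately have "\<forall>\<^sub>F t in nhds 0. poly P t \<noteq> 0" by (rule tendsto_imp_eventually_ne)
  then show ?thesis by (rule eventually_mono) (use e(3) P p w in simp)
qed

lemma dir_deriv_cong:
  assumes U: "affine_open n U" "p \<in> U" and w: "length w = n" and "\<And>q. q \<in> U \<Longrightarrow> f q = g q"
  shows "dir_deriv f p w = dir_deriv g p w"
  by (rule dir_deriv_cong_ev, rule eventually_mono[OF eventually_line[OF U w]]) (rule assms(4))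

lemma gradient_at_line:
  assumes L: "gradient_at n f p L" and l: "length p = n" "length w = n"
  shows "((\<lambda>t. f (map2 (\<lambda>a b. a + t * b) p w)) has_field_derivative (\<Sum>i<n. L i * w ! i)) (at 0)"
    and "dir_deriv f p w = (\<Sum>i<n. L i * w ! i)"
proof -
  show *: "((\<lambda>t. f (map2 (\<lambda>a b. a + t * b) p w)) has_field_derivative (\<Sum>i<n. L i * w ! i)) (at 0)"
    using gradient_atD[OF L, of "\<lambda>t. map2 (\<lambda>a b. a + t * b) p w" "\<lambda>i. w ! i"] l line_derivative[OF l] line_0[of p w]
    by simp
  show "dir_deriv f p w = (\<Sum>i<n. L i * w ! i)" by (rule dir_deriv_eqI[OF *])
qed

lemma reg_line_derivative:
  assumes f: "f \<in> reg (affine_space n) U" "affine_open n U" "p \<in> U" and w: "length w = n"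
  shows "((\<lambda>t. f (map2 (\<lambda>a b. a + t * b) p w)) has_field_derivative dir_deriv f p w) (at 0)"
proof -
  obtain L where "gradient_at n f p L" using reg_gradient[OF f] by blast
  from gradient_at_line[OF this affine_open_length[OF f(2,3)] w] show ?thesis by simp
qed

text \<open>Near each point \<open>f = a / b\<close>, and its derivative along \<open>D\<close> is
  \<open>(D a) b - a (D b)\<close> divided by \<open>b^2\<close>, again a fraction of polynomials
  because the gradients and \<open>D\<close> are polynomial.\<close>

lemma vector_field_affine:
  assumes U: "affine_open n U" and D: "\<And>i. i < n \<Longrightarrow> (\<lambda>p. D p ! i) \<in> polyfun n" "\<And>p. length p = n \<Longrightarrow> length (D p) = n"
  shows "vector_field (affine_space n) U (\<lambda>f p. dir_deriv f p (D p))"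
  unfolding vector_field_def openin_affine
proof (intro conjI allI impI ballI; (elim conjE)?)
  show "affine_open n U" by fact
  fix V f g
  assume V: "affine_open n V" and f: "f \<in> reg (affine_space n) V" and g: "g \<in> reg (affine_space n) V"
  have len: "length x = n" if "x \<in> V" for x using affine_open_length[OF V that] .
  show "(\<lambda>p. dir_deriv f p (D p)) \<in> reg (affine_space n) V"
  proof (rule reg_affineI)
    fix p assume p: "p \<in> V"
    obtain e a b where e: "e \<in> polyfun n" "a \<in> polyfun n" "b \<in> polyfun n" "e p \<noteq> 0"
      "\<And>q. length q = n \<Longrightarrow> e q \<noteq> 0 \<Longrightarrow> q \<in> V \<and> b q \<noteq> 0 \<and> f q = a q / b q"
      using reg_affine_basic[OF f V p] by blast
    obtain A B where A: "\<forall>i<n. A i \<in> polyfun n" "\<And>p. gradient_at n a p (\<lambda>i. A i p)"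
      and B: "\<forall>i<n. B i \<in> polyfun n" "\<And>p. gradient_at n b p (\<lambda>i. B i p)"
      using polyfun_gradient[OF e(2)] polyfun_gradient[OF e(3)] by blast
    let ?N = "{q. length q = n \<and> e q \<noteq> 0}"
    let ?g = "\<lambda>q. (\<Sum>i<n. A i q * D q ! i) * b q - a q * (\<Sum>i<n. B i q * D q ! i)"
    show "\<exists>V' g h. affine_open n V' \<and> p \<in> V' \<and> g \<in> polyfun n \<and> h \<in> polyfun n \<and>
                (\<forall>q\<in>V \<inter> V'. h q \<noteq> 0 \<and> dir_deriv f q (D q) = g q / h q)"
    proof (intro exI conjI ballI)
      show "affine_open n ?N" by (rule affine_open_basic[OF e(1)])
      show "p \<in> ?N" using e(4) len[OF p] by simp
      show "?g \<in> polyfun n" "(\<lambda>q. b q * b q) \<in> polyfun n"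
        using A(1) B(1) D(1) e(2,3) by (auto intro!: polyfun_diff polyfun.mult polyfun_sum)
      fix q assume q: "q \<in> V \<inter> ?N"
      then show "b q * b q \<noteq> 0" using e(5) by simp
      have l: "length q = n" "length (D q) = n" using q D(2) by auto
      have "dir_deriv f q (D q) = dir_deriv (\<lambda>q. a q / b q) q (D q)"
        by (rule dir_deriv_cong[OF affine_open_basic[OF e(1)] _ l(2)]) (use q e(5) in auto)
      also have "\<dots> = ?g q / (b q * b q)"
        using DERIV_divide[OF gradient_at_line(1)[OF A(2) l] gradient_at_line(1)[OF B(2) l]]
          q e(5) line_0[of q "D q"] l by (intro dir_deriv_eqI) simp
      finally show "dir_deriv f q (D q) = ?g q / (b q * b q)" .
    qed
  qed
  show "dir_deriv (\<lambda>y. f y + g y) x (D x) = dir_deriv f x (D x) + dir_deriv g x (D x)" if x: "x \<in> V" for x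
    by (rule dir_deriv_eqI, rule DERIV_add)
      (rule reg_line_derivative[OF f V x] reg_line_derivative[OF g V x], use D(2) len[OF x] in simp)+
  show "dir_deriv (\<lambda>y. f y * g y) x (D x) = f x * dir_deriv g x (D x) + g x * dir_deriv f x (D x)" if x: "x \<in> V" for x
  proof -
    have l: "length (D x) = n" "length x = length (D x)" using D(2) len[OF x] by auto
    have 1: "((\<lambda>t. f (map2 (\<lambda>a b. a + t * b) x (D x))) has_field_derivative dir_deriv f x (D x)) (at 0)"
      by (rule reg_line_derivative[OF f V x l(1)])
    have 2: "((\<lambda>t. g (map2 (\<lambda>a b. a + t * b) x (D x))) has_field_derivative dir_deriv g x (D x)) (at 0)"
      by (rule reg_line_derivative[OF g V x l(1)])
    from dir_deriv_eqI[OF DERIV_mult[OF 1 2]] show ?thesis using line_0[OF l(2)] by (simp add: mult_ac)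
  qed
  show "dir_deriv (\<lambda>y. c) x (D x) = 0" for c x by (rule dir_deriv_eqI) simp
  show "dir_deriv f x (D x) = dir_deriv g x (D x)" if "\<forall>x\<in>V. f x = g x" "x \<in> V" for x
    by (rule dir_deriv_cong[OF V]) (use that D(2) len in auto)
qed

section \<open>Vector fields as derivations, and their transport\<close>

lemma
  assumes "vector_field X U v"
  shows vector_field_open: "openin (zar X) U"
    and vector_field_reg: "\<And>V f. openin (zar X) V \<Longrightarrow> V \<subseteq> U \<Longrightarrow> f \<in> reg X V \<Longrightarrow> v f \<in> reg X V"
    and vector_field_add: "\<And>V f g x. openin (zar X) V \<Longrightarrow> V \<subseteq> U \<Longrightarrow> f \<in> reg X V \<Longrightarrow> g \<in> reg X V \<Longrightarrow> x \<in> V \<Longrightarrow>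
      v (\<lambda>y. f y + g y) x = v f x + v g x"
    and vector_field_mult: "\<And>V f g x. openin (zar X) V \<Longrightarrow> V \<subseteq> U \<Longrightarrow> f \<in> reg X V \<Longrightarrow> g \<in> reg X V \<Longrightarrow> x \<in> V \<Longrightarrow>
      v (\<lambda>y. f y * g y) x = f x * v g x + g x * v f x"
    and vector_field_const: "\<And>V f g x c. openin (zar X) V \<Longrightarrow> V \<subseteq> U \<Longrightarrow> f \<in> reg X V \<Longrightarrow> x \<in> V \<Longrightarrow> v (\<lambda>y. c) x = 0"
    and vector_field_cong: "\<And>V f g x. openin (zar X) V \<Longrightarrow> V \<subseteq> U \<Longrightarrow> f \<in> reg X V \<Longrightarrow> g \<in> reg X V \<Longrightarrow> x \<in> V \<Longrightarrow>
      (\<And>y. y \<in> V \<Longrightarrow> f y = g y) \<Longrightarrow> v f x = v g x"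
  using assms unfolding vector_field_def by meson+

text \<open>A regular function need only be given near the point, possibly outside the domain of the field.\<close>

lemma vector_field_local:
  assumes X: "ringed X" and v: "vector_field X U v" and x: "x \<in> U"
    and f: "openin (zar X) M" "x \<in> M" "f \<in> reg X M" and g: "openin (zar X) N" "x \<in> N" "g \<in> reg X N"
    and e: "\<And>y. y \<in> M \<Longrightarrow> y \<in> N \<Longrightarrow> y \<in> U \<Longrightarrow> f y = g y"
  shows "v f x = v g x"
proof (rule vector_field_cong[OF v, of "M \<inter> N \<inter> U"])
  show o: "openin (zar X) (M \<inter> N \<inter> U)" using f(1) g(1) vector_field_open[OF v] by blast
  show "f \<in> reg X (M \<inter> N \<inter> U)" by (rule ringed_restrict[OF X f(1,3) o]) auto
  show "g \<in> reg X (M \<inter> N \<inter> U)" by (rule ringed_restrict[OF X g(1,3) o]) auto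
qed (use x f g e in auto)

lemma vector_field_restrict:
  "vector_field X U v \<Longrightarrow> openin (zar X) V \<Longrightarrow> V \<subseteq> U \<Longrightarrow> vector_field X V v"
  unfolding vector_field_def by (meson order_trans)

text \<open>The isomorphism is one of the subvarieties \<open>U\<close> and \<open>V\<close>, but
  vector fields act on functions of \<open>X\<close> and \<open>Y\<close>. Both parts being open,
  pull-back along \<open>\<psi>\<close> can be stated for the ambient varieties.\<close>

lemma iso_reg:
  assumes X: "ringed X" and Y: "ringed Y" and U: "openin (zar X) U" and V: "openin (zar Y) V"
    and iso: "inverse_isomorphisms (subvariety X U) (subvariety Y V) \<phi> \<psi>" and N: "openin (zar X) N"
  shows "openin (zar Y) {q \<in> V. \<psi> q \<in> N}"
    and "f \<in> reg X N \<Longrightarrow> f \<circ> \<psi> \<in> reg Y {q \<in> V. \<psi> q \<in> N}"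
proof -
  note i = inverse_isomorphismsD[OF iso]
  have pt: "points (subvariety Y V) = V" using openin_subset[OF V] by (auto simp: points_subvariety)
  have m: "morphism (subvariety Y V) X \<psi>"
    using morphism_compose[OF i(2) morphism_inclusion[OF X]] by (simp add: comp_def)
  show o: "openin (zar Y) {q \<in> V. \<psi> q \<in> N}"
    using morphism_open[OF m N] unfolding pt openin_subvariety_open[OF V] by simp
  show "f \<circ> \<psi> \<in> reg Y {q \<in> V. \<psi> q \<in> N}" if "f \<in> reg X N"
    using morphism_reg[OF m N that] unfolding pt reg_subvariety_open[OF Y o] .
qed

lemma iso_points:
  assumes U: "openin (zar X) U" and V: "openin (zar Y) V"
    and iso: "inverse_isomorphisms (subvariety X U) (subvariety Y V) \<phi> \<psi>"
  shows "\<And>p. p \<in> U \<Longrightarrow> \<phi> p \<in> V \<and> \<psi> (\<phi> p) = p" "\<And>q. q \<in> V \<Longrightarrow> \<psi> q \<in> U \<and> \<phi> (\<psi> q) = q"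
proof -
  note i = inverse_isomorphismsD[OF iso]
  have pt: "points (subvariety Y V) = V" "points (subvariety X U) = U"
    using openin_subset[OF V] openin_subset[OF U] by (auto simp: points_subvariety)
  show "\<phi> p \<in> V \<and> \<psi> (\<phi> p) = p" if "p \<in> U" for p
    using i(3) morphism_points[OF i(1)] that unfolding pt by auto
  show "\<psi> q \<in> U \<and> \<phi> (\<psi> q) = q" if "q \<in> V" for q
    using i(4) morphism_points[OF i(2)] that unfolding pt by auto
qed

lemma vector_field_transport:
  assumes X: "ringed X" and Y: "ringed Y" and U: "openin (zar X) U" and V: "openin (zar Y) V"
    and iso: "inverse_isomorphisms (subvariety X U) (subvariety Y V) \<phi> \<psi>"
    and w: "vector_field Y W w" "W \<subseteq> V"
  shows "vector_field X {p \<in> U. \<phi> p \<in> W} (\<lambda>f. w (f \<circ> \<psi>) \<circ> \<phi>)"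
  unfolding vector_field_def
proof (intro conjI allI impI ballI; (elim conjE)?)
  note ip = iso_points[OF U V iso]
  note ir = iso_reg[OF X Y U V iso]
  note irs = iso_reg[OF Y X V U inverse_isomorphisms_sym[OF iso]]
  show "openin (zar X) {p \<in> U. \<phi> p \<in> W}"
    by (rule irs(1)) (rule vector_field_open[OF w(1)])
  fix N f g assume N: "openin (zar X) N" "N \<subseteq> {p \<in> U. \<phi> p \<in> W}" and f: "f \<in> reg X N" and g: "g \<in> reg X N"
  let ?M = "{q \<in> V. \<psi> q \<in> N}"
  have M: "openin (zar Y) ?M" "?M \<subseteq> W" using ir(1)[OF N(1)] N(2) ip by auto
  note f' = ir(2)[OF N(1) f] and g' = ir(2)[OF N(1) g]
  have x: "\<phi> x \<in> ?M" if "x \<in> N" for x using that N(2) ip(1) by auto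
  have c: "(\<lambda>y. f y + g y) \<circ> \<psi> = (\<lambda>y. (f \<circ> \<psi>) y + (g \<circ> \<psi>) y)"
    "(\<lambda>y. f y * g y) \<circ> \<psi> = (\<lambda>y. (f \<circ> \<psi>) y * (g \<circ> \<psi>) y)" "(\<lambda>y. c) \<circ> \<psi> = (\<lambda>y. c)" for c :: complex
    by auto
  show "w (f \<circ> \<psi>) \<circ> \<phi> \<in> reg X N"
  proof (rule ringed_restrict[OF X _ irs(2)[OF M(1) vector_field_reg[OF w(1) M f']] N(1)])
    show "openin (zar X) {p \<in> U. \<phi> p \<in> ?M}" by (rule irs(1)[OF M(1)])
  qed (use N(2) x in auto)
  show "(w ((\<lambda>y. f y + g y) \<circ> \<psi>) \<circ> \<phi>) y = (w (f \<circ> \<psi>) \<circ> \<phi>) y + (w (g \<circ> \<psi>) \<circ> \<phi>) y" if "y \<in> N" for y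
    using vector_field_add[OF w(1) M f' g' x[OF that]] unfolding c by simp
  show "(w ((\<lambda>y. f y * g y) \<circ> \<psi>) \<circ> \<phi>) y = f y * (w (g \<circ> \<psi>) \<circ> \<phi>) y + g y * (w (f \<circ> \<psi>) \<circ> \<phi>) y" if "y \<in> N" for y
    using vector_field_mult[OF w(1) M f' g' x[OF that]] that N(2) ip(1) unfolding c by auto
  show "(w ((\<lambda>y. c) \<circ> \<psi>) \<circ> \<phi>) y = 0" if "y \<in> N" for y c
    using vector_field_const[OF w(1) M f' x[OF that]] unfolding c by simp
  show "(w (f \<circ> \<psi>) \<circ> \<phi>) y = (w (g \<circ> \<psi>) \<circ> \<phi>) y" if "\<forall>x\<in>N. f x = g x" "y \<in> N" for y
    using vector_field_cong[OF w(1) M f' g' x[OF that(2)]] that(1) by simp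
qed

section \<open>Plane charts of foliations\<close>

text \<open>Linear dependence of two tangent vectors is tested on pairs of functions, so no tangent
  space has to be constructed. The arguments may be any maps on functions evaluated at
  \<open>x\<close>, not only vector fields.\<close>

definition parallel_at ::
  "'a variety \<Rightarrow> (('a \<Rightarrow> complex) \<Rightarrow> 'a \<Rightarrow> complex) \<Rightarrow> (('a \<Rightarrow> complex) \<Rightarrow> 'a \<Rightarrow> complex) \<Rightarrow> 'a \<Rightarrow> bool" where
  "parallel_at X v w x \<longleftrightarrow> (\<forall>N f g. openin (zar X) N \<and> x \<in> N \<and> f \<in> reg X N \<and> g \<in> reg X N \<longrightarrow>
     v f x * w g x = v g x * w f x)"

lemma parallel_atD:
  "parallel_at X v w x \<Longrightarrow> openin (zar X) N \<Longrightarrow> x \<in> N \<Longrightarrow> f \<in> reg X N \<Longrightarrow> g \<in> reg X N \<Longrightarrow>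
    v f x * w g x = v g x * w f x"
  unfolding parallel_at_def by blast

text \<open>A tangent vector \<open>u\<close> with \<open>u h x \<noteq> 0\<close> spans its line:
  at \<open>x\<close> both \<open>v\<close> and \<open>w\<close> are multiples of it, with factors
  \<open>v h / u h\<close> and \<open>w h / u h\<close>.\<close>

lemma parallel_at_trans:
  assumes X: "ringed X" and v: "parallel_at X v u x" and w: "parallel_at X w u x"
    and h: "openin (zar X) M" "x \<in> M" "h \<in> reg X M" "u h x \<noteq> 0"
  shows "parallel_at X v w x"
  unfolding parallel_at_def
proof (intro allI impI; elim conjE)
  fix N f g assume N: "openin (zar X) N" "x \<in> N" "f \<in> reg X N" "g \<in> reg X N"
  have o: "openin (zar X) (M \<inter> N)" using h(1) N(1) by blast
  have r: "h \<in> reg X (M \<inter> N)" "f \<in> reg X (M \<inter> N)" "g \<in> reg X (M \<inter> N)"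
    using ringed_restrict[OF X h(1,3) o] ringed_restrict[OF X N(1,3) o] ringed_restrict[OF X N(1,4) o] by auto
  have x: "x \<in> M \<inter> N" using h N by blast
  note * = parallel_atD[OF v o x] parallel_atD[OF w o x]
  have "v f x = v h x / u h x * u f x" "v g x = v h x / u h x * u g x"
    "w f x = w h x / u h x * u f x" "w g x = w h x / u h x * u g x"
    using *(1)[OF r(2,1)] *(1)[OF r(3,1)] *(2)[OF r(2,1)] *(2)[OF r(3,1)] h(4) by (simp_all add: field_simps)
  then show "v f x * w g x = v g x * w f x" by simp
qed


definition transported ::
  "(complex list \<Rightarrow> complex list) \<Rightarrow> ('a \<Rightarrow> complex list) \<Rightarrow> (complex list \<Rightarrow> 'a) \<Rightarrow> ('a \<Rightarrow> complex) \<Rightarrow> 'a \<Rightarrow> complex" where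
  "transported D \<phi> \<psi> f x = dir_deriv (f \<circ> \<psi>) (\<phi> x) (D (\<phi> x))"

definition plane_field :: "(complex list \<Rightarrow> complex list) \<Rightarrow> bool" where
  "plane_field D \<longleftrightarrow> (\<forall>i<2. (\<lambda>q. D q ! i) \<in> polyfun 2) \<and> (\<forall>q. length (D q) = 2)"

text \<open>The last two clauses identify \<open>F\<close> over subsets of \<open>U\<close> with the
  fields parallel to \<open>D\<close>. The first of them admits every \<open>W\<close>, since
  sections over sets not contained in \<open>U\<close> must also be tested at points of
  \<open>U\<close>. The condition on \<open>D q ! 0\<close> keeps the generator nonzero, and visibly
  so on the first coordinate.\<close>

definition plane_chart ::
  "'a variety \<Rightarrow> 'a foliation \<Rightarrow> (complex list \<Rightarrow> complex list) \<Rightarrow> 'a set \<Rightarrow> complex list set \<Rightarrow>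
     ('a \<Rightarrow> complex list) \<Rightarrow> (complex list \<Rightarrow> 'a) \<Rightarrow> bool" where
  "plane_chart X F D U \<O> \<phi> \<psi> \<longleftrightarrow> dense_open X U \<and> affine_open 2 \<O> \<and> \<O> \<noteq> {} \<and>
     inverse_isomorphisms (subvariety X U) (subvariety (affine_space 2) \<O>) \<phi> \<psi> \<and>
     (\<forall>q\<in>\<O>. D q ! 0 \<noteq> 0) \<and>
     (\<forall>W v x. v \<in> F W \<and> x \<in> W \<and> x \<in> U \<longrightarrow> parallel_at X v (transported D \<phi> \<psi>) x) \<and>
     (\<forall>W v. W \<subseteq> U \<and> vector_field X W v \<and> (\<forall>x\<in>W. parallel_at X v (transported D \<phi> \<psi>) x) \<longrightarrow> v \<in> F W)"

lemma dense_openI: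
  assumes "openin (zar X) U" "\<And>W. openin (zar X) W \<Longrightarrow> W \<noteq> {} \<Longrightarrow> U \<inter> W \<noteq> {}"
  shows "dense_open X U"
  unfolding dense_open_def using assms dense_intersects_open[of "zar X" U] by blast

lemma dense_openD:
  "dense_open X U \<Longrightarrow> openin (zar X) U"
  "dense_open X U \<Longrightarrow> openin (zar X) W \<Longrightarrow> W \<noteq> {} \<Longrightarrow> U \<inter> W \<noteq> {}"
  unfolding dense_open_def using dense_intersects_open[of "zar X" U] by blast+

lemma plane_chartD:
  assumes "plane_chart X F D U \<O> \<phi> \<psi>"
  shows "dense_open X U" "openin (zar X) U" "affine_open 2 \<O>" "openin (zar (affine_space 2)) \<O>" "\<O> \<noteq> {}"
    "inverse_isomorphisms (subvariety X U) (subvariety (affine_space 2) \<O>) \<phi> \<psi>"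
    "\<And>q. q \<in> \<O> \<Longrightarrow> D q ! 0 \<noteq> 0"
    "\<And>W v x. v \<in> F W \<Longrightarrow> x \<in> W \<Longrightarrow> x \<in> U \<Longrightarrow> parallel_at X v (transported D \<phi> \<psi>) x"
    "\<And>W v. W \<subseteq> U \<Longrightarrow> vector_field X W v \<Longrightarrow> (\<And>x. x \<in> W \<Longrightarrow> parallel_at X v (transported D \<phi> \<psi>) x) \<Longrightarrow> v \<in> F W"
  using assms dense_openD(1) unfolding plane_chart_def openin_affine by blast+

lemma plane_chart_points:
  assumes "plane_chart X F D U \<O> \<phi> \<psi>"
  shows "\<And>p. p \<in> U \<Longrightarrow> \<phi> p \<in> \<O> \<and> \<psi> (\<phi> p) = p" "\<And>q. q \<in> \<O> \<Longrightarrow> \<psi> q \<in> U \<and> \<phi> (\<psi> q) = q"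
  using iso_points[OF plane_chartD(2,4,6)[OF assms]] by blast+

lemma plane_chart_field:
  assumes X: "ringed X" and c: "plane_chart X F D U \<O> \<phi> \<psi>" and D: "plane_field D"
  shows "transported D \<phi> \<psi> \<in> F U"
proof (rule plane_chartD(9)[OF c order_refl])
  have "vector_field (affine_space 2) \<O> (\<lambda>f p. dir_deriv f p (D p))"
    by (rule vector_field_affine[OF plane_chartD(3)[OF c]]) (use D in \<open>auto simp: plane_field_def\<close>)
  from vector_field_transport[OF X ringed_affine_space plane_chartD(2,4,6)[OF c] this order_refl]
  have "vector_field X {p \<in> U. \<phi> p \<in> \<O>} (\<lambda>f. (\<lambda>p. dir_deriv (f \<circ> \<psi>) p (D p)) \<circ> \<phi>)" .
  moreover have "{p \<in> U. \<phi> p \<in> \<O>} = U" using plane_chart_points[OF c] by blast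
  moreover have "(\<lambda>f. (\<lambda>p. dir_deriv (f \<circ> \<psi>) p (D p)) \<circ> \<phi>) = transported D \<phi> \<psi>"
    by (intro ext) (simp add: transported_def)
  ultimately show "vector_field X U (transported D \<phi> \<psi>)" by simp
qed (simp add: parallel_at_def mult.commute)

text \<open>The first coordinate of the chart is moved with speed \<open>D q ! 0\<close>, which a
  plane chart requires to be nonzero.\<close>

lemma plane_chart_nonzero:
  assumes X: "ringed X" and c: "plane_chart X F D U \<O> \<phi> \<psi>" and D: "plane_field D" and x: "x \<in> U"
  obtains h where "h \<in> reg X U" "transported D \<phi> \<psi> h x \<noteq> 0"
proof
  let ?h = "(\<lambda>p. p ! 0) \<circ> \<phi>"
  note pt = plane_chart_points[OF c]
  have e: "{p \<in> U. \<phi> p \<in> \<O>} = U" using pt by blast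
  have "(\<lambda>p. p ! 0) \<in> reg (affine_space 2) \<O>"
    by (rule polyfun_reg) (use plane_chartD(3)[OF c] affine_open_length in \<open>auto intro: polyfun.coord\<close>)
  from iso_reg(2)[OF ringed_affine_space X plane_chartD(4,2)[OF c] inverse_isomorphisms_sym[OF plane_chartD(6)[OF c]]
      plane_chartD(4)[OF c] this]
  show "?h \<in> reg X U" unfolding e .
  have l: "length (D (\<phi> x)) = 2" "length (\<phi> x) = 2"
    using D affine_open_length[OF plane_chartD(3)[OF c]] pt(1)[OF x] by (auto simp: plane_field_def)
  have "transported D \<phi> \<psi> ?h x = dir_deriv (\<lambda>p. p ! 0) (\<phi> x) (D (\<phi> x))"
    unfolding transported_def
    by (rule dir_deriv_cong[OF plane_chartD(3)[OF c] _ l(1)]) (use pt x in auto)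
  also have "\<dots> = D (\<phi> x) ! 0"
    by (rule dir_deriv_eqI) (rule line_derivative[OF l(2,1)], simp)
  finally show "transported D \<phi> \<psi> ?h x \<noteq> 0" using plane_chartD(7)[OF c] pt x by simp
qed

text \<open>A nonempty open part of the plane meets every other one, so its preimage still meets
  every nonempty open subset of \<open>X\<close>.\<close>

lemma plane_chart_restrict:
  assumes X: "ringed X" and c: "plane_chart X F D U \<O> \<phi> \<psi>" and O': "affine_open 2 \<O>'" "\<O>' \<subseteq> \<O>" "\<O>' \<noteq> {}"
  shows "plane_chart X F D {x \<in> U. \<phi> x \<in> \<O>'} \<O>' \<phi> \<psi>"
proof -
  let ?U = "{x \<in> U. \<phi> x \<in> \<O>'}"
  note d = plane_chartD[OF c] and pt = plane_chart_points[OF c]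
  have O'o: "openin (zar (affine_space 2)) \<O>'" using O'(1) by (simp add: openin_affine)
  have o: "openin (zar X) ?U"
    by (rule iso_reg(1)[OF ringed_affine_space X d(4,2) inverse_isomorphisms_sym[OF d(6)] O'o])
  have "dense_open X ?U"
  proof (rule dense_openI[OF o])
    fix W assume W: "openin (zar X) W" "W \<noteq> {}"
    then obtain x where x: "x \<in> U" "x \<in> W" using dense_openD(2)[OF d(1)] by blast
    have "affine_open 2 {q \<in> \<O>. \<psi> q \<in> W}"
      using iso_reg(1)[OF X ringed_affine_space d(2,4,6) W(1)] by (simp add: openin_affine)
    moreover have "\<phi> x \<in> {q \<in> \<O>. \<psi> q \<in> W}" using x pt by simp
    ultimately obtain q where "q \<in> \<O>'" "q \<in> \<O>" "\<psi> q \<in> W"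
      using affine_irreducible[OF O'(1) _ O'(3)] by blast
    then have "\<psi> q \<in> ?U \<inter> W" using pt by auto
    then show "?U \<inter> W \<noteq> {}" by blast
  qed
  moreover have "inverse_isomorphisms (subvariety X ?U) (subvariety (affine_space 2) \<O>') \<phi> \<psi>"
    by (rule inverse_isomorphisms_restrict[OF X ringed_affine_space d(6) openin_subset[OF d(2)] O'(2)
        openin_subset[OF d(4)] refl])
  ultimately show ?thesis unfolding plane_chart_def using O' d(7,8,9) by (auto simp: subset_iff)
qed

text \<open>Going down by one chart and up by the other carries the generator \<open>D\<close> to
  itself, hence parallelism to parallelism; the last two clauses of \<open>plane_chart\<close> turn
  this into the equivalence for sections.\<close>

lemma plane_charts_birational:
  assumes X: "ringed X" and Y: "ringed Y" and D: "plane_field D"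
    and c: "plane_chart X F D U \<O> \<phi> \<psi>" and c': "plane_chart Y G D V \<O> \<phi>' \<psi>'"
  shows "birationally_equivalent X F Y G"
proof -
  let ?f = "\<psi>' \<circ> \<phi>" and ?g = "\<psi> \<circ> \<phi>'"
  note d = plane_chartD[OF c] and d' = plane_chartD[OF c'] and pt = plane_chart_points[OF c] and pt' = plane_chart_points[OF c']
  have iso: "inverse_isomorphisms (subvariety X U) (subvariety Y V) ?f ?g"
    by (rule inverse_isomorphisms_compose[OF d(6) inverse_isomorphisms_sym[OF d'(6)]])
  note ir = iso_reg[OF X Y d(2) d'(2) iso] and ir' = iso_reg[OF Y X d'(2) d(2) inverse_isomorphisms_sym[OF iso]]
  have "w \<in> G W \<longleftrightarrow> (\<lambda>f. w (f \<circ> ?g) \<circ> ?f) \<in> F {p \<in> U. ?f p \<in> W}"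
    if W: "W \<subseteq> V" and w: "vector_field Y W w" for W w
  proof -
    let ?W = "{p \<in> U. ?f p \<in> W}" and ?w = "\<lambda>f. w (f \<circ> ?g) \<circ> ?f"
    have v: "vector_field X ?W ?w" by (rule vector_field_transport[OF X Y d(2) d'(2) iso w W])
    have len: "length (D q) = 2" for q using D by (simp add: plane_field_def)
    have 1: "parallel_at X ?w (transported D \<phi> \<psi>) x" if p: "parallel_at Y w (transported D \<phi>' \<psi>') (?f x)" and x: "x \<in> ?W" for x
      unfolding parallel_at_def
    proof (intro allI impI; elim conjE)
      fix N f g assume N: "openin (zar X) N" "x \<in> N" "f \<in> reg X N" "g \<in> reg X N"
      have t: "transported D \<phi>' \<psi>' (h \<circ> ?g) (?f x) = transported D \<phi> \<psi> h x" for h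
        unfolding transported_def
        using x pt pt' by (auto intro!: dir_deriv_cong[OF d(3) _ len])
      show "?w f x * transported D \<phi> \<psi> g x = ?w g x * transported D \<phi> \<psi> f x"
        using parallel_atD[OF p ir(1)[OF N(1)] _ ir(2)[OF N(1,3)] ir(2)[OF N(1,4)]] x N(2) pt pt' W
        unfolding t by auto
    qed
    have 2: "parallel_at Y w (transported D \<phi>' \<psi>') y" if p: "\<And>x. x \<in> ?W \<Longrightarrow> parallel_at X ?w (transported D \<phi> \<psi>) x" and y: "y \<in> W" for y
      unfolding parallel_at_def
    proof (intro allI impI; elim conjE)
      fix N f g assume N: "openin (zar Y) N" "y \<in> N" "f \<in> reg Y N" "g \<in> reg Y N"
      have x: "?g y \<in> ?W" "?f (?g y) = y" "y \<in> V" using y W pt pt' by auto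
      have t: "transported D \<phi> \<psi> (h \<circ> ?f) (?g y) = transported D \<phi>' \<psi>' h y" for h
        unfolding transported_def
        using x(3) pt pt' by (auto intro!: dir_deriv_cong[OF d(3) _ len])
      let ?N = "{p \<in> U. ?f p \<in> N}"
      \<comment> \<open>The round trip \<open>h \<circ> ?f \<circ> ?g\<close> agrees with
        \<open>h\<close> near \<open>y\<close>, and the locality of \<open>w\<close> makes this
        enough.\<close>
      have wf: "?w (h \<circ> ?f) (?g y) = w h y" if h: "h \<in> reg Y N" for h
      proof -
        have "w (h \<circ> ?f \<circ> ?g) y = w h y"
          by (rule vector_field_local[OF Y w y ir(1)[OF ir'(1)[OF N(1)]] _ ir(2)[OF ir'(1)[OF N(1)] ir'(2)[OF N(1) h]] N(1,2) h])
            (use x N(2) pt pt' in auto)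
        then show ?thesis using x(2) by simp
      qed
      show "w f y * transported D \<phi>' \<psi>' g y = w g y * transported D \<phi>' \<psi>' f y"
        using parallel_atD[OF p[OF x(1)] ir'(1)[OF N(1)] _ ir'(2)[OF N(1,3)] ir'(2)[OF N(1,4)]] x N(2)
        unfolding t wf[OF N(3)] wf[OF N(4)] by auto
    qed
    show ?thesis
    proof
      assume "w \<in> G W"
      then show "?w \<in> F ?W" using d'(8) W by (intro d(9)[OF _ v] 1) auto
    next
      assume "?w \<in> F ?W"
      then show "w \<in> G W" using d(8) by (intro d'(9)[OF W w] 2) auto
    qed
  qed
  then show ?thesis unfolding birationally_equivalent_def
    by (intro exI[of _ U] exI[of _ V] exI[of _ ?f] exI[of _ ?g] conjI iso d(1) d'(1)) simp
qed

text \<open>Where \<open>\<pi>\<close> is an isomorphism, the chart of \<open>Y\<close> is composed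
  with it; the part of the plane that survives consists of the points whose image lies in
  \<open>V'\<close>. For the sections, the generator of \<open>F\<close> over \<open>V\<close> is
  the field against which the pull-back is tested.\<close>

lemma plane_chart_pullback:
  assumes X: "ringed X" and Y: "ringed Y" and D: "plane_field D"
    and c: "plane_chart Y F D V \<O> \<phi> \<psi>" and \<pi>: "morphism X Y \<pi>"
    and U: "dense_open X U" and V': "dense_open Y V'"
    and iso: "inverse_isomorphisms (subvariety X U) (subvariety Y V') \<pi> \<rho>"
  obtains \<O>' where "\<O>' \<subseteq> \<O>"
    "plane_chart X (pullback_foliation X Y \<pi> F) D {x \<in> U. \<pi> x \<in> V} \<O>' (\<phi> \<circ> \<pi>) (\<rho> \<circ> \<psi>)"
proof
  let ?O = "{q \<in> \<O>. \<psi> q \<in> V'}" and ?U = "{x \<in> U. \<pi> x \<in> V}"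
  note d = plane_chartD[OF c] and pt = plane_chart_points[OF c]
  note Uo = dense_openD(1)[OF U] and V'o = dense_openD(1)[OF V']
  note ip = iso_points[OF Uo V'o iso]
  show "?O \<subseteq> \<O>" by blast
  have Oo: "openin (zar (affine_space 2)) ?O" by (rule iso_reg(1)[OF Y ringed_affine_space d(2,4,6) V'o])
  have One: "?O \<noteq> {}"
  proof -
    obtain q where "q \<in> \<O>" using d(5) by blast
    then have "V \<noteq> {}" using pt(2) by blast
    from dense_openD(2)[OF V' d(2) this] obtain y where y: "y \<in> V'" "y \<in> V" by blast
    from pt(1)[OF y(2)] y(1) have "\<phi> y \<in> ?O" by simp
    then show ?thesis by blast
  qed
  have Uo': "openin (zar X) ?U" by (rule iso_reg(1)[OF Y X V'o Uo inverse_isomorphisms_sym[OF iso] d(2)])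
  have dense: "dense_open X ?U"
  proof (rule dense_openI[OF Uo'])
    fix W assume W: "openin (zar X) W" "W \<noteq> {}"
    then obtain x where x: "x \<in> U" "x \<in> W" using dense_openD(2)[OF U] by blast
    have "openin (zar Y) {y \<in> V'. \<rho> y \<in> W}" by (rule iso_reg(1)[OF X Y Uo V'o iso W(1)])
    moreover have "\<pi> x \<in> {y \<in> V'. \<rho> y \<in> W}" using x ip by simp
    ultimately obtain y where "y \<in> V" "y \<in> V'" "\<rho> y \<in> W" using dense_openD(2)[OF d(1)] by blast
    then have "\<rho> y \<in> ?U \<inter> W" using ip by auto
    then show "?U \<inter> W \<noteq> {}" by blast
  qed
  have iso1: "inverse_isomorphisms (subvariety X ?U) (subvariety Y (V \<inter> V')) \<pi> \<rho>"
    by (rule inverse_isomorphisms_restrict[OF X Y iso]) (use openin_subset[OF Uo] openin_subset[OF V'o] ip in auto)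
  have iso2: "inverse_isomorphisms (subvariety Y (V \<inter> V')) (subvariety (affine_space 2) ?O) \<phi> \<psi>"
    by (rule inverse_isomorphisms_restrict[OF Y ringed_affine_space d(6)])
      (use openin_subset[OF d(2)] openin_subset[OF d(4)] pt in auto)
  have len: "length (D q) = 2" for q using D by (simp add: plane_field_def)
  have Oa: "affine_open 2 ?O" using Oo by (simp add: openin_affine)
  let ?t = "transported D \<phi> \<psi>" and ?T = "transported D (\<phi> \<circ> \<pi>) (\<rho> \<circ> \<psi>)"
  have T1: "?t (f \<circ> \<rho>) (\<pi> x) = ?T f x" for f x by (simp add: transported_def comp_assoc)
  have T2: "?T (f \<circ> \<pi>) x = ?t f (\<pi> x)" if x: "x \<in> ?U" for f x
    unfolding transported_def
    using x ip pt by (auto intro!: dir_deriv_cong[OF Oa _ len])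
  have A: "parallel_at X v ?T x" if v: "v \<in> pullback_foliation X Y \<pi> F W" and x: "x \<in> W" "x \<in> ?U" for v W x
    unfolding parallel_at_def
  proof (intro allI impI; elim conjE)
    fix N f g assume N: "openin (zar X) N" "x \<in> N" "f \<in> reg X N" "g \<in> reg X N"
    note ir = iso_reg[OF X Y Uo V'o iso N(1)]
    let ?M = "{q \<in> V'. \<rho> q \<in> N}"
    have M: "openin (zar Y) ?M" "\<pi> x \<in> ?M" using ir(1) N x ip by auto
    have vv: "vector_field X W v" using v by (simp add: pullback_foliation_def)
    have "v (f \<circ> \<rho> \<circ> \<pi>) x * ?t (g \<circ> \<rho>) (\<pi> x) = v (g \<circ> \<rho> \<circ> \<pi>) x * ?t (f \<circ> \<rho>) (\<pi> x)"
      using v plane_chart_field[OF Y c D] x M ir(2)[OF N(3)] ir(2)[OF N(4)] d(2)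
      unfolding pullback_foliation_def by blast
    moreover have "v (h \<circ> \<rho> \<circ> \<pi>) x = v h x" if h: "h \<in> reg X N" for h
    proof (rule vector_field_local[OF X vv x(1) _ _ _ _ _ h])
      let ?N = "{p \<in> points X. \<pi> p \<in> ?M} \<inter> U"
      show o: "openin (zar X) ?N" using morphism_open[OF \<pi> M(1)] Uo by blast
      show "h \<circ> \<rho> \<circ> \<pi> \<in> reg X ?N"
        by (rule ringed_restrict[OF X morphism_open[OF \<pi> M(1)] morphism_reg[OF \<pi> M(1) ir(2)[OF h]] o]) auto
      show "x \<in> ?N" using x M openin_subset[OF Uo] by auto
      show "(h \<circ> \<rho> \<circ> \<pi>) y = h y" if "y \<in> ?N" for y using that ip by auto
    qed (use N in auto)
    ultimately show "v f x * ?T g x = v g x * ?T f x" using N(3,4) by (simp add: T1)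
  qed
  have B: "v \<in> pullback_foliation X Y \<pi> F W"
    if W: "W \<subseteq> ?U" and v: "vector_field X W v" and p: "\<And>x. x \<in> W \<Longrightarrow> parallel_at X v ?T x" for v W
    unfolding pullback_foliation_def
  proof (intro CollectI conjI v allI impI; elim conjE)
    fix V1 w x N f g assume w: "w \<in> F V1" "x \<in> W" "\<pi> x \<in> V1"
      and N: "openin (zar Y) N" "\<pi> x \<in> N" "f \<in> reg Y N" "g \<in> reg Y N"
    have x: "x \<in> ?U" "\<pi> x \<in> V" "x \<in> points X" using w(2) W openin_subset[OF Uo] by auto
    have w': "parallel_at Y w ?t (\<pi> x)" by (rule d(8)[OF w(1,3) x(2)])
    have v': "v (k \<circ> \<pi>) x * ?t l (\<pi> x) = v (l \<circ> \<pi>) x * ?t k (\<pi> x)"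
      if "openin (zar Y) N" "\<pi> x \<in> N" "k \<in> reg Y N" "l \<in> reg Y N" for N k l
      using parallel_atD[OF p[OF w(2)] morphism_open[OF \<pi> that(1)] _ morphism_reg[OF \<pi> that(1,3)] morphism_reg[OF \<pi> that(1,4)]]
        that(2) x(3) unfolding T2[OF x(1)] by simp
    obtain h where h: "h \<in> reg Y V" "?t h (\<pi> x) \<noteq> 0"
      using plane_chart_nonzero[OF Y c D x(2)] by blast
    \<comment> \<open>The first argument is the image of the tangent vector \<open>v\<close> at
      \<open>x\<close> under the differential of \<open>\<pi>\<close>, written as a map that ignores
      its point; it need not extend to a vector field on \<open>Y\<close>.\<close>
    have "parallel_at Y (\<lambda>f y. v (f \<circ> \<pi>) x) w (\<pi> x)"
      by (rule parallel_at_trans[OF Y _ w' d(2) x(2) h]) (unfold parallel_at_def, intro allI impI, elim conjE, rule v')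
    from parallel_atD[OF this N] show "v (f \<circ> \<pi>) x * w g (\<pi> x) = v (g \<circ> \<pi>) x * w f (\<pi> x)" .
  qed
  show "plane_chart X (pullback_foliation X Y \<pi> F) D ?U ?O (\<phi> \<circ> \<pi>) (\<rho> \<circ> \<psi>)"
    unfolding plane_chart_def
    by (intro conjI dense Oa One inverse_isomorphisms_compose[OF iso1 iso2]) (use d(7) A B in auto)
qed

section \<open>Plane charts of quotient foliations\<close>

definition irreducible_variety :: "'a variety \<Rightarrow> bool" where
  "irreducible_variety X \<longleftrightarrow>
     (\<forall>U V. openin (zar X) U \<and> openin (zar X) V \<and> U \<noteq> {} \<and> V \<noteq> {} \<longrightarrow> U \<inter> V \<noteq> {})"

text \<open>Preimages of open sets are open in an affine space, where nonempty open sets meet;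
  surjectivity keeps the preimages nonempty.\<close>

lemma irreducible_variety_image:
  assumes \<mu>: "morphism (subvariety (affine_space n) \<Omega>) X \<mu>" and \<Omega>: "affine_open n \<Omega>"
    and sur: "\<And>x. x \<in> points X \<Longrightarrow> \<exists>p\<in>\<Omega>. \<mu> p = x"
  shows "irreducible_variety X"
  unfolding irreducible_variety_def
proof (intro allI impI; elim conjE)
  fix U V assume U: "openin (zar X) U" "U \<noteq> {}" and V: "openin (zar X) V" "V \<noteq> {}"
  have \<Omega>o: "openin (zar (affine_space n)) \<Omega>" using \<Omega> by (simp add: openin_affine)
  have pt: "points (subvariety (affine_space n) \<Omega>) = \<Omega>"
    using openin_subset[OF \<Omega>o] by (auto simp: points_subvariety)
  have pre: "affine_open n {p \<in> \<Omega>. \<mu> p \<in> W}" if "openin (zar X) W" for W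
    using morphism_open[OF \<mu> that] unfolding pt openin_subvariety_open[OF \<Omega>o] by (simp add: openin_affine)
  have ne: "{p \<in> \<Omega>. \<mu> p \<in> W} \<noteq> {}" if "openin (zar X) W" "W \<noteq> {}" for W
    using sur openin_subset[OF that(1)] that(2) by fastforce
  from affine_irreducible[OF pre[OF U(1)] pre[OF V(1)] ne[OF U] ne[OF V]] show "U \<inter> V \<noteq> {}" by blast
qed

lemma irreducible_variety_quotient:
  assumes "irreducible_variety X"
  shows "irreducible_variety (quotient_variety X r)"
  unfolding irreducible_variety_def
proof (intro allI impI; elim conjE)
  let ?pre = "\<lambda>U. {p \<in> points X. r `` {p} \<in> U}"
  fix U V assume U: "openin (zar (quotient_variety X r)) U" "U \<noteq> {}" and V: "openin (zar (quotient_variety X r)) V" "V \<noteq> {}"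
  have "?pre W \<noteq> {}" if W: "openin (zar (quotient_variety X r)) W" "W \<noteq> {}" for W
  proof -
    obtain y where "y \<in> W" using W by blast
    moreover from this obtain p where "p \<in> points X" "y = r `` {p}"
      using W(1) by (auto simp: openin_quotient_variety elim!: quotientE)
    ultimately show ?thesis by blast
  qed
  with U V assms have "?pre U \<inter> ?pre V \<noteq> {}"
    unfolding irreducible_variety_def openin_quotient_variety by simp
  then show "U \<inter> V \<noteq> {}" by blast
qed

text \<open>The data describe a quotient whose fibres are seen through a root. \<open>M\<close> is
  an invariant open part of \<open>X\<close>, parametrized by \<open>\<Omega>\<close> through
  \<open>\<kappa>\<close>, and \<open>\<Phi>\<close> is a pair of invariant functions on it;
  \<open>\<sigma>\<close> gives a point over \<open>[s, t]\<close> once a root \<open>b\<close> is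
  chosen, and \<open>orbit\<close> says that the fibre is a single orbit. The foliation is generated
  on \<open>\<Omega>\<close> by \<open>\<delta>\<close>, whose image in the plane is a nonzero
  multiple of \<open>D\<close>: by \<open>EA\<close> the sections of \<open>E\<close> are parallel
  to it, and by \<open>EB\<close> it is at each point the value of a section.\<close>

lemma quotient_plane_chart:
  assumes X: "ringed X" and irr: "irreducible_variety X" and r: "equiv (points X) r"
    and M: "openin (zar X) M" "\<And>x x'. (x, x') \<in> r \<Longrightarrow> x \<in> M \<Longrightarrow> x' \<in> M \<and> \<Phi> x' = \<Phi> x"
    and \<Phi>: "\<And>x. length (\<Phi> x) = 2" "\<And>i. i < 2 \<Longrightarrow> (\<lambda>x. \<Phi> x ! i) \<in> reg X M" "\<And>x. x \<in> M \<Longrightarrow> \<Phi> x \<in> \<O>"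
    and \<kappa>: "morphism (subvariety (affine_space n) \<Omega>) X \<kappa>" "\<And>p. p \<in> \<Omega> \<Longrightarrow> \<kappa> p \<in> M" "\<And>x. x \<in> M \<Longrightarrow> \<exists>p\<in>\<Omega>. \<kappa> p = x"
    and \<Omega>: "affine_open n \<Omega>"
    and \<O>: "affine_open 2 \<O>" "\<O> \<noteq> {}"
    and \<sigma>: "\<And>i. i < n \<Longrightarrow> (\<lambda>p. \<sigma> p ! i) \<in> polyfun 3"
    and R: "R \<in> polyfun 2" "\<And>q. q \<in> \<O> \<Longrightarrow> R q \<noteq> 0" and k: "k \<ge> 1"
    and lift: "\<And>s t b. [s, t] \<in> \<O> \<Longrightarrow> b ^ k = R [s, t] \<Longrightarrow> \<sigma> [s, t, b] \<in> \<Omega> \<and> \<Phi> (\<kappa> (\<sigma> [s, t, b])) = [s, t]"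
    and orbit: "\<And>x s t b. x \<in> M \<Longrightarrow> \<Phi> x = [s, t] \<Longrightarrow> b ^ k = R [s, t] \<Longrightarrow> (x, \<kappa> (\<sigma> [s, t, b])) \<in> r"
    and D: "plane_field D" "\<And>q. q \<in> \<O> \<Longrightarrow> D q ! 0 \<noteq> 0"
    and \<delta>: "\<And>p. p \<in> \<Omega> \<Longrightarrow> length (\<delta> p) = n"
      "\<And>p. p \<in> \<Omega> \<Longrightarrow> \<exists>c. c \<noteq> 0 \<and> (\<forall>i<2. ((\<lambda>t. \<Phi> (\<kappa> (map2 (\<lambda>a b. a + t * b) p (\<delta> p))) ! i)
         has_field_derivative c * D (\<Phi> (\<kappa> p)) ! i) (at 0))"
    and EA: "\<And>V w p N f g. w \<in> E V \<Longrightarrow> p \<in> \<Omega> \<Longrightarrow> \<kappa> p \<in> V \<Longrightarrow> openin (zar X) N \<Longrightarrow> \<kappa> p \<in> N \<Longrightarrow>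
      f \<in> reg X N \<Longrightarrow> g \<in> reg X N \<Longrightarrow>
      w f (\<kappa> p) * dir_deriv (g \<circ> \<kappa>) p (\<delta> p) = w g (\<kappa> p) * dir_deriv (f \<circ> \<kappa>) p (\<delta> p)"
    and EB: "\<And>p. p \<in> \<Omega> \<Longrightarrow> \<exists>V w. openin (zar X) V \<and> \<kappa> p \<in> V \<and> w \<in> E V \<and>
      (\<forall>N f. openin (zar X) N \<and> \<kappa> p \<in> N \<and> f \<in> reg X N \<longrightarrow> w f (\<kappa> p) = dir_deriv (f \<circ> \<kappa>) p (\<delta> p))"
  obtains V \<phi> \<psi> where "plane_chart (quotient_variety X r) (quotient_foliation X r E) D V \<O> \<phi> \<psi>"
proof -
  let ?Y = "quotient_variety X r" and ?q = "\<lambda>x. r `` {x}"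
  have Y: "ringed ?Y" by (rule ringed_quotient_variety[OF X])
  have A: "ringed (affine_space m)" for m by (rule ringed_affine_space)
  have q: "morphism X ?Y ?q" by (rule morphism_quotient)
  have Mp: "M \<subseteq> points X" by (rule openin_subset[OF M(1)])
  have \<Omega>o: "openin (zar (affine_space n)) \<Omega>" and \<O>o: "openin (zar (affine_space 2)) \<O>"
    using \<Omega> \<O> by (simp_all add: openin_affine)
  have pt: "points (subvariety (affine_space n) \<Omega>) = \<Omega>"
    using openin_subset[OF \<Omega>o] by (auto simp: points_subvariety)
  define V where "V = ?q ` M"
  have qV: "x \<in> M" if x: "x \<in> points X" "?q x \<in> V" for x
  proof -
    obtain x' where x': "x' \<in> M" "?q x = ?q x'" using x(2) unfolding V_def by blast
    then have "(x', x) \<in> r" using eq_equiv_class[OF x'(2)[symmetric] r] x(1) by blast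
    then show ?thesis using M(2) x'(1) by blast
  qed
  have pre: "{x \<in> points X. ?q x \<in> V} = M" using qV Mp unfolding V_def by blast
  have Vo: "openin (zar ?Y) V"
    unfolding openin_quotient_variety pre using M(1) Mp unfolding V_def by (auto intro: quotientI)
  have ptV: "points (subvariety ?Y V) = V" using openin_subset[OF Vo] by (auto simp: points_subvariety)
  \<comment> \<open>Invariance of \<open>\<Phi>\<close> along orbits makes the choice of the
    representative immaterial.\<close>
  define \<phi> where "\<phi> y = \<Phi> (SOME x. x \<in> M \<and> y = ?q x)" for y
  have \<phi>: "\<phi> (?q x) = \<Phi> x" if x: "x \<in> M" for x
  proof -
    let ?x = "SOME x'. x' \<in> M \<and> ?q x = ?q x'"
    have "?x \<in> M \<and> ?q x = ?q ?x" by (rule someI[of _ x]) (use x in simp)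
    then have "(x, ?x) \<in> r" using eq_equiv_class[OF _ r] Mp by blast
    then show ?thesis using M(2) x unfolding \<phi>_def by blast
  qed
  have "\<phi> y \<in> \<O>" if "y \<in> V" for y using that \<phi> \<Phi>(3) unfolding V_def by auto
  moreover have "morphism (subvariety ?Y V) (affine_space 2) \<phi>"
  proof (rule morphism_affine[OF ringed_subvariety[OF Y]])
    show "length (\<phi> y) = 2" for y by (simp add: \<phi>_def \<Phi>(1))
    fix i :: nat assume i: "i < 2"
    show "(\<lambda>y. \<phi> y ! i) \<in> reg (subvariety ?Y V) (points (subvariety ?Y V))"
      unfolding ptV reg_subvariety_open[OF Y Vo] reg_quotient_variety pre
      by (rule ringed_restrict[OF X M(1) \<Phi>(2)[OF i] M(1)]) (simp_all add: \<phi>)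
  qed
  ultimately have m\<phi>: "morphism (subvariety ?Y V) (subvariety (affine_space 2) \<O>) \<phi>"
    by (intro morphism_into_subvariety ringed_subvariety Y A) (simp_all add: ptV)
  have root: "\<exists>b. b ^ k = R q" if "q \<in> \<O>" for q
  proof -
    have "card {z. z ^ k = R q} = k" using card_nth_roots R(2)[OF that] k by simp
    then show ?thesis using k by (metis (mono_tags) card.empty empty_Collect_eq not_one_le_zero)
  qed
  have two: "\<exists>s t. q = [s, t]" if "q \<in> \<O>" for q
    using affine_open_length[OF \<O>(1) that] by (auto simp: numeral_2_eq_2 length_Suc_conv)
  define \<psi> where "\<psi> q = ?q (\<kappa> (\<sigma> [q ! 0, q ! 1, SOME b. b ^ k = R q]))" for q
  \<comment> \<open>Two roots give points of the same fibre of \<open>\<Phi>\<close>, hence of the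
    same orbit, so the choice of the root disappears in the quotient.\<close>
  have \<psi>: "?q (\<kappa> (\<sigma> [s, t, b])) = \<psi> [s, t]" if st: "[s, t] \<in> \<O>" "b ^ k = R [s, t]" for s t b
  proof -
    let ?b = "SOME b. b ^ k = R [s, t]"
    have b: "?b ^ k = R [s, t]" using someI_ex[OF root[OF st(1)]] .
    have "(\<kappa> (\<sigma> [s, t, b]), \<kappa> (\<sigma> [s, t, ?b])) \<in> r"
      using lift[OF st] \<kappa>(2) by (intro orbit[OF _ _ b]) auto
    then show ?thesis unfolding \<psi>_def using equiv_class_eq[OF r] by simp
  qed
  have m\<psi>': "morphism (subvariety (affine_space 2) \<O>) ?Y \<psi>"
    by (rule cover_morphism[OF Y morphism_compose[OF \<kappa>(1) q] \<Omega> \<O>(1) \<sigma> R k]) (use lift \<psi> in auto)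
  have pt\<O>: "points (subvariety (affine_space 2) \<O>) = \<O>"
    using openin_subset[OF \<O>o] by (auto simp: points_subvariety)
  have \<psi>\<O>: "\<psi> q \<in> V \<and> \<phi> (\<psi> q) = q" if q: "q \<in> \<O>" for q
  proof -
    obtain s t where st: "q = [s, t]" using two[OF q] by blast
    obtain b where b: "b ^ k = R [s, t]" using root[OF q] unfolding st by blast
    have l: "\<sigma> [s, t, b] \<in> \<Omega>" "\<Phi> (\<kappa> (\<sigma> [s, t, b])) = [s, t]" using lift[OF _ b] q unfolding st by auto
    have "\<psi> q = ?q (\<kappa> (\<sigma> [s, t, b]))" using \<psi>[OF _ b] q unfolding st by simp
    then show ?thesis using \<phi>[OF \<kappa>(2)[OF l(1)]] \<kappa>(2)[OF l(1)] l(2) st unfolding V_def by simp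
  qed
  have m\<psi>: "morphism (subvariety (affine_space 2) \<O>) (subvariety ?Y V) \<psi>"
    using \<psi>\<O> by (intro morphism_into_subvariety ringed_subvariety Y A m\<psi>') (simp add: pt\<O>)
  have \<psi>\<Phi>: "\<psi> (\<Phi> x) = ?q x" if x: "x \<in> M" for x
  proof -
    obtain s t b where st: "\<Phi> x = [s, t]" "b ^ k = R [s, t]" using two[OF \<Phi>(3)[OF x]] root[OF \<Phi>(3)[OF x]] by metis
    have "(x, \<kappa> (\<sigma> [s, t, b])) \<in> r" by (rule orbit[OF x st])
    then show ?thesis using \<psi>[OF _ st(2)] \<Phi>(3)[OF x] equiv_class_eq[OF r] st(1) by metis
  qed
  have iso: "inverse_isomorphisms (subvariety ?Y V) (subvariety (affine_space 2) \<O>) \<phi> \<psi>"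
    unfolding inverse_isomorphisms_def ptV pt\<O> using m\<phi> m\<psi> \<psi>\<O> \<phi> \<psi>\<Phi> unfolding V_def by auto
  have dense: "dense_open ?Y V"
  proof (rule dense_openI[OF Vo])
    have "V \<noteq> {}" using \<O>(2) \<psi>\<O> by blast
    then show "V \<inter> W \<noteq> {}" if "openin (zar ?Y) W" "W \<noteq> {}" for W
      using irreducible_variety_quotient[OF irr] that Vo unfolding irreducible_variety_def by blast
  qed
  let ?t = "transported D \<phi> \<psi>"
  have lenD: "length (D q) = 2" for q using D by (simp add: plane_field_def)
  \<comment> \<open>Along the line in direction \<open>\<delta> p\<close>, a function
    \<open>f\<close> on the quotient equals \<open>f \<circ> \<psi>\<close> on the plane curve
    traced by \<open>\<Phi>\<close>, whose velocity is \<open>c\<close> times \<open>D\<close>; the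
    chain rule gives the claim with the same \<open>c\<close> for all \<open>f\<close>.\<close>
  have key: "\<exists>c. c \<noteq> 0 \<and> (\<forall>N f. openin (zar ?Y) N \<and> ?q (\<kappa> p) \<in> N \<and> f \<in> reg ?Y N \<longrightarrow>
      dir_deriv ((f \<circ> ?q) \<circ> \<kappa>) p (\<delta> p) = c * ?t f (?q (\<kappa> p)))" if p: "p \<in> \<Omega>" for p
  proof -
    obtain c where c: "c \<noteq> 0" "\<And>i. i < 2 \<Longrightarrow> ((\<lambda>t. \<Phi> (\<kappa> (map2 (\<lambda>a b. a + t * b) p (\<delta> p))) ! i)
         has_field_derivative c * D (\<Phi> (\<kappa> p)) ! i) (at 0)"
      using \<delta>(2)[OF p] by blast
    have len: "length p = n" "length (\<delta> p) = n" using affine_open_length[OF \<Omega> p] \<delta>(1)[OF p] by auto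
    let ?l = "\<lambda>t. map2 (\<lambda>a b. a + t * b) p (\<delta> p)"
    have "dir_deriv ((f \<circ> ?q) \<circ> \<kappa>) p (\<delta> p) = c * ?t f (?q (\<kappa> p))"
      if N: "openin (zar ?Y) N" "?q (\<kappa> p) \<in> N" "f \<in> reg ?Y N" for N f
    proof -
      have f\<psi>: "f \<circ> \<psi> \<in> reg (affine_space 2) {q \<in> \<O>. \<psi> q \<in> N}" and o: "affine_open 2 {q \<in> \<O>. \<psi> q \<in> N}"
        using iso_reg[OF Y A Vo \<O>o iso N(1)] N(3) by (simp_all add: openin_affine)
      have x: "\<kappa> p \<in> M" "\<Phi> (\<kappa> p) \<in> \<O>" "\<psi> (\<Phi> (\<kappa> p)) = ?q (\<kappa> p)" using \<kappa>(2)[OF p] \<Phi>(3) \<psi>\<Phi> by auto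
      obtain L where L: "gradient_at 2 (f \<circ> \<psi>) (\<Phi> (\<kappa> p)) L"
        using reg_gradient[OF f\<psi> o, of "\<Phi> (\<kappa> p)"] x N(2) by auto
      have "((\<lambda>t. (f \<circ> \<psi>) (\<Phi> (\<kappa> (?l t)))) has_field_derivative (\<Sum>i<2. L i * (c * D (\<Phi> (\<kappa> p)) ! i))) (at 0)"
        by (rule gradient_atD[OF L]) (use len line_0[of p "\<delta> p"] c(2) \<Phi>(1) in simp_all)
      moreover have "(\<Sum>i<2. L i * (c * D (\<Phi> (\<kappa> p)) ! i)) = c * dir_deriv (f \<circ> \<psi>) (\<Phi> (\<kappa> p)) (D (\<Phi> (\<kappa> p)))"
        by (subst gradient_at_line(2)[OF L]) (simp_all add: \<Phi>(1) lenD sum_distrib_left mult_ac)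
      moreover have "\<forall>\<^sub>F t in nhds 0. (f \<circ> ?q \<circ> \<kappa>) (?l t) = (f \<circ> \<psi>) (\<Phi> (\<kappa> (?l t)))"
        using eventually_line[OF \<Omega> p len(2)] by eventually_elim (simp add: \<psi>\<Phi> \<kappa>(2))
      ultimately have "((\<lambda>t. (f \<circ> ?q \<circ> \<kappa>) (?l t)) has_field_derivative
          c * dir_deriv (f \<circ> \<psi>) (\<Phi> (\<kappa> p)) (D (\<Phi> (\<kappa> p)))) (at 0)"
        using DERIV_cong_ev[OF refl _ refl] by fastforce
      then show ?thesis by (simp add: dir_deriv_eqI transported_def \<phi> x)
    qed
    with c(1) show ?thesis by blast
  qed
  have qo: "openin (zar X) {x \<in> points X. ?q x \<in> N}" if "openin (zar ?Y) N" for N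
    by (rule morphism_open[OF q that])
  have qr: "f \<circ> ?q \<in> reg X {x \<in> points X. ?q x \<in> N}" if "openin (zar ?Y) N" "f \<in> reg ?Y N" for N f
    by (rule morphism_reg[OF q that])
  have PA: "parallel_at ?Y v ?t y" if v: "v \<in> quotient_foliation X r E W" and y: "y \<in> W" "y \<in> V" for v W y
    unfolding parallel_at_def
  proof (intro allI impI; elim conjE)
    fix N f g assume N: "openin (zar ?Y) N" "y \<in> N" "f \<in> reg ?Y N" "g \<in> reg ?Y N"
    obtain p where p: "p \<in> \<Omega>" "y = ?q (\<kappa> p)" using y(2) \<kappa>(3) unfolding V_def by blast
    obtain c where c: "c \<noteq> 0" "\<And>N f. openin (zar ?Y) N \<Longrightarrow> ?q (\<kappa> p) \<in> N \<Longrightarrow> f \<in> reg ?Y N \<Longrightarrow>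
      dir_deriv ((f \<circ> ?q) \<circ> \<kappa>) p (\<delta> p) = c * ?t f (?q (\<kappa> p))" using key[OF p(1)] by blast
    obtain V1 w where w: "openin (zar X) V1" "\<kappa> p \<in> V1" "w \<in> E V1"
      "\<And>N f. openin (zar X) N \<Longrightarrow> \<kappa> p \<in> N \<Longrightarrow> f \<in> reg X N \<Longrightarrow> w f (\<kappa> p) = dir_deriv (f \<circ> \<kappa>) p (\<delta> p)"
      using EB[OF p(1)] by blast
    have \<kappa>p: "\<kappa> p \<in> points X" using \<kappa>(2)[OF p(1)] Mp by blast
    have "v f (?q (\<kappa> p)) * w (g \<circ> ?q) (\<kappa> p) = v g (?q (\<kappa> p)) * w (f \<circ> ?q) (\<kappa> p)"
      using v[unfolded quotient_foliation_def pushforward_foliation_def mem_Collect_eq, THEN conjunct2, rule_format,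
        of V1 w "\<kappa> p" N f g] w(1-3) N y(1) unfolding p(2) by simp
    moreover have "w (h \<circ> ?q) (\<kappa> p) = c * ?t h (?q (\<kappa> p))" if "h \<in> reg ?Y N" for h
      using w(4)[OF qo[OF N(1)] _ qr[OF N(1) that]] c(2)[OF N(1) _ that] N(2) \<kappa>p unfolding p(2) by simp
    ultimately show "v f y * ?t g y = v g y * ?t f y"
      using N(3,4) c(1) unfolding p(2) by simp
  qed
  have PB: "v \<in> quotient_foliation X r E W"
    if W: "W \<subseteq> V" and v: "vector_field ?Y W v" and p: "\<And>y. y \<in> W \<Longrightarrow> parallel_at ?Y v ?t y" for v W
    unfolding quotient_foliation_def pushforward_foliation_def
  proof (intro CollectI conjI v allI impI; elim conjE)
    fix V1 w x N f g assume w: "openin (zar X) V1" "w \<in> E V1" "x \<in> V1" "?q x \<in> W"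
      and N: "openin (zar ?Y) N" "?q x \<in> N" "f \<in> reg ?Y N" "g \<in> reg ?Y N"
    have "x \<in> points X" using w(1,3) openin_subset by blast
    then have x: "x \<in> M" using qV w(4) W by blast
    obtain u where u: "u \<in> \<Omega>" "\<kappa> u = x" using \<kappa>(3)[OF x] by blast
    obtain c where c: "c \<noteq> 0" "\<And>N f. openin (zar ?Y) N \<Longrightarrow> ?q (\<kappa> u) \<in> N \<Longrightarrow> f \<in> reg ?Y N \<Longrightarrow>
      dir_deriv ((f \<circ> ?q) \<circ> \<kappa>) u (\<delta> u) = c * ?t f (?q (\<kappa> u))" using key[OF u(1)] by blast
    \<comment> \<open>Only ratios of derivatives enter, so the factor \<open>c\<close> cancels and
      the image of \<open>w\<close> is parallel to the field of the chart.\<close>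
    have *: "w (f \<circ> ?q) x * ?t g (?q x) = w (g \<circ> ?q) x * ?t f (?q x)"
      if N: "openin (zar ?Y) N" "?q x \<in> N" "f \<in> reg ?Y N" "g \<in> reg ?Y N" for N f g
      using EA[OF w(2) u(1) _ qo[OF N(1)] _ qr[OF N(1,3)] qr[OF N(1,4)]] w(3) N(2) \<open>x \<in> points X\<close>
        c(2)[OF N(1) _ N(3)] c(2)[OF N(1) _ N(4)] c(1) unfolding u(2) by simp
    have y: "?q x \<in> V" using x unfolding V_def by blast
    obtain h where h: "h \<in> reg ?Y V" "?t h (?q x) \<noteq> 0"
    proof -
      have "(\<lambda>y. \<phi> y ! 0) \<in> reg ?Y V"
        unfolding reg_quotient_variety pre
        by (rule ringed_restrict[OF X M(1) \<Phi>(2)[of 0] M(1)]) (simp_all add: \<phi>)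
      moreover have "?t (\<lambda>y. \<phi> y ! 0) (?q x) = D (\<Phi> x) ! 0"
      proof -
        have "?t (\<lambda>y. \<phi> y ! 0) (?q x) = dir_deriv (\<lambda>p. p ! 0) (\<Phi> x) (D (\<Phi> x))"
          unfolding transported_def \<phi>[OF x]
          by (rule dir_deriv_cong[OF \<O>(1) \<Phi>(3)[OF x] lenD]) (simp add: \<psi>\<O>)
        also have "\<dots> = D (\<Phi> x) ! 0"
          by (rule dir_deriv_eqI) (rule line_derivative[OF \<Phi>(1) lenD], simp)
        finally show ?thesis .
      qed
      ultimately show thesis using that D(2)[OF \<Phi>(3)[OF x]] by simp
    qed
    have "parallel_at ?Y v (\<lambda>f y. w (f \<circ> ?q) x) (?q x)"
      by (rule parallel_at_trans[OF Y p[OF w(4)] _ Vo y h]) (unfold parallel_at_def, intro allI impI, elim conjE, rule *)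
    from parallel_atD[OF this N] show "v f (?q x) * w (g \<circ> ?q) x = v g (?q x) * w (f \<circ> ?q) x" .
  qed
  have "plane_chart ?Y (quotient_foliation X r E) D V \<O> \<phi> \<psi>"
    unfolding plane_chart_def
    by (intro conjI dense \<O> iso) (use D(2) PA PB in auto)
  then show thesis by (rule that)
qed

section \<open>Weighted projective spaces and finite quotients\<close>

lemma open_preimage:
  assumes X: "ringed X" and B: "openin (zar X) B" and F: "\<And>x. x \<in> B \<Longrightarrow> length (F x) = n" "\<And>i. i < n \<Longrightarrow> (\<lambda>x. F x ! i) \<in> reg X B"
    and \<O>: "affine_open n \<O>"
  shows "openin (zar X) {x \<in> B. F x \<in> \<O>}"
proof -
  have pt: "points (subvariety X B) = B" using openin_subset[OF B] by (auto simp: points_subvariety)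
  have m: "morphism (subvariety X B) (affine_space n) F"
    by (rule morphism_affine[OF ringed_subvariety[OF X]]) (use F in \<open>simp_all add: pt reg_subvariety_open[OF X B]\<close>)
  have "openin (zar (affine_space n)) \<O>" using \<O> by (simp add: openin_affine)
  from morphism_open[OF m this] show ?thesis unfolding pt openin_subvariety_open[OF B] by simp
qed

lemma vector_field_subvariety:
  "ringed X \<Longrightarrow> openin (zar X) S \<Longrightarrow> U \<subseteq> S \<Longrightarrow> vector_field X U v \<Longrightarrow> vector_field (subvariety X S) U v"
proof -
  assume X: "ringed X" and S: "openin (zar X) S" and U: "U \<subseteq> S" and v: "vector_field X U v"
  have o: "openin (zar (subvariety X S)) V \<and> V \<subseteq> U \<longleftrightarrow> openin (zar X) V \<and> V \<subseteq> U" for V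
    using openin_subvariety_open[OF S, of V] U by blast
  have r: "reg (subvariety X S) V = reg X V" if "openin (zar X) V" for V by (rule reg_subvariety_open[OF X that])
  show "vector_field (subvariety X S) U v"
    unfolding vector_field_def
  proof (rule conjI, use o[of U] vector_field_open[OF v] in blast, intro allI impI)
    fix V f g
    assume *: "openin (zar (subvariety X S)) V \<and> V \<subseteq> U \<and> f \<in> reg (subvariety X S) V \<and> g \<in> reg (subvariety X S) V"
    then have V: "openin (zar X) V" using o by blast
    note v[unfolded vector_field_def, THEN conjunct2, THEN spec, THEN spec, THEN spec, THEN mp, of V f g]
    then show "v f \<in> reg (subvariety X S) V \<and> (\<forall>x\<in>V. v (\<lambda>y. f y + g y) x = v f x + v g x) \<and>
        (\<forall>x\<in>V. v (\<lambda>y. f y * g y) x = f x * v g x + g x * v f x) \<and>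
        (\<forall>c. \<forall>x\<in>V. v (\<lambda>y. c) x = 0) \<and> ((\<forall>x\<in>V. f x = g x) \<longrightarrow> (\<forall>x\<in>V. v f x = v g x))"
      using * V unfolding r[OF V] by blast
  qed
qed

section \<open>Punctured spaces and orbit relations\<close>

definition punctured :: "nat \<Rightarrow> complex list set" where
  "punctured n = {p. length p = n \<and> p \<noteq> replicate n 0}"

lemma affine_open_punctured: "affine_open n (punctured n)"
proof (rule affine_openI)
  fix p assume p: "p \<in> punctured n"
  have "\<exists>i<n. p ! i \<noteq> 0"
  proof (rule ccontr)
    assume "\<not> ?thesis"
    then have "p = replicate n 0" using p by (intro nth_equalityI) (auto simp: punctured_def)
    then show False using p by (simp add: punctured_def)
  qed
  then obtain i where "i < n" "p ! i \<noteq> 0" by blast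
  then show "\<exists>e\<in>polyfun n. e p \<noteq> 0 \<and> (\<forall>q. length q = n \<and> e q \<noteq> 0 \<longrightarrow> q \<in> punctured n)"
    by (intro bexI[of _ "\<lambda>p. p ! i"] polyfun.coord) (auto simp: punctured_def dest!: arg_cong[of _ _ "\<lambda>q. q ! i"])
qed (simp add: punctured_def)

lemma punctured_space_eq: "punctured_space n = subvariety (affine_space n) (punctured n)"
  by (simp add: punctured_space_def punctured_def)

lemma points_affine_subvariety: "affine_open n S \<Longrightarrow> points (subvariety (affine_space n) S) = S"
  by (auto simp: points_subvariety affine_open_length)

lemma points_punctured_space [simp]: "points (punctured_space n) = punctured n"
  by (simp add: punctured_space_eq points_affine_subvariety affine_open_punctured)

lemma openin_affine_subvariety:
  "affine_open n S \<Longrightarrow> openin (zar (subvariety (affine_space n) S)) U \<longleftrightarrow> affine_open n U \<and> U \<subseteq> S"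
  using openin_subvariety_open[of "affine_space n" S U] by (simp add: openin_affine)

lemma reg_affine_subvariety:
  "affine_open n U \<Longrightarrow> reg (subvariety (affine_space n) S) U = reg (affine_space n) U"
  using reg_subvariety_open[OF ringed_affine_space, of n U S] by (simp add: openin_affine)

lemma morphism_affine_subvarieties:
  "affine_open n S \<Longrightarrow> S' \<subseteq> S \<Longrightarrow> morphism (subvariety (affine_space n) S') (subvariety (affine_space n) S) (\<lambda>p. p)"
  by (intro morphism_into_subvariety ringed_subvariety ringed_affine_space morphism_inclusion)
    (auto simp: points_subvariety)

lemma weighted_rel_iff:
  "(p, p') \<in> weighted_rel ws \<longleftrightarrow>
     p \<in> punctured (length ws) \<and> (\<exists>c. c \<noteq> 0 \<and> p' = map2 (\<lambda>w x. c ^ w * x) ws p)"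
  by (auto simp: weighted_rel_def)

lemma equiv_weighted_rel: "equiv (punctured (length ws)) (weighted_rel ws)"
proof -
  have closed: "map2 (\<lambda>w x. c ^ w * x) ws p \<in> punctured (length ws)"
    if c: "c \<noteq> 0" and p: "p \<in> punctured (length ws)" for c p
  proof -
    have "p = replicate (length ws) 0" if "map2 (\<lambda>w x. c ^ w * x) ws p = replicate (length ws) 0"
    proof (rule nth_equalityI)
      fix i assume i: "i < length p"
      then have "map2 (\<lambda>w x. c ^ w * x) ws p ! i = 0" using that p by (simp add: punctured_def)
      then show "p ! i = replicate (length ws) 0 ! i" using i p c by (simp add: punctured_def)
    qed (use p in \<open>simp add: punctured_def\<close>)
    then show ?thesis using p by (auto simp: punctured_def)
  qed
  have comp: "map2 (\<lambda>w x. d ^ w * x) ws (map2 (\<lambda>w x. c ^ w * x) ws p) = map2 (\<lambda>w x. (d * c) ^ w * x) ws p" for c d :: complex and p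
    by (intro nth_equalityI) (auto simp: power_mult_distrib mult.assoc)
  have one: "map2 (\<lambda>w x. 1 ^ w * x) ws p = p" if "p \<in> punctured (length ws)" for p :: "complex list"
    using that by (intro nth_equalityI) (auto simp: punctured_def)
  show ?thesis
  proof (intro equivI)
    show "weighted_rel ws \<subseteq> punctured (length ws) \<times> punctured (length ws)"
      using closed by (auto simp: weighted_rel_iff)
    show "refl_on (punctured (length ws)) (weighted_rel ws)"
    proof (rule refl_onI)
      fix p :: "complex list" assume p: "p \<in> punctured (length ws)"
      show "(p, p) \<in> weighted_rel ws"
        unfolding weighted_rel_iff by (intro conjI exI[of _ 1] p one[OF p, symmetric]) simp
    qed
    show "sym (weighted_rel ws)"
    proof (rule symI)
      fix p p' assume "(p, p') \<in> weighted_rel ws"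
      then obtain c where c: "p \<in> punctured (length ws)" "c \<noteq> 0" "p' = map2 (\<lambda>w x. c ^ w * x) ws p"
        by (auto simp: weighted_rel_iff)
      then have "p = map2 (\<lambda>w x. inverse c ^ w * x) ws p'"
        unfolding c(3) comp left_inverse[OF c(2)] by (intro one[OF c(1), symmetric])
      then show "(p', p) \<in> weighted_rel ws" using closed[of c p] c unfolding weighted_rel_iff
        by (intro conjI exI[of _ "inverse c"]) auto
    qed
    show "trans (weighted_rel ws)"
    proof (rule transI)
      fix p q s assume "(p, q) \<in> weighted_rel ws" "(q, s) \<in> weighted_rel ws"
      then obtain c d where c: "p \<in> punctured (length ws)" "c \<noteq> 0" "q = map2 (\<lambda>w x. c ^ w * x) ws p"
        and d: "d \<noteq> 0" "s = map2 (\<lambda>w x. d ^ w * x) ws q"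
        unfolding weighted_rel_iff by blast
      show "(p, s) \<in> weighted_rel ws"
        unfolding weighted_rel_iff d(2) c(3) comp by (intro conjI c(1) exI[of _ "d * c"]) (use c d in simp_all)
    qed
  qed
qed

lemma cyclic_rel_iff: "(x, y) \<in> cyclic_rel X T \<longleftrightarrow> x \<in> points X \<and> (\<exists>k. y = (T ^^ k) x)"
  by (auto simp: cyclic_rel_def)

lemma equiv_cyclic_rel:
  assumes T: "\<And>x. x \<in> points X \<Longrightarrow> T x \<in> points X" and m: "m \<ge> 1" "\<And>x. x \<in> points X \<Longrightarrow> (T ^^ m) x = x"
  shows "equiv (points X) (cyclic_rel X T)"
proof (intro equivI)
  have closed: "(T ^^ k) x \<in> points X" if "x \<in> points X" for k x
    by (induction k) (use that T in auto)
  show "cyclic_rel X T \<subseteq> points X \<times> points X" using closed by (auto simp: cyclic_rel_iff)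
  show "refl_on (points X) (cyclic_rel X T)"
    by (intro refl_onI) (auto simp: cyclic_rel_iff intro: exI[of _ 0])
  have per: "(T ^^ (m * j)) x = x" if "x \<in> points X" for j x
    by (induction j) (use that m in \<open>simp_all add: funpow_add\<close>)
  show "sym (cyclic_rel X T)"
  proof (rule symI)
    fix x y assume "(x, y) \<in> cyclic_rel X T"
    then obtain k where k: "x \<in> points X" "y = (T ^^ k) x" by (auto simp: cyclic_rel_iff)
    \<comment> \<open>\<open>T ^^ (m * k)\<close> is the identity, so the iterate with exponent
      \<open>m * k - k\<close> inverts \<open>T ^^ k\<close>; as \<open>m\<close> is at least 1, the
      subtraction of natural numbers is exact.\<close>
    have "m * k - k + k = m * k" using m(1) by simp
    then have "(T ^^ (m * k - k)) y = x" using per[OF k(1), of k] unfolding k(2)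
      by (metis comp_apply funpow_add)
    then show "(y, x) \<in> cyclic_rel X T" using closed k by (auto simp: cyclic_rel_iff intro: exI[of _ "m * k - k"])
  qed
  show "trans (cyclic_rel X T)"
  proof (rule transI)
    fix x y z assume "(x, y) \<in> cyclic_rel X T" "(y, z) \<in> cyclic_rel X T"
    then obtain j k where "x \<in> points X" "y = (T ^^ j) x" "z = (T ^^ k) y" by (auto simp: cyclic_rel_iff)
    then have "x \<in> points X \<and> z = (T ^^ (k + j)) x" by (simp add: funpow_add)
    then show "(x, z) \<in> cyclic_rel X T" unfolding cyclic_rel_iff by blast
  qed
qed


definition descended_field ::
  "complex list rel \<Rightarrow> (complex list \<Rightarrow> complex list) \<Rightarrow> (complex list set \<Rightarrow> complex) \<Rightarrow> complex list set \<Rightarrow> complex" where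
  "descended_field r \<delta> f y = dir_deriv (\<lambda>p. f (r `` {p})) (SOME p. p \<in> y) (\<delta> (SOME p. p \<in> y))"

text \<open>The hypothesis \<open>lines\<close> asks that the segments in direction
  \<open>\<delta>\<close> at equivalent points be equivalent for each \<open>t\<close>; it holds for
  the scalings and the diagonal linear fields below because they commute. The derivative then does
  not depend on the representative chosen in \<open>descended_field\<close>, and the derivation
  rules come from the field upstairs.\<close>

lemma
  fixes r :: "complex list rel"
  assumes S: "affine_open n S" and r: "equiv S r"
    and \<delta>: "\<And>i. i < n \<Longrightarrow> (\<lambda>p. \<delta> p ! i) \<in> polyfun n" "\<And>p. length p = n \<Longrightarrow> length (\<delta> p) = n"
    and lines: "\<And>p p' t. (p, p') \<in> r \<Longrightarrow> map2 (\<lambda>a b. a + t * b) p (\<delta> p) \<in> S \<Longrightarrow>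
      (map2 (\<lambda>a b. a + t * b) p (\<delta> p), map2 (\<lambda>a b. a + t * b) p' (\<delta> p')) \<in> r"
  shows descended_field_eq: "\<And>p f. p \<in> S \<Longrightarrow> descended_field r \<delta> f (r `` {p}) = dir_deriv (\<lambda>p. f (r `` {p})) p (\<delta> p)"
    and vector_field_descended:
      "vector_field (quotient_variety (subvariety (affine_space n) S) r) (S // r) (descended_field r \<delta>)"
proof -
  let ?X = "subvariety (affine_space n) S"
  let ?Y = "quotient_variety ?X r"
  have pt: "points ?X = S" by (rule points_affine_subvariety[OF S])
  show eq: "descended_field r \<delta> f (r `` {p}) = dir_deriv (\<lambda>p. f (r `` {p})) p (\<delta> p)" if p: "p \<in> S" for p f
  proof -
    let ?p = "SOME p'. p' \<in> r `` {p}"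
    have "?p \<in> r `` {p}" by (rule someI[of _ p]) (use equiv_class_self[OF r p] in simp)
    then have pp: "(p, ?p) \<in> r" by simp
    have "dir_deriv (\<lambda>p. f (r `` {p})) p (\<delta> p) = dir_deriv (\<lambda>p. f (r `` {p})) ?p (\<delta> ?p)"
      unfolding dir_deriv_def
    proof (rule deriv_cong_ev[OF _ refl])
      show "\<forall>\<^sub>F t in nhds 0. f (r `` {map2 (\<lambda>a b. a + t * b) p (\<delta> p)}) = f (r `` {map2 (\<lambda>a b. a + t * b) ?p (\<delta> ?p)})"
        using eventually_line[OF S p \<delta>(2)[OF affine_open_length[OF S p]]]
        by eventually_elim (simp add: equiv_class_eq[OF r lines[OF pp]])
    qed
    then show ?thesis by (simp add: descended_field_def)
  qed
  have vf: "vector_field (affine_space n) S (\<lambda>f p. dir_deriv f p (\<delta> p))" by (rule vector_field_affine[OF S \<delta>])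
  let ?d = "\<lambda>f p. dir_deriv f p (\<delta> p)"
  let ?pre = "\<lambda>V. {p \<in> S. r `` {p} \<in> V}"
  have rep: "\<exists>p\<in>?pre V. y = r `` {p}" if "V \<subseteq> S // r" "y \<in> V" for y V
    using that by (auto elim!: quotientE)
  have preo: "affine_open n (?pre V)" if "openin (zar ?Y) V" for V
    using that unfolding openin_quotient_variety pt by (simp add: openin_affine_subvariety[OF S])
  show "vector_field ?Y (S // r) (descended_field r \<delta>)"
    unfolding vector_field_def
  proof (intro conjI allI impI ballI; (elim conjE)?)
    show "openin (zar ?Y) (S // r)" using openin_topspace[of "zar ?Y"] by (simp add: points_quotient_variety pt)
    fix V f g assume V: "openin (zar ?Y) V" "V \<subseteq> S // r" and f: "f \<in> reg ?Y V" and g: "g \<in> reg ?Y V"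
    let ?W = "?pre V"
    have W: "affine_open n ?W" "openin (zar (affine_space n)) ?W" "?W \<subseteq> S" using preo[OF V(1)] by (auto simp: openin_affine)
    have f': "(\<lambda>p. f (r `` {p})) \<in> reg (affine_space n) ?W" and g': "(\<lambda>p. g (r `` {p})) \<in> reg (affine_space n) ?W"
      using f g by (simp_all add: reg_quotient_variety pt reg_affine_subvariety[OF W(1)])
    have "(\<lambda>p. descended_field r \<delta> f (r `` {p})) \<in> reg (affine_space n) ?W"
      by (rule ringed_restrict[OF ringed_affine_space W(2) vector_field_reg[OF vf W(2,3) f'] W(2)]) (simp_all add: eq)
    then show "descended_field r \<delta> f \<in> reg ?Y V"
      by (simp add: reg_quotient_variety pt reg_affine_subvariety[OF W(1)])
    note * = vector_field_add[OF vf W(2,3) f' g'] vector_field_mult[OF vf W(2,3) f' g']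
      vector_field_const[OF vf W(2,3) f'] vector_field_cong[OF vf W(2,3) f' g']
    fix y assume "y \<in> V"
    then obtain p where p: "p \<in> ?W" "y = r `` {p}" using rep[OF V(2)] by blast
    have pS: "p \<in> S" using p by simp
    show "descended_field r \<delta> (\<lambda>y. f y + g y) y = descended_field r \<delta> f y + descended_field r \<delta> g y"
      using *(1)[OF p(1)] unfolding p(2) by (simp add: eq[OF pS])
    show "descended_field r \<delta> (\<lambda>y. f y * g y) y = f y * descended_field r \<delta> g y + g y * descended_field r \<delta> f y"
      using *(2)[OF p(1)] unfolding p(2) by (simp add: eq[OF pS])
    show "descended_field r \<delta> (\<lambda>y. c) y = 0" for c
      using *(3)[OF p(1)] unfolding p(2) by (simp add: eq[OF pS])
    show "descended_field r \<delta> f y = descended_field r \<delta> g y" if "\<forall>x\<in>V. f x = g x"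
      using *(4)[OF p(1)] that unfolding p(2) by (simp add: eq[OF pS])
  qed
qed


text \<open>A function that is constant on orbits is evaluated at a chosen representative. Since
  \<open>\<Omega>\<close> is a union of orbits, it is the full preimage of its image, which gives
  both openness and regularity in the quotient.\<close>

lemma orbit_functions:
  fixes r :: "complex list rel"
  assumes S: "affine_open n S" and r: "equiv S r" and \<Omega>: "affine_open n \<Omega>" "\<Omega> \<subseteq> S"
    and inv: "\<And>p p'. (p, p') \<in> r \<Longrightarrow> p \<in> \<Omega> \<Longrightarrow> p' \<in> \<Omega> \<and> F p' = F p"
    and F: "\<And>p. length (F p) = m" "\<And>i. i < m \<Longrightarrow> (\<lambda>p. F p ! i) \<in> reg (affine_space n) \<Omega>"
  obtains \<Phi> where "\<And>y. length (\<Phi> y) = m" "\<And>p. p \<in> \<Omega> \<Longrightarrow> \<Phi> (r `` {p}) = F p"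
    "\<And>i. i < m \<Longrightarrow> (\<lambda>y. \<Phi> y ! i) \<in> reg (quotient_variety (subvariety (affine_space n) S) r) ((\<lambda>p. r `` {p}) ` \<Omega>)"
    "openin (zar (quotient_variety (subvariety (affine_space n) S) r)) ((\<lambda>p. r `` {p}) ` \<Omega>)"
    "{p \<in> S. r `` {p} \<in> (\<lambda>p. r `` {p}) ` \<Omega>} = \<Omega>"
proof
  let ?X = "subvariety (affine_space n) S"
  let ?Y = "quotient_variety ?X r"
  let ?\<Phi> = "\<lambda>y. F (SOME p. p \<in> y)"
  have pt: "points ?X = S" by (rule points_affine_subvariety[OF S])
  show "length (?\<Phi> y) = m" for y by (rule F(1))
  show e: "?\<Phi> (r `` {p}) = F p" if p: "p \<in> \<Omega>" for p
  proof -
    have "(SOME p'. p' \<in> r `` {p}) \<in> r `` {p}"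
      by (rule someI[of _ p]) (use equiv_class_self[OF r] p \<Omega>(2) in blast)
    then show ?thesis using inv p by blast
  qed
  show pre: "{p \<in> S. r `` {p} \<in> (\<lambda>p. r `` {p}) ` \<Omega>} = \<Omega>"
  proof
    show "{p \<in> S. r `` {p} \<in> (\<lambda>p. r `` {p}) ` \<Omega>} \<subseteq> \<Omega>"
    proof (clarify)
      fix p q assume "p \<in> S" "q \<in> \<Omega>" "r `` {p} = r `` {q}"
      then have "(q, p) \<in> r" using eq_equiv_class[OF _ r] by metis
      then show "p \<in> \<Omega>" using inv \<open>q \<in> \<Omega>\<close> by blast
    qed
  qed (use \<Omega>(2) in blast)
  show "(\<lambda>y. ?\<Phi> y ! i) \<in> reg ?Y ((\<lambda>p. r `` {p}) ` \<Omega>)" if "i < m" for i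
    unfolding reg_quotient_variety pt pre reg_affine_subvariety[OF \<Omega>(1)]
    by (rule ringed_restrict[OF ringed_affine_space _ F(2)[OF that]]) (use \<Omega>(1) e in \<open>simp_all add: openin_affine\<close>)
  show "openin (zar ?Y) ((\<lambda>p. r `` {p}) ` \<Omega>)"
    unfolding openin_quotient_variety pt pre using \<Omega> by (auto simp: openin_affine_subvariety[OF S] intro: quotientI)
qed

section \<open>The Chazy foliations\<close>

text \<open>With \<open>s = y / x^2\<close> and \<open>t = z / x^3\<close>, the equation field
  satisfies \<open>s' = x (t - 2 s^2)\<close> and \<open>t' = x (P 1 s t - 3 s t)\<close>; the
  common factor \<open>x\<close> is dropped.\<close>

definition chazy_field :: "(complex \<Rightarrow> complex \<Rightarrow> complex \<Rightarrow> complex) \<Rightarrow> complex list \<Rightarrow> complex list" where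
  "chazy_field P q = [q ! 1 - 2 * q ! 0 ^ 2, P 1 (q ! 0) (q ! 1) - 3 * q ! 0 * q ! 1]"

lemma weighted_rel_123: "(p, p') \<in> weighted_rel [1, 2, 3] \<longleftrightarrow>
   p \<in> punctured 3 \<and> (\<exists>c. c \<noteq> 0 \<and> p' = [c * p ! 0, c ^ 2 * p ! 1, c ^ 3 * p ! 2])"
  by (auto simp: weighted_rel_iff numeral_3_eq_3 punctured_def length_Suc_conv)

lemma P123_eq: "P123 = quotient_variety (punctured_space 3) (weighted_rel [1, 2, 3])"
  by (simp add: weighted_space_def eval_nat_numeral)

lemma reg_quotient_polyfun:
  assumes "affine_open n U" "f \<in> polyfun n" "g \<in> polyfun n" "\<And>p. p \<in> U \<Longrightarrow> g p \<noteq> 0"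
  shows "(\<lambda>p. f p / g p) \<in> reg (affine_space n) U"
proof -
  have "openin (zar (affine_space n)) U" using assms(1) by (simp add: openin_affine)
  from ringed_divide[OF ringed_affine_space this] show ?thesis
    using polyfun_reg[OF affine_open_length[OF assms(1)]] assms by blast
qed

text \<open>Since \<open>x\<close> has weight 1, every orbit with nonzero \<open>x\<close> meets the
  plane \<open>x = 1\<close> in exactly one point. The cover is therefore trivial:
  \<open>k = 1\<close>, \<open>R = 1\<close>, and the section is \<open>(1, s, t)\<close>. The
  inequality for the points of \<open>\<O>\<close> keeps the first component of the field
  nonzero.\<close>

lemma equation_plane_chart:
  assumes P: "(\<lambda>p. P (p ! 0) (p ! 1) (p ! 2)) \<in> polyfun 3" "\<And>c x y z. P (c * x) (c ^ 2 * y) (c ^ 3 * z) = c ^ 4 * P x y z"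
    and \<O>: "affine_open 2 \<O>" "\<O> \<noteq> {}" "\<And>q. q \<in> \<O> \<Longrightarrow> q ! 1 \<noteq> 2 * q ! 0 ^ 2"
    and D: "plane_field (chazy_field P)"
  obtains V \<phi> \<psi> where "plane_chart P123 (equation_foliation P) (chazy_field P) V \<O> \<phi> \<psi>"
proof -
  let ?X = "punctured_space 3" and ?r = "weighted_rel [1, 2, 3]"
  let ?B = "{p. length p = 3 \<and> p ! 0 \<noteq> (0::complex)}"
  define \<Phi> where "\<Phi> p = [p ! 1 / p ! 0 ^ 2, p ! 2 / p ! 0 ^ 3]" for p :: "complex list"
  let ?M = "{p \<in> ?B. \<Phi> p \<in> \<O>}"
  let ?W = "equation_field P"
  have pol: "(\<lambda>p. p ! 0) \<in> polyfun 3" "(\<lambda>p. p ! 1) \<in> polyfun 3" "(\<lambda>p. p ! 2) \<in> polyfun 3" by (simp_all add: polyfun.coord del: One_nat_def)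
  have B: "affine_open 3 ?B" by (rule affine_open_basic[OF pol(1)])
  have Bo: "openin (zar (affine_space 3)) ?B" using B by (simp add: openin_affine)
  have \<Phi>B: "(\<lambda>x. \<Phi> x ! i) \<in> reg (affine_space 3) ?B" if "i < 2" for i
  proof -
    have "i = 0 \<or> i = 1" using that by linarith
    then show ?thesis
      using reg_quotient_polyfun[OF B pol(2) polyfun_power[OF pol(1), of 2]]
        reg_quotient_polyfun[OF B pol(3) polyfun_power[OF pol(1), of 3]] by (auto simp: \<Phi>_def)
  qed
  have M: "affine_open 3 ?M"
    using open_preimage[OF ringed_affine_space Bo, of \<Phi> 2] \<Phi>B \<O>(1) by (simp add: openin_affine \<Phi>_def)
  have Mo: "openin (zar (affine_space 3)) ?M" using M by (simp add: openin_affine)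
  have Mp: "?M \<subseteq> punctured 3" by (auto simp: punctured_def)
  have pt: "points ?X = punctured 3" by simp
  have Xo: "openin (zar ?X) U \<longleftrightarrow> affine_open 3 U \<and> U \<subseteq> punctured 3" for U
    unfolding punctured_space_eq by (rule openin_affine_subvariety[OF affine_open_punctured])
  have W: "length (?W p) = 3" for p by (simp add: equation_field_def)
  have vW: "vector_field ?X (punctured 3) (\<lambda>f p. dir_deriv f p (?W p))"
    unfolding punctured_space_eq
  proof (rule vector_field_subvariety[OF ringed_affine_space])
    show "vector_field (affine_space 3) (punctured 3) (\<lambda>f p. dir_deriv f p (?W p))"
    proof (rule vector_field_affine[OF affine_open_punctured _ W])
      fix i :: nat assume "i < 3"
      then have "i = 0 \<or> i = 1 \<or> i = 2" by linarith
      then show "(\<lambda>p. ?W p ! i) \<in> polyfun 3" using pol P(1) by (auto simp: equation_field_def)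
    qed
  qed (use affine_open_punctured in \<open>simp_all add: openin_affine\<close>)
  show thesis
  proof (rule quotient_plane_chart[where X = ?X and r = ?r and M = ?M and \<Phi> = \<Phi> and \<O> = \<O> and n = 3 and \<Omega> = ?M
        and \<kappa> = "\<lambda>p. p" and \<sigma> = "\<lambda>p. [1, p ! 0, p ! 1]" and R = "\<lambda>p. 1" and k = 1 and D = "chazy_field P" and \<delta> = ?W
        and E = "trajectory_foliation ?X ?W"])
    show "ringed ?X" by (rule ringed_punctured_space)
    show "irreducible_variety ?X"
      by (rule irreducible_variety_image[of 3 "punctured 3" _ "\<lambda>p. p"])
        (simp_all add: punctured_space_eq[symmetric] affine_open_punctured,
          simp add: punctured_space_eq morphism_affine_subvarieties affine_open_punctured)
    show "equiv (points ?X) ?r" using equiv_weighted_rel[of "[1, 2, 3]"] by (simp add: eval_nat_numeral)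
    show "openin (zar ?X) ?M" using M Mp by (simp add: Xo)
    show "x' \<in> ?M \<and> \<Phi> x' = \<Phi> x" if x: "(x, x') \<in> ?r" "x \<in> ?M" for x x'
    proof -
      obtain c where c: "c \<noteq> 0" "x' = [c * x ! 0, c ^ 2 * x ! 1, c ^ 3 * x ! 2]" using x(1) unfolding weighted_rel_123 by blast
      then have "\<Phi> x' = \<Phi> x" by (simp add: \<Phi>_def power_mult_distrib)
      then show ?thesis using x(2) c by simp
    qed
    show "length (\<Phi> x) = 2" for x by (simp add: \<Phi>_def)
    show "(\<lambda>x. \<Phi> x ! i) \<in> reg ?X ?M" if "i < 2" for i
      unfolding punctured_space_eq reg_affine_subvariety[OF M]
      by (rule ringed_restrict[OF ringed_affine_space Bo \<Phi>B[OF that] Mo]) auto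
    show "morphism (subvariety (affine_space 3) ?M) ?X (\<lambda>p. p)"
      unfolding punctured_space_eq by (rule morphism_affine_subvarieties[OF affine_open_punctured Mp])
    show "affine_open 3 ?M" by (rule M)
    show "affine_open 2 \<O>" "\<O> \<noteq> {}" by fact+
    show "(\<lambda>p. [1, p ! 0, p ! 1] ! i) \<in> polyfun 3" if "i < 3" for i
    proof -
      have "i = 0 \<or> i = 1 \<or> i = 2" using that by linarith
      then show ?thesis using pol by (auto intro: polyfun.const)
    qed
    show "(\<lambda>p. 1) \<in> polyfun 2" by (rule polyfun.const)
    show "[1, [s, t, b] ! 0, [s, t, b] ! 1] \<in> ?M \<and> \<Phi> [1, [s, t, b] ! 0, [s, t, b] ! 1] = [s, t]" if "[s, t] \<in> \<O>" for s t b
      using that by (simp add: \<Phi>_def)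
    show "(x, [1, [s, t, b] ! 0, [s, t, b] ! 1]) \<in> ?r" if "x \<in> ?M" "\<Phi> x = [s, t]" for x s t b
      unfolding weighted_rel_123 using that Mp
      by (auto simp: \<Phi>_def power_one_over intro!: exI[of _ "1 / x ! 0"])
    show "plane_field (chazy_field P)" by fact
    show "chazy_field P q ! 0 \<noteq> 0" if "q \<in> \<O>" for q using \<O>(3)[OF that] by (simp add: chazy_field_def)
    show "length (?W p) = 3" for p by (rule W)
    show "\<exists>c. c \<noteq> 0 \<and> (\<forall>i<2. ((\<lambda>t. \<Phi> (map2 (\<lambda>a b. a + t * b) p (?W p)) ! i)
         has_field_derivative c * chazy_field P (\<Phi> p) ! i) (at 0))" if p: "p \<in> ?M" for p
    proof -
      obtain x y z where xyz: "p = [x, y, z]" and x: "x \<noteq> 0"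
        using p by (auto simp: numeral_3_eq_3 length_Suc_conv)
      \<comment> \<open>Homogeneity of degree 4 matches the powers of \<open>x\<close> that are
        needed: three for the denominator of \<open>t\<close> and one for the time factor
        \<open>c = x\<close>.\<close>
      have hom: "P x y z = x ^ 4 * P 1 (y / x ^ 2) (z / x ^ 3)"
        using P(2)[of x 1 "y / x ^ 2" "z / x ^ 3"] x by simp
      have 1: "((\<lambda>t. (y + t * z) / (x + t * y) ^ 2) has_field_derivative x * (z / x ^ 3 - 2 * (y / x ^ 2) ^ 2)) (at 0)"
        using x by (auto intro!: derivative_eq_intros simp: field_simps power2_eq_square power3_eq_cube)
      have 2: "((\<lambda>t. (z + t * P x y z) / (x + t * y) ^ 3) has_field_derivative
          x * (P 1 (y / x ^ 2) (z / x ^ 3) - 3 * (y / x ^ 2) * (z / x ^ 3))) (at 0)"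
        unfolding hom using x by (auto intro!: derivative_eq_intros simp: field_simps eval_nat_numeral)
      show ?thesis
      proof (intro exI[of _ x] conjI x allI impI)
        fix i :: nat assume "i < 2"
        then have "i = 0 \<or> i = 1" by linarith
        then show "((\<lambda>t. \<Phi> (map2 (\<lambda>a b. a + t * b) p (?W p)) ! i)
         has_field_derivative x * chazy_field P (\<Phi> p) ! i) (at 0)"
          using 1 2 by (auto simp: \<Phi>_def xyz equation_field_def chazy_field_def)
      qed
    qed
    show "w f p * dir_deriv (g \<circ> (\<lambda>p. p)) p (?W p) = w g p * dir_deriv (f \<circ> (\<lambda>p. p)) p (?W p)"
      if "w \<in> trajectory_foliation ?X ?W V" "p \<in> V" "openin (zar ?X) N" "p \<in> N" "f \<in> reg ?X N" "g \<in> reg ?X N"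
      for V w p N f g
      using that unfolding trajectory_foliation_def by (simp add: comp_def)
    show "\<exists>V w. openin (zar ?X) V \<and> p \<in> V \<and> w \<in> trajectory_foliation ?X ?W V \<and>
      (\<forall>N f. openin (zar ?X) N \<and> p \<in> N \<and> f \<in> reg ?X N \<longrightarrow> w f p = dir_deriv (f \<circ> (\<lambda>p. p)) p (?W p))"
      if p: "p \<in> ?M" for p
      using vW vector_field_open[OF vW] subsetD[OF Mp p]
      by (intro exI[of _ "punctured 3"] exI[of _ "\<lambda>f p. dir_deriv f p (?W p)"])
        (auto simp: trajectory_foliation_def comp_def)
    fix V \<phi> \<psi> assume "plane_chart (quotient_variety ?X ?r) (quotient_foliation ?X ?r (trajectory_foliation ?X ?W)) (chazy_field P) V \<O> \<phi> \<psi>"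
    then show thesis by (intro that) (simp only: equation_foliation_def P123_eq)
  qed auto
qed

text \<open>
  With \<open>x = - u\<^sub>1 / u\<close> and \<open>u, u\<^sub>1, u\<^sub>2, \<dots>\<close> the successive derivatives of \<open>u\<close>, the coordinates
  \<open>s = x' / x\<^sup>2\<close> and \<open>t = x'' / x\<^sup>3\<close> are \<open>1 - m\<close> and \<open>n + 2 - 3 m\<close> where \<open>m = u u\<^sub>2 / u\<^sub>1\<^sup>2\<close> and
  \<open>n = u\<^sup>2 u\<^sub>3 / u\<^sub>1\<^sup>3\<close>.
\<close>

definition chazy_coords :: "complex \<Rightarrow> complex \<Rightarrow> complex \<Rightarrow> complex \<Rightarrow> complex list" where
  "chazy_coords u u1 u2 u3 = [1 - u * u2 / u1 ^ 2, u ^ 2 * u3 / u1 ^ 3 + 2 - 3 * (u * u2 / u1 ^ 2)]"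

text \<open>The third-order equation for \<open>x\<close> is the relation \<open>u\<^sup>3 u\<^sub>4 / u\<^sub>1\<^sup>4 = K(m, n)\<close>.\<close>

lemma chazy_coords_derivative:
  assumes d: "(u has_field_derivative U1) (at 0)" "(u1 has_field_derivative U2) (at 0)"
    "(u2 has_field_derivative U3) (at 0)" "(u3 has_field_derivative U4) (at 0)"
    and z: "u 0 = U" "u1 0 = U1" "u2 0 = U2" "u3 0 = U3"
    and nz: "U \<noteq> 0" "U1 \<noteq> 0"
    and P: "\<And>m n. P 1 (1 - m) (n + 2 - 3 * m) - 3 * (1 - m) * (n + 2 - 3 * m) =
      3 * (n + m - 2 * m ^ 2) - (K m n + 2 * n - 3 * n * m)"
    and K: "U ^ 3 * U4 / U1 ^ 4 = K (U * U2 / U1 ^ 2) (U ^ 2 * U3 / U1 ^ 3)" and i: "i < 2"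
  shows "((\<lambda>t. chazy_coords (u t) (u1 t) (u2 t) (u3 t) ! i) has_field_derivative
      - U1 / U * chazy_field P (chazy_coords U U1 U2 U3) ! i) (at (0::complex))"
proof -
  define m n where "m = U * U2 / U1 ^ 2" and "n = U ^ 2 * U3 / U1 ^ 3"
  \<comment> \<open>The derivatives of \<open>m\<close> and \<open>n\<close> are
    \<open>U1 / U\<close> times polynomials in \<open>m\<close>, \<open>n\<close> and the
    fourth-order quantity \<open>K m n\<close>. As \<open>x = - u1 / u\<close>, this is the time
    factor of the equation field up to the sign.\<close>
  have m: "((\<lambda>t. u t * u2 t / u1 t ^ 2) has_field_derivative U1 / U * (n + m - 2 * m ^ 2)) (at 0)"
    unfolding m_def n_def
    by (rule DERIV_cong[OF DERIV_divide[OF DERIV_mult[OF d(1,3)] DERIV_power[OF d(2), of 2]]])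
      (use nz in \<open>simp_all add: z field_simps eval_nat_numeral\<close>)
  have n: "((\<lambda>t. u t ^ 2 * u3 t / u1 t ^ 3) has_field_derivative
      U1 / U * (U ^ 3 * U4 / U1 ^ 4 + 2 * n - 3 * n * m)) (at 0)"
    unfolding m_def n_def
    by (rule DERIV_cong[OF DERIV_divide[OF DERIV_mult[OF DERIV_power[OF d(1), of 2] d(4)] DERIV_power[OF d(2), of 3]]])
      (use nz in \<open>simp_all add: z field_simps eval_nat_numeral\<close>)
  have t: "((\<lambda>t. u t ^ 2 * u3 t / u1 t ^ 3 + 2 - 3 * (u t * u2 t / u1 t ^ 2)) has_field_derivative
      U1 / U * (K m n + 2 * n - 3 * n * m) - 3 * (U1 / U * (n + m - 2 * m ^ 2))) (at 0)"
    using DERIV_diff[OF DERIV_add[OF n DERIV_const[of 2]] DERIV_cmult[OF m, of 3]]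
    unfolding K m_def[symmetric] n_def[symmetric] by simp
  have t': "U1 / U * (K m n + 2 * n - 3 * n * m) - 3 * (U1 / U * (n + m - 2 * m ^ 2)) =
      - U1 / U * (3 * (n + m - 2 * m ^ 2) - (K m n + 2 * n - 3 * n * m))"
    by algebra
  have s: "((\<lambda>t. 1 - u t * u2 t / u1 t ^ 2) has_field_derivative - (U1 / U * (n + m - 2 * m ^ 2))) (at 0)"
    using DERIV_diff[OF DERIV_const[of 1] m] by simp
  have D: "chazy_field P [1 - m, n + 2 - 3 * m] =
      [n + m - 2 * m ^ 2, 3 * (n + m - 2 * m ^ 2) - (K m n + 2 * n - 3 * n * m)]"
    unfolding chazy_field_def using P[of m n] by (simp add: power2_eq_square algebra_simps)
  have e: "chazy_coords (U) (U1) (U2) (U3) = [1 - m, n + 2 - 3 * m]"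
    by (simp add: chazy_coords_def m_def n_def)
  have "i = 0 \<or> i = 1" using i by linarith
  then show ?thesis unfolding e D
  proof
    assume "i = 0"
    then show "((\<lambda>t. chazy_coords (u t) (u1 t) (u2 t) (u3 t) ! i) has_field_derivative - U1 / U *
      [n + m - 2 * m ^ 2, 3 * (n + m - 2 * m ^ 2) - (K m n + 2 * n - 3 * n * m)] ! i) (at 0)"
      using s by (simp add: chazy_coords_def)
  next
    assume "i = 1"
    then show "((\<lambda>t. chazy_coords (u t) (u1 t) (u2 t) (u3 t) ! i) has_field_derivative - U1 / U *
      [n + m - 2 * m ^ 2, 3 * (n + m - 2 * m ^ 2) - (K m n + 2 * n - 3 * n * m)] ! i) (at 0)"
      using t unfolding t' by (simp add: chazy_coords_def)
  qed
qed

text \<open>The map \<open>\<tau>\<close> is \<open>T\<close> in the coordinates of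
  \<open>\<Omega>\<close>; it multiplies the root \<open>B\<close> by \<open>\<zeta>\<close>, whose
  powers are all the \<open>k\<close>-th roots of unity. Any root \<open>b\<close> over
  \<open>F p\<close> is therefore the value of \<open>B\<close> at an iterate of \<open>p\<close>,
  and \<open>return\<close> identifies the section there with that iterate: the fibre is one
  orbit.\<close>

lemma cyclic_plane_chart:
  assumes X: "ringed X" "irreducible_variety X"
    and T: "\<And>x. x \<in> points X \<Longrightarrow> T x \<in> points X" "\<And>x. x \<in> points X \<Longrightarrow> (T ^^ k) x = x" and k: "k \<ge> 1"
    and M: "openin (zar X) M"
    and \<Phi>: "\<And>x. length (\<Phi> x) = 2" "\<And>i. i < 2 \<Longrightarrow> (\<lambda>x. \<Phi> x ! i) \<in> reg X M" "\<And>p. p \<in> \<Omega> \<Longrightarrow> \<Phi> (\<kappa> p) = F p"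
    and \<kappa>: "morphism (subvariety (affine_space n) \<Omega>) X \<kappa>" "\<And>p. p \<in> \<Omega> \<Longrightarrow> \<kappa> p \<in> M" "\<And>x. x \<in> M \<Longrightarrow> \<exists>p\<in>\<Omega>. \<kappa> p = x"
    and \<Omega>: "affine_open n \<Omega>" "\<And>p. p \<in> \<Omega> \<Longrightarrow> F p \<in> \<O>"
    and \<O>: "affine_open 2 \<O>" "\<O> \<noteq> {}"
    and \<sigma>: "\<And>i. i < n \<Longrightarrow> (\<lambda>p. \<sigma> p ! i) \<in> polyfun 3"
    and R: "R \<in> polyfun 2" "\<And>q. q \<in> \<O> \<Longrightarrow> R q \<noteq> 0"
    and \<tau>: "\<And>p. p \<in> \<Omega> \<Longrightarrow> \<tau> p \<in> \<Omega> \<and> T (\<kappa> p) = \<kappa> (\<tau> p) \<and> F (\<tau> p) = F p \<and> B (\<tau> p) = \<zeta> * B p"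
    and B: "\<And>p. p \<in> \<Omega> \<Longrightarrow> B p ^ k = R (F p)" and \<zeta>: "\<And>x. x ^ k = 1 \<Longrightarrow> \<exists>j. x = \<zeta> ^ j"
    and lift: "\<And>s t b. [s, t] \<in> \<O> \<Longrightarrow> b ^ k = R [s, t] \<Longrightarrow> \<sigma> [s, t, b] \<in> \<Omega> \<and> F (\<sigma> [s, t, b]) = [s, t]"
    and return: "\<And>p s t. p \<in> \<Omega> \<Longrightarrow> F p = [s, t] \<Longrightarrow> \<kappa> (\<sigma> [s, t, B p]) = \<kappa> p"
    and D: "plane_field D" "\<And>q. q \<in> \<O> \<Longrightarrow> D q ! 0 \<noteq> 0"
    and \<delta>: "\<And>p. p \<in> \<Omega> \<Longrightarrow> length (\<delta> p) = n"
      "\<And>p. p \<in> \<Omega> \<Longrightarrow> \<exists>c. c \<noteq> 0 \<and> (\<forall>i<2. ((\<lambda>t. F (map2 (\<lambda>a b. a + t * b) p (\<delta> p)) ! i)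
         has_field_derivative c * D (F p) ! i) (at 0))"
    and EA: "\<And>V w p N f g. w \<in> E V \<Longrightarrow> p \<in> \<Omega> \<Longrightarrow> \<kappa> p \<in> V \<Longrightarrow> openin (zar X) N \<Longrightarrow> \<kappa> p \<in> N \<Longrightarrow>
      f \<in> reg X N \<Longrightarrow> g \<in> reg X N \<Longrightarrow>
      w f (\<kappa> p) * dir_deriv (g \<circ> \<kappa>) p (\<delta> p) = w g (\<kappa> p) * dir_deriv (f \<circ> \<kappa>) p (\<delta> p)"
    and EB: "\<And>p. p \<in> \<Omega> \<Longrightarrow> \<exists>V w. openin (zar X) V \<and> \<kappa> p \<in> V \<and> w \<in> E V \<and>
      (\<forall>N f. openin (zar X) N \<and> \<kappa> p \<in> N \<and> f \<in> reg X N \<longrightarrow> w f (\<kappa> p) = dir_deriv (f \<circ> \<kappa>) p (\<delta> p))"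
  obtains V \<phi> \<psi> where
    "plane_chart (quotient_variety X (cyclic_rel X T)) (quotient_foliation X (cyclic_rel X T) E) D V \<O> \<phi> \<psi>"
proof (rule quotient_plane_chart[where X = X and r = "cyclic_rel X T" and M = M and \<Phi> = \<Phi> and \<O> = \<O> and n = n and \<Omega> = \<Omega>
        and \<kappa> = \<kappa> and \<sigma> = \<sigma> and R = R and k = k and D = D and \<delta> = \<delta> and E = E])
  have iter: "(\<tau> ^^ j) p \<in> \<Omega> \<and> (T ^^ j) (\<kappa> p) = \<kappa> ((\<tau> ^^ j) p) \<and> F ((\<tau> ^^ j) p) = F p \<and> B ((\<tau> ^^ j) p) = \<zeta> ^ j * B p"
    if "p \<in> \<Omega>" for p j
    by (induction j) (use that \<tau> in \<open>auto simp: mult.assoc\<close>)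
  show "equiv (points X) (cyclic_rel X T)" by (rule equiv_cyclic_rel[OF T(1) k T(2)])
  show "x' \<in> M \<and> \<Phi> x' = \<Phi> x" if x: "(x, x') \<in> cyclic_rel X T" "x \<in> M" for x x'
  proof -
    obtain p where p: "p \<in> \<Omega>" "\<kappa> p = x" using \<kappa>(3)[OF x(2)] by blast
    obtain j where "x' = (T ^^ j) x" using x(1) by (auto simp: cyclic_rel_iff)
    then have "x' = \<kappa> ((\<tau> ^^ j) p)" "(\<tau> ^^ j) p \<in> \<Omega>" "F ((\<tau> ^^ j) p) = F p" using iter[OF p(1), of j] p(2) by auto
    then show ?thesis using \<kappa>(2) \<Phi>(3) p by metis
  qed
  show "\<Phi> x \<in> \<O>" if "x \<in> M" for x using \<kappa>(3)[OF that] \<Phi>(3) \<Omega>(2) by metis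
  show "\<sigma> [s, t, b] \<in> \<Omega> \<and> \<Phi> (\<kappa> (\<sigma> [s, t, b])) = [s, t]" if "[s, t] \<in> \<O>" "b ^ k = R [s, t]" for s t b
    using lift[OF that] \<Phi>(3) by simp
  show "(x, \<kappa> (\<sigma> [s, t, b])) \<in> cyclic_rel X T" if x: "x \<in> M" "\<Phi> x = [s, t]" and b: "b ^ k = R [s, t]" for x s t b
  proof -
    obtain p where p: "p \<in> \<Omega>" "\<kappa> p = x" using \<kappa>(3)[OF x(1)] by blast
    have Fp: "F p = [s, t]" using \<Phi>(3)[OF p(1)] p(2) x(2) by simp
    have "B p \<noteq> 0"
      using B[OF p(1)] R(2)[OF \<Omega>(2)[OF p(1)]] k by (auto simp: zero_power)
    moreover from this have "(b / B p) ^ k = 1"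
      using b B[OF p(1)] Fp by (simp add: power_divide) (metis divide_self power_not_zero)
    ultimately obtain j where "b = \<zeta> ^ j * B p" using \<zeta>[of "b / B p"] by (auto simp: field_simps)
    then have "b = B ((\<tau> ^^ j) p)" "F ((\<tau> ^^ j) p) = [s, t]" "(\<tau> ^^ j) p \<in> \<Omega>" "(T ^^ j) x = \<kappa> ((\<tau> ^^ j) p)"
      using iter[OF p(1), of j] Fp p(2) by auto
    then have "\<kappa> (\<sigma> [s, t, b]) = (T ^^ j) x" using return by metis
    then show ?thesis using openin_subset[OF M] x(1) by (auto simp: cyclic_rel_iff)
  qed
  show "\<exists>c. c \<noteq> 0 \<and> (\<forall>i<2. ((\<lambda>t. \<Phi> (\<kappa> (map2 (\<lambda>a b. a + t * b) p (\<delta> p))) ! i)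
         has_field_derivative c * D (\<Phi> (\<kappa> p)) ! i) (at 0))" if p: "p \<in> \<Omega>" for p
  proof -
    have "\<forall>\<^sub>F t in nhds 0. \<Phi> (\<kappa> (map2 (\<lambda>a b. a + t * b) p (\<delta> p))) ! i = F (map2 (\<lambda>a b. a + t * b) p (\<delta> p)) ! i" for i
      using eventually_line[OF \<Omega>(1) p \<delta>(1)[OF p]] by eventually_elim (simp add: \<Phi>(3))
    from DERIV_cong_ev[OF refl this refl] show ?thesis using \<delta>(2)[OF p] \<Phi>(3)[OF p] by simp
  qed
  show "plane_chart (quotient_variety X (cyclic_rel X T)) (quotient_foliation X (cyclic_rel X T) E) D V \<O> \<phi> \<psi> \<Longrightarrow> thesis"
    for V \<phi> \<psi> by (rule that)
qed (assumption | rule assms)+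

section \<open>The projective plane and the quotient of order three\<close>

lemma punctured_3: "[x, y, z] \<in> punctured 3 \<longleftrightarrow> x \<noteq> 0 \<or> y \<noteq> 0 \<or> z \<noteq> 0"
  by (auto simp: punctured_def eval_nat_numeral)

lemma sum_lessThan_3: "(\<Sum>i<3::nat. f i) = f 0 + f 1 + (f 2 :: complex)"
  by (simp add: eval_nat_numeral)

declare One_nat_def [simp del]

lemma nth_Cons_1 [simp]: "(x # xs) ! 1 = xs ! 0"
  by (simp add: One_nat_def)

abbreviation class3 :: "complex list \<Rightarrow> complex list set" where
  "class3 p \<equiv> weighted_rel [1, 1, 1] `` {p}"

lemma length_3: "length p = 3 \<longleftrightarrow> (\<exists>x y z. p = [x, y, z])"
  by (auto simp: numeral_3_eq_3 length_Suc_conv)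

lemma length_111: "length [1, 1, 1 :: nat] = 3" by simp

lemma weighted_rel_111: "(p, p') \<in> weighted_rel [1, 1, 1] \<longleftrightarrow>
   p \<in> punctured 3 \<and> (\<exists>c. c \<noteq> 0 \<and> p' = [c * p ! 0, c * p ! 1, c * p ! 2])"
proof -
  have "map2 (\<lambda>w x. c ^ w * x) [1, 1, 1] p = [c * p ! 0, c * p ! 1, c * p ! 2]" if "p \<in> punctured 3" for c
    using that by (auto simp: punctured_def length_3)
  then show ?thesis unfolding weighted_rel_iff length_111 by metis
qed

lemma equiv_111: "equiv (punctured 3) (weighted_rel [1, 1, 1])"
  using equiv_weighted_rel[of "[1, 1, 1]"] unfolding length_111 .

lemma P2_eq: "P2 = quotient_variety (subvariety (affine_space 3) (punctured 3)) (weighted_rel [1, 1, 1])"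
  unfolding weighted_space_def length_111 punctured_space_eq ..

lemma points_P2: "points P2 = punctured 3 // weighted_rel [1, 1, 1]"
  unfolding P2_eq by (simp add: points_quotient_variety points_affine_subvariety affine_open_punctured)

lemma ringed_P2: "ringed P2" by (rule ringed_weighted_space)

lemma irreducible_punctured: "irreducible_variety (subvariety (affine_space n) (punctured n))"
  by (rule irreducible_variety_image[of n "punctured n" _ "\<lambda>p. p"])
    (simp_all add: morphism_affine_subvarieties affine_open_punctured points_affine_subvariety)

lemma irreducible_P2: "irreducible_variety P2"
  unfolding P2_eq by (rule irreducible_variety_quotient[OF irreducible_punctured])

lemma morphism_class3: "\<Omega> \<subseteq> punctured 3 \<Longrightarrow> morphism (subvariety (affine_space 3) \<Omega>) P2 class3"
  unfolding P2_eq
  using morphism_compose[OF morphism_affine_subvarieties[OF affine_open_punctured] morphism_quotient]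
  by (simp add: comp_def)

lemma class3_eq: "c \<noteq> 0 \<Longrightarrow> p \<in> punctured 3 \<Longrightarrow> class3 [c * p ! 0, c * p ! 1, c * p ! 2] = class3 p"
  using equiv_class_eq[OF equiv_111, of p "[c * p ! 0, c * p ! 1, c * p ! 2]"] by (auto simp: weighted_rel_111)

text \<open>The weights 1, \<open>\<omega>^2\<close>, \<open>\<omega>\<close> are in the kernel of
  the form of \<open>E3\<close>, as
  \<open>\<omega>^2 + \<omega> * \<omega>^2 + \<omega> = 0\<close>. Being the three cube roots of
  unity, they make the third derivative of a linear form along the field equal to the form
  itself.\<close>

definition field3 :: "complex \<Rightarrow> complex list \<Rightarrow> complex list" where
  "field3 \<omega> p = [p ! 0, \<omega>\<^sup>2 * p ! 1, \<omega> * p ! 2]"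

lemma length_field3 [simp]: "length (field3 \<omega> p) = 3" by (simp add: field3_def)

lemma polyfun_field3: "i < 3 \<Longrightarrow> (\<lambda>p. field3 \<omega> p ! i) \<in> polyfun 3"
proof -
  assume "i < 3"
  then have "i = 0 \<or> i = 1 \<or> i = 2" by linarith
  then show ?thesis by (auto simp: field3_def intro!: polyfun_intros)
qed

lemma lines_field3:
  assumes "(p, p') \<in> weighted_rel [1, 1, 1]" "map2 (\<lambda>a b. a + t * b) p (field3 \<omega> p) \<in> punctured 3"
  shows "(map2 (\<lambda>a b. a + t * b) p (field3 \<omega> p), map2 (\<lambda>a b. a + t * b) p' (field3 \<omega> p')) \<in> weighted_rel [1, 1, 1]"
proof -
  obtain c x y z where c: "c \<noteq> 0" "p = [x, y, z]" "p' = [c * x, c * y, c * z]"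
    using assms(1) by (auto simp: weighted_rel_111 punctured_def length_3)
  then show ?thesis using assms(2) unfolding weighted_rel_111
    by (auto simp: field3_def algebra_simps intro!: exI[of _ c])
qed

lemma reg_class3:
  assumes "openin (zar P2) N" "f \<in> reg P2 N" "p \<in> punctured 3" "class3 p \<in> N"
  obtains U where "affine_open 3 U" "p \<in> U" "f \<circ> class3 \<in> reg (affine_space 3) U"
proof -
  let ?U = "{p \<in> punctured 3. class3 p \<in> N}"
  note m = morphism_class3[OF order_refl]
  have pt: "points (subvariety (affine_space 3) (punctured 3)) = punctured 3"
    by (simp add: points_affine_subvariety affine_open_punctured)
  have U: "affine_open 3 ?U"
    using morphism_open[OF m assms(1)] unfolding pt openin_affine_subvariety[OF affine_open_punctured] by blast
  show thesis
    by (rule that[OF U]) (use assms morphism_reg[OF m assms(1,2)] in \<open>simp_all add: pt reg_affine_subvariety[OF U]\<close>)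
qed

text \<open>The class does not change along the ray through \<open>p\<close>: the Euler field maps
  to zero in the projective plane.\<close>

lemma radial_derivative:
  assumes "p \<in> punctured 3"
  shows "dir_deriv (f \<circ> class3) p p = 0"
proof (rule dir_deriv_eqI)
  have len: "length p = 3" using assms by (simp add: punctured_def)
  have "\<forall>\<^sub>F t in nhds 0. (f \<circ> class3) (map2 (\<lambda>a b. a + t * b) p p) = (f \<circ> class3) p"
  proof -
    have "\<forall>\<^sub>F t::complex in nhds 0. 1 + t \<noteq> 0"
      by (rule tendsto_imp_eventually_ne[of _ "1 + 0", OF tendsto_add[OF tendsto_const filterlim_ident]]) simp
    then show ?thesis
    proof eventually_elim
      case (elim t)
      have "map2 (\<lambda>a b. a + t * b) p p = [(1 + t) * p ! 0, (1 + t) * p ! 1, (1 + t) * p ! 2]"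
        using len by (auto simp: length_3 algebra_simps)
      then show ?case using class3_eq[OF elim assms] by simp
    qed
  qed
  from DERIV_cong_ev[OF refl this refl] show "((\<lambda>t. (f \<circ> class3) (map2 (\<lambda>a b. a + t * b) p p)) has_field_derivative 0) (at 0)"
    by simp
qed

text \<open>Off the coordinate lines, the kernel of the form at \<open>p\<close> is spanned by
  \<open>p\<close> itself and \<open>field3\<close>. The radial part acts as zero, so the value of
  \<open>w\<close> is a multiple of the image of \<open>field3\<close>.\<close>

lemma E3_parallel:
  assumes \<omega>: "\<omega>\<^sup>2 + \<omega> + 1 = 0"
    and w: "w \<in> E3 \<omega> V" and p: "p \<in> punctured 3" "p ! 0 * p ! 1 * p ! 2 \<noteq> 0" "class3 p \<in> V"
    and N: "openin (zar P2) N" "class3 p \<in> N" "f \<in> reg P2 N" "g \<in> reg P2 N"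
  shows "w f (class3 p) * dir_deriv (g \<circ> class3) p (field3 \<omega> p) = w g (class3 p) * dir_deriv (f \<circ> class3) p (field3 \<omega> p)"
proof -
  have len: "length p = 3" using p(1) by (simp add: punctured_def)
  obtain v where v: "length v = length p"
    "(\<Sum>i<length p. [\<omega>\<^sup>2 * p ! 1 * p ! 2, \<omega> * p ! 0 * p ! 2, p ! 0 * p ! 1] ! i * v ! i) = 0"
    "\<And>N f. openin (zar P2) N \<Longrightarrow> class3 p \<in> N \<Longrightarrow> f \<in> reg P2 N \<Longrightarrow> w f (class3 p) = dir_deriv (f \<circ> class3) p v"
    using w p(1,3) unfolding E3_def form_foliation_def by (auto simp: punctured_def)
  obtain x y z where xyz: "p = [x, y, z]" "x \<noteq> 0" "y \<noteq> 0" "z \<noteq> 0" using len p(2) by (auto simp: length_3)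
  obtain v0 v1 v2 where vv: "v = [v0, v1, v2]" using v(1) len by (auto simp: length_3)
  have eq: "\<omega>\<^sup>2 * y * z * v0 + \<omega> * x * z * v1 + x * y * v2 = 0"
    using v(2) len by (simp add: xyz vv sum_lessThan_3)
  have w3: "\<omega> ^ 3 = 1" using \<omega> by algebra
  have w1: "1 - \<omega>\<^sup>2 \<noteq> 0"
  proof
    assume "1 - \<omega>\<^sup>2 = 0"
    then have "(3::complex) = 0" using \<omega> by algebra
    then show False by simp
  qed
  \<comment> \<open>The coefficients \<open>a\<close> and \<open>c\<close> solve the first two
    components of \<open>v = a p + c field3\<close>, which is possible as
    \<open>1 - \<omega>^2\<close> is nonzero; the third component then follows from the
    form.\<close>
  define c where "c = (v0 / x - v1 / y) / (1 - \<omega>\<^sup>2)"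
  define a where "a = v0 / x - c"
  have c': "c * (1 - \<omega>\<^sup>2) = v0 / x - v1 / y" using w1 by (simp add: c_def)
  have 0: "v0 = a * x + c * x" using xyz by (simp add: a_def field_simps)
  have 1: "v1 = a * y + c * (\<omega>\<^sup>2 * y)"
  proof -
    have "v1 / y = a + c * \<omega>\<^sup>2" using c' unfolding a_def by (simp add: algebra_simps)
    then show ?thesis using xyz by (simp add: field_simps)
  qed
  have "x * y * (v2 - (a * z + c * (\<omega> * z))) = 0" using eq \<omega> unfolding 0 1 by algebra
  then have 2: "v2 = a * z + c * (\<omega> * z)" using xyz by simp
  have dec: "dir_deriv (h \<circ> class3) p v = c * dir_deriv (h \<circ> class3) p (field3 \<omega> p)" if h: "h \<in> reg P2 N" for h
  proof -
    obtain U where U: "affine_open 3 U" "p \<in> U" "h \<circ> class3 \<in> reg (affine_space 3) U"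
      using reg_class3[OF N(1) h p(1) N(2)] by blast
    obtain L where L: "gradient_at 3 (h \<circ> class3) p L" using reg_gradient[OF U(3,1,2)] by blast
    have "dir_deriv (h \<circ> class3) p v = a * dir_deriv (h \<circ> class3) p p + c * dir_deriv (h \<circ> class3) p (field3 \<omega> p)"
      using gradient_at_line(2)[OF L len] v(1) len
      by (simp add: xyz vv 0 1 2 field3_def sum_lessThan_3 algebra_simps)
    then show ?thesis using radial_derivative[OF p(1)] by simp
  qed
  show ?thesis using v(3)[OF N(1,2)] N(3,4) dec by simp
qed

text \<open>The field lies in the kernel of the form at every point, also on the coordinate lines,
  so its image is a section over the whole plane.\<close>

lemma E3_field:
  assumes \<omega>: "\<omega>\<^sup>2 + \<omega> + 1 = 0"
  shows "descended_field (weighted_rel [1, 1, 1]) (field3 \<omega>) \<in> E3 \<omega> (points P2)"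
  unfolding E3_def form_foliation_def
proof (intro CollectI conjI ballI impI allI)
  show "vector_field P2 (points P2) (descended_field (weighted_rel [1, 1, 1]) (field3 \<omega>))"
    by (rule vector_field_descended[OF affine_open_punctured equiv_111 polyfun_field3 length_field3 lines_field3, folded P2_eq points_P2])
  fix p assume p: "p \<in> points (punctured_space 3)"
  then have len: "length p = 3" by (simp add: punctured_def)
  have z: "(\<Sum>i<3. [\<omega>\<^sup>2 * p ! 1 * p ! 2, \<omega> * p ! 0 * p ! 2, p ! 0 * p ! 1] ! i * field3 \<omega> p ! i) =
      (\<omega>\<^sup>2 + \<omega> * \<omega>\<^sup>2 + \<omega>) * (p ! 0 * p ! 1 * p ! 2)"
    by (simp add: field3_def sum_lessThan_3 algebra_simps)
  have w: "\<omega>\<^sup>2 + \<omega> * \<omega>\<^sup>2 + \<omega> = 0" using \<omega> by algebra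
  show "\<exists>w. length w = length p \<and>
      (\<Sum>i<length p. [\<omega>\<^sup>2 * p ! 1 * p ! 2, \<omega> * p ! 0 * p ! 2, p ! 0 * p ! 1] ! i * w ! i) = 0 \<and>
      (\<forall>N f. openin (zar P2) N \<and> class3 p \<in> N \<and> f \<in> reg P2 N \<longrightarrow>
        descended_field (weighted_rel [1, 1, 1]) (field3 \<omega>) f (class3 p) = dir_deriv (f \<circ> class3) p w)"
    using p by (intro exI[of _ "field3 \<omega> p"]) (simp add: z w len descended_field_eq[OF affine_open_punctured equiv_111 polyfun_field3 length_field3 lines_field3] comp_def)
qed

lemma E3_field_eq:
  "p \<in> punctured 3 \<Longrightarrow> descended_field (weighted_rel [1, 1, 1]) (field3 \<omega>) f (class3 p) = dir_deriv (f \<circ> class3) p (field3 \<omega> p)"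
  by (simp add: descended_field_eq[OF affine_open_punctured equiv_111 polyfun_field3 length_field3 lines_field3] comp_def)

lemma T3_class3:
  assumes p: "p \<in> punctured 3"
  shows "T3 (class3 p) = class3 [p ! 2, p ! 0, p ! 1]"
proof -
  obtain x y z where xyz: "p = [x, y, z]" using p by (auto simp: punctured_def length_3)
  have p': "[z, x, y] \<in> punctured 3" using p by (auto simp: punctured_3 xyz)
  have e: "class3 q = (\<lambda>c. [c * q ! 0, c * q ! 1, c * q ! 2]) ` (- {0})" if "q \<in> punctured 3" for q
    using that by (auto simp: weighted_rel_111)
  show ?thesis unfolding T3_def xyz e[OF p[unfolded xyz]] image_image using e[OF p'] by simp
qed

text \<open>Both \<open>m\<close> and \<open>n\<close> are homogeneous of degree 0, and of weight 0
  when derivatives are counted, so neither a common factor \<open>c\<close> nor a rescaling of time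
  by \<open>z\<close> changes them. The first covers changes of homogeneous coordinates, the second
  the eigenvalues of \<open>T\<close>.\<close>

lemma chazy_coords_scale:
  "c \<noteq> 0 \<Longrightarrow> z \<noteq> 0 \<Longrightarrow> chazy_coords (c * u) (c * (z * u1)) (c * (z ^ 2 * u2)) (c * (z ^ 3 * u3)) = chazy_coords u u1 u2 u3"
  by (simp add: chazy_coords_def power_mult_distrib power2_eq_square power3_eq_cube mult.assoc)

lemma length_chazy_coords [simp]: "length (chazy_coords u u1 u2 u3) = 2"
  by (simp add: chazy_coords_def)

lemma reg_chazy_coords:
  assumes B: "affine_open n B" "\<And>p. p \<in> B \<Longrightarrow> u1 p \<noteq> 0"
    and u: "u \<in> polyfun n" "u1 \<in> polyfun n" "u2 \<in> polyfun n" "u3 \<in> polyfun n" and i: "i < 2"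
  shows "(\<lambda>p. chazy_coords (u p) (u1 p) (u2 p) (u3 p) ! i) \<in> reg (affine_space n) B"
proof -
  have Bo: "openin (zar (affine_space n)) B" using B by (simp add: openin_affine)
  have 0: "(\<lambda>p. (u1 p ^ 2 - u p * u2 p) / u1 p ^ 2) \<in> reg (affine_space n) B"
    by (rule reg_quotient_polyfun[OF B(1)]) (use u B(2) in \<open>auto intro!: polyfun_diff polyfun.mult polyfun_power\<close>)
  have 1: "(\<lambda>p. (u p ^ 2 * u3 p + 2 * u1 p ^ 3 - 3 * (u p * u2 p * u1 p)) / u1 p ^ 3) \<in> reg (affine_space n) B"
    by (rule reg_quotient_polyfun[OF B(1)])
      (use u B(2) in \<open>auto intro!: polyfun_diff polyfun.add polyfun.mult polyfun.const polyfun_power\<close>)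
  have "i = 0 \<or> i = 1" using i by linarith
  then show ?thesis
  proof
    assume "i = 0"
    then show ?thesis
      by (intro ringed_restrict[OF ringed_affine_space Bo 0 Bo order_refl]) (use B(2) in \<open>simp add: chazy_coords_def field_simps\<close>)
  next
    assume "i = 1"
    then show ?thesis
      by (intro ringed_restrict[OF ringed_affine_space Bo 1 Bo order_refl])
        (use B(2) in \<open>simp add: chazy_coords_def field_simps power2_eq_square power3_eq_cube\<close>)
  qed
qed

section \<open>The three Chazy fields in the plane\<close>

lemma plane_field_chazy:
  assumes "(\<lambda>q. P 1 (q ! 0) (q ! 1)) \<in> polyfun 2"
  shows "plane_field (chazy_field P)"
  unfolding plane_field_def
proof (intro conjI allI impI)
  fix i :: nat assume "i < 2"
  then have "i = 0 \<or> i = 1" by linarith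
  then show "(\<lambda>q. chazy_field P q ! i) \<in> polyfun 2"
    using assms by (auto simp: chazy_field_def intro!: polyfun_intros)
qed (simp add: chazy_field_def)

lemma coord_polyfun_2: "(\<lambda>q. q ! 0) \<in> polyfun 2" "(\<lambda>q. q ! 1) \<in> polyfun 2"
  by (simp_all add: polyfun.coord)

lemma coord_polyfun_3: "(\<lambda>q. q ! 0) \<in> polyfun 3" "(\<lambda>q. q ! 1) \<in> polyfun 3" "(\<lambda>q. q ! 2) \<in> polyfun 3"
  by (simp_all add: polyfun.coord)

lemmas coord_polyfun = coord_polyfun_2 coord_polyfun_3

lemma plane_field_IV: "plane_field (chazy_field chazy_IV)"
  and plane_field_V: "plane_field (chazy_field chazy_V)"
  and plane_field_VI: "plane_field (chazy_field chazy_VI)"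
  by (rule plane_field_chazy, simp add: chazy_IV_def chazy_V_def chazy_VI_def,
      intro polyfun.add polyfun.mult polyfun_diff polyfun_power polyfun.const coord_polyfun)+

text \<open>The three right-hand sides differ only in \<open>K\<close>, which is \<open>n\<close>,
  \<open>2 n - m^2\<close> and \<open>3 n - 2 m^2\<close>: the relation
  \<open>u u4 = j u1 u3 - (j - 1) u2^2\<close> for \<open>j = 1, 2, 3\<close>.\<close>

lemma chazy_IV_relation:
    "chazy_IV 1 (1 - m) (n + 2 - 3 * m) - 3 * (1 - m) * (n + 2 - 3 * m) =
      3 * (n + m - 2 * m ^ 2) - (n + 2 * n - 3 * n * m)"
  and chazy_V_relation:
    "chazy_V 1 (1 - m) (n + 2 - 3 * m) - 3 * (1 - m) * (n + 2 - 3 * m) =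
      3 * (n + m - 2 * m ^ 2) - (2 * n - m ^ 2 + 2 * n - 3 * n * m)"
  and chazy_VI_relation:
    "chazy_VI 1 (1 - m) (n + 2 - 3 * m) - 3 * (1 - m) * (n + 2 - 3 * m) =
      3 * (n + m - 2 * m ^ 2) - (3 * n - 2 * m ^ 2 + 2 * n - 3 * n * m)"
  by (simp_all add: chazy_IV_def chazy_V_def chazy_VI_def algebra_simps power2_eq_square)


text \<open>The first factor is the first component of the Chazy field, \<open>R \<noteq> 0\<close>
  gives distinct roots, and \<open>H \<noteq> 0\<close> keeps the section inside the torus.\<close>

definition region :: "(complex list \<Rightarrow> complex) \<Rightarrow> (complex list \<Rightarrow> complex) \<Rightarrow> complex list set" where
  "region R H = {q. length q = 2 \<and> (q ! 1 - 2 * q ! 0 ^ 2) * R q * H q \<noteq> 0}"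

lemma affine_open_region:
  "R \<in> polyfun 2 \<Longrightarrow> H \<in> polyfun 2 \<Longrightarrow> affine_open 2 (region R H)"
  unfolding region_def
  by (rule affine_open_basic) (intro polyfun.mult polyfun_diff polyfun_power polyfun.const coord_polyfun)

section \<open>Cover and section for equation IV\<close>

definition R_IV :: "complex list \<Rightarrow> complex" where
  "R_IV q = q ! 1 + 1 - 3 * q ! 0"

text \<open>\<open>R_IV\<close> is \<open>n\<close>, which equals \<open>b^3\<close> because the
  third derivative of \<open>u\<close> is \<open>u\<close>. With \<open>b^3\<close> replaced in this
  way, \<open>H_IV\<close> is the product of the three coordinates of
  \<open>section_IV\<close>.\<close>

definition H_IV :: "complex list \<Rightarrow> complex" where
  "H_IV q = R_IV q ^ 2 + R_IV q + (1 - q ! 0) ^ 3 - 3 * R_IV q * (1 - q ! 0)"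

lemma polyfun_IV: "R_IV \<in> polyfun 2" "H_IV \<in> polyfun 2"
proof -
  show R: "R_IV \<in> polyfun 2"
    unfolding R_IV_def[abs_def] by (intro polyfun.add polyfun.mult polyfun_diff polyfun_power polyfun.const coord_polyfun)
  show "H_IV \<in> polyfun 2"
    unfolding H_IV_def[abs_def] by (intro polyfun.add polyfun.mult polyfun_diff polyfun_power polyfun.const coord_polyfun R)
qed

text \<open>From \<open>b = u / v\<close> and \<open>m = u w / v^2\<close> one gets
  \<open>u : v : w = b^2 : b : m\<close>. The entries are the inverse Fourier transform of this
  triple, which returns the homogeneous coordinates up to a common factor.\<close>

definition section_IV :: "complex \<Rightarrow> complex list \<Rightarrow> complex list" where
  "section_IV \<omega> p = (let m = 1 - p ! 0; b = p ! 2 in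
     [b\<^sup>2 + b + m, b\<^sup>2 + \<omega> * b + \<omega>\<^sup>2 * m, b\<^sup>2 + \<omega>\<^sup>2 * b + \<omega> * m])"

lemma X3_plane_chart:
  assumes \<omega>: "\<omega>\<^sup>2 + \<omega> + 1 = 0"
  obtains V \<phi> \<psi> where
    "plane_chart X3 (quotient_foliation P2 (cyclic_rel P2 T3) (E3 \<omega>)) (chazy_field chazy_IV) V (region R_IV H_IV) \<phi> \<psi>"
proof -
  have w3: "\<omega> ^ 3 = 1" using \<omega> by algebra
  have w0: "\<omega> \<noteq> 0" using w3 by auto
  let ?u = "\<lambda>p. p ! 0 + p ! 1 + p ! (2::nat)" and ?v = "\<lambda>p. p ! 0 + \<omega>\<^sup>2 * p ! 1 + \<omega> * p ! (2::nat)"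
    and ?w = "\<lambda>p. p ! 0 + \<omega> * p ! 1 + \<omega>\<^sup>2 * p ! (2::nat)"
  let ?O = "region R_IV H_IV" and ?r = "weighted_rel [1, 1, 1]"
  \<comment> \<open>The last argument repeats \<open>?u\<close>: the field takes \<open>?u\<close>
    to \<open>?v\<close>, \<open>?v\<close> to \<open>?w\<close> and \<open>?w\<close> back to
    \<open>?u\<close>.\<close>
  define F where "F p = chazy_coords (?u p) (?v p) (?w p) (?u p)" for p
  have pol: "?u \<in> polyfun 3" "?v \<in> polyfun 3" "?w \<in> polyfun 3"
    by (intro polyfun.add polyfun.mult polyfun.const coord_polyfun)+
  let ?e = "\<lambda>p. p ! 0 * p ! 1 * p ! 2 * ?u p * ?v p"
  define U where "U = {p. length p = 3 \<and> ?e p \<noteq> 0}"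
  have U: "affine_open 3 U" unfolding U_def
    by (rule affine_open_basic) (intro polyfun.mult pol coord_polyfun)
  have Uo: "openin (zar (affine_space 3)) U" using U by (simp add: openin_affine)
  have O: "affine_open 2 ?O" by (rule affine_open_region[OF polyfun_IV])
  have FU: "(\<lambda>p. F p ! i) \<in> reg (affine_space 3) U" if "i < 2" for i
    unfolding F_def by (rule reg_chazy_coords[OF U _ pol(1,2,3,1) that]) (simp add: U_def)
  define \<Omega> where "\<Omega> = {p \<in> U. F p \<in> ?O}"
  have \<Omega>: "affine_open 3 \<Omega>"
    using open_preimage[OF ringed_affine_space Uo, of F 2] FU O by (simp add: openin_affine \<Omega>_def F_def)
  have \<Omega>o: "openin (zar (affine_space 3)) \<Omega>" using \<Omega> by (simp add: openin_affine)
  have F\<Omega>: "(\<lambda>p. F p ! i) \<in> reg (affine_space 3) \<Omega>" if "i < 2" for i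
    by (rule ringed_restrict[OF ringed_affine_space Uo FU[OF that] \<Omega>o]) (auto simp: \<Omega>_def)
  have \<Omega>S: "\<Omega> \<subseteq> punctured 3" by (auto simp: \<Omega>_def U_def length_3 punctured_3)
  have inv: "p' \<in> \<Omega> \<and> F p' = F p" if r: "(p, p') \<in> ?r" and p: "p \<in> \<Omega>" for p p'
  proof -
    obtain c where c: "c \<noteq> 0" "p' = [c * p ! 0, c * p ! 1, c * p ! 2]" using r unfolding weighted_rel_111 by blast
    have e: "?u p' = c * ?u p" "?v p' = c * ?v p" "?w p' = c * ?w p" by (simp_all add: c(2) algebra_simps)
    have "F p' = F p" unfolding F_def e using chazy_coords_scale[of c 1] c(1) by simp
    moreover have "p' \<in> U" using p c(1) e unfolding \<Omega>_def U_def by (simp add: c(2))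
    ultimately show ?thesis using p by (simp add: \<Omega>_def)
  qed
  obtain \<Phi> where \<Phi>: "\<And>y. length (\<Phi> y) = 2" "\<And>p. p \<in> \<Omega> \<Longrightarrow> \<Phi> (class3 p) = F p"
    "\<And>i. i < 2 \<Longrightarrow> (\<lambda>y. \<Phi> y ! i) \<in> reg P2 (class3 ` \<Omega>)" "openin (zar P2) (class3 ` \<Omega>)"
    by (rule orbit_functions[OF affine_open_punctured equiv_111 \<Omega> \<Omega>S inv _ F\<Omega>, folded P2_eq]) (auto simp: F_def)
  have lift: "section_IV \<omega> [s, t, b] \<in> \<Omega> \<and> F (section_IV \<omega> [s, t, b]) = [s, t]"
    if st: "[s, t] \<in> ?O" and b: "b ^ 3 = R_IV [s, t]" for s t b
  proof -
    have nz: "R_IV [s, t] \<noteq> 0" "H_IV [s, t] \<noteq> 0" using st by (auto simp: region_def)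
    have b0: "b \<noteq> 0" using nz(1) b by auto
    let ?s = "section_IV \<omega> [s, t, b]"
    have s: "?s = [b\<^sup>2 + b + (1 - s), b\<^sup>2 + \<omega> * b + \<omega>\<^sup>2 * (1 - s), b\<^sup>2 + \<omega>\<^sup>2 * b + \<omega> * (1 - s)]"
      by (simp add: section_IV_def Let_def)
    have u: "?u ?s = 3 * b\<^sup>2" "?v ?s = 3 * b" "?w ?s = 3 * (1 - s)" unfolding s using \<omega> by simp_all algebra+
    \<comment> \<open>The three linear factors of \<open>A^3 + B^3 + C^3 - 3 A B C\<close>, with
      \<open>A = b^2\<close>, \<open>B = b\<close> and \<open>C = 1 - s\<close>.\<close>
    have "?s ! 0 * ?s ! 1 * ?s ! 2 = (b ^ 3) ^ 2 + b ^ 3 + (1 - s) ^ 3 - 3 * b ^ 3 * (1 - s)"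
      unfolding s using \<omega> by simp algebra
    also have "\<dots> = H_IV [s, t]" unfolding b by (simp add: H_IV_def)
    finally have "?s \<in> U" using nz(2) b0 unfolding U_def by (auto simp: u) (simp add: s)
    moreover have "F ?s = [s, t]"
    proof -
      have "F ?s = [1 - (1 - s), b ^ 3 + 2 - 3 * (1 - s)]"
        unfolding F_def u chazy_coords_def using b0 by (simp add: field_simps power2_eq_square power3_eq_cube power4_eq_xxxx)
      then show ?thesis unfolding b by (simp add: R_IV_def)
    qed
    ultimately show ?thesis using st by (simp add: \<Omega>_def)
  qed
  have inF: "R_IV (F p) = (?u p / ?v p) ^ 3" if "p \<in> \<Omega>" for p
    using that unfolding R_IV_def F_def chazy_coords_def by (simp add: \<Omega>_def U_def power_divide power2_eq_square power3_eq_cube power4_eq_xxxx)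
  let ?T = "\<lambda>p. [p ! 2, p ! 0, p ! 1]"
  have T3p: "T3 y \<in> points P2" "(T3 ^^ 3) y = y" if y: "y \<in> points P2" for y
  proof -
    obtain p where p: "p \<in> punctured 3" "y = class3 p" using y by (auto simp: points_P2 elim!: quotientE)
    obtain x0 x1 x2 where "p = [x0, x1, x2]" using p(1) by (auto simp: punctured_def length_3)
    with p(1) have T: "?T p \<in> punctured 3" "?T (?T p) \<in> punctured 3" "?T (?T (?T p)) = p"
      by (auto simp: punctured_3)
    show "T3 y \<in> points P2" unfolding p(2) T3_class3[OF p(1)] points_P2 by (rule quotientI[OF T(1)])
    show "(T3 ^^ 3) y = y"
      by (simp only: numeral_3_eq_3 funpow.simps comp_apply id_apply p(2) T3_class3[OF p(1)] T3_class3[OF T(1)] T3_class3[OF T(2)] T(3))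
  qed
  show thesis
  proof (rule cyclic_plane_chart[where X = P2 and T = T3 and k = 3 and M = "class3 ` \<Omega>" and \<Phi> = \<Phi> and \<Omega> = \<Omega> and n = 3
        and \<kappa> = class3 and F = F and \<O> = ?O and \<sigma> = "section_IV \<omega>" and R = R_IV and \<tau> = ?T and B = "\<lambda>p. ?u p / ?v p"
        and \<zeta> = \<omega> and D = "chazy_field chazy_IV" and \<delta> = "field3 \<omega>" and E = "E3 \<omega>"])
    show "ringed P2" "irreducible_variety P2" by (fact ringed_P2 irreducible_P2)+
    show "T3 y \<in> points P2" "(T3 ^^ 3) y = y" if "y \<in> points P2" for y by (fact T3p[OF that])+
    show "morphism (subvariety (affine_space 3) \<Omega>) P2 class3" by (rule morphism_class3[OF \<Omega>S])
    show "?O \<noteq> {}"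
    proof -
      \<comment> \<open>The point with \<open>m = 0\<close> and \<open>n = 1\<close>, where
        \<open>R_IV\<close> is 1 and \<open>H_IV\<close> is 2; it serves for the other two equations
        as well.\<close>
      have "[1, 3] \<in> ?O" by (simp add: region_def R_IV_def H_IV_def)
      then show ?thesis by blast
    qed
    show "(\<lambda>p. section_IV \<omega> p ! i) \<in> polyfun 3" if "i < 3" for i
    proof -
      have "i = 0 \<or> i = 1 \<or> i = 2" using that by linarith
      then show ?thesis
        by (elim disjE; simp add: section_IV_def Let_def)
          (intro polyfun.add polyfun.mult polyfun_diff polyfun_power polyfun.const coord_polyfun)+
    qed
    show "?T p \<in> \<Omega> \<and> T3 (class3 p) = class3 (?T p) \<and> F (?T p) = F p \<and> ?u (?T p) / ?v (?T p) = \<omega> * (?u p / ?v p)"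
      if p: "p \<in> \<Omega>" for p
    proof -
      have e: "?u (?T p) = ?u p" "?v (?T p) = \<omega>\<^sup>2 * ?v p" "?w (?T p) = (\<omega>\<^sup>2)\<^sup>2 * ?w p" and w6: "(\<omega>\<^sup>2) ^ 3 = 1"
        using w3 by simp_all algebra+
      \<comment> \<open>The eigenvalues 1, \<open>\<omega>^2\<close>, \<open>\<omega>^4\<close>, 1
        of the four arguments are successive powers of \<open>\<omega>^2\<close>, so the
        automorphism acts on them as a rescaling of time.\<close>
      have "F (?T p) = chazy_coords (1 * ?u p) (1 * (\<omega>\<^sup>2 * ?v p)) (1 * ((\<omega>\<^sup>2)\<^sup>2 * ?w p)) (1 * ((\<omega>\<^sup>2) ^ 3 * ?u p))"
        unfolding F_def e w6 by (simp only: mult_1_left)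
      also have "\<dots> = F p" unfolding F_def by (rule chazy_coords_scale) (use w0 in simp_all)
      finally have F: "F (?T p) = F p" .
      have "?T p \<in> U" unfolding U_def mem_Collect_eq e(1,2) using p w0 by (simp add: \<Omega>_def U_def)
      moreover have quot: "a / (\<omega>\<^sup>2 * b) = \<omega> * (a / b)" for a b
      proof -
        have "a / (\<omega>\<^sup>2 * b) = \<omega> ^ 3 * a / (\<omega>\<^sup>2 * b)" by (simp add: w3)
        also have "\<dots> = \<omega> * (a / b)" using w0 by (simp add: power2_eq_square power3_eq_cube)
        finally show ?thesis .
      qed
      have "?u (?T p) / ?v (?T p) = \<omega> * (?u p / ?v p)"
        unfolding e(1,2) by (rule quot)
      ultimately show ?thesis using F p T3_class3[of p] \<Omega>S by (auto simp: \<Omega>_def)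
    qed
    show "\<exists>j. x = \<omega> ^ j" if "x ^ 3 = 1" for x
    proof -
      have "(x - 1) * (x - \<omega>) * (x - \<omega> ^ 2) = 0" using that \<omega> by algebra
      then have "x = \<omega> ^ 0 \<or> x = \<omega> ^ 1 \<or> x = \<omega> ^ 2" by auto
      then show ?thesis by blast
    qed
    show "class3 (section_IV \<omega> [s, t, ?u p / ?v p]) = class3 p" if p: "p \<in> \<Omega>" "F p = [s, t]" for p s t
    proof -
      \<comment> \<open>The triple \<open>b^2, b, m\<close> is \<open>u, v, w\<close> times
        \<open>u / v^2\<close>, and the inverse transform contributes the factor 3.\<close>
      let ?c = "3 * ?u p / ?v p ^ 2"
      have nz: "?u p \<noteq> 0" "?v p \<noteq> 0" using p(1) by (auto simp: \<Omega>_def U_def)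
      have m: "1 - s = ?u p * ?w p / ?v p ^ 2" using p(2) by (auto simp: F_def chazy_coords_def)
      have k: "?u p + 1 * ?v p + 1 * ?w p = 3 * p ! 0" "?u p + \<omega> * ?v p + \<omega>\<^sup>2 * ?w p = 3 * p ! 1" "?u p + \<omega>\<^sup>2 * ?v p + \<omega> * ?w p = 3 * p ! 2"
        using \<omega> by algebra+
      have c0: "(u / v)\<^sup>2 + x * (u / v) + y * (u * w / v\<^sup>2) = u / v\<^sup>2 * (u + x * v + y * w)" if "v \<noteq> 0" for u v w x y :: complex
        using that by (simp add: field_simps power2_eq_square)
      note c = c0[OF nz(2), of "?u p" _ _ "?w p"]
      have nc: "3 * u / v\<^sup>2 \<noteq> 0" if "u \<noteq> 0" "v \<noteq> 0" for u v :: complex using that by simp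
      have S: "section_IV \<omega> [s, t, ?u p / ?v p] = [?c * p ! 0, ?c * p ! 1, ?c * p ! 2]"
        using c[of 1 1, unfolded k] c[of \<omega> "\<omega>\<^sup>2", unfolded k] c[of "\<omega>\<^sup>2" \<omega>, unfolded k]
        unfolding section_IV_def Let_def by (simp add: m)
      show ?thesis unfolding S by (rule class3_eq[OF nc[OF nz]]) (use p(1) \<Omega>S in blast)
    qed
    show "chazy_field chazy_IV q ! 0 \<noteq> 0" if "q \<in> ?O" for q using that by (auto simp: region_def chazy_field_def)
    show "R_IV q \<noteq> 0" if "q \<in> ?O" for q using that by (auto simp: region_def)
    show "\<exists>c. c \<noteq> 0 \<and> (\<forall>i<2. ((\<lambda>t. F (map2 (\<lambda>a b. a + t * b) p (field3 \<omega> p)) ! i)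
         has_field_derivative c * chazy_field chazy_IV (F p) ! i) (at 0))" if p: "p \<in> \<Omega>" for p
    proof -
      obtain x y z where xyz: "p = [x, y, z]" using p by (auto simp: \<Omega>_def U_def length_3)
      let ?l = "\<lambda>t. map2 (\<lambda>a b. a + t * b) p (field3 \<omega> p)"
      have nz: "?u p \<noteq> 0" "?v p \<noteq> 0" using p by (auto simp: \<Omega>_def U_def)
      have l0: "?l 0 = p" by (simp add: xyz field3_def)
      have d: "((\<lambda>t. ?u (?l t)) has_field_derivative ?v p) (at 0)" "((\<lambda>t. ?v (?l t)) has_field_derivative ?w p) (at 0)"
        "((\<lambda>t. ?w (?l t)) has_field_derivative ?u p) (at 0)"
        unfolding xyz field3_def by (auto intro!: derivative_eq_intros) (use w3 in algebra)+
      \<comment> \<open>The fourth derivative is \<open>?v\<close> again, so the fourth-order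
        quantity is \<open>u^3 / v^3\<close>, which is also \<open>n\<close>.\<close>
      have K: "u ^ 3 * v / v ^ 4 = u ^ 2 * u / v ^ 3" if "v \<noteq> 0" for u v :: complex
        using that by (simp add: power2_eq_square power3_eq_cube power4_eq_xxxx)
      have dF: "((\<lambda>t. F (?l t) ! i) has_field_derivative - ?v p / ?u p * chazy_field chazy_IV (F p) ! i) (at 0)" if "i < 2" for i
        unfolding F_def
        by (rule chazy_coords_derivative[where P = chazy_IV and K = "\<lambda>m n. n", OF d d(1) _ _ _ _ nz chazy_IV_relation K[OF nz(2)] that]) (simp_all only: l0)
      have "- ?v p / ?u p \<noteq> 0" using nz by (metis divide_eq_0_iff neg_equal_0_iff_equal)
      then show ?thesis using dF by blast
    qed
    show "w f (class3 p) * dir_deriv (g \<circ> class3) p (field3 \<omega> p) = w g (class3 p) * dir_deriv (f \<circ> class3) p (field3 \<omega> p)"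
      if "w \<in> E3 \<omega> V" "p \<in> \<Omega>" "class3 p \<in> V" "openin (zar P2) N" "class3 p \<in> N" "f \<in> reg P2 N" "g \<in> reg P2 N" for V w p N f g
      by (rule E3_parallel[OF \<omega> that(1) _ _ that(3-7)]) (use that(2) \<Omega>S in \<open>auto simp: \<Omega>_def U_def\<close>)
    show "\<exists>V w. openin (zar P2) V \<and> class3 p \<in> V \<and> w \<in> E3 \<omega> V \<and>
      (\<forall>N f. openin (zar P2) N \<and> class3 p \<in> N \<and> f \<in> reg P2 N \<longrightarrow> w f (class3 p) = dir_deriv (f \<circ> class3) p (field3 \<omega> p))"
      if "p \<in> \<Omega>" for p
      using E3_field[OF \<omega>] E3_field_eq \<Omega>S that openin_topspace[of "zar P2"]
      by (intro exI[of _ "points P2"] exI[of _ "descended_field ?r (field3 \<omega>)"]) (auto simp: points_P2 intro: quotientI)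
    show "plane_chart X3 (quotient_foliation P2 (cyclic_rel P2 T3) (E3 \<omega>)) (chazy_field chazy_IV) V ?O \<phi> \<psi> \<Longrightarrow> thesis"
      for V \<phi> \<psi> by (rule that)
  qed (use \<Phi> \<Omega> O polyfun_IV plane_field_IV lift inF in \<open>auto simp: \<Omega>_def\<close>)
qed

section \<open>Biprojective spaces and the quotient of order four\<close>

definition bipunctured :: "nat \<Rightarrow> nat \<Rightarrow> complex list set" where
  "bipunctured m n = {p. length p = m + n \<and> take m p \<noteq> replicate m 0 \<and> drop m p \<noteq> replicate n 0}"

lemma bipunctured_space_eq: "bipunctured_space m n = subvariety (affine_space (m + n)) (bipunctured m n)"
  by (simp add: bipunctured_space_def bipunctured_def)

lemma affine_open_bipunctured: "affine_open (m + n) (bipunctured m n)"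
proof (rule affine_openI)
  have ex: "\<exists>i<k. p ! i \<noteq> 0" if "length p = k" "p \<noteq> replicate k 0" for p :: "complex list" and k
    using that by (metis nth_equalityI length_replicate nth_replicate)
  fix p assume p: "p \<in> bipunctured m n"
  obtain i where i: "i < m" "take m p ! i \<noteq> 0" using ex[of "take m p" m] p by (auto simp: bipunctured_def)
  obtain j where j: "j < n" "drop m p ! j \<noteq> 0" using ex[of "drop m p" n] p by (auto simp: bipunctured_def)
  have "q \<in> bipunctured m n" if q: "length q = m + n" "q ! i * q ! (m + j) \<noteq> 0" for q
  proof -
    have "take m q ! i \<noteq> replicate m 0 ! i" "drop m q ! j \<noteq> replicate n 0 ! j" using q i j by auto
    then have "take m q \<noteq> replicate m 0" "drop m q \<noteq> replicate n 0" by metis+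
    then show ?thesis using q(1) by (simp add: bipunctured_def)
  qed
  moreover have "(\<lambda>p. p ! i * p ! (m + j)) \<in> polyfun (m + n)" using i j by (intro polyfun.mult polyfun.coord) auto
  moreover have "p ! i * p ! (m + j) \<noteq> 0" using i j p by (simp add: bipunctured_def)
  ultimately show "\<exists>e\<in>polyfun (m + n). e p \<noteq> 0 \<and> (\<forall>q. length q = m + n \<and> e q \<noteq> 0 \<longrightarrow> q \<in> bipunctured m n)"
    by (intro bexI[of _ "\<lambda>p. p ! i * p ! (m + j)"]) auto
qed (simp add: bipunctured_def)

lemma biscaling_rel_iff:
  "(p, p') \<in> biscaling_rel m n \<longleftrightarrow> p \<in> bipunctured m n \<and>
     (\<exists>c d. c \<noteq> 0 \<and> d \<noteq> 0 \<and> p' = map ((*) c) (take m p) @ map ((*) d) (drop m p))"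
  by (auto simp: biscaling_rel_def bipunctured_space_eq points_affine_subvariety affine_open_bipunctured)

lemma equiv_biscaling_rel: "equiv (bipunctured m n) (biscaling_rel m n)"
proof -
  let ?s = "\<lambda>c d p. map ((*) c) (take m p) @ map ((*) d) (drop m p)"
  have z: "map ((*) c) q = replicate k 0 \<longleftrightarrow> q = replicate k 0" if "c \<noteq> 0" "length q = k" for c :: complex and q k
  proof
    assume *: "map ((*) c) q = replicate k 0"
    show "q = replicate k 0"
    proof (rule nth_equalityI)
      fix i assume i: "i < length q"
      then have "map ((*) c) q ! i = 0" using * that(2) by simp
      then show "q ! i = replicate k 0 ! i" using i that by simp
    qed (use that in simp)
  qed (simp add: that)
  have closed: "?s c d p \<in> bipunctured m n" if "c \<noteq> 0" "d \<noteq> 0" "p \<in> bipunctured m n" for c d p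
    using that by (simp add: bipunctured_def z)
  have comp: "?s c' d' (?s c d p) = ?s (c' * c) (d' * d) p" if "p \<in> bipunctured m n" for c d c' d' p
    using that by (simp add: bipunctured_def o_def mult.assoc)
  have one: "?s 1 1 p = p" for p :: "complex list" by (simp add: list.map_id0[unfolded id_def] map_idI)
  show ?thesis
  proof (intro equivI)
    show "biscaling_rel m n \<subseteq> bipunctured m n \<times> bipunctured m n"
      using closed by (auto simp: biscaling_rel_iff)
    show "refl_on (bipunctured m n) (biscaling_rel m n)"
    proof (rule refl_onI)
      fix p assume p: "p \<in> bipunctured m n"
      show "(p, p) \<in> biscaling_rel m n"
        unfolding biscaling_rel_iff by (intro conjI p exI[of _ 1] one[symmetric]) simp_all
    qed
    show "sym (biscaling_rel m n)"
    proof (rule symI)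
      fix p p' assume "(p, p') \<in> biscaling_rel m n"
      then obtain c d where c: "p \<in> bipunctured m n" "c \<noteq> 0" "d \<noteq> 0" "p' = ?s c d p"
        unfolding biscaling_rel_iff by blast
      have "?s (inverse c) (inverse d) p' = p"
        unfolding c(4) comp[OF c(1)] left_inverse[OF c(2)] left_inverse[OF c(3)] by (rule one)
      moreover have "p' \<in> bipunctured m n" unfolding c(4) by (rule closed[OF c(2,3,1)])
      ultimately show "(p', p) \<in> biscaling_rel m n" unfolding biscaling_rel_iff
        using c(2,3) by (intro conjI exI[of _ "inverse c"] exI[of _ "inverse d"]) simp_all
    qed
    show "trans (biscaling_rel m n)"
    proof (rule transI)
      fix p q s assume "(p, q) \<in> biscaling_rel m n" "(q, s) \<in> biscaling_rel m n"
      then obtain c d c' d' where c: "p \<in> bipunctured m n" "c \<noteq> 0" "d \<noteq> 0" "q = ?s c d p"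
        and d: "c' \<noteq> 0" "d' \<noteq> 0" "s = ?s c' d' q"
        unfolding biscaling_rel_iff by blast
      show "(p, s) \<in> biscaling_rel m n"
        unfolding biscaling_rel_iff d(3) c(4) comp[OF c(1)]
        by (intro conjI c(1) exI[of _ "c' * c"] exI[of _ "d' * d"]) (use c d in simp_all)
    qed
  qed
qed

lemma biprojective_space_eq:
  "biprojective_space m n = quotient_variety (subvariety (affine_space (m + n)) (bipunctured m n)) (biscaling_rel m n)"
  by (simp add: biprojective_space_def bipunctured_space_eq)

lemma points_biprojective: "points (biprojective_space m n) = bipunctured m n // biscaling_rel m n"
  unfolding biprojective_space_eq
  by (simp add: points_quotient_variety points_affine_subvariety affine_open_bipunctured)

section \<open>The product of two projective lines\<close>

lemma length_4: "length p = 4 \<longleftrightarrow> (\<exists>x y z w. p = [x, y, z, w])"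
  by (auto simp: numeral_eq_Suc length_Suc_conv)

lemma bipunctured_22: "[x, y, z, w] \<in> bipunctured 2 2 \<longleftrightarrow> (x \<noteq> 0 \<or> y \<noteq> 0) \<and> (z \<noteq> 0 \<or> w \<noteq> 0)"
  by (auto simp: bipunctured_def numeral_2_eq_2)

lemma bipunctured_22_cases:
  "p \<in> bipunctured 2 2 \<Longrightarrow> \<exists>x y z w. p = [x, y, z, w] \<and> (x \<noteq> 0 \<or> y \<noteq> 0) \<and> (z \<noteq> 0 \<or> w \<noteq> 0)"
proof -
  assume p: "p \<in> bipunctured 2 2"
  then have "length p = 4" by (simp add: bipunctured_def)
  then obtain x y z w where e: "p = [x, y, z, w]" by (auto simp: length_4)
  with p bipunctured_22[of x y z w] show ?thesis by blast
qed

abbreviation class4 :: "complex list \<Rightarrow> complex list set" where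
  "class4 p \<equiv> biscaling_rel 2 2 `` {p}"

lemma biscaling_rel_22: "(p, p') \<in> biscaling_rel 2 2 \<longleftrightarrow> p \<in> bipunctured 2 2 \<and>
   (\<exists>c d. c \<noteq> 0 \<and> d \<noteq> 0 \<and> p' = [c * p ! 0, c * p ! 1, d * p ! 2, d * p ! 3])"
proof -
  have "map ((*) c) (take 2 p) @ map ((*) d) (drop 2 p) = [c * p ! 0, c * p ! 1, d * p ! 2, d * p ! 3]"
    if p: "p \<in> bipunctured 2 2" for c d
    using bipunctured_22_cases[OF p] by (auto simp: numeral_2_eq_2 numeral_3_eq_3 One_nat_def)
  then show ?thesis unfolding biscaling_rel_iff by metis
qed

lemma affine_open_22: "affine_open 4 (bipunctured 2 2)"
  using affine_open_bipunctured[of 2 2] by simp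

lemma P1P1_eq: "P1P1 = quotient_variety (subvariety (affine_space 4) (bipunctured 2 2)) (biscaling_rel 2 2)"
  unfolding biprojective_space_eq by simp

lemma class4_eq: "c \<noteq> 0 \<Longrightarrow> d \<noteq> 0 \<Longrightarrow> p \<in> bipunctured 2 2 \<Longrightarrow>
    class4 [c * p ! 0, c * p ! 1, d * p ! 2, d * p ! 3] = class4 p"
  using equiv_class_eq[OF equiv_biscaling_rel, of p "[c * p ! 0, c * p ! 1, d * p ! 2, d * p ! 3]" 2 2]
  by (metis biscaling_rel_22)

lemma morphism_class4: "\<Omega> \<subseteq> bipunctured 2 2 \<Longrightarrow> morphism (subvariety (affine_space 4) \<Omega>) P1P1 class4"
  unfolding P1P1_eq
  using morphism_compose[OF morphism_affine_subvarieties[OF affine_open_22] morphism_quotient]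
  by (simp add: comp_def)

lemma irreducible_P1P1: "irreducible_variety P1P1"
  unfolding P1P1_eq
  by (rule irreducible_variety_quotient, rule irreducible_variety_image[of 4 "bipunctured 2 2" _ "\<lambda>p. p"])
    (simp_all add: morphism_affine_subvarieties affine_open_22 points_affine_subvariety)

text \<open>In the affine coordinates the weights are \<open>1 + \<i>\<close> and
  \<open>1 - \<i>\<close>, with quotient \<open>\<i>\<close> as the form of \<open>E4\<close>
  requires. Splitting them evenly between the two homogeneous coordinates of each line gives the
  products \<open>X_a Y_b\<close> the weights 1, \<open>- \<i>\<close>, -1,
  \<open>\<i>\<close>.\<close>

definition field4 :: "complex list \<Rightarrow> complex list" where
  "field4 p = [(1 + \<i>) / 2 * p ! 0, - (1 + \<i>) / 2 * p ! 1, (1 - \<i>) / 2 * p ! 2, - (1 - \<i>) / 2 * p ! 3]"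

lemma length_field4 [simp]: "length (field4 p) = 4" by (simp add: field4_def)

lemma coord_polyfun_4: "(\<lambda>q. q ! 0) \<in> polyfun 4" "(\<lambda>q. q ! 1) \<in> polyfun 4" "(\<lambda>q. q ! 2) \<in> polyfun 4" "(\<lambda>q. q ! 3) \<in> polyfun 4"
  by (simp_all add: polyfun.coord)

lemma less_4_cases: "i < 4 \<Longrightarrow> i = 0 \<or> i = 1 \<or> i = 2 \<or> i = (3::nat)" by linarith

lemma nth_Cons_3 [simp]: "(x # xs) ! 3 = xs ! 2"
  by (simp add: numeral_3_eq_3 numeral_2_eq_2)

lemma polyfun_field4: "i < 4 \<Longrightarrow> (\<lambda>p. field4 p ! i) \<in> polyfun 4"
proof -
  assume i: "i < 4"
  have c: "(\<lambda>p. c * p ! j) \<in> polyfun 4" if "j < 4" for c j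
    by (intro polyfun.mult polyfun.const polyfun.coord that)
  show ?thesis
    using less_4_cases[OF i] c[of 0 "(1 + \<i>) / 2"] c[of 1 "- (1 + \<i>) / 2"] c[of 2 "(1 - \<i>) / 2"] c[of 3 "- (1 - \<i>) / 2"]
    by (auto simp: field4_def)
qed

lemma lines_field4:
  assumes "(p, p') \<in> biscaling_rel 2 2" "map2 (\<lambda>a b. a + t * b) p (field4 p) \<in> bipunctured 2 2"
  shows "(map2 (\<lambda>a b. a + t * b) p (field4 p), map2 (\<lambda>a b. a + t * b) p' (field4 p')) \<in> biscaling_rel 2 2"
proof -
  obtain c d where c: "c \<noteq> 0" "d \<noteq> 0" "p' = [c * p ! 0, c * p ! 1, d * p ! 2, d * p ! 3]" "p \<in> bipunctured 2 2"
    using assms(1) unfolding biscaling_rel_22 by blast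
  obtain x y z w where p: "p = [x, y, z, w]" using bipunctured_22_cases[OF c(4)] by blast
  show ?thesis unfolding biscaling_rel_22
    by (intro conjI assms(2) exI[of _ c] exI[of _ d] c(1,2)) (simp add: c(3) p field4_def algebra_simps)
qed

lemma morphism_chart4: "morphism (affine_space 2) P1P1 chart4"
proof -
  have "morphism (affine_space 2) (affine_space 4) (\<lambda>p. [p ! 0, 1, p ! 1, 1])"
  proof (rule morphism_affine[OF ringed_affine_space])
    fix i :: nat assume "i < 4"
    from less_4_cases[OF this] have "(\<lambda>p. [p ! 0, 1, p ! 1, 1] ! i) \<in> polyfun 2"
      by (elim disjE) (simp_all add: coord_polyfun_2 polyfun.const)
    then show "(\<lambda>p. [p ! 0, 1, p ! 1, 1] ! i) \<in> reg (affine_space 2) (points (affine_space 2))"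
      by (intro polyfun_reg) simp_all
  qed simp
  then have "morphism (affine_space 2) (subvariety (affine_space 4) (bipunctured 2 2)) (\<lambda>p. [p ! 0, 1, p ! 1, 1])"
    by (intro morphism_into_subvariety ringed_affine_space) (simp_all add: bipunctured_22)
  from morphism_compose[OF this morphism_quotient] show ?thesis
    unfolding P1P1_eq chart4_def[abs_def] by (simp add: comp_def)
qed

lemma length_2: "length p = 2 \<longleftrightarrow> (\<exists>x y. p = [x, y])"
  by (auto simp: numeral_2_eq_2 length_Suc_conv)

lemma reg_chart4:
  assumes "openin (zar P1P1) N" "f \<in> reg P1P1 N" "length q = 2" "chart4 q \<in> N"
  obtains U where "affine_open 2 U" "q \<in> U" "f \<circ> chart4 \<in> reg (affine_space 2) U"
proof (rule that[of "{q. length q = 2 \<and> chart4 q \<in> N}"])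
  show "affine_open 2 {q. length q = 2 \<and> chart4 q \<in> N}"
    using morphism_open[OF morphism_chart4 assms(1)] by (simp add: openin_affine)
  show "f \<circ> chart4 \<in> reg (affine_space 2) {q. length q = 2 \<and> chart4 q \<in> N}"
    using morphism_reg[OF morphism_chart4 assms(1,2)] by simp
qed (use assms in simp)

text \<open>\<open>E4\<close> is defined in the affine chart, while fields are handled in
  homogeneous coordinates. The line in direction \<open>field4\<close> maps to an affine curve that
  need not be a line, but its velocity at 0 is \<open>((1 + \<i>) X, (1 - \<i>) Y)\<close>, and the
  chain rule asks for no more.\<close>

lemma chart4_derivative:
  assumes p: "p = [x0, x1, y0, y1]" and nz: "x1 \<noteq> 0" "y1 \<noteq> 0"
    and N: "openin (zar P1P1) N" "class4 p \<in> N" "f \<in> reg P1P1 N"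
  shows "class4 p = chart4 [x0 / x1, y0 / y1]"
    and "dir_deriv (f \<circ> class4) p (field4 p) =
      dir_deriv (f \<circ> chart4) [x0 / x1, y0 / y1] [(1 + \<i>) * (x0 / x1), (1 - \<i>) * (y0 / y1)]"
proof -
  have cc: "class4 [a, b, c, d] = chart4 [a / b, c / d]" if "b \<noteq> 0" "d \<noteq> 0" for a b c d
    using class4_eq[of "1 / b" "1 / d" "[a, b, c, d]"] that by (simp add: chart4_def bipunctured_22)
  show e: "class4 p = chart4 [x0 / x1, y0 / y1]" using cc nz p by simp
  let ?q = "[x0 / x1, y0 / y1]" and ?l = "\<lambda>t. map2 (\<lambda>a b. a + t * b) p (field4 p)"
  obtain U where U: "affine_open 2 U" "?q \<in> U" "f \<circ> chart4 \<in> reg (affine_space 2) U"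
    using reg_chart4[OF N(1,3), of ?q] N(2) unfolding e by (metis length_Cons list.size(3) numeral_2_eq_2)
  obtain L where L: "gradient_at 2 (f \<circ> chart4) ?q L" using reg_gradient[OF U(3,1,2)] by blast
  let ?X = "\<lambda>t. (x0 + t * ((1 + \<i>) / 2 * x0)) / (x1 + t * (- (1 + \<i>) / 2 * x1))"
    and ?Y = "\<lambda>t. (y0 + t * ((1 - \<i>) / 2 * y0)) / (y1 + t * (- (1 - \<i>) / 2 * y1))"
  let ?c' = "\<lambda>i. [(1 + \<i>) * (x0 / x1), (1 - \<i>) * (y0 / y1)] ! i"
  have X: "(?X has_field_derivative (1 + \<i>) * (x0 / x1)) (at 0)" "(?Y has_field_derivative (1 - \<i>) * (y0 / y1)) (at 0)"
    using nz by (auto intro!: derivative_eq_intros simp: field_simps)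
  have "((\<lambda>t. (f \<circ> chart4) [?X t, ?Y t]) has_field_derivative (\<Sum>i<2. L i * ?c' i)) (at 0)"
  proof (rule gradient_atD[OF L])
    fix i :: nat assume "i < 2"
    then have "i = 0 \<or> i = 1" by linarith
    then show "((\<lambda>t. [?X t, ?Y t] ! i) has_field_derivative ?c' i) (at 0)" using X by auto
  qed simp_all
  moreover have "(\<Sum>i<2. L i * ?c' i) = dir_deriv (f \<circ> chart4) ?q [(1 + \<i>) * (x0 / x1), (1 - \<i>) * (y0 / y1)]"
    using gradient_at_line(2)[OF L] by simp
  moreover have "\<forall>\<^sub>F t in nhds 0. (f \<circ> class4) (?l t) = (f \<circ> chart4) [?X t, ?Y t]"
  proof -
    have ne: "\<forall>\<^sub>F t::complex in nhds 0. a + t * b \<noteq> 0" if "a \<noteq> 0" for a b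
      by (rule tendsto_imp_eventually_ne[of _ "a + 0 * b", OF tendsto_add[OF tendsto_const tendsto_mult[OF filterlim_ident tendsto_const]]])
        (use that in simp)
    show ?thesis using ne[OF nz(1), of "- (1 + \<i>) / 2 * x1"] ne[OF nz(2), of "- (1 - \<i>) / 2 * y1"]
      by eventually_elim (simp add: p field4_def cc)
  qed
  ultimately show "dir_deriv (f \<circ> class4) p (field4 p) =
      dir_deriv (f \<circ> chart4) ?q [(1 + \<i>) * (x0 / x1), (1 - \<i>) * (y0 / y1)]"
    by (intro dir_deriv_eqI) (use DERIV_cong_ev[OF refl _ refl] in fastforce)
qed

text \<open>Where \<open>X\<close> and \<open>Y\<close> are nonzero, the kernel of the form is the
  line spanned by \<open>((1 + \<i>) X, (1 - \<i>) Y)\<close>, so the value of \<open>w\<close> is a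
  multiple of the generator.\<close>

lemma E4_parallel:
  assumes w: "w \<in> E4 V" and p: "p = [x0, x1, y0, y1]" and nz: "x0 \<noteq> 0" "x1 \<noteq> 0" "y0 \<noteq> 0" "y1 \<noteq> 0" and pV: "class4 p \<in> V"
    and N: "openin (zar P1P1) N" "class4 p \<in> N" "f \<in> reg P1P1 N" "g \<in> reg P1P1 N"
  shows "w f (class4 p) * dir_deriv (g \<circ> class4) p (field4 p) = w g (class4 p) * dir_deriv (f \<circ> class4) p (field4 p)"
proof -
  let ?q = "[x0 / x1, y0 / y1]" and ?d = "[(1 + \<i>) * (x0 / x1), (1 - \<i>) * (y0 / y1)]"
  note e = chart4_derivative(1)[OF p nz(2,4) N(1-3)]
  obtain v where v: "length v = 2" "(\<Sum>i<2. [?q ! 1, - \<i> * ?q ! 0] ! i * v ! i) = 0"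
    "\<And>N f. openin (zar P1P1) N \<Longrightarrow> chart4 ?q \<in> N \<Longrightarrow> f \<in> reg P1P1 N \<Longrightarrow> w f (chart4 ?q) = dir_deriv (f \<circ> chart4) ?q v"
  proof -
    have len: "length ?q = 2" by simp
    have "\<exists>v. length v = 2 \<and> (\<Sum>i<2. [?q ! 1, - \<i> * ?q ! 0] ! i * v ! i) = 0 \<and>
        (\<forall>N f. openin (zar P1P1) N \<and> chart4 ?q \<in> N \<and> f \<in> reg P1P1 N \<longrightarrow> w f (chart4 ?q) = dir_deriv (f \<circ> chart4) ?q v)"
      using w[unfolded E4_def form_foliation_def mem_Collect_eq, THEN conjunct2, THEN bspec, of ?q, unfolded len] pV e
      by (simp only: len simp_thms mem_Collect_eq)
    then show thesis using that by blast
  qed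
  obtain v0 v1 where vv: "v = [v0, v1]" using v(1) by (auto simp: length_2)
  have s2: "(\<Sum>i<2. h i) = h 0 + h 1" for h :: "nat \<Rightarrow> complex" by (simp add: numeral_2_eq_2 One_nat_def)
  \<comment> \<open>The factor is read off the first component; the form then fixes the
    second.\<close>
  define l where "l = v0 / ((1 + \<i>) * (x0 / x1))"
  have i1: "1 + \<i> \<noteq> 0" by (simp add: complex_eq_iff)
  have 0: "v0 = l * ((1 + \<i>) * (x0 / x1))" unfolding l_def using nz i1 by simp
  have gen: "v1 = l * ((1 - \<i>) * Y)" if "Y * (l * ((1 + \<i>) * X)) = \<i> * X * v1" "X \<noteq> 0" for X Y
  proof -
    have "X * (\<i> * v1 - Y * l * (1 + \<i>)) = 0" using that(1) by (simp add: algebra_simps)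
    then have "\<i> * v1 - Y * l * (1 + \<i>) = 0" using that(2) by (metis mult_eq_0_iff)
    then have "\<i> * v1 = \<i> * (l * ((1 - \<i>) * Y))" by (simp add: algebra_simps)
    then show ?thesis by simp
  qed
  have "y0 / y1 * v0 = \<i> * (x0 / x1) * v1" using v(2) unfolding s2 vv by (simp add: algebra_simps)
  then have 1: "v1 = l * ((1 - \<i>) * (y0 / y1))" unfolding 0 by (rule gen) (use nz in simp)
  have dec: "w h (class4 p) = l * dir_deriv (h \<circ> class4) p (field4 p)" if h: "h \<in> reg P1P1 N" for h
  proof -
    obtain U where U: "affine_open 2 U" "?q \<in> U" "h \<circ> chart4 \<in> reg (affine_space 2) U"
      using reg_chart4[OF N(1) h, of ?q] N(2) unfolding e by (metis length_Cons list.size(3) numeral_2_eq_2)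
    obtain L where L: "gradient_at 2 (h \<circ> chart4) ?q L" using reg_gradient[OF U(3,1,2)] by blast
    have "w h (chart4 ?q) = dir_deriv (h \<circ> chart4) ?q v" using v(3)[OF N(1) _ h] N(2) e by simp
    also have "\<dots> = l * dir_deriv (h \<circ> chart4) ?q ?d"
      using gradient_at_line(2)[OF L] unfolding vv 0 1 by (simp add: s2 algebra_simps)
    finally show ?thesis using chart4_derivative(2)[OF p nz(2,4) N(1,2) h] e by simp
  qed
  show ?thesis using dec N(3,4) by simp
qed

lemma E4_field_eq:
  "p \<in> bipunctured 2 2 \<Longrightarrow> descended_field (biscaling_rel 2 2) field4 f (class4 p) = dir_deriv (f \<circ> class4) p (field4 p)"
  by (simp add: descended_field_eq[OF affine_open_22 equiv_biscaling_rel polyfun_field4 length_field4 lines_field4] comp_def)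

lemma E4_field: "descended_field (biscaling_rel 2 2) field4 \<in> E4 (points P1P1)"
  unfolding E4_def form_foliation_def
proof (intro CollectI conjI ballI impI allI)
  show "vector_field P1P1 (points P1P1) (descended_field (biscaling_rel 2 2) field4)"
    unfolding points_biprojective by (rule vector_field_descended[OF affine_open_22 equiv_biscaling_rel polyfun_field4 length_field4 lines_field4, folded P1P1_eq])
  fix q :: "complex list" assume "q \<in> {p. length p = 2}"
  then obtain x y where q: "q = [x, y]" by (auto simp: length_2)
  have s2: "(\<Sum>i<2. h i) = h 0 + h 1" for h :: "nat \<Rightarrow> complex" by (simp add: numeral_2_eq_2 One_nat_def)
  let ?p = "[x, 1, y, 1]" and ?w = "[(1 + \<i>) * x, (1 - \<i>) * y]"
  have pq: "chart4 q = class4 ?p" by (simp add: chart4_def q)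
  have p: "?p \<in> bipunctured 2 2" by (simp add: bipunctured_22)
  have z: "(\<Sum>i<length q. [q ! 1, - \<i> * q ! 0] ! i * ?w ! i) = 0"
    by (simp add: q s2 algebra_simps)
  have d: "descended_field (biscaling_rel 2 2) field4 f (chart4 q) = dir_deriv (f \<circ> chart4) q ?w"
    if N: "openin (zar P1P1) N" "chart4 q \<in> N" "f \<in> reg P1P1 N" for N f
    using chart4_derivative(2)[OF refl, where ?x0.0 = x and ?x1.0 = 1 and ?y0.0 = y and ?y1.0 = 1 and N = N and f = f] N unfolding pq
    by (simp add: E4_field_eq[OF p] q)
  show "\<exists>w. length w = length q \<and> (\<Sum>i<length q. [q ! 1, - \<i> * q ! 0] ! i * w ! i) = 0 \<and>
      (\<forall>N f. openin (zar P1P1) N \<and> chart4 q \<in> N \<and> f \<in> reg P1P1 N \<longrightarrow>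
        descended_field (biscaling_rel 2 2) field4 f (chart4 q) = dir_deriv (f \<circ> chart4) q w)"
  proof (intro exI[of _ ?w] conjI allI impI)
    show "length ?w = length q" by (simp add: q)
  qed (use z d in blast)+
qed

lemma T4_class4:
  assumes p: "p \<in> bipunctured 2 2"
  shows "T4 (class4 p) = class4 [p ! 2, p ! 3, p ! 1, p ! 0]"
proof -
  obtain x y z w where xyz: "p = [x, y, z, w]" using bipunctured_22_cases[OF p] by blast
  have p': "[z, w, y, x] \<in> bipunctured 2 2" using p by (auto simp: bipunctured_22 xyz)
  have e: "class4 q = (\<lambda>(c, d). [c * q ! 0, c * q ! 1, d * q ! 2, d * q ! 3]) ` ((- {0}) \<times> (- {0}))"
    if "q \<in> bipunctured 2 2" for q
  proof (intro equalityI subsetI)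
    fix x assume "x \<in> class4 q"
    then obtain c d where "c \<noteq> 0" "d \<noteq> 0" "x = [c * q ! 0, c * q ! 1, d * q ! 2, d * q ! 3]"
      unfolding Image_singleton_iff biscaling_rel_22 by blast
    then show "x \<in> (\<lambda>(c, d). [c * q ! 0, c * q ! 1, d * q ! 2, d * q ! 3]) ` ((- {0}) \<times> (- {0}))"
      by (intro rev_image_eqI[of "(c, d)"]) auto
  next
    fix x assume "x \<in> (\<lambda>(c, d). [c * q ! 0, c * q ! 1, d * q ! 2, d * q ! 3]) ` ((- {0}) \<times> (- {0}))"
    then obtain c d where "c \<noteq> 0" "d \<noteq> 0" "x = [c * q ! 0, c * q ! 1, d * q ! 2, d * q ! 3]" by auto
    then show "x \<in> class4 q" unfolding Image_singleton_iff biscaling_rel_22 using that by blast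
  qed
  \<comment> \<open>Since \<open>T4\<close> exchanges the two lines, the two scalings change
    roles.\<close>
  have s: "(- {0::complex}) \<times> (- {0::complex}) = (\<lambda>(c, d). (d, c)) ` ((- {0}) \<times> (- {0}))" by auto
  have "T4 (class4 p) = (\<lambda>(c, d). [d * z, d * w, c * y, c * x]) ` ((- {0}) \<times> (- {0}))"
    unfolding T4_def xyz e[OF p[unfolded xyz]] image_image by (simp add: case_prod_unfold)
  also have "\<dots> = class4 [z, w, y, x]"
    unfolding e[OF p'] by (subst (2) s) (simp add: image_image case_prod_unfold)
  finally show ?thesis by (simp add: xyz)
qed

section \<open>Cover and section for equation V\<close>

definition R_V :: "complex list \<Rightarrow> complex" where
  "R_V q = 2 * (q ! 1 + 1 - 3 * q ! 0) - (1 - q ! 0) ^ 2"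

text \<open>\<open>R_V\<close> is \<open>2 n - m^2\<close>, which equals \<open>b^4\<close> by
  \<open>u^2 + w^2 = 2 v z\<close>. \<open>H_V\<close> is the product \<open>e0 e2 = e1 e3\<close>
  of opposite Segre coordinates in the inverse transform, so its nonvanishing keeps all four
  nonzero.\<close>

definition H_V :: "complex list \<Rightarrow> complex" where
  "H_V q = (q ! 1 + 1 - 3 * q ! 0) ^ 2 + R_V q * (1 - 2 * (1 - q ! 0))"

lemma polyfun_V: "R_V \<in> polyfun 2" "H_V \<in> polyfun 2"
proof -
  show R: "R_V \<in> polyfun 2"
    unfolding R_V_def[abs_def] by (intro polyfun.add polyfun.mult polyfun_diff polyfun_power polyfun.const coord_polyfun)
  show "H_V \<in> polyfun 2"
    unfolding H_V_def[abs_def] by (intro polyfun.add polyfun.mult polyfun_diff polyfun_power polyfun.const coord_polyfun R)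
qed

text \<open>Here \<open>u : v : w : z = b^3 : b^2 : m b : n\<close>, and the inverse Fourier
  transform gives the Segre coordinates \<open>e0, e1, e2, e3\<close>. The two lines are recovered
  from \<open>X0 : X1 = e0 : e1\<close> and \<open>Y0 : Y1 = e0 : e3\<close>, hence the repeated
  entry.\<close>

definition section_V :: "complex list \<Rightarrow> complex list" where
  "section_V p = (let m = 1 - p ! 0; n = p ! 1 + 1 - 3 * p ! 0; b = p ! 2 in
     [n + m * b + b\<^sup>2 + b ^ 3, n - \<i> * m * b - b\<^sup>2 + \<i> * b ^ 3, n + m * b + b\<^sup>2 + b ^ 3, n + \<i> * m * b - b\<^sup>2 - \<i> * b ^ 3])"

lemma X4_plane_chart:
  obtains V \<phi> \<psi> where
    "plane_chart X4 (quotient_foliation P1P1 (cyclic_rel P1P1 T4) E4) (chazy_field chazy_V) V (region R_V H_V) \<phi> \<psi>"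
proof -
  \<comment> \<open>The Segre coordinates, ordered so that \<open>T4\<close> pulls each back to the
    next; their weights under \<open>field4\<close> are 1, \<open>- \<i>\<close>, -1,
    \<open>\<i>\<close>.\<close>
  let ?e0 = "\<lambda>p. p ! 0 * p ! (2::nat)" and ?e1 = "\<lambda>p. p ! 1 * p ! (2::nat)" and ?e2 = "\<lambda>p. p ! 1 * p ! (3::nat)" and ?e3 = "\<lambda>p. p ! 0 * p ! (3::nat)"
  let ?u = "\<lambda>p. ?e0 p - \<i> * ?e1 p - ?e2 p + \<i> * ?e3 p" and ?v = "\<lambda>p. ?e0 p - ?e1 p + ?e2 p - ?e3 p"
    and ?w = "\<lambda>p. ?e0 p + \<i> * ?e1 p - ?e2 p - \<i> * ?e3 p" and ?z = "\<lambda>p. ?e0 p + ?e1 p + ?e2 p + ?e3 p"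
  let ?O = "region R_V H_V" and ?r = "biscaling_rel 2 2"
  define F where "F p = chazy_coords (?u p) (?v p) (?w p) (?z p)" for p
  have pol: "?u \<in> polyfun 4" "?v \<in> polyfun 4" "?w \<in> polyfun 4" "?z \<in> polyfun 4"
    by (intro polyfun.add polyfun.mult polyfun_diff polyfun.const coord_polyfun_4)+
  let ?den = "\<lambda>p. p ! 0 * p ! 1 * p ! 2 * p ! 3 * ?u p * ?v p"
  define U where "U = {p. length p = 4 \<and> ?den p \<noteq> 0}"
  have U: "affine_open 4 U" unfolding U_def
    by (rule affine_open_basic) (intro polyfun.mult pol coord_polyfun_4)
  have Uo: "openin (zar (affine_space 4)) U" using U by (simp add: openin_affine)
  have O: "affine_open 2 ?O" by (rule affine_open_region[OF polyfun_V])
  have FU: "(\<lambda>p. F p ! i) \<in> reg (affine_space 4) U" if "i < 2" for i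
    unfolding F_def by (rule reg_chazy_coords[OF U _ pol that]) (simp add: U_def)
  define \<Omega> where "\<Omega> = {p \<in> U. F p \<in> ?O}"
  have \<Omega>: "affine_open 4 \<Omega>"
    using open_preimage[OF ringed_affine_space Uo, of F 2] FU O by (simp add: openin_affine \<Omega>_def F_def)
  have \<Omega>o: "openin (zar (affine_space 4)) \<Omega>" using \<Omega> by (simp add: openin_affine)
  have F\<Omega>: "(\<lambda>p. F p ! i) \<in> reg (affine_space 4) \<Omega>" if "i < 2" for i
    by (rule ringed_restrict[OF ringed_affine_space Uo FU[OF that] \<Omega>o]) (auto simp: \<Omega>_def)
  have \<Omega>S: "\<Omega> \<subseteq> bipunctured 2 2" by (auto simp: \<Omega>_def U_def length_4 bipunctured_22)
  have \<Omega>D: "?u p \<noteq> 0" "?v p \<noteq> 0" "p ! 0 \<noteq> 0" "p ! 1 \<noteq> 0" "p ! 2 \<noteq> 0" "p ! 3 \<noteq> 0" "F p \<in> ?O" "length p = 4"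
    if "p \<in> \<Omega>" for p using that unfolding \<Omega>_def U_def by simp_all
  have \<Omega>I: "p \<in> \<Omega>"
    if "?u p \<noteq> 0" "?v p \<noteq> 0" "p ! 0 \<noteq> 0" "p ! 1 \<noteq> 0" "p ! 2 \<noteq> 0" "p ! 3 \<noteq> 0" "F p \<in> ?O" "length p = 4"
    for p using that unfolding \<Omega>_def U_def by simp
  have inv: "p' \<in> \<Omega> \<and> F p' = F p" if r: "(p, p') \<in> ?r" and p: "p \<in> \<Omega>" for p p'
  proof -
    obtain c d where c: "c \<noteq> 0" "d \<noteq> 0" "p' = [c * p ! 0, c * p ! 1, d * p ! 2, d * p ! 3]"
      using r unfolding biscaling_rel_22 by blast
    have e: "?u p' = (c * d) * ?u p" "?v p' = (c * d) * ?v p" "?w p' = (c * d) * ?w p" "?z p' = (c * d) * ?z p"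
      by (simp_all add: c(3) algebra_simps)
    have F: "F p' = F p" unfolding F_def e using chazy_coords_scale[of "c * d" 1] c(1,2) by simp
    have "p' \<in> \<Omega>" by (rule \<Omega>I; (unfold e F)?) (use \<Omega>D[OF p] c in simp_all)
    with F show ?thesis by simp
  qed
  obtain \<Phi> where \<Phi>: "\<And>y. length (\<Phi> y) = 2" "\<And>p. p \<in> \<Omega> \<Longrightarrow> \<Phi> (class4 p) = F p"
    "\<And>i. i < 2 \<Longrightarrow> (\<lambda>y. \<Phi> y ! i) \<in> reg P1P1 (class4 ` \<Omega>)" "openin (zar P1P1) (class4 ` \<Omega>)"
    by (rule orbit_functions[OF affine_open_22 equiv_biscaling_rel \<Omega> \<Omega>S inv _ F\<Omega>, folded P1P1_eq]) (auto simp: F_def)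
  have lift: "section_V [s, t, b] \<in> \<Omega> \<and> F (section_V [s, t, b]) = [s, t]"
    if st: "[s, t] \<in> ?O" and b: "b ^ 4 = R_V [s, t]" for s t b
  proof -
    have nz: "R_V [s, t] \<noteq> 0" "H_V [s, t] \<noteq> 0" using st by (auto simp: region_def)
    have b0: "b \<noteq> 0" using nz(1) b by auto
    define m where "m = 1 - s"
    define n where "n = t + 1 - 3 * s"
    have R: "b ^ 4 = 2 * n - m\<^sup>2" using b by (simp add: R_V_def m_def n_def)
    define x0 where "x0 = n + m * b + b\<^sup>2 + b ^ 3"
    define x1 where "x1 = n - \<i> * m * b - b\<^sup>2 + \<i> * b ^ 3"
    define x2 where "x2 = n - m * b + b\<^sup>2 - b ^ 3"
    define x3 where "x3 = n + \<i> * m * b - b\<^sup>2 - \<i> * b ^ 3"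
    let ?s = "section_V [s, t, b]"
    have s: "?s = [x0, x1, x0, x3]"
      by (simp add: section_V_def Let_def m_def n_def x0_def x1_def x3_def)
    have ii: "\<i>\<^sup>2 = -1" by simp
    \<comment> \<open>The two products differ by \<open>2 b^2 (b^4 - 2 n + m^2)\<close>: the
      equation of the cover is the Segre equation.\<close>
    have e13: "x1 * x3 = x0 * x2" unfolding x0_def x1_def x2_def x3_def using R ii by algebra
    have "x0 * x2 = H_V [s, t]"
    proof -
      have "x0 * x2 = n\<^sup>2 + (2 * n - m\<^sup>2) * (1 - 2 * m)" unfolding x0_def x2_def using R by algebra
      then show ?thesis by (simp add: H_V_def R_V_def m_def n_def)
    qed
    then have x: "x0 \<noteq> 0" "x1 \<noteq> 0" "x3 \<noteq> 0" using nz(2) e13 by auto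
    have u: "?u ?s = x0 * (4 * b ^ 3)" "?v ?s = x0 * (4 * b\<^sup>2)" "?w ?s = x0 * (4 * (m * b))" "?z ?s = x0 * (4 * n)"
    proof -
      have L: "4 * b ^ 3 = x0 - \<i> * x1 - x2 + \<i> * x3" "4 * b\<^sup>2 = x0 - x1 + x2 - x3"
        "4 * (m * b) = x0 + \<i> * x1 - x2 - \<i> * x3" "4 * n = x0 + x1 + x2 + x3"
        by (simp_all add: x0_def x1_def x2_def x3_def algebra_simps)
      show "?u ?s = x0 * (4 * b ^ 3)" "?v ?s = x0 * (4 * b\<^sup>2)" "?w ?s = x0 * (4 * (m * b))" "?z ?s = x0 * (4 * n)"
        unfolding s L using e13 by (simp_all add: algebra_simps)
    qed
    have F: "F ?s = [s, t]"
    proof -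
      have "F ?s = [1 - m, n + 2 - 3 * m]"
        unfolding F_def u chazy_coords_def using b0 x(1)
        by (simp add: field_simps power2_eq_square power3_eq_cube)
      then show ?thesis by (simp add: m_def n_def)
    qed
    have "?s \<in> \<Omega>" by (rule \<Omega>I; (unfold u F)?) (use x b0 st s in simp_all)
    with F show ?thesis by simp
  qed
  have inF: "R_V (F p) = (?u p / ?v p) ^ 4" if p: "p \<in> \<Omega>" for p
  proof -
    \<comment> \<open>The second premise is the Segre equation \<open>e0 e2 = e1 e3\<close> written
      in the eigenvectors; it replaces \<open>2 v z - w^2\<close> by \<open>u^2\<close>.\<close>
    have g: "R_V (chazy_coords u v w z) = (u / v) ^ 4" if "v \<noteq> 0" "u\<^sup>2 + w\<^sup>2 = 2 * v * z" for u v w z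
    proof -
      have "R_V (chazy_coords u v w z) = u\<^sup>2 * (2 * v * z - w\<^sup>2) / v ^ 4"
        using that(1) unfolding R_V_def chazy_coords_def
        by (simp add: field_simps power2_eq_square power3_eq_cube power4_eq_xxxx)
      also have "\<dots> = (u / v) ^ 4" using that(1) unfolding that(2)[symmetric]
        by (simp add: power_divide power2_eq_square power4_eq_xxxx)
      finally show ?thesis .
    qed
    have ii: "\<i>\<^sup>2 = -1" by simp
    show ?thesis unfolding F_def by (rule g[OF \<Omega>D(2)[OF p]]) (use ii in algebra)
  qed
  let ?T = "\<lambda>p. [p ! 2, p ! 3, p ! 1, p ! 0]"
  have T4p: "T4 y \<in> points P1P1" "(T4 ^^ 4) y = y" if y: "y \<in> points P1P1" for y
  proof -
    obtain p where p: "p \<in> bipunctured 2 2" "y = class4 p" using y by (auto simp: points_biprojective elim!: quotientE)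
    obtain x0 x1 x2 x3 where "p = [x0, x1, x2, x3]" using bipunctured_22_cases[OF p(1)] by blast
    with p(1) have T: "?T p \<in> bipunctured 2 2" "?T (?T p) \<in> bipunctured 2 2" "?T (?T (?T p)) \<in> bipunctured 2 2" "?T (?T (?T (?T p))) = p"
      by (auto simp: bipunctured_22)
    show "T4 y \<in> points P1P1" unfolding p(2) T4_class4[OF p(1)] points_biprojective by (rule quotientI[OF T(1)])
    have "T4 (T4 (T4 (T4 y))) = y"
      unfolding p(2) T4_class4[OF p(1)] T4_class4[OF T(1)] T4_class4[OF T(2)] T4_class4[OF T(3)] T(4) ..
    then show "(T4 ^^ 4) y = y" by (simp add: numeral_eq_Suc)
  qed
  show thesis
  proof (rule cyclic_plane_chart[where X = P1P1 and T = T4 and k = 4 and M = "class4 ` \<Omega>" and \<Phi> = \<Phi> and \<Omega> = \<Omega> and n = 4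
        and \<kappa> = class4 and F = F and \<O> = ?O and \<sigma> = section_V and R = R_V and \<tau> = ?T and B = "\<lambda>p. ?u p / ?v p"
        and \<zeta> = "- \<i>" and D = "chazy_field chazy_V" and \<delta> = field4 and E = E4])
    show "ringed P1P1" "irreducible_variety P1P1" by (fact ringed_biprojective_space irreducible_P1P1)+
    show "T4 y \<in> points P1P1" "(T4 ^^ 4) y = y" if "y \<in> points P1P1" for y by (fact T4p[OF that])+
    show "morphism (subvariety (affine_space 4) \<Omega>) P1P1 class4" by (rule morphism_class4[OF \<Omega>S])
    show "?O \<noteq> {}"
    proof -
      have "[1, 3] \<in> ?O" by (simp add: region_def R_V_def H_V_def)
      then show ?thesis by blast
    qed
    show "(\<lambda>p. section_V p ! i) \<in> polyfun 3" if "i < 4" for i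
      using less_4_cases[OF that]
      by (elim disjE; simp add: section_V_def Let_def)
        (intro polyfun.add polyfun.mult polyfun_diff polyfun_power polyfun.const coord_polyfun)+
    show "?T p \<in> \<Omega> \<and> T4 (class4 p) = class4 (?T p) \<and> F (?T p) = F p \<and> ?u (?T p) / ?v (?T p) = - \<i> * (?u p / ?v p)"
      if p: "p \<in> \<Omega>" for p
    proof -
      have ii: "\<i>\<^sup>2 = -1" by simp
      have e: "?u (?T p) = \<i> * ?u p" "?v (?T p) = \<i> * (\<i> * ?v p)" "?w (?T p) = \<i> * (\<i>\<^sup>2 * ?w p)" "?z (?T p) = \<i> * (\<i> ^ 3 * ?z p)"
        by (simp_all add: algebra_simps power3_eq_cube)
      \<comment> \<open>The eigenvalues of the four arguments are \<open>\<i>\<close>,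
        \<open>\<i>^2\<close>, \<open>\<i>^3\<close>, \<open>\<i>^4\<close>: a common factor
        \<open>\<i>\<close> and a rescaling of time by \<open>\<i>\<close>.\<close>
      have F: "F (?T p) = F p" unfolding F_def e by (rule chazy_coords_scale) simp_all
      have "?T p \<in> \<Omega>" by (rule \<Omega>I; (unfold e F)?) (use \<Omega>D[OF p] in simp_all)
      moreover have quot: "\<i> * a / (\<i> * (\<i> * b)) = - \<i> * (a / b)" for a b
        by (cases "b = 0") (simp_all add: field_simps)
      have "?u (?T p) / ?v (?T p) = - \<i> * (?u p / ?v p)" unfolding e(1,2) by (rule quot)
      ultimately show ?thesis using F T4_class4[of p] \<Omega>S p by blast
    qed
    show "\<exists>j. x = (- \<i>) ^ j" if "x ^ 4 = 1" for x
    proof -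
      have ii: "\<i>\<^sup>2 = -1" by simp
      have "(x - 1) * (x + \<i>) * (x + 1) * (x - \<i>) = 0" using that ii by algebra
      then have "x = (- \<i>) ^ 0 \<or> x = (- \<i>) ^ 1 \<or> x = (- \<i>) ^ 2 \<or> x = (- \<i>) ^ 3"
        by (auto simp: eq_neg_iff_add_eq_0 power3_eq_cube)
      then show ?thesis by blast
    qed
    show "class4 (section_V [s, t, ?u p / ?v p]) = class4 p" if p: "p \<in> \<Omega>" "F p = [s, t]" for p s t
    proof -
      note nz = \<Omega>D[OF p(1)]
      have m: "1 - s = ?u p * ?w p / ?v p ^ 2" and n: "t + 1 - 3 * s = ?u p ^ 2 * ?z p / ?v p ^ 3"
        using p(2) by (auto simp: F_def chazy_coords_def)
      have c0: "u\<^sup>2 * z / v ^ 3 + x * (u * w / v\<^sup>2) * (u / v) + y * (u / v)\<^sup>2 + a * (u / v) ^ 3 = u\<^sup>2 / v ^ 3 * (z + x * w + y * v + a * u)"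
        if "v \<noteq> 0" for u v w z x y a :: complex
        using that by (simp add: field_simps power2_eq_square power3_eq_cube)
      let ?k = "?u p ^ 2 / ?v p ^ 3"
      have ii: "\<i>\<^sup>2 = -1" by simp
      have k: "?z p + 1 * ?w p + 1 * ?v p + 1 * ?u p = 4 * ?e0 p" "?z p + (- \<i>) * ?w p + (- 1) * ?v p + \<i> * ?u p = 4 * ?e1 p"
        "?z p + \<i> * ?w p + (- 1) * ?v p + (- \<i>) * ?u p = 4 * ?e3 p"
        by (simp_all add: algebra_simps)
      note c = c0[OF nz(2), of "?u p" "?z p" _ "?w p"]
      have sec: "section_V [s, t, b] = [(t + 1 - 3 * s) + 1 * (1 - s) * b + 1 * b\<^sup>2 + 1 * b ^ 3,
          (t + 1 - 3 * s) + - \<i> * (1 - s) * b + - 1 * b\<^sup>2 + \<i> * b ^ 3,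
          (t + 1 - 3 * s) + 1 * (1 - s) * b + 1 * b\<^sup>2 + 1 * b ^ 3,
          (t + 1 - 3 * s) + \<i> * (1 - s) * b + - 1 * b\<^sup>2 + - \<i> * b ^ 3]" for b
        by (simp add: section_V_def Let_def)
      have S: "section_V [s, t, ?u p / ?v p] = [?k * (4 * ?e0 p), ?k * (4 * ?e1 p), ?k * (4 * ?e0 p), ?k * (4 * ?e3 p)]"
        unfolding k[symmetric] c[symmetric] m[symmetric] n[symmetric] by (rule sec)
      have nk: "u\<^sup>2 / v ^ 3 * 4 \<noteq> 0" if "u \<noteq> 0" "v \<noteq> 0" for u v :: complex using that by simp
      define l where "l = ?k * 4"
      have l: "l \<noteq> 0" unfolding l_def by (rule nk[OF nz(1,2)])
      have S': "section_V [s, t, ?u p / ?v p] = [l * ?e0 p, l * ?e1 p, l * ?e0 p, l * ?e3 p]"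
        unfolding S l_def mult.assoc ..
      \<comment> \<open>With \<open>e0 = X0 Y0\<close>, \<open>e1 = X1 Y0\<close> and
        \<open>e3 = X0 Y1\<close>, the first pair is \<open>(X0, X1)\<close> scaled by
        \<open>l Y0\<close> and the second is \<open>(Y0, Y1)\<close> scaled by
        \<open>l X0\<close>.\<close>
      have "section_V [s, t, ?u p / ?v p] =
          [(l * p ! 2) * p ! 0, (l * p ! 2) * p ! 1, (l * p ! 0) * p ! 2, (l * p ! 0) * p ! 3]"
        unfolding S' by (simp add: mult_ac)
      also have "class4 \<dots> = class4 p"
        by (rule class4_eq) (use nz(3-6) l p(1) \<Omega>S in auto)
      finally show ?thesis .
    qed
    show "chazy_field chazy_V q ! 0 \<noteq> 0" if "q \<in> ?O" for q using that by (auto simp: region_def chazy_field_def)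
    show "R_V q \<noteq> 0" if "q \<in> ?O" for q using that by (auto simp: region_def)
    show "\<exists>c. c \<noteq> 0 \<and> (\<forall>i<2. ((\<lambda>t. F (map2 (\<lambda>a b. a + t * b) p (field4 p)) ! i)
         has_field_derivative c * chazy_field chazy_V (F p) ! i) (at 0))" if p: "p \<in> \<Omega>" for p
    proof -
      obtain x y z w where xyz: "p = [x, y, z, w]" using \<Omega>D(8)[OF p] by (auto simp: length_4)
      let ?l = "\<lambda>t. map2 (\<lambda>a b. a + t * b) p (field4 p)"
      note nz = \<Omega>D(1,2)[OF p]
      have l0: "?l 0 = p" by (simp add: xyz field4_def)
      have ii: "\<i>\<^sup>2 = -1" by simp
      have m: "((\<lambda>t. (a + t * (c * a)) * (b + t * (d * b))) has_field_derivative (c + d) * (a * b)) (at 0)" for a b c d :: complex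
        by (auto intro!: derivative_eq_intros simp: algebra_simps)
      have E: "((\<lambda>t. ?e0 (?l t)) has_field_derivative ?e0 p) (at 0)" "((\<lambda>t. ?e1 (?l t)) has_field_derivative - \<i> * ?e1 p) (at 0)"
        "((\<lambda>t. ?e2 (?l t)) has_field_derivative - ?e2 p) (at 0)" "((\<lambda>t. ?e3 (?l t)) has_field_derivative \<i> * ?e3 p) (at 0)"
        using m[of x "(1 + \<i>) / 2" z "(1 - \<i>) / 2"] m[of y "- (1 + \<i>) / 2" z "(1 - \<i>) / 2"]
          m[of y "- (1 + \<i>) / 2" w "- (1 - \<i>) / 2"] m[of x "(1 + \<i>) / 2" w "- (1 - \<i>) / 2"]
        unfolding xyz field4_def by (simp_all add: field_simps)
      have lin: "((\<lambda>t. a * ?e0 (?l t) + b * ?e1 (?l t) + c * ?e2 (?l t) + d * ?e3 (?l t)) has_field_derivative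
          a * ?e0 p + b * (- \<i> * ?e1 p) + c * (- ?e2 p) + d * (\<i> * ?e3 p)) (at 0)" for a b c d
        by (intro DERIV_add DERIV_cmult E)
      have d: "((\<lambda>t. ?u (?l t)) has_field_derivative ?v p) (at 0)" "((\<lambda>t. ?v (?l t)) has_field_derivative ?w p) (at 0)"
        "((\<lambda>t. ?w (?l t)) has_field_derivative ?z p) (at 0)" "((\<lambda>t. ?z (?l t)) has_field_derivative ?u p) (at 0)"
        using lin[of 1 "- \<i>" "- 1" "\<i>"] lin[of 1 "- 1" 1 "- 1"] lin[of 1 "\<i>" "- 1" "- \<i>"] lin[of 1 1 1 1]
        by (simp_all add: algebra_simps)
      have g: "u ^ 3 * u / v ^ 4 = 2 * (u\<^sup>2 * z / v ^ 3) - (u * w / v\<^sup>2)\<^sup>2" if "v \<noteq> 0" "u\<^sup>2 + w\<^sup>2 = 2 * v * z" for u v w z :: complex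
      proof -
        have "2 * (u\<^sup>2 * z / v ^ 3) - (u * w / v\<^sup>2)\<^sup>2 = u\<^sup>2 * (2 * v * z - w\<^sup>2) / v ^ 4"
          using that(1) by (simp add: field_simps power2_eq_square power3_eq_cube power4_eq_xxxx)
        also have "\<dots> = u ^ 3 * u / v ^ 4" unfolding that(2)[symmetric] by (simp add: power2_eq_square power3_eq_cube)
        finally show ?thesis by simp
      qed
      have K: "?u p ^ 3 * ?u p / ?v p ^ 4 = 2 * (?u p ^ 2 * ?z p / ?v p ^ 3) - (?u p * ?w p / ?v p ^ 2) ^ 2"
        by (rule g[OF nz(2)]) (use ii in algebra)
      have dF: "((\<lambda>t. F (?l t) ! i) has_field_derivative - ?v p / ?u p * chazy_field chazy_V (F p) ! i) (at 0)" if "i < 2" for i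
        unfolding F_def
        by (rule chazy_coords_derivative[where P = chazy_V and K = "\<lambda>m n. 2 * n - m\<^sup>2", OF d _ _ _ _ nz chazy_V_relation K that])
          (simp_all only: l0)
      have "- ?v p / ?u p \<noteq> 0" using nz by (metis divide_eq_0_iff neg_equal_0_iff_equal)
      then show ?thesis using dF by blast
    qed
    show "w f (class4 p) * dir_deriv (g \<circ> class4) p (field4 p) = w g (class4 p) * dir_deriv (f \<circ> class4) p (field4 p)"
      if A: "w \<in> E4 V" "p \<in> \<Omega>" "class4 p \<in> V" "openin (zar P1P1) N" "class4 p \<in> N" "f \<in> reg P1P1 N" "g \<in> reg P1P1 N" for V w p N f g
    proof -
      obtain x0 x1 y0 y1 where p: "p = [x0, x1, y0, y1]" using \<Omega>D(8)[OF A(2)] by (auto simp: length_4)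
      show ?thesis by (rule E4_parallel[OF A(1) p _ _ _ _ A(3-7)]) (use \<Omega>D(3-6)[OF A(2)] p in simp_all)
    qed
    show "\<exists>V w. openin (zar P1P1) V \<and> class4 p \<in> V \<and> w \<in> E4 V \<and>
      (\<forall>N f. openin (zar P1P1) N \<and> class4 p \<in> N \<and> f \<in> reg P1P1 N \<longrightarrow> w f (class4 p) = dir_deriv (f \<circ> class4) p (field4 p))"
      if "p \<in> \<Omega>" for p
      using E4_field E4_field_eq \<Omega>S that openin_topspace[of "zar P1P1"]
      by (intro exI[of _ "points P1P1"] exI[of _ "descended_field ?r field4"]) (auto simp: points_biprojective intro: quotientI)
    show "plane_chart X4 (quotient_foliation P1P1 (cyclic_rel P1P1 T4) E4) (chazy_field chazy_V) V ?O \<phi> \<psi> \<Longrightarrow> thesis"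
      for V \<phi> \<psi> by (rule that)
  qed (use \<Phi> \<Omega> O polyfun_V plane_field_V lift inF in \<open>auto simp: \<Omega>_def\<close>)
qed

section \<open>The blown-up plane and the quotient of order six\<close>

lemma nth_Cons_45 [simp]: "(x # xs) ! 4 = xs ! 3" "(x # xs) ! 5 = xs ! 4"
  by (simp_all add: numeral_eq_Suc)

lemma length_6: "length p = 6 \<longleftrightarrow> (\<exists>x y z a b c. p = [x, y, z, a, b, c])"
  by (auto simp: numeral_eq_Suc length_Suc_conv)

lemma less_6_cases: "i < 6 \<Longrightarrow> i = 0 \<or> i = 1 \<or> i = 2 \<or> i = 3 \<or> i = 4 \<or> i = (5::nat)" by linarith

lemma bipunctured_33:
  "[x, y, z, a, b, c] \<in> bipunctured 3 3 \<longleftrightarrow> (x \<noteq> 0 \<or> y \<noteq> 0 \<or> z \<noteq> 0) \<and> (a \<noteq> 0 \<or> b \<noteq> 0 \<or> c \<noteq> 0)"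
  by (auto simp: bipunctured_def numeral_3_eq_3)

lemma bipunctured_33_cases:
  assumes p: "p \<in> bipunctured 3 3"
  obtains x y z a b c where "p = [x, y, z, a, b, c]" "x \<noteq> 0 \<or> y \<noteq> 0 \<or> z \<noteq> 0" "a \<noteq> 0 \<or> b \<noteq> 0 \<or> c \<noteq> 0"
proof -
  have "length p = 6" using p by (simp add: bipunctured_def)
  then obtain x y z a b c where e: "p = [x, y, z, a, b, c]" by (auto simp: length_6)
  with p bipunctured_33[of x y z a b c] that show ?thesis by blast
qed

lemma bipunctured_33_ex:
  "p \<in> bipunctured 3 3 \<Longrightarrow> \<exists>x y z a b c. p = [x, y, z, a, b, c] \<and> (x \<noteq> 0 \<or> y \<noteq> 0 \<or> z \<noteq> 0) \<and> (a \<noteq> 0 \<or> b \<noteq> 0 \<or> c \<noteq> 0)"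
  by (erule bipunctured_33_cases) blast

abbreviation class6 :: "complex list \<Rightarrow> complex list set" where
  "class6 p \<equiv> biscaling_rel 3 3 `` {p}"

lemma biscaling_rel_33: "(p, p') \<in> biscaling_rel 3 3 \<longleftrightarrow> p \<in> bipunctured 3 3 \<and>
   (\<exists>c d. c \<noteq> 0 \<and> d \<noteq> 0 \<and> p' = [c * p ! 0, c * p ! 1, c * p ! 2, d * p ! 3, d * p ! 4, d * p ! 5])"
proof -
  have "map ((*) c) (take 3 p) @ map ((*) d) (drop 3 p) = [c * p ! 0, c * p ! 1, c * p ! 2, d * p ! 3, d * p ! 4, d * p ! 5]"
    if p: "p \<in> bipunctured 3 3" for c d
    using p by (elim bipunctured_33_cases) (simp add: numeral_3_eq_3 numeral_2_eq_2 numeral_eq_Suc One_nat_def)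
  then show ?thesis unfolding biscaling_rel_iff by metis
qed

lemma class6_iff: "q \<in> bipunctured 3 3 \<Longrightarrow> x \<in> class6 q \<longleftrightarrow>
   (\<exists>c d. c \<noteq> 0 \<and> d \<noteq> 0 \<and> x = [c * q ! 0, c * q ! 1, c * q ! 2, d * q ! 3, d * q ! 4, d * q ! 5])"
  unfolding Image_singleton_iff biscaling_rel_33 by blast

lemma class6_eq: "c \<noteq> 0 \<Longrightarrow> d \<noteq> 0 \<Longrightarrow> p \<in> bipunctured 3 3 \<Longrightarrow>
    class6 [c * p ! 0, c * p ! 1, c * p ! 2, d * p ! 3, d * p ! 4, d * p ! 5] = class6 p"
  using equiv_class_eq[OF equiv_biscaling_rel, of p "[c * p ! 0, c * p ! 1, c * p ! 2, d * p ! 3, d * p ! 4, d * p ! 5]" 3 3]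
  by (metis biscaling_rel_33)

lemma affine_open_33: "affine_open 6 (bipunctured 3 3)"
  using affine_open_bipunctured[of 3 3] by simp

lemma biprojective_33_eq:
  "biprojective_space 3 3 = quotient_variety (subvariety (affine_space 6) (bipunctured 3 3)) (biscaling_rel 3 3)"
  unfolding biprojective_space_eq by simp

section \<open>The blown-up plane as an incidence surface\<close>

definition incident :: "complex list \<Rightarrow> bool" where
  "incident p \<longleftrightarrow> p ! 0 * p ! 3 = p ! 1 * p ! 4 \<and> p ! 1 * p ! 4 = p ! 2 * p ! 5"

lemma class6_incident:
  assumes q: "q \<in> bipunctured 3 3"
  shows "(\<forall>p\<in>class6 q. p ! 0 * p ! 3 = p ! 1 * p ! 4 \<and> p ! 1 * p ! 4 = p ! 2 * p ! 5) \<longleftrightarrow> incident q"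
proof
  assume "\<forall>p\<in>class6 q. p ! 0 * p ! 3 = p ! 1 * p ! 4 \<and> p ! 1 * p ! 4 = p ! 2 * p ! 5"
  then show "incident q" unfolding incident_def using equiv_class_self[OF equiv_biscaling_rel q] by blast
next
  assume i: "incident q"
  show "\<forall>p\<in>class6 q. p ! 0 * p ! 3 = p ! 1 * p ! 4 \<and> p ! 1 * p ! 4 = p ! 2 * p ! 5"
  proof
    fix p assume "p \<in> class6 q"
    then obtain c d where "p = [c * q ! 0, c * q ! 1, c * q ! 2, d * q ! 3, d * q ! 4, d * q ! 5]"
      unfolding class6_iff[OF q] by blast
    moreover have "c * u * (d * v) = c * d * (u * v)" for u v by simp
    ultimately show "p ! 0 * p ! 3 = p ! 1 * p ! 4 \<and> p ! 1 * p ! 4 = p ! 2 * p ! 5"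
      using i by (simp add: incident_def)
  qed
qed

lemma points_Bl3: "points Bl3 = class6 ` {q \<in> bipunctured 3 3. incident q}"
proof -
  have "P \<in> points (biprojective_space 3 3) \<longleftrightarrow> (\<exists>q\<in>bipunctured 3 3. P = class6 q)" for P
    unfolding points_biprojective by (auto simp: quotient_def)
  moreover have "P \<in> points Bl3 \<longleftrightarrow> P \<in> points (biprojective_space 3 3) \<and>
      (\<forall>p\<in>P. p ! 0 * p ! 3 = p ! 1 * p ! 4 \<and> p ! 1 * p ! 4 = p ! 2 * p ! 5)" for P
    unfolding Bl3_def points_subvariety by blast
  ultimately have "P \<in> points Bl3 \<longleftrightarrow> (\<exists>q\<in>bipunctured 3 3. incident q \<and> P = class6 q)" for P
    using class6_incident by metis
  then show ?thesis by blast
qed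

lemma ringed_Bl3: "ringed Bl3"
  unfolding Bl3_def by (intro ringed_subvariety ringed_biprojective_space)


lemma morphism_Bl3:
  assumes \<Omega>: "affine_open n \<Omega>" and f: "\<And>i. i < 6 \<Longrightarrow> (\<lambda>p. f p ! i) \<in> polyfun n" "\<And>p. length (f p) = 6"
    and S: "\<And>p. p \<in> \<Omega> \<Longrightarrow> f p \<in> bipunctured 3 3 \<and> incident (f p)"
  shows "morphism (subvariety (affine_space n) \<Omega>) Bl3 (\<lambda>p. class6 (f p))"
proof -
  let ?X = "subvariety (affine_space n) \<Omega>"
  have pt: "points ?X = \<Omega>" by (rule points_affine_subvariety[OF \<Omega>])
  have X: "ringed ?X" by (intro ringed_subvariety ringed_affine_space)
  have "morphism ?X (affine_space 6) f"
  proof (rule morphism_affine[OF X f(2)])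
    fix i :: nat assume "i < 6"
    from polyfun_reg[OF affine_open_length[OF \<Omega>] f(1)[OF this]]
    show "(\<lambda>p. f p ! i) \<in> reg ?X (points ?X)" unfolding pt reg_affine_subvariety[OF \<Omega>] .
  qed
  then have "morphism ?X (subvariety (affine_space 6) (bipunctured 3 3)) f"
    by (intro morphism_into_subvariety X ringed_affine_space) (use S pt in simp_all)
  from morphism_compose[OF this morphism_quotient[of _ "biscaling_rel 3 3"]]
  have "morphism ?X (biprojective_space 3 3) (\<lambda>p. class6 (f p))"
    unfolding biprojective_33_eq by (simp add: comp_def)
  then show ?thesis unfolding Bl3_def
  proof (rule morphism_into_subvariety[OF X ringed_biprojective_space])
    fix p assume "p \<in> points ?X"
    then have "class6 (f p) \<in> points Bl3" using S unfolding pt points_Bl3 by blast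
    then show "class6 (f p) \<in> {P \<in> points (biprojective_space 3 3).
        \<forall>p\<in>P. p ! 0 * p ! 3 = p ! 1 * p ! 4 \<and> p ! 1 * p ! 4 = p ! 2 * p ! 5}"
      unfolding Bl3_def points_subvariety by blast
  qed
qed

text \<open>Cox coordinates: sections of the three lines and of the three exceptional curves.\<close>

definition cox_map :: "complex list \<Rightarrow> complex list" where
  "cox_map p = [p ! 0 * p ! 4 * p ! 5, p ! 1 * p ! 3 * p ! 5, p ! 2 * p ! 3 * p ! 4,
     p ! 3 * p ! 1 * p ! 2, p ! 4 * p ! 0 * p ! 2, p ! 5 * p ! 0 * p ! 1]"

text \<open>The second triple matters only up to a scalar, so the Cox map may hit it up to the
  factor \<open>d\<close>; this leaves room for explicit witnesses in all boundary cases.\<close>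

definition has_cox :: "complex \<Rightarrow> complex \<Rightarrow> complex \<Rightarrow> complex \<Rightarrow> complex \<Rightarrow> complex \<Rightarrow> bool" where
  "has_cox x y z a b c \<longleftrightarrow> (\<exists>p d. length p = 6 \<and> d \<noteq> 0 \<and> cox_map p = [x, y, z, d * a, d * b, d * c])"

lemma has_coxI:
  "x = l1 * e2 * e3 \<Longrightarrow> y = l2 * e1 * e3 \<Longrightarrow> z = l3 * e1 * e2 \<Longrightarrow> d * a = e1 * l2 * l3 \<Longrightarrow> d * b = e2 * l1 * l3 \<Longrightarrow>
    d * c = e3 * l1 * l2 \<Longrightarrow> d \<noteq> 0 \<Longrightarrow> has_cox x y z a b c"
  unfolding has_cox_def by (intro exI[of _ "[l1, l2, l3, e1, e2, e3]"] exI[of _ d]) (simp add: cox_map_def)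

text \<open>The Cox map is symmetric under simultaneous rotation of all triples, which reduces
  surjectivity to nonzero \<open>x\<close>.\<close>

lemma has_cox_rotate: "has_cox y z x b c a \<Longrightarrow> has_cox x y z a b c"
proof -
  assume "has_cox y z x b c a"
  then obtain p d where p: "length p = 6" "d \<noteq> 0" "cox_map p = [y, z, x, d * b, d * c, d * a]" unfolding has_cox_def by blast
  obtain l2 l3 l1 e2 e3 e1 where "p = [l2, l3, l1, e2, e3, e1]" using p(1) by (auto simp: length_6)
  with p(2,3) show ?thesis
    by (intro has_coxI[of x l1 e2 e3 y l2 e1 z l3 d a b c]) (auto simp: cox_map_def mult_ac)
qed

text \<open>If \<open>a\<close> is nonzero, all coordinates are, and the point lies over the torus.
  If \<open>a = 0\<close>, both \<open>y b\<close> and \<open>z c\<close> vanish, and the cases are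
  the boundary strata where \<open>x\<close> is nonzero; each witness sets the Cox coordinates of
  the curves through the point to 0.\<close>

lemma has_cox_x:
  assumes "x \<noteq> 0" "a \<noteq> 0 \<or> b \<noteq> 0 \<or> c \<noteq> 0" "x * a = y * b" "y * b = z * c"
  shows "has_cox x y z a b c"
proof (cases "a = 0")
  case False
  then have nz: "y \<noteq> 0" "b \<noteq> 0" "z \<noteq> 0" "c \<noteq> 0" using assms by auto
  have "y * z / a * b = x * z" "y * z / a * c = x * y" using assms(3,4) False by (simp_all add: field_simps)
  then show ?thesis
    by (intro has_coxI[of x x 1 1 y y 1 z z "y * z / a" a b c]) (use nz False in simp_all)
next
  case a: True
  then have 0: "y * b = 0" "z * c = 0" using assms by auto
  show ?thesis
  proof (cases "y = 0")
    case y: True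
    show ?thesis
    proof (cases "z = 0")
      case True
      then show ?thesis
        by (intro has_coxI[of x x 1 1 y "c / x" 0 z "b / x" 1 a b c]) (use a y assms(1) in simp_all)
    next
      case False
      then have "c = 0" "b \<noteq> 0" using 0 a assms(2) by auto
      then show ?thesis
        by (intro has_coxI[of x 1 1 x y 0 "z / b" z b 1 a b c]) (use a y in simp_all)
    qed
  next
    case False
    then have "b = 0" "c \<noteq> 0" "z = 0" using 0 a assms(2) by auto
    then show ?thesis
      by (intro has_coxI[of x 1 x 1 y c "y / c" z 0 1 a b c]) (use a in simp_all)
  qed
qed

text \<open>The Cox map followed by the class is a surjection from an open part of affine six-space,
  so irreducibility is inherited.\<close>

lemma irreducible_Bl3: "irreducible_variety Bl3"
proof -
  have pol: "(\<lambda>p. cox_map p ! i) \<in> polyfun 6" if "i < 6" for i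
    using less_6_cases[OF that] by (elim disjE; simp add: cox_map_def; intro polyfun.mult polyfun.coord) simp_all
  let ?\<Omega> = "{p. length p = 6 \<and> cox_map p \<in> bipunctured 3 3}"
  have A: "openin (zar (affine_space 6)) {p. length p = 6}" using openin_topspace[of "zar (affine_space 6)"] by simp
  have "openin (zar (affine_space 6)) {p \<in> {p. length p = 6}. cox_map p \<in> bipunctured 3 3}"
    by (rule open_preimage[OF ringed_affine_space A _ _ affine_open_33])
      (simp add: cox_map_def, rule polyfun_reg[OF _ pol], simp_all)
  then have \<Omega>: "affine_open 6 ?\<Omega>" by (simp add: openin_affine)
  show ?thesis
  proof (rule irreducible_variety_image[OF morphism_Bl3[OF \<Omega> pol] \<Omega>])
    show "length (cox_map p) = 6" for p by (simp add: cox_map_def)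
    show "cox_map p \<in> bipunctured 3 3 \<and> incident (cox_map p)" if "p \<in> ?\<Omega>" for p
      using that by (simp add: incident_def cox_map_def mult_ac)
    fix P assume "P \<in> points Bl3"
    then obtain q where q: "q \<in> bipunctured 3 3" "incident q" "P = class6 q" unfolding points_Bl3 by blast
    obtain x y z a b c where e: "q = [x, y, z, a, b, c]" "x \<noteq> 0 \<or> y \<noteq> 0 \<or> z \<noteq> 0" "a \<noteq> 0 \<or> b \<noteq> 0 \<or> c \<noteq> 0"
      using bipunctured_33_ex[OF q(1)] by blast
    have i: "x * a = y * b" "y * b = z * c" using q(2) by (simp_all add: incident_def e)
    have i': "z * c = x * a" using i by simp
    have "has_cox x y z a b c"
    proof -
      consider "x \<noteq> 0" | "y \<noteq> 0" | "z \<noteq> 0" using e(2) by blast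
      then show ?thesis
      proof cases
        case 1
        show ?thesis by (rule has_cox_x[OF 1 e(3) i])
      next
        case 2
        have "has_cox y z x b c a" by (rule has_cox_x[OF 2 _ i(2) i']) (use e(3) in blast)
        then show ?thesis by (rule has_cox_rotate)
      next
        case 3
        have "has_cox z x y c a b" by (rule has_cox_x[OF 3 _ i' i(1)]) (use e(3) in blast)
        then show ?thesis by (rule has_cox_rotate[OF has_cox_rotate])
      qed
    qed
    then obtain p d where p: "length p = 6" "d \<noteq> 0" "cox_map p = [x, y, z, d * a, d * b, d * c]"
      unfolding has_cox_def by blast
    have "class6 (cox_map p) = P" using class6_eq[of 1 d q] p(2,3) q(1,3) e(1) by simp
    moreover have "cox_map p \<in> bipunctured 3 3" using p(2,3) e by (simp add: bipunctured_33)
    ultimately show "\<exists>p\<in>?\<Omega>. class6 (cox_map p) = P" using p(1) by blast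
  qed
qed

section \<open>The blow-down and its inverse over the torus\<close>

lemma morphism_from_quotient:
  assumes "morphism X Z (\<lambda>x. \<psi> (r `` {x}))"
  shows "morphism (quotient_variety X r) Z \<psi>"
proof (rule morphismI)
  let ?Y = "quotient_variety X r"
  have pre: "{x \<in> points X. r `` {x} \<in> {y \<in> points ?Y. \<psi> y \<in> V}} = {x \<in> points X. \<psi> (r `` {x}) \<in> V}" for V
    by (auto simp: points_quotient_variety intro: quotientI)
  show "\<psi> y \<in> points Z" if "y \<in> points ?Y" for y
    using that morphism_points[OF assms] by (auto simp: points_quotient_variety elim!: quotientE)
  show "openin (zar ?Y) {y \<in> points ?Y. \<psi> y \<in> V}" if "openin (zar Z) V" for V
    using morphism_open[OF assms that] unfolding openin_quotient_variety pre by (auto simp: points_quotient_variety)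
  show "f \<circ> \<psi> \<in> reg ?Y {y \<in> points ?Y. \<psi> y \<in> V}" if "openin (zar Z) V" "f \<in> reg Z V" for V f
    using morphism_reg[OF assms that] unfolding reg_quotient_variety pre by (simp add: comp_def)
qed

lemma blow_down_class6:
  assumes p: "p \<in> bipunctured 3 3"
  shows "blow_down (class6 p) = class3 [p ! 0, p ! 1, p ! 2]"
proof -
  obtain x y z a b c where e: "p = [x, y, z, a, b, c]" "x \<noteq> 0 \<or> y \<noteq> 0 \<or> z \<noteq> 0"
    using bipunctured_33_ex[OF p] by blast
  have t: "take 3 [x, y, z, a, b, c] = [x, y, z]" for x y z a b c :: complex by (simp add: numeral_3_eq_3)
  have "[x, y, z] \<in> punctured 3" using e(2) by (simp add: punctured_3)
  then have "class3 [x, y, z] = {[k * x, k * y, k * z] | k. k \<noteq> 0}" by (auto simp: weighted_rel_111)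
  moreover have "blow_down (class6 p) = {[k * x, k * y, k * z] | k. k \<noteq> 0}"
  proof (intro equalityI subsetI)
    fix q assume "q \<in> blow_down (class6 p)"
    then obtain r where "r \<in> class6 p" "q = take 3 r" by (auto simp: blow_down_def)
    then show "q \<in> {[k * x, k * y, k * z] | k. k \<noteq> 0}"
      unfolding class6_iff[OF p] by (auto simp: e(1) t)
  next
    fix q assume "q \<in> {[k * x, k * y, k * z] | k. k \<noteq> 0}"
    then obtain k where k: "k \<noteq> 0" "q = [k * x, k * y, k * z]" by blast
    have "[k * x, k * y, k * z, 1 * a, 1 * b, 1 * c] \<in> class6 p"
      unfolding class6_iff[OF p] by (intro exI[of _ k] exI[of _ 1]) (simp add: e(1) k(1))
    then have "take 3 [k * x, k * y, k * z, 1 * a, 1 * b, 1 * c] \<in> blow_down (class6 p)"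
      unfolding blow_down_def by (rule imageI)
    then show "q \<in> blow_down (class6 p)" unfolding t k(2) .
  qed
  ultimately show ?thesis by (simp add: e(1))
qed

lemma morphism_blow_down: "morphism Bl3 P2 blow_down"
proof -
  let ?X = "subvariety (affine_space 6) (bipunctured 3 3)"
  let ?f = "\<lambda>p. [p ! 0, p ! 1, p ! 2]"
  have pt: "points ?X = bipunctured 3 3" by (rule points_affine_subvariety[OF affine_open_33])
  have X: "ringed ?X" by (intro ringed_subvariety ringed_affine_space)
  have "morphism ?X (affine_space 3) ?f"
  proof (rule morphism_affine[OF X])
    fix i :: nat assume "i < 3"
    then have "i = 0 \<or> i = 1 \<or> i = 2" by linarith
    then have "(\<lambda>p. ?f p ! i) \<in> polyfun 6" by (elim disjE) (simp_all add: polyfun.coord)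
    from polyfun_reg[OF affine_open_length[OF affine_open_33] this]
    show "(\<lambda>p. ?f p ! i) \<in> reg ?X (points ?X)" unfolding pt reg_affine_subvariety[OF affine_open_33] .
  qed simp
  then have "morphism ?X (subvariety (affine_space 3) (punctured 3)) ?f"
  proof (rule morphism_into_subvariety[OF X ringed_affine_space])
    fix p assume "p \<in> points ?X"
    then show "?f p \<in> punctured 3" unfolding pt by (elim bipunctured_33_cases) (simp add: punctured_3)
  qed
  from morphism_compose[OF this morphism_class3[OF order_refl]]
  have "morphism ?X P2 (\<lambda>p. class3 (?f p))" by (simp add: comp_def)
  then have "morphism ?X P2 (\<lambda>p. blow_down (class6 p))"
    by (rule morphism_cong[OF X]) (simp add: pt blow_down_class6)
  then have "morphism (biprojective_space 3 3) P2 blow_down"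
    unfolding biprojective_33_eq by (rule morphism_from_quotient)
  then show ?thesis unfolding Bl3_def by (rule morphism_restrict[OF ringed_biprojective_space])
qed

definition torus :: "complex list set" where
  "torus = {p. length p = 3 \<and> p ! 0 * p ! 1 * p ! 2 \<noteq> 0}"

definition graph_point :: "complex list \<Rightarrow> complex list" where
  "graph_point p = [p ! 0, p ! 1, p ! 2, p ! 1 * p ! 2, p ! 2 * p ! 0, p ! 0 * p ! 1]"

abbreviation lift6 :: "complex list \<Rightarrow> complex list set" where
  "lift6 p \<equiv> class6 (graph_point p)"

lemma affine_open_torus: "affine_open 3 torus"
  unfolding torus_def by (rule affine_open_basic) (intro polyfun.mult coord_polyfun)

lemma torus_punctured: "torus \<subseteq> punctured 3"
  by (auto simp: torus_def length_3 punctured_3)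

lemma graph_point_torus: "p \<in> torus \<Longrightarrow> graph_point p \<in> bipunctured 3 3 \<and> incident (graph_point p)"
  by (auto simp: torus_def graph_point_def bipunctured_33 incident_def)

lemma morphism_lift6: "affine_open 3 \<Omega> \<Longrightarrow> \<Omega> \<subseteq> torus \<Longrightarrow> morphism (subvariety (affine_space 3) \<Omega>) Bl3 lift6"
proof (rule morphism_Bl3)
  show "(\<lambda>p. graph_point p ! i) \<in> polyfun 3" if "i < 6" for i
    using less_6_cases[OF that] by (elim disjE; simp add: graph_point_def; intro polyfun.mult polyfun.coord) simp_all
qed (use graph_point_torus in \<open>auto simp: graph_point_def\<close>)

lemma blow_down_lift6: "p \<in> torus \<Longrightarrow> blow_down (lift6 p) = class3 p"
proof -
  assume p: "p \<in> torus"
  then obtain x y z where e: "p = [x, y, z]" by (auto simp: torus_def length_3)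
  show ?thesis using blow_down_class6 graph_point_torus[OF p] unfolding e graph_point_def by fastforce
qed

lemma torus_scale:
  assumes r: "(p, p') \<in> weighted_rel [1, 1, 1]" and p: "p \<in> torus"
  shows "p' \<in> torus" "lift6 p' = lift6 p"
proof -
  obtain c where c: "c \<noteq> 0" "p' = [c * p ! 0, c * p ! 1, c * p ! 2]" using r unfolding weighted_rel_111 by blast
  show "p' \<in> torus" using p c by (simp add: torus_def)
  have "graph_point p' = [c * graph_point p ! 0, c * graph_point p ! 1, c * graph_point p ! 2,
      c\<^sup>2 * graph_point p ! 3, c\<^sup>2 * graph_point p ! 4, c\<^sup>2 * graph_point p ! 5]"
    by (simp add: graph_point_def c(2) power2_eq_square mult_ac)
  then show "lift6 p' = lift6 p" using class6_eq[of c "c\<^sup>2"] c(1) graph_point_torus[OF p] by simp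
qed

text \<open>When the first triple has no zero entry, the incidence equations determine the second up
  to a scalar, and the graph of the quadratic map provides a solution.\<close>

lemma lift6_surj:
  assumes x: "x \<in> points Bl3" and p: "p \<in> torus" "blow_down x = class3 p"
  shows "x = lift6 p"
proof -
  obtain q where q: "q \<in> bipunctured 3 3" "incident q" "x = class6 q" using x unfolding points_Bl3 by blast
  obtain u v w a b c where e: "q = [u, v, w, a, b, c]" "a \<noteq> 0 \<or> b \<noteq> 0 \<or> c \<noteq> 0"
    using bipunctured_33_ex[OF q(1)] by blast
  have "class3 [u, v, w] = class3 p" using blow_down_class6[OF q(1)] p(2) unfolding q(3) by (simp add: e(1))
  moreover have "[u, v, w] \<in> punctured 3" using q(1) by (simp add: e(1) bipunctured_33 punctured_3)
  ultimately have r: "(p, [u, v, w]) \<in> weighted_rel [1, 1, 1]"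
    using eq_equiv_class[OF _ equiv_111] by metis
  note t = torus_scale[OF r p(1)]
  have nz: "u \<noteq> 0" "v \<noteq> 0" "w \<noteq> 0" using t(1) by (auto simp: torus_def)
  have i: "u * a = v * b" "v * b = w * c" using q(2) by (simp_all add: incident_def e(1))
  have a: "a \<noteq> 0" using e(2) i nz by auto
  define d where "d = v * w / a"
  have d: "d \<noteq> 0" "d * a = v * w" "d * b = w * u" "d * c = u * v"
    using nz a i by (simp_all add: d_def field_simps)
  have "class6 q = class6 [1 * q ! 0, 1 * q ! 1, 1 * q ! 2, d * q ! 3, d * q ! 4, d * q ! 5]"
    using class6_eq[of 1 d q] d(1) q(1) by simp
  also have "\<dots> = lift6 [u, v, w]" by (simp add: e(1) graph_point_def d)
  finally show ?thesis using t(2) q(3) by simp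
qed

definition lift_back :: "complex list set \<Rightarrow> complex list set" where
  "lift_back P = lift6 (SOME p. p \<in> P)"

lemma lift_back_class3: "p \<in> torus \<Longrightarrow> lift_back (class3 p) = lift6 p"
proof -
  assume p: "p \<in> torus"
  have "(SOME p'. p' \<in> class3 p) \<in> class3 p"
    by (rule someI[of _ p]) (use equiv_class_self[OF equiv_111] p torus_punctured in blast)
  then have "(p, SOME p'. p' \<in> class3 p) \<in> weighted_rel [1, 1, 1]" by simp
  from torus_scale(2)[OF this p] show ?thesis by (simp add: lift_back_def)
qed

abbreviation torus_P2 :: "complex list set set" where
  "torus_P2 \<equiv> class3 ` torus"

lemma class3_torus: "{p \<in> punctured 3. class3 p \<in> class3 ` \<Omega>} = \<Omega>"
  if "\<Omega> \<subseteq> punctured 3" "\<And>p p'. (p, p') \<in> weighted_rel [1, 1, 1] \<Longrightarrow> p \<in> \<Omega> \<Longrightarrow> p' \<in> \<Omega>"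
proof
  show "{p \<in> punctured 3. class3 p \<in> class3 ` \<Omega>} \<subseteq> \<Omega>"
  proof clarify
    fix p q assume "p \<in> punctured 3" "q \<in> \<Omega>" "class3 p = class3 q"
    then have "(q, p) \<in> weighted_rel [1, 1, 1]" using eq_equiv_class[OF _ equiv_111] by metis
    then show "p \<in> \<Omega>" using that(2) \<open>q \<in> \<Omega>\<close> by blast
  qed
qed (use that in blast)

lemma openin_P2: "openin (zar P2) U \<longleftrightarrow> U \<subseteq> points P2 \<and> affine_open 3 {p \<in> punctured 3. class3 p \<in> U}"
proof -
  have pt: "points (subvariety (affine_space 3) (punctured 3)) = punctured 3"
    by (rule points_affine_subvariety[OF affine_open_punctured])
  have "{p \<in> punctured 3. class3 p \<in> U} \<subseteq> punctured 3" by blast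
  then show ?thesis
    unfolding points_P2 unfolding P2_eq openin_quotient_variety pt openin_affine_subvariety[OF affine_open_punctured] by simp
qed

lemma open_torus_P2: "openin (zar P2) torus_P2"
proof -
  have "{p \<in> punctured 3. class3 p \<in> torus_P2} = torus"
    by (rule class3_torus[OF torus_punctured torus_scale(1)])
  moreover have "torus_P2 \<subseteq> points P2" using torus_punctured by (auto simp: points_P2 intro: quotientI)
  ultimately show ?thesis unfolding openin_P2 using affine_open_torus by simp
qed

definition torus_Bl3 :: "complex list set set" where
  "torus_Bl3 = {x \<in> points Bl3. blow_down x \<in> torus_P2}"

lemma open_torus_Bl3: "openin (zar Bl3) torus_Bl3"
  unfolding torus_Bl3_def by (rule morphism_open[OF morphism_blow_down open_torus_P2])

text \<open>\<open>E6\<close> is pulled back from the plane, so fields on the two surfaces are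
  compared where the blow-down is invertible. Over the torus \<open>lift6\<close> gives the inverse;
  it is constant on classes by \<open>torus_scale\<close>, and therefore descends to the
  plane.\<close>

lemma blow_down_iso: "inverse_isomorphisms (subvariety Bl3 torus_Bl3) (subvariety P2 torus_P2) blow_down lift_back"
proof -
  note B = ringed_Bl3 and P = ringed_P2
  have pt: "points (subvariety Bl3 torus_Bl3) = torus_Bl3" "points (subvariety P2 torus_P2) = torus_P2"
    using openin_subset[OF open_torus_Bl3] openin_subset[OF open_torus_P2] by (auto simp: points_subvariety)
  have l: "lift6 p \<in> torus_Bl3" if "p \<in> torus" for p
    using that graph_point_torus[OF that] blow_down_lift6[OF that] by (auto simp: torus_Bl3_def points_Bl3)
  have 1: "morphism (subvariety Bl3 torus_Bl3) (subvariety P2 torus_P2) blow_down"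
    by (intro morphism_into_subvariety ringed_subvariety B P morphism_restrict morphism_blow_down)
      (unfold pt, simp add: torus_Bl3_def)
  have "morphism (subvariety P2 torus_P2) Bl3 lift_back"
  proof (rule morphismI; unfold pt)
    show "lift_back y \<in> points Bl3" if y: "y \<in> torus_P2" for y
    proof -
      obtain p where p: "p \<in> torus" "y = class3 p" using y by blast
      show ?thesis using l[OF p(1)] unfolding p(2) lift_back_class3[OF p(1)] torus_Bl3_def by blast
    qed
    fix V assume V: "openin (zar Bl3) V"
    have m: "morphism (subvariety (affine_space 3) torus) Bl3 lift6" by (rule morphism_lift6[OF affine_open_torus order_refl])
    have ptt: "points (subvariety (affine_space 3) torus) = torus" by (rule points_affine_subvariety[OF affine_open_torus])
    have t: "affine_open 3 {p \<in> torus. lift6 p \<in> V}"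
      using morphism_open[OF m V] unfolding ptt openin_affine_subvariety[OF affine_open_torus] by blast
    have e: "{y \<in> torus_P2. lift_back y \<in> V} = class3 ` {p \<in> torus. lift6 p \<in> V}"
      using lift_back_class3 by force
    have pre: "{p \<in> punctured 3. class3 p \<in> class3 ` {p \<in> torus. lift6 p \<in> V}} = {p \<in> torus. lift6 p \<in> V}"
      by (rule class3_torus) (use torus_punctured torus_scale in auto)
    have o: "openin (zar P2) {y \<in> torus_P2. lift_back y \<in> V}"
      unfolding openin_P2 e pre using t torus_punctured by (auto simp: points_P2 intro: quotientI)
    show "openin (zar (subvariety P2 torus_P2)) {y \<in> torus_P2. lift_back y \<in> V}"
      unfolding openin_subvariety_open[OF open_torus_P2] using o by blast
    fix f assume f: "f \<in> reg Bl3 V"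
    have "f \<circ> lift6 \<in> reg (affine_space 3) {p \<in> torus. lift6 p \<in> V}"
      using morphism_reg[OF m V f] unfolding ptt reg_affine_subvariety[OF t] .
    then have "(\<lambda>p. (f \<circ> lift_back) (class3 p)) \<in> reg (affine_space 3) {p \<in> torus. lift6 p \<in> V}"
      by (rule ringed_restrict[OF ringed_affine_space, rotated]) (use t in \<open>simp_all add: openin_affine lift_back_class3\<close>)
    then have "f \<circ> lift_back \<in> reg P2 {y \<in> torus_P2. lift_back y \<in> V}"
      unfolding P2_eq reg_quotient_variety points_affine_subvariety[OF affine_open_punctured] e pre
        reg_affine_subvariety[OF t] .
    then show "f \<circ> lift_back \<in> reg (subvariety P2 torus_P2) {y \<in> torus_P2. lift_back y \<in> V}"
      unfolding reg_subvariety_open[OF P o] .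
  qed
  then have 2: "morphism (subvariety P2 torus_P2) (subvariety Bl3 torus_Bl3) lift_back"
    by (intro morphism_into_subvariety ringed_subvariety B P) (unfold pt, use l lift_back_class3 in auto)
  show ?thesis unfolding inverse_isomorphisms_def pt
  proof (intro conjI 1 2 ballI)
    show "lift_back (blow_down x) = x" if x: "x \<in> torus_Bl3" for x
    proof -
      obtain p where p: "p \<in> torus" "blow_down x = class3 p" using x by (auto simp: torus_Bl3_def)
      show ?thesis using lift6_surj[OF _ p] x unfolding p(2) lift_back_class3[OF p(1)] torus_Bl3_def by simp
    qed
    show "blow_down (lift_back y) = y" if y: "y \<in> torus_P2" for y
      using y lift_back_class3 blow_down_lift6 by auto
  qed
qed

abbreviation D3 :: "complex \<Rightarrow> (complex list set \<Rightarrow> complex) \<Rightarrow> complex list set \<Rightarrow> complex" where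
  "D3 \<omega> \<equiv> descended_field (weighted_rel [1, 1, 1]) (field3 \<omega>)"

lemma D3_lift_back:
  assumes p: "p \<in> torus"
  shows "D3 \<omega> (f \<circ> lift_back) (class3 p) = dir_deriv (f \<circ> lift6) p (field3 \<omega> p)"
proof -
  have "D3 \<omega> (f \<circ> lift_back) (class3 p) = dir_deriv (f \<circ> lift_back \<circ> class3) p (field3 \<omega> p)"
    by (rule E3_field_eq) (use p torus_punctured in blast)
  also have "\<dots> = dir_deriv (f \<circ> lift6) p (field3 \<omega> p)"
    by (rule dir_deriv_cong[OF affine_open_torus p]) (simp_all add: lift_back_class3)
  finally show ?thesis .
qed

text \<open>The condition defining the pull-back is applied to the section \<open>D3\<close>.
  Functions on the blown-up plane become functions on the plane through \<open>lift_back\<close>,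
  and near \<open>lift6 p\<close> composing back with \<open>blow_down\<close> changes
  nothing.\<close>

lemma E6_parallel:
  assumes \<omega>: "\<omega>\<^sup>2 + \<omega> + 1 = 0"
    and w: "w \<in> E6 \<omega> V" and p: "p \<in> torus" "lift6 p \<in> V"
    and N: "openin (zar Bl3) N" "lift6 p \<in> N" "f \<in> reg Bl3 N" "g \<in> reg Bl3 N"
  shows "w f (lift6 p) * dir_deriv (g \<circ> lift6) p (field3 \<omega> p) = w g (lift6 p) * dir_deriv (f \<circ> lift6) p (field3 \<omega> p)"
proof -
  note ir = iso_reg[OF ringed_Bl3 ringed_P2 open_torus_Bl3 open_torus_P2 blow_down_iso N(1)]
  note ip = iso_points[OF open_torus_Bl3 open_torus_P2 blow_down_iso]
  let ?M = "{q \<in> torus_P2. lift_back q \<in> N}"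
  have l: "lift6 p \<in> torus_Bl3" using ip(2)[of "class3 p"] p lift_back_class3 by auto
  have M: "openin (zar P2) ?M" "class3 p \<in> ?M" using ir(1) p(1) N(2) lift_back_class3 by auto
  have v: "vector_field Bl3 V w" using w by (simp add: E6_def pullback_foliation_def)
  have "w (f \<circ> lift_back \<circ> blow_down) (lift6 p) * D3 \<omega> (g \<circ> lift_back) (blow_down (lift6 p)) =
      w (g \<circ> lift_back \<circ> blow_down) (lift6 p) * D3 \<omega> (f \<circ> lift_back) (blow_down (lift6 p))"
    using w[unfolded E6_def pullback_foliation_def mem_Collect_eq, THEN conjunct2, rule_format,
        of "points P2" "D3 \<omega>" "lift6 p" ?M "f \<circ> lift_back" "g \<circ> lift_back"]
      E3_field[OF \<omega>] M p ir(2)[OF N(3)] ir(2)[OF N(4)] openin_topspace[of "zar P2"] openin_subset[OF M(1)]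
    unfolding blow_down_lift6[OF p(1)] by blast
  moreover have "w (h \<circ> lift_back \<circ> blow_down) (lift6 p) = w h (lift6 p)" if h: "h \<in> reg Bl3 N" for h
  proof (rule vector_field_local[OF ringed_Bl3 v p(2) _ _ _ N(1,2) h])
    let ?N = "{x \<in> points Bl3. blow_down x \<in> ?M} \<inter> torus_Bl3"
    show o: "openin (zar Bl3) ?N" using morphism_open[OF morphism_blow_down M(1)] open_torus_Bl3 by blast
    show "h \<circ> lift_back \<circ> blow_down \<in> reg Bl3 ?N"
      by (rule ringed_restrict[OF ringed_Bl3 morphism_open[OF morphism_blow_down M(1)]
            morphism_reg[OF morphism_blow_down M(1) ir(2)[OF h]] o]) auto
    show "lift6 p \<in> ?N" using l M(2) blow_down_lift6[OF p(1)] by (auto simp: torus_Bl3_def)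
    show "(h \<circ> lift_back \<circ> blow_down) y = h y" if "y \<in> ?N" for y using that ip(1) by auto
  qed
  ultimately show ?thesis using N(3,4) by (simp add: blow_down_lift6[OF p(1)] D3_lift_back[OF p(1)])
qed

lemma E6_field:
  assumes \<omega>: "\<omega>\<^sup>2 + \<omega> + 1 = 0"
  shows "(\<lambda>f. D3 \<omega> (f \<circ> lift_back) \<circ> blow_down) \<in> E6 \<omega> torus_Bl3"
  unfolding E6_def pullback_foliation_def
proof (intro CollectI conjI allI impI; (elim conjE)?)
  note ip = iso_points[OF open_torus_Bl3 open_torus_P2 blow_down_iso]
  have v: "vector_field P2 (points P2) (D3 \<omega>)" using E3_field[OF \<omega>] by (simp add: E3_def form_foliation_def)
  have vt: "vector_field P2 torus_P2 (D3 \<omega>)"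
    by (rule vector_field_restrict[OF v open_torus_P2 openin_subset[OF open_torus_P2]])
  have "{p \<in> torus_Bl3. blow_down p \<in> torus_P2} = torus_Bl3" using ip(1) by blast
  with vector_field_transport[OF ringed_Bl3 ringed_P2 open_torus_Bl3 open_torus_P2 blow_down_iso vt order_refl]
  show "vector_field Bl3 torus_Bl3 (\<lambda>f. D3 \<omega> (f \<circ> lift_back) \<circ> blow_down)" by simp
  fix V w x N f g
  assume w: "w \<in> E3 \<omega> V" "x \<in> torus_Bl3" "blow_down x \<in> V"
    and N: "openin (zar P2) N" "blow_down x \<in> N" "f \<in> reg P2 N" "g \<in> reg P2 N"
  obtain p where p: "p \<in> torus" "blow_down x = class3 p" using w(2) by (auto simp: torus_Bl3_def)
  have pp: "p \<in> punctured 3" "p ! 0 * p ! 1 * p ! 2 \<noteq> 0" using p(1) torus_punctured by (auto simp: torus_def)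
  have d: "D3 \<omega> (h \<circ> blow_down \<circ> lift_back) (class3 p) = dir_deriv (h \<circ> class3) p (field3 \<omega> p)" for h
    unfolding D3_lift_back[OF p(1)]
    by (rule dir_deriv_cong[OF affine_open_torus p(1)]) (simp_all add: blow_down_lift6)
  show "(D3 \<omega> (f \<circ> blow_down \<circ> lift_back) \<circ> blow_down) x * w g (blow_down x) =
      (D3 \<omega> (g \<circ> blow_down \<circ> lift_back) \<circ> blow_down) x * w f (blow_down x)"
    using E3_parallel[OF \<omega> w(1) pp, of N f g] w(3) N unfolding comp_apply p(2) d by (simp only: mult.commute)
qed

section \<open>The automorphism of order six and its eigenvectors\<close>

lemma T6_class6:
  assumes p: "p \<in> bipunctured 3 3"
  shows "T6 (class6 p) = class6 [p ! 5, p ! 3, p ! 4, p ! 2, p ! 0, p ! 1]"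
proof -
  let ?T = "\<lambda>p. [p ! 5, p ! 3, p ! 4, p ! 2, p ! 0, p ! 1]"
  have p': "?T p \<in> bipunctured 3 3" using p by (elim bipunctured_33_cases) (auto simp: bipunctured_33)
  show ?thesis
  proof (intro equalityI subsetI)
    fix q assume "q \<in> T6 (class6 p)"
    then obtain q' where "q' \<in> class6 p" "q = ?T q'" by (auto simp: T6_def)
    then obtain c d where "c \<noteq> 0" "d \<noteq> 0" "q = ?T [c * p ! 0, c * p ! 1, c * p ! 2, d * p ! 3, d * p ! 4, d * p ! 5]"
      unfolding class6_iff[OF p] by blast
    then show "q \<in> class6 (?T p)" unfolding class6_iff[OF p'] by (intro exI[of _ d] exI[of _ c]) simp
  next
    fix q assume "q \<in> class6 (?T p)"
    then obtain c d where c: "c \<noteq> 0" "d \<noteq> 0" "q = [c * p ! 5, c * p ! 3, c * p ! 4, d * p ! 2, d * p ! 0, d * p ! 1]"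
      unfolding class6_iff[OF p'] by auto
    have "[d * p ! 0, d * p ! 1, d * p ! 2, c * p ! 3, c * p ! 4, c * p ! 5] \<in> class6 p"
      unfolding class6_iff[OF p] using c by blast
    then show "q \<in> T6 (class6 p)" unfolding T6_def by (rule rev_image_eqI) (simp add: c(3))
  qed
qed

text \<open>
  The monomials \<open>e\<^sub>j\<close> and \<open>c\<close> are the anticanonical sections of the blown-up plane; \<open>T\<^sub>6\<close> permutes the
  \<open>e\<^sub>j\<close> cyclically, and \<open>u, v\<^sub>1, \<dots>, v\<^sub>5\<close> are eigenvectors, with \<open>- \<omega>\<close> as sixth root of unity.
\<close>

definition hexagon :: "nat \<Rightarrow> complex list \<Rightarrow> complex" where
  "hexagon j p = (let x = p ! 0; y = p ! 1; z = p ! 2 in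
     [x * x * z, x * x * y, x * y * y, y * y * z, y * z * z, x * z * z] ! j)"

text \<open>The product \<open>xyz\<close> is constant along the flow, so subtracting a multiple of
  it from the sum leaves the derivatives unchanged. The multiple 6 is forced: at
  \<open>(1, 1, 1)\<close> the other eigenvectors vanish, and the relation
  \<open>u^2 + 3 v3^2 = 4 v2 v4\<close> requires \<open>u\<close> to vanish there too.\<close>

definition eigen :: "complex \<Rightarrow> nat \<Rightarrow> complex list \<Rightarrow> complex" where
  "eigen \<omega> k p = (let e = (\<lambda>j. hexagon j p) in
     [e 0 + e 1 + e 2 + e 3 + e 4 + e 5 - 6 * (p ! 0 * p ! 1 * p ! 2),
      e 0 - \<omega> * e 1 + \<omega>\<^sup>2 * e 2 - e 3 + \<omega> * e 4 - \<omega>\<^sup>2 * e 5,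
      e 0 + \<omega>\<^sup>2 * e 1 + \<omega> * e 2 + e 3 + \<omega>\<^sup>2 * e 4 + \<omega> * e 5,
      e 0 - e 1 + e 2 - e 3 + e 4 - e 5,
      e 0 + \<omega> * e 1 + \<omega>\<^sup>2 * e 2 + e 3 + \<omega> * e 4 + \<omega>\<^sup>2 * e 5,
      e 0 - \<omega>\<^sup>2 * e 1 + \<omega> * e 2 - e 3 + \<omega>\<^sup>2 * e 4 - \<omega> * e 5] ! k)"

lemma hexagon_simps:
  "hexagon 0 [x, y, z] = x * x * z" "hexagon 1 [x, y, z] = x * x * y" "hexagon 2 [x, y, z] = x * y * y"
  "hexagon 3 [x, y, z] = y * y * z" "hexagon 4 [x, y, z] = y * z * z" "hexagon 5 [x, y, z] = x * z * z"
  by (simp_all add: hexagon_def Let_def)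

lemma eigen_simps:
  "eigen \<omega> 0 p = hexagon 0 p + hexagon 1 p + hexagon 2 p + hexagon 3 p + hexagon 4 p + hexagon 5 p - 6 * (p ! 0 * p ! 1 * p ! 2)"
  "eigen \<omega> 1 p = hexagon 0 p - \<omega> * hexagon 1 p + \<omega>\<^sup>2 * hexagon 2 p - hexagon 3 p + \<omega> * hexagon 4 p - \<omega>\<^sup>2 * hexagon 5 p"
  "eigen \<omega> 2 p = hexagon 0 p + \<omega>\<^sup>2 * hexagon 1 p + \<omega> * hexagon 2 p + hexagon 3 p + \<omega>\<^sup>2 * hexagon 4 p + \<omega> * hexagon 5 p"
  "eigen \<omega> 3 p = hexagon 0 p - hexagon 1 p + hexagon 2 p - hexagon 3 p + hexagon 4 p - hexagon 5 p"
  "eigen \<omega> 4 p = hexagon 0 p + \<omega> * hexagon 1 p + \<omega>\<^sup>2 * hexagon 2 p + hexagon 3 p + \<omega> * hexagon 4 p + \<omega>\<^sup>2 * hexagon 5 p"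
  "eigen \<omega> 5 p = hexagon 0 p - \<omega>\<^sup>2 * hexagon 1 p + \<omega> * hexagon 2 p - hexagon 3 p + \<omega>\<^sup>2 * hexagon 4 p - \<omega> * hexagon 5 p"
  by (simp_all add: eigen_def Let_def)

lemma hexagon_polyfun: "j < 6 \<Longrightarrow> hexagon j \<in> polyfun 3"
  by (drule less_6_cases, elim disjE; simp add: hexagon_def[abs_def] Let_def; intro polyfun.mult coord_polyfun)

lemma eigen_polyfun: "k < 6 \<Longrightarrow> eigen \<omega> k \<in> polyfun 3"
proof -
  assume k: "k < 6"
  have "(\<lambda>p. eigen \<omega> k p) \<in> polyfun 3"
    using less_6_cases[OF k]
    by (elim disjE; simp only: eigen_simps; intro polyfun_diff polyfun.add polyfun.mult polyfun.const coord_polyfun hexagon_polyfun)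
      simp_all
  then show ?thesis by simp
qed

text \<open>Relations between quadratic functions of \<open>u\<close> and the \<open>v\<^sub>k\<close>, from \<open>e\<^sub>j e\<^sub>j\<^sub>+\<^sub>2 = c e\<^sub>j\<^sub>+\<^sub>1\<close> and \<open>e\<^sub>j e\<^sub>j\<^sub>+\<^sub>3 = c\<^sup>2\<close>.\<close>

lemma eigen_relations:
  fixes p :: "complex list"
  assumes \<omega>: "\<omega>\<^sup>2 + \<omega> + 1 = 0" and p: "length p = 3"
  defines "u \<equiv> eigen \<omega> 0 p" and "v1 \<equiv> eigen \<omega> 1 p" and "v2 \<equiv> eigen \<omega> 2 p" and "v3 \<equiv> eigen \<omega> 3 p"
    and "v4 \<equiv> eigen \<omega> 4 p" and "v5 \<equiv> eigen \<omega> 5 p" and "c \<equiv> p ! 0 * p ! 1 * p ! 2"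
  shows "u\<^sup>2 + 3 * v3\<^sup>2 = 4 * v2 * v4" "u * v4 = 3 * v1 * v3 - 2 * v2\<^sup>2" "u * v5 = 2 * v1 * v4 - v2 * v3"
    "6 * c * u = v1 * v5 + v2 * v4 - v3\<^sup>2 - u\<^sup>2"
proof -
  obtain x y z where e: "p = [x, y, z]" using p by (auto simp: length_3)
  note defs = u_def v1_def v2_def v3_def v4_def v5_def c_def e eigen_simps hexagon_simps
  show "u\<^sup>2 + 3 * v3\<^sup>2 = 4 * v2 * v4" unfolding defs using \<omega> by simp algebra
  show "u * v4 = 3 * v1 * v3 - 2 * v2\<^sup>2" unfolding defs using \<omega> by simp algebra
  show "u * v5 = 2 * v1 * v4 - v2 * v3" unfolding defs using \<omega> by simp algebra
  show "6 * c * u = v1 * v5 + v2 * v4 - v3\<^sup>2 - u\<^sup>2" unfolding defs using \<omega> by simp algebra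
qed

text \<open>Multiplying \<open>u^2 + 3 v3^2 = 4 v2 v4\<close> by \<open>u^4 / v1^6\<close> and
  replacing \<open>u v4\<close> by \<open>3 v1 v3 - 2 v2^2\<close> gives
  \<open>b^6 = 12 m n - 8 m^3 - 3 n^2\<close>.\<close>

definition R_VI :: "complex list \<Rightarrow> complex" where
  "R_VI q = (let m = 1 - q ! 0; n = q ! 1 + 1 - 3 * q ! 0 in 12 * m * n - 8 * m ^ 3 - 3 * n ^ 2)"

definition H_VI :: "complex list \<Rightarrow> complex" where
  "H_VI q = (let m = 1 - q ! 0; n = q ! 1 + 1 - 3 * q ! 0 in
     6 * n - 4 * m ^ 2 + 2 * m * n - 2 * m ^ 3 - n ^ 2 - R_VI q)"

lemma polyfun_VI: "R_VI \<in> polyfun 2" "H_VI \<in> polyfun 2"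
proof -
  show R: "R_VI \<in> polyfun 2"
    unfolding R_VI_def[abs_def] Let_def by (intro polyfun.add polyfun.mult polyfun_diff polyfun_power polyfun.const coord_polyfun)
  show "H_VI \<in> polyfun 2"
    unfolding H_VI_def[abs_def] Let_def by (intro polyfun.add polyfun.mult polyfun_diff polyfun_power polyfun.const coord_polyfun R)
qed

text \<open>The values of \<open>v\<^sub>0 = e\<^sub>0 + \<dots> + e\<^sub>5 = u + 6 c\<close> and \<open>v\<^sub>1, \<dots>, v\<^sub>5\<close> in terms of \<open>m\<close>, \<open>n\<close> and \<open>b = u / v\<^sub>1\<close>,
  up to a common factor; \<open>H_VI\<close> is that of \<open>6 c\<close>.\<close>

definition section_VI :: "complex \<Rightarrow> complex list \<Rightarrow> complex list" where
  "section_VI \<omega> p = (let m = 1 - p ! 0; n = p ! 1 + 1 - 3 * p ! 0; b = p ! 2;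
       v0 = 6 * n - 4 * m ^ 2 + 2 * m * n - 2 * m ^ 3 - n ^ 2; v1 = b ^ 5; v2 = b ^ 4 * m; v3 = b ^ 3 * n;
       v4 = b ^ 2 * (3 * n - 2 * m ^ 2); v5 = b * (6 * n - 4 * m ^ 2 - m * n) in
     [v0 - \<omega>\<^sup>2 * v1 + \<omega> * v2 - v3 + \<omega>\<^sup>2 * v4 - \<omega> * v5, v0 + \<omega> * v1 + \<omega>\<^sup>2 * v2 + v3 + \<omega> * v4 + \<omega>\<^sup>2 * v5,
      H_VI [p ! 0, p ! 1]])"

lemma section_VI_polyfun:
  assumes "i < 3"
  shows "(\<lambda>p. section_VI \<omega> p ! i) \<in> polyfun 3"
proof -
  have H: "(\<lambda>p. H_VI [p ! 0, p ! 1]) \<in> polyfun 3"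
  proof (rule polyfun_compose[OF polyfun_VI(2)])
    fix i :: nat assume "i < 2"
    then have "i = 0 \<or> i = 1" by linarith
    then show "(\<lambda>p. [p ! 0, p ! 1] ! i) \<in> polyfun 3" by (auto simp: coord_polyfun)
  qed
  have "i = 0 \<or> i = 1 \<or> i = 2" using assms by linarith
  then show ?thesis
    by (elim disjE; simp add: section_VI_def Let_def H)
      (intro polyfun.add polyfun.mult polyfun_diff polyfun_power polyfun.const coord_polyfun)+
qed

text \<open>The inverse Fourier transform \<open>E j\<close> of the values
  \<open>v0, ..., v5\<close> plays the part of \<open>6 e_j\<close>, as \<open>K\<close> does of
  \<open>6 c\<close>. Since \<open>e_1 : e_2 : c = x : y : z\<close>, the section is
  \<open>[E 1, E 2, K]\<close>; what has to be checked is that the \<open>E j\<close> satisfy the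
  relations between the monomials.\<close>

lemma section_VI_eigen:
  assumes \<omega>: "\<omega>\<^sup>2 + \<omega> + 1 = 0" and b: "b ^ 6 = R_VI [s, t]" and nz: "R_VI [s, t] \<noteq> 0" "H_VI [s, t] \<noteq> 0"
  defines "p \<equiv> section_VI \<omega> [s, t, b]" and "m \<equiv> 1 - s" and "n \<equiv> t + 1 - 3 * s"
  obtains d where "d \<noteq> 0" "p \<in> torus" "eigen \<omega> 0 p = d * b ^ 6" "eigen \<omega> 1 p = d * b ^ 5" "eigen \<omega> 2 p = d * (b ^ 4 * m)"
    "eigen \<omega> 3 p = d * (b ^ 3 * n)"
proof -
  have w3: "\<omega> ^ 3 = 1" using \<omega> by algebra
  define v0 where "v0 = 6 * n - 4 * m ^ 2 + 2 * m * n - 2 * m ^ 3 - n ^ 2"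
  define v1 where "v1 = b ^ 5"
  define v2 where "v2 = b ^ 4 * m"
  define v3 where "v3 = b ^ 3 * n"
  define v4 where "v4 = b ^ 2 * (3 * n - 2 * m ^ 2)"
  define v5 where "v5 = b * (6 * n - 4 * m ^ 2 - m * n)"
  define K where "K = v0 - b ^ 6"
  note vd = K_def v0_def v1_def v2_def v3_def v4_def v5_def
  have R: "b ^ 6 = 12 * m * n - 8 * m ^ 3 - 3 * n ^ 2" using b by (simp add: R_VI_def Let_def m_def n_def)
  have K: "K = H_VI [s, t]" unfolding K_def b v0_def by (simp add: H_VI_def Let_def m_def n_def)
  define E where "E = (\<lambda>j. [v0 + v1 + v2 + v3 + v4 + v5,
     v0 - \<omega>\<^sup>2 * v1 + \<omega> * v2 - v3 + \<omega>\<^sup>2 * v4 - \<omega> * v5,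
     v0 + \<omega> * v1 + \<omega>\<^sup>2 * v2 + v3 + \<omega> * v4 + \<omega>\<^sup>2 * v5,
     v0 - v1 + v2 - v3 + v4 - v5,
     v0 + \<omega>\<^sup>2 * v1 + \<omega> * v2 + v3 + \<omega>\<^sup>2 * v4 + \<omega> * v5,
     v0 - \<omega> * v1 + \<omega>\<^sup>2 * v2 - v3 + \<omega> * v4 - \<omega>\<^sup>2 * v5] ! j)"
  have E: "E 0 = v0 + v1 + v2 + v3 + v4 + v5" "E 1 = v0 - \<omega>\<^sup>2 * v1 + \<omega> * v2 - v3 + \<omega>\<^sup>2 * v4 - \<omega> * v5"
     "E 2 = v0 + \<omega> * v1 + \<omega>\<^sup>2 * v2 + v3 + \<omega> * v4 + \<omega>\<^sup>2 * v5" "E 3 = v0 - v1 + v2 - v3 + v4 - v5"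
     "E 4 = v0 + \<omega>\<^sup>2 * v1 + \<omega> * v2 + v3 + \<omega>\<^sup>2 * v4 + \<omega> * v5"
     "E 5 = v0 - \<omega> * v1 + \<omega>\<^sup>2 * v2 - v3 + \<omega> * v4 - \<omega>\<^sup>2 * v5"
    by (simp_all add: E_def)
  have p: "p = [E 1, E 2, K]"
    unfolding p_def K by (simp add: section_VI_def Let_def E vd m_def n_def)
  \<comment> \<open>\<open>S\<close> and \<open>S'\<close> are the Fourier coefficients of
    \<open>E j * E (j + 2) = K * E (j + 1)\<close> and \<open>E j * E (j + 3) = K * K\<close>,
    indices modulo 6. In this form \<open>\<omega>\<close> has disappeared, and they follow from the
    equation for \<open>b^6\<close>.\<close>
  have S: "v0 * v0 - v1 * v5 - v2 * v4 + v3 * v3 = K * v0" "v0 * v1 - 2 * v2 * v5 + v3 * v4 = K * v1"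
    "- v0 * v2 + v1 * v1 - v3 * v5 + v4 * v4 = K * v2" "- 2 * v0 * v3 + v1 * v2 + v4 * v5 = K * v3"
    "- v0 * v4 - v1 * v3 + v2 * v2 + v5 * v5 = K * v4" "v0 * v5 - 2 * v1 * v4 + v2 * v3 = K * v5"
    unfolding vd using R by algebra+
  have S': "v0 * v0 - 2 * v1 * v5 + 2 * v2 * v4 - v3 * v3 = K * K" "2 * v0 * v2 - v1 * v1 - 2 * v3 * v5 + v4 * v4 = 0"
    "2 * v0 * v4 + v2 * v2 - 2 * v1 * v3 - v5 * v5 = 0"
    unfolding vd using R by algebra+
  have rel: "E 0 * E 2 = K * E 1" "E 1 * E 3 = K * E 2" unfolding E using S \<omega> by algebra+
  have rel': "E 1 * E 4 = K * K" "E 2 * E 5 = K * K" unfolding E using S' \<omega> by algebra+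
  have nzE: "K \<noteq> 0" "E 1 \<noteq> 0" "E 2 \<noteq> 0" using K nz(2) rel' by auto
  \<comment> \<open>The hexagon monomials of \<open>[E 1, E 2, K]\<close> are
    \<open>E 1 * E 2\<close> times the \<open>E j\<close>; inverting the transform adds the factor
    6, hence the witness \<open>6 * (E 1 * E 2)\<close> below.\<close>
  have hex: "hexagon 0 p = E 1 * E 2 * E 0" "hexagon 1 p = E 1 * E 2 * E 1" "hexagon 2 p = E 1 * E 2 * E 2"
    "hexagon 3 p = E 1 * E 2 * E 3" "hexagon 4 p = E 1 * E 2 * E 4" "hexagon 5 p = E 1 * E 2 * E 5"
  proof -
    show "hexagon 0 p = E 1 * E 2 * E 0" unfolding p hexagon_simps using rel(1) by algebra
    show "hexagon 1 p = E 1 * E 2 * E 1" "hexagon 2 p = E 1 * E 2 * E 2" unfolding p hexagon_simps by simp_all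
    show "hexagon 3 p = E 1 * E 2 * E 3" unfolding p hexagon_simps using rel(2) by algebra
    show "hexagon 4 p = E 1 * E 2 * E 4" unfolding p hexagon_simps using rel'(1) by algebra
    show "hexagon 5 p = E 1 * E 2 * E 5" unfolding p hexagon_simps using rel'(2) by algebra
  qed
  have c: "p ! 0 * p ! 1 * p ! 2 = E 1 * E 2 * K" by (simp add: p)
  show thesis
  proof (rule that[of "6 * (E 1 * E 2)"])
    show "6 * (E 1 * E 2) \<noteq> 0" using nzE by simp
    show "p \<in> torus" using nzE by (simp add: torus_def p)
    have "E 0 + E 1 + E 2 + E 3 + E 4 + E 5 - 6 * K = 6 * b ^ 6" unfolding E K_def using \<omega> by algebra
    then show "eigen \<omega> 0 p = 6 * (E 1 * E 2) * b ^ 6" unfolding eigen_simps hex c by algebra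
    have "E 0 - \<omega> * E 1 + \<omega>\<^sup>2 * E 2 - E 3 + \<omega> * E 4 - \<omega>\<^sup>2 * E 5 = 6 * v1" unfolding E using \<omega> by algebra
    then show "eigen \<omega> 1 p = 6 * (E 1 * E 2) * b ^ 5" unfolding eigen_simps hex v1_def by algebra
    have "E 0 + \<omega>\<^sup>2 * E 1 + \<omega> * E 2 + E 3 + \<omega>\<^sup>2 * E 4 + \<omega> * E 5 = 6 * v2" unfolding E using \<omega> by algebra
    then show "eigen \<omega> 2 p = 6 * (E 1 * E 2) * (b ^ 4 * m)" unfolding eigen_simps hex v2_def by algebra
    have "E 0 - E 1 + E 2 - E 3 + E 4 - E 5 = 6 * v3" unfolding E using \<omega> by algebra
    then show "eigen \<omega> 3 p = 6 * (E 1 * E 2) * (b ^ 3 * n)" unfolding eigen_simps hex v3_def by algebra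
  qed
qed

lemma section_VI_return:
  assumes \<omega>: "\<omega>\<^sup>2 + \<omega> + 1 = 0" and p: "p \<in> torus" and nz: "eigen \<omega> 0 p \<noteq> 0" "eigen \<omega> 1 p \<noteq> 0"
    and st: "chazy_coords (eigen \<omega> 0 p) (eigen \<omega> 1 p) (eigen \<omega> 2 p) (eigen \<omega> 3 p) = [s, t]"
  shows "R_VI [s, t] = (eigen \<omega> 0 p / eigen \<omega> 1 p) ^ 6"
    "\<exists>k. k \<noteq> 0 \<and> section_VI \<omega> [s, t, eigen \<omega> 0 p / eigen \<omega> 1 p] = [k * p ! 0, k * p ! 1, k * p ! 2]"
proof -
  define u where "u = eigen \<omega> 0 p"
  define v1 where "v1 = eigen \<omega> 1 p"
  define v2 where "v2 = eigen \<omega> 2 p"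
  define v3 where "v3 = eigen \<omega> 3 p"
  define v4 where "v4 = eigen \<omega> 4 p"
  define v5 where "v5 = eigen \<omega> 5 p"
  define c where "c = p ! 0 * p ! 1 * p ! 2"
  define m where "m = 1 - s"
  define n where "n = t + 1 - 3 * s"
  define b where "b = u / v1"
  note vd = u_def v1_def v2_def v3_def v4_def v5_def
  have len: "length p = 3" using p by (simp add: torus_def)
  note rel = eigen_relations[OF \<omega> len, folded vd c_def]
  have uv: "u \<noteq> 0" "v1 \<noteq> 0" using nz by (simp_all add: vd)
  \<comment> \<open>With \<open>r\<close> in place of division by \<open>v1\<close>, the identities
    below become polynomial consequences of the relations and \<open>r * v1 = 1\<close>.\<close>
  define r where "r = 1 / v1"
  have r: "r * v1 = 1" using uv by (simp add: r_def)
  have b: "b = u * r" by (simp add: b_def r_def)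
  have m: "m = u * v2 * r ^ 2" and n: "n = u ^ 2 * v3 * r ^ 3"
    using st unfolding vd[symmetric] by (auto simp: chazy_coords_def m_def n_def r_def power_divide)
  \<comment> \<open>The factor between the values in the section and the eigenvectors at
    \<open>p\<close>: \<open>b^5 = k v1\<close> forces \<open>k = u^5 / v1^6\<close>.\<close>
  define k where "k = u ^ 5 * r ^ 6"
  have k0: "k \<noteq> 0" using uv by (simp add: k_def r_def)
  have R: "12 * m * n - 8 * m ^ 3 - 3 * n ^ 2 = b ^ 6"
    unfolding m n b using rel(1,2) r by algebra
  have R': "R_VI [s, t] = b ^ 6" unfolding R[symmetric] by (simp add: R_VI_def Let_def m_def n_def)
  then show "R_VI [s, t] = (eigen \<omega> 0 p / eigen \<omega> 1 p) ^ 6" by (simp add: b_def vd)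
  have 1: "b ^ 5 = k * v1" "b ^ 4 * m = k * v2" "b ^ 3 * n = k * v3"
    unfolding b m n k_def using r by algebra+
  have 4: "b ^ 2 * (3 * n - 2 * m ^ 2) = k * v4" unfolding b m n k_def using r rel(2) by algebra
  have 5: "b * (6 * n - 4 * m ^ 2 - m * n) = k * v5" unfolding b m n k_def using r rel(2,3) by algebra
  have 6: "b ^ 6 = k * u" unfolding b k_def by algebra
  have 0: "6 * n - 4 * m ^ 2 + 2 * m * n - 2 * m ^ 3 - n ^ 2 = k * (6 * c + u)"
  proof -
    \<comment> \<open>The fourth relation gives only the product \<open>6 c u\<close>, so the
      identity is proved after multiplication by the nonzero \<open>u\<close>.\<close>
    have "u * (6 * n - 4 * m ^ 2 + 2 * m * n - 2 * m ^ 3 - n ^ 2) = k * (6 * c * u + u\<^sup>2)"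
      unfolding rel(4) m n k_def using r rel(2,3) by algebra
    then have "u * (6 * n - 4 * m ^ 2 + 2 * m * n - 2 * m ^ 3 - n ^ 2 - k * (6 * c + u)) = 0" by algebra
    then show ?thesis using uv(1) by simp
  qed
  have H: "H_VI [s, t] = k * (6 * c)"
  proof -
    have "H_VI [s, t] = k * (6 * c + u) - b ^ 6" unfolding 0[symmetric] R'[symmetric]
      by (simp add: H_VI_def Let_def m_def n_def)
    then show ?thesis unfolding 6 by (simp add: algebra_simps)
  qed
  obtain x y z where e: "p = [x, y, z]" using len by (auto simp: length_3)
  have nzx: "x \<noteq> 0" "y \<noteq> 0" using p by (auto simp: torus_def e)
  have S: "section_VI \<omega> [s, t, b] =
     [k * (6 * c + u) - \<omega>\<^sup>2 * (k * v1) + \<omega> * (k * v2) - k * v3 + \<omega>\<^sup>2 * (k * v4) - \<omega> * (k * v5),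
      k * (6 * c + u) + \<omega> * (k * v1) + \<omega>\<^sup>2 * (k * v2) + k * v3 + \<omega> * (k * v4) + \<omega>\<^sup>2 * (k * v5), k * (6 * c)]"
    unfolding 0[symmetric] 1[symmetric] 4[symmetric] 5[symmetric] H[symmetric]
    by (simp add: section_VI_def Let_def m_def n_def)
  have "k * (6 * c + u) - \<omega>\<^sup>2 * (k * v1) + \<omega> * (k * v2) - k * v3 + \<omega>\<^sup>2 * (k * v4) - \<omega> * (k * v5) = 6 * k * hexagon 1 p"
    "k * (6 * c + u) + \<omega> * (k * v1) + \<omega>\<^sup>2 * (k * v2) + k * v3 + \<omega> * (k * v4) + \<omega>\<^sup>2 * (k * v5) = 6 * k * hexagon 2 p"
    unfolding vd c_def eigen_simps using \<omega> by algebra+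
  with S have "section_VI \<omega> [s, t, b] = [6 * k * hexagon 1 p, 6 * k * hexagon 2 p, k * (6 * c)]" by simp
  also have "\<dots> = [6 * k * (x * y) * p ! 0, 6 * k * (x * y) * p ! 1, 6 * k * (x * y) * p ! 2]"
    by (simp add: c_def e hexagon_simps)
  finally show "\<exists>k. k \<noteq> 0 \<and> section_VI \<omega> [s, t, eigen \<omega> 0 p / eigen \<omega> 1 p] = [k * p ! 0, k * p ! 1, k * p ! 2]"
    using k0 nzx unfolding b_def vd by (intro exI[of _ "6 * k * (x * y)"]) simp
qed

lemma eigen_scale:
  "eigen \<omega> 0 [c * x, c * y, c * z] = c ^ 3 * eigen \<omega> 0 [x, y, z]" "eigen \<omega> 1 [c * x, c * y, c * z] = c ^ 3 * eigen \<omega> 1 [x, y, z]"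
  "eigen \<omega> 2 [c * x, c * y, c * z] = c ^ 3 * eigen \<omega> 2 [x, y, z]" "eigen \<omega> 3 [c * x, c * y, c * z] = c ^ 3 * eigen \<omega> 3 [x, y, z]"
  unfolding eigen_simps hexagon_simps by (simp_all add: power3_eq_cube algebra_simps)

text \<open>The quadratic map followed by \<open>T3\<close>, in homogeneous coordinates of the
  plane.\<close>

definition rotate6 :: "complex list \<Rightarrow> complex list" where
  "rotate6 p = [p ! 0 * p ! 1, p ! 1 * p ! 2, p ! 2 * p ! 0]"

text \<open>Each hexagon monomial goes to \<open>xyz\<close> times the next one, so the eigenvector
  with index \<open>k\<close> acquires the factor \<open>(- \<omega>)^(-k)\<close>, that is
  \<open>(- \<omega>^2)^k\<close>.\<close>

lemma eigen_rotate6: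
  assumes \<omega>: "\<omega>\<^sup>2 + \<omega> + 1 = 0"
  shows "eigen \<omega> 0 (rotate6 [x, y, z]) = x * y * z * eigen \<omega> 0 [x, y, z]"
    "eigen \<omega> 1 (rotate6 [x, y, z]) = x * y * z * (- \<omega>\<^sup>2 * eigen \<omega> 1 [x, y, z])"
    "eigen \<omega> 2 (rotate6 [x, y, z]) = x * y * z * ((- \<omega>\<^sup>2) ^ 2 * eigen \<omega> 2 [x, y, z])"
    "eigen \<omega> 3 (rotate6 [x, y, z]) = x * y * z * ((- \<omega>\<^sup>2) ^ 3 * eigen \<omega> 3 [x, y, z])"
proof -
  have e: "rotate6 [x, y, z] = [x * y, y * z, z * x]" by (simp add: rotate6_def)
  show "eigen \<omega> 0 (rotate6 [x, y, z]) = x * y * z * eigen \<omega> 0 [x, y, z]"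
    unfolding e eigen_simps hexagon_simps by (simp add: algebra_simps)
  show "eigen \<omega> 1 (rotate6 [x, y, z]) = x * y * z * (- \<omega>\<^sup>2 * eigen \<omega> 1 [x, y, z])"
    unfolding e eigen_simps hexagon_simps using \<omega> by algebra
  show "eigen \<omega> 2 (rotate6 [x, y, z]) = x * y * z * ((- \<omega>\<^sup>2) ^ 2 * eigen \<omega> 2 [x, y, z])"
    unfolding e eigen_simps hexagon_simps using \<omega> by algebra
  show "eigen \<omega> 3 (rotate6 [x, y, z]) = x * y * z * ((- \<omega>\<^sup>2) ^ 3 * eigen \<omega> 3 [x, y, z])"
    unfolding e eigen_simps hexagon_simps using \<omega> by algebra
qed

text \<open>The exchanged and rotated triples are \<open>(xy, yz, zx)\<close> and
  \<open>(z, x, y)\<close>; scaling the second by \<open>xyz\<close> makes it the image of the first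
  under the quadratic map.\<close>

lemma T6_lift6:
  assumes p: "p \<in> torus"
  shows "T6 (lift6 p) = lift6 (rotate6 p)"
proof -
  obtain x y z where e: "p = [x, y, z]" "x \<noteq> 0" "y \<noteq> 0" "z \<noteq> 0" using p by (auto simp: torus_def length_3)
  let ?q = "[x * y, y * z, z * x, z, x, y]"
  have q: "?q \<in> bipunctured 3 3" using e by (simp add: bipunctured_33)
  have "T6 (lift6 p) = class6 ?q"
    using T6_class6[of "graph_point p"] graph_point_torus[OF p] by (simp add: e(1) graph_point_def)
  also have "\<dots> = class6 [1 * ?q ! 0, 1 * ?q ! 1, 1 * ?q ! 2, (x * y * z) * ?q ! 3, (x * y * z) * ?q ! 4, (x * y * z) * ?q ! 5]"
    by (rule class6_eq[OF _ _ q, symmetric]) (use e in simp_all)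
  also have "\<dots> = lift6 (rotate6 p)" by (simp add: e(1) rotate6_def graph_point_def mult_ac)
  finally show ?thesis .
qed

lemma T6_points:
  assumes x: "x \<in> points Bl3"
  shows "T6 x \<in> points Bl3" "(T6 ^^ 6) x = x"
proof -
  define T :: "complex list \<Rightarrow> complex list" where "T p = [p ! 5, p ! 3, p ! 4, p ! 2, p ! 0, p ! 1]" for p
  obtain q where q: "q \<in> bipunctured 3 3" "incident q" "x = class6 q" using x unfolding points_Bl3 by blast
  have T: "T p \<in> bipunctured 3 3" if "p \<in> bipunctured 3 3" for p
    using that by (elim bipunctured_33_cases) (auto simp: bipunctured_33 T_def)
  have T6: "T6 (class6 p) = class6 (T p)" if "p \<in> bipunctured 3 3" for p
    using T6_class6[OF that] by (simp add: T_def)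
  have "incident (T q)" using q(2) by (simp add: incident_def T_def mult.commute)
  then show "T6 x \<in> points Bl3" unfolding q(3) T6[OF q(1)] points_Bl3 using T[OF q(1)] by blast
  have T_list: "T [a, b, c, d, e, f] = [f, d, e, c, a, b]" for a b c d e f by (simp add: T_def)
  have "T (T (T (T (T (T q))))) = q" using bipunctured_33_ex[OF q(1)] by (auto simp: T_list)
  then have "T6 (T6 (T6 (T6 (T6 (T6 x))))) = x" unfolding q(3) by (simp add: T6 T q(1))
  then show "(T6 ^^ 6) x = x" by (simp add: numeral_eq_Suc)
qed

lemma eigen_linear:
  "eigen \<omega> 0 p = 1 * hexagon 0 p + 1 * hexagon 1 p + 1 * hexagon 2 p + 1 * hexagon 3 p + 1 * hexagon 4 p + 1 * hexagon 5 p + (- 6) * (p ! 0 * p ! 1 * p ! 2)"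
  "eigen \<omega> 1 p = 1 * hexagon 0 p + (- \<omega>) * hexagon 1 p + \<omega>\<^sup>2 * hexagon 2 p + (- 1) * hexagon 3 p + \<omega> * hexagon 4 p + (- \<omega>\<^sup>2) * hexagon 5 p + 0 * (p ! 0 * p ! 1 * p ! 2)"
  "eigen \<omega> 2 p = 1 * hexagon 0 p + \<omega>\<^sup>2 * hexagon 1 p + \<omega> * hexagon 2 p + 1 * hexagon 3 p + \<omega>\<^sup>2 * hexagon 4 p + \<omega> * hexagon 5 p + 0 * (p ! 0 * p ! 1 * p ! 2)"
  "eigen \<omega> 3 p = 1 * hexagon 0 p + (- 1) * hexagon 1 p + 1 * hexagon 2 p + (- 1) * hexagon 3 p + 1 * hexagon 4 p + (- 1) * hexagon 5 p + 0 * (p ! 0 * p ! 1 * p ! 2)"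
  "eigen \<omega> 4 p = 1 * hexagon 0 p + \<omega> * hexagon 1 p + \<omega>\<^sup>2 * hexagon 2 p + 1 * hexagon 3 p + \<omega> * hexagon 4 p + \<omega>\<^sup>2 * hexagon 5 p + 0 * (p ! 0 * p ! 1 * p ! 2)"
  unfolding eigen_simps by simp_all

text \<open>The weight of \<open>hexagon 0\<close> is
  \<open>2 + \<omega> = 1 - \<omega>^2 = h\<close>, each next monomial has \<open>- \<omega>\<close>
  times the weight of the one before, and \<open>xyz\<close> has weight
  \<open>1 + \<omega>^2 + \<omega> = 0\<close>. So differentiation passes to the next eigenvector
  with the factor \<open>h\<close>.\<close>

lemma eigen_derivatives:
  assumes \<omega>: "\<omega>\<^sup>2 + \<omega> + 1 = 0" and p: "length p = 3"
  defines "l \<equiv> \<lambda>t. map2 (\<lambda>a b. a + t * b) p (field3 \<omega> p)" and "h \<equiv> 1 - \<omega>\<^sup>2"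
  shows "((\<lambda>t. eigen \<omega> 0 (l t)) has_field_derivative h * eigen \<omega> 1 p) (at 0)"
    "((\<lambda>t. eigen \<omega> 1 (l t)) has_field_derivative h * eigen \<omega> 2 p) (at 0)"
    "((\<lambda>t. eigen \<omega> 2 (l t)) has_field_derivative h * eigen \<omega> 3 p) (at 0)"
    "((\<lambda>t. eigen \<omega> 3 (l t)) has_field_derivative h * eigen \<omega> 4 p) (at 0)"
proof -
  obtain x y z where e: "p = [x, y, z]" using p by (auto simp: length_3)
  have l: "l t = [x + t * (1 * x), y + t * (\<omega>\<^sup>2 * y), z + t * (\<omega> * z)]" for t
    by (simp add: l_def e field3_def)
  have m: "((\<lambda>t. (a + t * (\<alpha> * a)) * (b + t * (\<beta> * b)) * (c + t * (\<gamma> * c))) has_field_derivative (\<alpha> + \<beta> + \<gamma>) * (a * b * c)) (at 0)"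
    for a b c \<alpha> \<beta> \<gamma> :: complex
    by (auto intro!: derivative_eq_intros simp: algebra_simps)
  have H: "((\<lambda>t. hexagon 0 (l t)) has_field_derivative h * hexagon 0 p) (at 0)"
    "((\<lambda>t. hexagon 1 (l t)) has_field_derivative - \<omega> * h * hexagon 1 p) (at 0)"
    "((\<lambda>t. hexagon 2 (l t)) has_field_derivative \<omega>\<^sup>2 * h * hexagon 2 p) (at 0)"
    "((\<lambda>t. hexagon 3 (l t)) has_field_derivative - h * hexagon 3 p) (at 0)"
    "((\<lambda>t. hexagon 4 (l t)) has_field_derivative \<omega> * h * hexagon 4 p) (at 0)"
    "((\<lambda>t. hexagon 5 (l t)) has_field_derivative - \<omega>\<^sup>2 * h * hexagon 5 p) (at 0)"
    unfolding l e hexagon_simps h_def by (rule DERIV_cong[OF m], use \<omega> in algebra)+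
  have C: "((\<lambda>t. l t ! 0 * l t ! 1 * l t ! 2) has_field_derivative 0) (at 0)"
    unfolding l nth_Cons_0 nth_Cons_1 nth_Cons_numeral
    using DERIV_cong[OF m[of x 1 y "\<omega>\<^sup>2" z \<omega>], of 0] \<omega> by (simp add: add_ac)
  have lin: "((\<lambda>t. a0 * hexagon 0 (l t) + a1 * hexagon 1 (l t) + a2 * hexagon 2 (l t) + a3 * hexagon 3 (l t) + a4 * hexagon 4 (l t) +
      a5 * hexagon 5 (l t) + a6 * (l t ! 0 * l t ! 1 * l t ! 2)) has_field_derivative
      a0 * (h * hexagon 0 p) + a1 * (- \<omega> * h * hexagon 1 p) + a2 * (\<omega>\<^sup>2 * h * hexagon 2 p) + a3 * (- h * hexagon 3 p) +
      a4 * (\<omega> * h * hexagon 4 p) + a5 * (- \<omega>\<^sup>2 * h * hexagon 5 p) + a6 * 0) (at 0)" for a0 a1 a2 a3 a4 a5 a6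
    by (intro DERIV_add DERIV_cmult H C)
  show "((\<lambda>t. eigen \<omega> 0 (l t)) has_field_derivative h * eigen \<omega> 1 p) (at 0)"
    unfolding eigen_linear by (rule DERIV_cong[OF lin]) (simp add: algebra_simps)
  show "((\<lambda>t. eigen \<omega> 1 (l t)) has_field_derivative h * eigen \<omega> 2 p) (at 0)"
    unfolding eigen_linear by (rule DERIV_cong[OF lin]) (use \<omega> in algebra)
  show "((\<lambda>t. eigen \<omega> 2 (l t)) has_field_derivative h * eigen \<omega> 3 p) (at 0)"
    unfolding eigen_linear by (rule DERIV_cong[OF lin]) (use \<omega> in algebra)
  show "((\<lambda>t. eigen \<omega> 3 (l t)) has_field_derivative h * eigen \<omega> 4 p) (at 0)"
    unfolding eigen_linear by (rule DERIV_cong[OF lin]) (simp add: algebra_simps)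
qed

lemma X6_plane_chart:
  assumes \<omega>: "\<omega>\<^sup>2 + \<omega> + 1 = 0"
  obtains V \<phi> \<psi> where
    "plane_chart X6 (quotient_foliation Bl3 (cyclic_rel Bl3 T6) (E6 \<omega>)) (chazy_field chazy_VI) V (region R_VI H_VI) \<phi> \<psi>"
proof -
  have w3: "\<omega> ^ 3 = 1" using \<omega> by algebra
  have w0: "\<omega> \<noteq> 0" using w3 by auto
  let ?u = "eigen \<omega> 0" and ?v = "eigen \<omega> 1" and ?w = "eigen \<omega> 2" and ?z = "eigen \<omega> 3"
  let ?O = "region R_VI H_VI" and ?r = "weighted_rel [1, 1, 1]"
  define F where "F p = chazy_coords (?u p) (?v p) (?w p) (?z p)" for p
  have pol: "?u \<in> polyfun 3" "?v \<in> polyfun 3" "?w \<in> polyfun 3" "?z \<in> polyfun 3"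
    by (simp_all add: eigen_polyfun)
  define U where "U = {p. length p = 3 \<and> p ! 0 * p ! 1 * p ! 2 * ?u p * ?v p \<noteq> 0}"
  have U: "affine_open 3 U" unfolding U_def
    by (rule affine_open_basic) (intro polyfun.mult pol coord_polyfun)
  have Uo: "openin (zar (affine_space 3)) U" using U by (simp add: openin_affine)
  have O: "affine_open 2 ?O" by (rule affine_open_region[OF polyfun_VI])
  have FU: "(\<lambda>p. F p ! i) \<in> reg (affine_space 3) U" if "i < 2" for i
    unfolding F_def by (rule reg_chazy_coords[OF U _ pol that]) (simp add: U_def)
  define \<Omega> where "\<Omega> = {p \<in> U. F p \<in> ?O}"
  have \<Omega>: "affine_open 3 \<Omega>"
    using open_preimage[OF ringed_affine_space Uo, of F 2] FU O by (simp add: openin_affine \<Omega>_def F_def)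
  have \<Omega>o: "openin (zar (affine_space 3)) \<Omega>" using \<Omega> by (simp add: openin_affine)
  have F\<Omega>: "(\<lambda>p. F p ! i) \<in> reg (affine_space 3) \<Omega>" if "i < 2" for i
    by (rule ringed_restrict[OF ringed_affine_space Uo FU[OF that] \<Omega>o]) (auto simp: \<Omega>_def)
  have \<Omega>D: "p \<in> torus" "?u p \<noteq> 0" "?v p \<noteq> 0" "F p \<in> ?O" "length p = 3" if "p \<in> \<Omega>" for p
    using that by (simp_all add: \<Omega>_def U_def torus_def)
  have \<Omega>I: "p \<in> \<Omega>" if "p \<in> torus" "?u p \<noteq> 0" "?v p \<noteq> 0" "F p \<in> ?O" for p
    using that by (simp add: \<Omega>_def U_def torus_def)
  have \<Omega>t: "\<Omega> \<subseteq> torus" using \<Omega>D(1) by blast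
  then have \<Omega>S: "\<Omega> \<subseteq> punctured 3" using torus_punctured by blast
  have ex3: "\<exists>x y z. p = [x, y, z]" if "p \<in> \<Omega>" for p using \<Omega>D(5)[OF that] by (simp add: length_3)
  have inv: "p' \<in> \<Omega> \<and> F p' = F p" if r: "(p, p') \<in> ?r" and p: "p \<in> \<Omega>" for p p'
  proof -
    obtain x y z where e: "p = [x, y, z]" using ex3[OF p] by blast
    obtain c where c: "c \<noteq> 0" "p' = [c * x, c * y, c * z]" using r unfolding weighted_rel_111 by (auto simp: e)
    have F: "F p' = F p" unfolding F_def c(2) e eigen_scale using chazy_coords_scale[of "c ^ 3" 1] c(1) by simp
    have "p' \<in> \<Omega>"
      by (rule \<Omega>I; (unfold F)?) (use \<Omega>D[OF p] c torus_scale(1)[OF r] in \<open>simp_all add: e eigen_scale\<close>)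
    with F show ?thesis by simp
  qed
  obtain \<Phi> where \<Phi>: "\<And>y. length (\<Phi> y) = 2" "\<And>p. p \<in> \<Omega> \<Longrightarrow> \<Phi> (class3 p) = F p"
    "\<And>i. i < 2 \<Longrightarrow> (\<lambda>y. \<Phi> y ! i) \<in> reg P2 (class3 ` \<Omega>)" "openin (zar P2) (class3 ` \<Omega>)"
    by (rule orbit_functions[OF affine_open_punctured equiv_111 \<Omega> \<Omega>S inv _ F\<Omega>, folded P2_eq]) (auto simp: F_def)
  define M where "M = {x \<in> points Bl3. blow_down x \<in> class3 ` \<Omega>}"
  have lift: "section_VI \<omega> [s, t, b] \<in> \<Omega> \<and> F (section_VI \<omega> [s, t, b]) = [s, t]"
    if st: "[s, t] \<in> ?O" and b: "b ^ 6 = R_VI [s, t]" for s t b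
  proof -
    have nz: "R_VI [s, t] \<noteq> 0" "H_VI [s, t] \<noteq> 0" using st by (auto simp: region_def)
    have b0: "b \<noteq> 0" using nz(1) b by auto
    let ?s = "section_VI \<omega> [s, t, b]"
    obtain d where d: "d \<noteq> 0" "?s \<in> torus" "?u ?s = d * b ^ 6" "?v ?s = d * b ^ 5" "?w ?s = d * (b ^ 4 * (1 - s))"
      "?z ?s = d * (b ^ 3 * (t + 1 - 3 * s))"
      using section_VI_eigen[OF \<omega> b nz] by blast
    \<comment> \<open>With \<open>r = 1 / b\<close> the four values are \<open>d b^6\<close> times
      \<open>1, r, r^2 m, r^3 n\<close>, so the coordinates are those of
      \<open>1, 1, m, n\<close>.\<close>
    have g: "chazy_coords (d * b ^ 6) (d * b ^ 5) (d * (b ^ 4 * m)) (d * (b ^ 3 * n)) = [1 - m, n + 2 - 3 * m]" for m n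
    proof -
      obtain r where r: "r * b = 1" using b0 by (metis left_inverse)
      have r0: "r \<noteq> 0" using r by auto
      have "b ^ 5 = b ^ 6 * r" "b ^ 4 = b ^ 6 * r ^ 2" "b ^ 3 = b ^ 6 * r ^ 3" using r by algebra+
      then have e: "d * b ^ 5 = d * b ^ 6 * (r * 1)" "d * (b ^ 4 * m) = d * b ^ 6 * (r ^ 2 * m)" "d * (b ^ 3 * n) = d * b ^ 6 * (r ^ 3 * n)"
        by simp_all
      have "chazy_coords (d * b ^ 6 * 1) (d * b ^ 6 * (r * 1)) (d * b ^ 6 * (r ^ 2 * m)) (d * b ^ 6 * (r ^ 3 * n)) = chazy_coords 1 1 m n"
        by (rule chazy_coords_scale) (use b0 d(1) r0 in simp_all)
      then have "chazy_coords (d * b ^ 6) (d * b ^ 5) (d * (b ^ 4 * m)) (d * (b ^ 3 * n)) = chazy_coords 1 1 m n"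
        unfolding e(1-3) by simp
      also have "\<dots> = [1 - m, n + 2 - 3 * m]" by (simp add: chazy_coords_def)
      finally show ?thesis .
    qed
    have F: "F ?s = [s, t]" unfolding F_def d(3-6) g by simp
    have "?s \<in> \<Omega>" by (rule \<Omega>I; (unfold F d)?) (use d b0 st in simp_all)
    with F show ?thesis by simp
  qed
  have e2: "\<exists>s t. F p = [s, t]" for p by (simp add: F_def chazy_coords_def)
  have inF: "(?u p / ?v p) ^ 6 = R_VI (F p)" if p: "p \<in> \<Omega>" for p
  proof -
    obtain s t where st: "F p = [s, t]" using e2 by blast
    show ?thesis using section_VI_return(1)[OF \<omega> \<Omega>D(1-3)[OF p] st[unfolded F_def]] unfolding st by simp
  qed
  have \<kappa>M: "lift6 p \<in> M" if p: "p \<in> \<Omega>" for p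
    using graph_point_torus[OF \<Omega>D(1)[OF p]] blow_down_lift6[OF \<Omega>D(1)[OF p]] p unfolding M_def points_Bl3 by auto
  show thesis
  proof (rule cyclic_plane_chart[where X = Bl3 and T = T6 and k = 6 and M = M and \<Phi> = "\<lambda>x. \<Phi> (blow_down x)" and \<Omega> = \<Omega> and n = 3
        and \<kappa> = lift6 and F = F and \<O> = ?O and \<sigma> = "section_VI \<omega>" and R = R_VI and \<tau> = rotate6 and B = "\<lambda>p. ?u p / ?v p"
        and \<zeta> = "- \<omega>" and D = "chazy_field chazy_VI" and \<delta> = "field3 \<omega>" and E = "E6 \<omega>"])
    show "ringed Bl3" "irreducible_variety Bl3" by (fact ringed_Bl3 irreducible_Bl3)+
    show "T6 y \<in> points Bl3" "(T6 ^^ 6) y = y" if "y \<in> points Bl3" for y by (fact T6_points[OF that])+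
    show "openin (zar Bl3) M" unfolding M_def by (rule morphism_open[OF morphism_blow_down \<Phi>(4)])
    show "(\<lambda>x. \<Phi> (blow_down x) ! i) \<in> reg Bl3 M" if "i < 2" for i
      using morphism_reg[OF morphism_blow_down \<Phi>(4) \<Phi>(3)[OF that]] unfolding M_def by (simp add: comp_def)
    show "\<Phi> (blow_down (lift6 p)) = F p" if "p \<in> \<Omega>" for p
      using \<Phi>(2)[OF that] blow_down_lift6[OF \<Omega>D(1)[OF that]] by simp
    show "morphism (subvariety (affine_space 3) \<Omega>) Bl3 lift6" by (rule morphism_lift6[OF \<Omega> \<Omega>t])
    show "\<exists>p\<in>\<Omega>. lift6 p = x" if "x \<in> M" for x
      using that lift6_surj \<Omega>t unfolding M_def by blast
    show "?O \<noteq> {}"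
    proof -
      have "[1, 3] \<in> ?O" by (simp add: region_def R_VI_def H_VI_def Let_def)
      then show ?thesis by blast
    qed
    show "(\<lambda>p. section_VI \<omega> p ! i) \<in> polyfun 3" if "i < 3" for i by (rule section_VI_polyfun[OF that])
    show "rotate6 p \<in> \<Omega> \<and> T6 (lift6 p) = lift6 (rotate6 p) \<and> F (rotate6 p) = F p \<and>
        ?u (rotate6 p) / ?v (rotate6 p) = - \<omega> * (?u p / ?v p)" if p: "p \<in> \<Omega>" for p
    proof -
      obtain x y z where e: "p = [x, y, z]" using ex3[OF p] by blast
      have nz: "x * y * z \<noteq> 0" using \<Omega>D(1)[OF p] by (simp add: torus_def e)
      note r = eigen_rotate6[OF \<omega>, of x y z, folded e]
      have F: "F (rotate6 p) = F p" unfolding F_def r by (rule chazy_coords_scale) (use nz w0 in simp_all)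
      have "rotate6 p \<in> torus" using \<Omega>D(1)[OF p] by (simp add: rotate6_def torus_def)
      then have "rotate6 p \<in> \<Omega>"
        by (rule \<Omega>I; (unfold F r)?) (use \<Omega>D[OF p] nz w0 in simp_all)
      moreover have quot: "c * a / (c * (- \<omega>\<^sup>2 * b)) = - \<omega> * (a / b)" if "c \<noteq> 0" for a b c
      proof -
        have "c * a / (c * (- \<omega>\<^sup>2 * b)) = - (\<omega> ^ 3 * a / (\<omega>\<^sup>2 * b))" using that by (simp add: w3)
        also have "\<dots> = - \<omega> * (a / b)" using w0 by (simp add: power2_eq_square power3_eq_cube)
        finally show ?thesis .
      qed
      have "?u (rotate6 p) / ?v (rotate6 p) = - \<omega> * (?u p / ?v p)" unfolding r(1,2) by (rule quot[OF nz])
      ultimately show ?thesis using F T6_lift6[OF \<Omega>D(1)[OF p]] by blast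
    qed
    show "\<exists>j. x = (- \<omega>) ^ j" if "x ^ 6 = 1" for x
    proof -
      have "(x - 1) * (x - \<omega>) * (x - \<omega>\<^sup>2) * ((x + 1) * (x + \<omega>) * (x + \<omega>\<^sup>2)) = 0" using that \<omega> by algebra
      then consider "x = 1" | "x = \<omega>" | "x = \<omega>\<^sup>2" | "x = - 1" | "x = - \<omega>" | "x = - \<omega>\<^sup>2"
        by (auto simp: eq_neg_iff_add_eq_0)
      then show ?thesis
      proof cases
        case 1
        then show ?thesis by (intro exI[of _ 0]) simp
      next
        case 2
        have "(- \<omega>) ^ 4 = \<omega>" using w3 by algebra
        then show ?thesis using 2 by metis
      next
        case 3
        have "(- \<omega>) ^ 2 = \<omega>\<^sup>2" by simp
        then show ?thesis using 3 by metis
      next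
        case 4
        have "(- \<omega>) ^ 3 = - 1" using w3 by algebra
        then show ?thesis using 4 by metis
      next
        case 5
        then show ?thesis by (intro exI[of _ 1]) simp
      next
        case 6
        have "(- \<omega>) ^ 5 = - \<omega>\<^sup>2" using w3 by algebra
        then show ?thesis using 6 by metis
      qed
    qed
    show "lift6 (section_VI \<omega> [s, t, ?u p / ?v p]) = lift6 p" if p: "p \<in> \<Omega>" "F p = [s, t]" for p s t
    proof -
      obtain k where k: "k \<noteq> 0" "section_VI \<omega> [s, t, ?u p / ?v p] = [k * p ! 0, k * p ! 1, k * p ! 2]"
        using section_VI_return(2)[OF \<omega> \<Omega>D(1-3)[OF p(1)] p(2)[unfolded F_def]] by blast
      have "(p, section_VI \<omega> [s, t, ?u p / ?v p]) \<in> ?r"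
        unfolding weighted_rel_111 using k p(1) \<Omega>S by blast
      from torus_scale(2)[OF this \<Omega>D(1)[OF p(1)]] show ?thesis .
    qed
    show "chazy_field chazy_VI q ! 0 \<noteq> 0" if "q \<in> ?O" for q using that by (auto simp: region_def chazy_field_def)
    show "R_VI q \<noteq> 0" if "q \<in> ?O" for q using that by (auto simp: region_def)
    show "\<exists>c. c \<noteq> 0 \<and> (\<forall>i<2. ((\<lambda>t. F (map2 (\<lambda>a b. a + t * b) p (field3 \<omega> p)) ! i)
         has_field_derivative c * chazy_field chazy_VI (F p) ! i) (at 0))" if p: "p \<in> \<Omega>" for p
    proof -
      obtain x y z where e: "p = [x, y, z]" using ex3[OF p] by blast
      let ?l = "\<lambda>t. map2 (\<lambda>a b. a + t * b) p (field3 \<omega> p)"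
      define h where "h = 1 - \<omega>\<^sup>2"
      have h0: "h \<noteq> 0"
      proof
        assume "h = 0"
        then have "(3::complex) = 0" unfolding h_def using \<omega> by algebra
        then show False by simp
      qed
      note d = eigen_derivatives[OF \<omega> \<Omega>D(5)[OF p], folded h_def]
      have l0: "?l 0 = p" by (simp add: e field3_def)
      have nz: "?u p \<noteq> 0" "h * ?v p \<noteq> 0" using \<Omega>D[OF p] h0 by auto
      \<comment> \<open>The eigenvectors are the derivatives of \<open>?u\<close> only up to powers
        of \<open>h\<close>; inserting these powers is a rescaling of time, which leaves
        \<open>F\<close> unchanged.\<close>
      have Fh: "F q = chazy_coords (?u q) (h * ?v q) (h ^ 2 * ?w q) (h ^ 3 * ?z q)" for q
        using chazy_coords_scale[of 1 h "?u q" "?v q" "?w q" "?z q"] h0 by (simp add: F_def)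
      have d': "((\<lambda>t. h * ?v (?l t)) has_field_derivative h ^ 2 * ?w p) (at 0)"
        "((\<lambda>t. h ^ 2 * ?w (?l t)) has_field_derivative h ^ 3 * ?z p) (at 0)"
        "((\<lambda>t. h ^ 3 * ?z (?l t)) has_field_derivative h ^ 4 * eigen \<omega> 4 p) (at 0)"
        by (rule DERIV_cong[OF DERIV_cmult[OF d(2)]] DERIV_cong[OF DERIV_cmult[OF d(3)]] DERIV_cong[OF DERIV_cmult[OF d(4)]],
            simp add: power2_eq_square power3_eq_cube power4_eq_xxxx)+
      have g: "u ^ 3 * (h ^ 4 * v4) / (h * v) ^ 4 =
          3 * (u ^ 2 * (h ^ 3 * z) / (h * v) ^ 3) - 2 * (u * (h ^ 2 * w) / (h * v) ^ 2) ^ 2"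
        if "u * v4 = 3 * v * z - 2 * w\<^sup>2" "v \<noteq> 0" for u v w z v4
      proof -
        have "u ^ 3 * (h ^ 4 * v4) / (h * v) ^ 4 = u ^ 2 * (u * v4) / v ^ 4"
          using h0 by (simp add: power_mult_distrib power2_eq_square power3_eq_cube)
        also have "\<dots> = 3 * (u ^ 2 * z / v ^ 3) - 2 * (u * w / v ^ 2) ^ 2"
          unfolding that(1) using that(2) by (simp add: field_simps power2_eq_square power3_eq_cube power4_eq_xxxx)
        also have "u ^ 2 * z / v ^ 3 = u ^ 2 * (h ^ 3 * z) / (h * v) ^ 3"
          using h0 by (simp add: power_mult_distrib)
        also have "u * w / v ^ 2 = u * (h ^ 2 * w) / (h * v) ^ 2"
          using h0 by (simp add: power_mult_distrib)
        finally show ?thesis .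
      qed
      have K: "?u p ^ 3 * (h ^ 4 * eigen \<omega> 4 p) / (h * ?v p) ^ 4 =
          3 * (?u p ^ 2 * (h ^ 3 * ?z p) / (h * ?v p) ^ 3) - 2 * (?u p * (h ^ 2 * ?w p) / (h * ?v p) ^ 2) ^ 2"
        by (rule g[OF eigen_relations(2)[OF \<omega> \<Omega>D(5)[OF p]] \<Omega>D(3)[OF p]])
      have dF: "((\<lambda>t. F (?l t) ! i) has_field_derivative - (h * ?v p) / ?u p * chazy_field chazy_VI (F p) ! i) (at 0)" if "i < 2" for i
        unfolding Fh
        by (rule chazy_coords_derivative[where P = chazy_VI and K = "\<lambda>m n. 3 * n - 2 * m\<^sup>2", OF d(1) d' _ _ _ _ nz chazy_VI_relation K that])
          (simp_all only: l0)
      have "- (h * ?v p) / ?u p \<noteq> 0" using nz by (metis divide_eq_0_iff neg_equal_0_iff_equal)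
      then show ?thesis using dF by blast
    qed
    show "w f (lift6 p) * dir_deriv (g \<circ> lift6) p (field3 \<omega> p) = w g (lift6 p) * dir_deriv (f \<circ> lift6) p (field3 \<omega> p)"
      if "w \<in> E6 \<omega> V" "p \<in> \<Omega>" "lift6 p \<in> V" "openin (zar Bl3) N" "lift6 p \<in> N" "f \<in> reg Bl3 N" "g \<in> reg Bl3 N" for V w p N f g
      by (rule E6_parallel[OF \<omega> that(1) _ that(3-7)]) (use that(2) \<Omega>t in blast)
    show "\<exists>V w. openin (zar Bl3) V \<and> lift6 p \<in> V \<and> w \<in> E6 \<omega> V \<and>
      (\<forall>N f. openin (zar Bl3) N \<and> lift6 p \<in> N \<and> f \<in> reg Bl3 N \<longrightarrow> w f (lift6 p) = dir_deriv (f \<circ> lift6) p (field3 \<omega> p))"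
      if p: "p \<in> \<Omega>" for p
    proof (intro exI conjI allI impI)
      show "openin (zar Bl3) torus_Bl3" by (rule open_torus_Bl3)
      show "lift6 p \<in> torus_Bl3"
        using \<kappa>M[OF p] \<Omega>t unfolding M_def torus_Bl3_def by blast
      show "(\<lambda>f. D3 \<omega> (f \<circ> lift_back) \<circ> blow_down) \<in> E6 \<omega> torus_Bl3" by (rule E6_field[OF \<omega>])
      show "(D3 \<omega> (f \<circ> lift_back) \<circ> blow_down) (lift6 p) = dir_deriv (f \<circ> lift6) p (field3 \<omega> p)" for f
        using D3_lift_back[OF \<Omega>D(1)[OF p]] blow_down_lift6[OF \<Omega>D(1)[OF p]] by simp
    qed
    show "plane_chart X6 (quotient_foliation Bl3 (cyclic_rel Bl3 T6) (E6 \<omega>)) (chazy_field chazy_VI) V ?O \<phi> \<psi> \<Longrightarrow> thesis"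
      for V \<phi> \<psi> by (rule that)
  qed (use \<Phi>(1) \<Omega> \<Omega>D(4) O polyfun_VI plane_field_VI lift inF \<kappa>M in auto)
qed

section \<open>The Chazy foliations and the special quotients\<close>

text \<open>The chart of the desingularization lives over a part \<open>\<O>'\<close> of the region,
  while that of the weighted plane is available over the whole region; it is restricted to
  \<open>\<O>'\<close> so that both share one plane domain and one field.\<close>

lemma desingularization_birational:
  assumes Y: "ringed Y" and c: "plane_chart Y G (chazy_field P) V (region R H) \<phi> \<psi>"
    and P: "(\<lambda>p. P (p ! 0) (p ! 1) (p ! 2)) \<in> polyfun 3" "\<And>c x y z. P (c * x) (c ^ 2 * y) (c ^ 3 * z) = c ^ 4 * P x y z"
    and D: "plane_field (chazy_field P)" and des: "desingularization Y n S \<pi>"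
  shows "birationally_equivalent P123 (equation_foliation P) (subvariety (projective_space n) S)
    (pullback_foliation (subvariety (projective_space n) S) Y \<pi> G)"
proof -
  let ?S = "subvariety (projective_space n) S"
  have S: "ringed ?S" by (intro ringed_subvariety ringed_weighted_space)
  have P123: "ringed P123" by (rule ringed_weighted_space)
  obtain U V' \<rho> where \<pi>: "morphism ?S Y \<pi>" "dense_open ?S U" "dense_open Y V'"
    "inverse_isomorphisms (subvariety ?S U) (subvariety Y V') \<pi> \<rho>"
    using des unfolding desingularization_def by blast
  obtain \<O>' where \<O>': "\<O>' \<subseteq> region R H" and
    c2: "plane_chart ?S (pullback_foliation ?S Y \<pi> G) (chazy_field P) {x \<in> U. \<pi> x \<in> V} \<O>' (\<phi> \<circ> \<pi>) (\<rho> \<circ> \<psi>)"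
    using plane_chart_pullback[OF S Y D c \<pi>] by blast
  have "q ! 1 \<noteq> 2 * q ! 0 ^ 2" if "q \<in> region R H" for q using that by (auto simp: region_def)
  then obtain V1 \<phi>1 \<psi>1 where "plane_chart P123 (equation_foliation P) (chazy_field P) V1 (region R H) \<phi>1 \<psi>1"
    using equation_plane_chart[OF P plane_chartD(3,5)[OF c] _ D] by blast
  from plane_charts_birational[OF P123 S D plane_chart_restrict[OF P123 this plane_chartD(3)[OF c2] \<O>' plane_chartD(5)[OF c2]] c2]
  show ?thesis .
qed

lemma chazy_polyfun:
  "(\<lambda>p. chazy_IV (p ! 0) (p ! 1) (p ! 2)) \<in> polyfun 3"
  "(\<lambda>p. chazy_V (p ! 0) (p ! 1) (p ! 2)) \<in> polyfun 3"
  "(\<lambda>p. chazy_VI (p ! 0) (p ! 1) (p ! 2)) \<in> polyfun 3"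
  unfolding chazy_IV_def chazy_V_def chazy_VI_def
  by (intro polyfun.add polyfun.mult polyfun_diff polyfun_power polyfun.const coord_polyfun)+

lemma chazy_homogeneous:
  "chazy_IV (c * x) (c ^ 2 * y) (c ^ 3 * z) = c ^ 4 * chazy_IV x y z"
  "chazy_V (c * x) (c ^ 2 * y) (c ^ 3 * z) = c ^ 4 * chazy_V x y z"
  "chazy_VI (c * x) (c ^ 2 * y) (c ^ 3 * z) = c ^ 4 * chazy_VI x y z"
  by (simp_all add: chazy_IV_def chazy_V_def chazy_VI_def power2_eq_square power3_eq_cube power4_eq_xxxx algebra_simps)

theorem theorem4:
  fixes \<omega> :: complex
  assumes "\<omega> ^ 3 = 1" and "\<omega> \<noteq> 1"
  shows "(\<forall>n S \<pi>. minimal_desingularization X3 n S \<pi> \<longrightarrow>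
            birationally_equivalent P123 (equation_foliation chazy_IV)
              (subvariety (projective_space n) S) (F3 \<omega> n S \<pi>)) \<and>
         (\<forall>n S \<pi>. minimal_desingularization X4 n S \<pi> \<longrightarrow>
            birationally_equivalent P123 (equation_foliation chazy_V)
              (subvariety (projective_space n) S) (F4 n S \<pi>)) \<and>
         (\<forall>n S \<pi>. minimal_desingularization X6 n S \<pi> \<longrightarrow>
            birationally_equivalent P123 (equation_foliation chazy_VI)
              (subvariety (projective_space n) S) (F6 \<omega> n S \<pi>))"
proof -
  have "(\<omega> - 1) * (\<omega>\<^sup>2 + \<omega> + 1) = 0" using assms(1) by algebra
  then have \<omega>: "\<omega>\<^sup>2 + \<omega> + 1 = 0" using assms(2) by simp
  show ?thesis unfolding minimal_desingularization_def F3_def F4_def F6_def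
  proof (intro conjI allI impI; elim conjE)
    fix n S \<pi> assume d: "desingularization X3 n S \<pi>"
    show "birationally_equivalent P123 (equation_foliation chazy_IV) (subvariety (projective_space n) S)
      (pullback_foliation (subvariety (projective_space n) S) X3 \<pi> (quotient_foliation P2 (cyclic_rel P2 T3) (E3 \<omega>)))"
      using X3_plane_chart[OF \<omega>] desingularization_birational[OF ringed_quotient_variety[OF ringed_P2] _ chazy_polyfun(1)
          chazy_homogeneous(1) plane_field_IV d] by metis
  next
    fix n S \<pi> assume d: "desingularization X4 n S \<pi>"
    show "birationally_equivalent P123 (equation_foliation chazy_V) (subvariety (projective_space n) S)
      (pullback_foliation (subvariety (projective_space n) S) X4 \<pi> (quotient_foliation P1P1 (cyclic_rel P1P1 T4) E4))"
      using X4_plane_chart desingularization_birational[OF ringed_quotient_variety[OF ringed_biprojective_space] _ chazy_polyfun(2)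
          chazy_homogeneous(2) plane_field_V d] by metis
  next
    fix n S \<pi> assume d: "desingularization X6 n S \<pi>"
    show "birationally_equivalent P123 (equation_foliation chazy_VI) (subvariety (projective_space n) S)
      (pullback_foliation (subvariety (projective_space n) S) X6 \<pi> (quotient_foliation Bl3 (cyclic_rel Bl3 T6) (E6 \<omega>)))"
      using X6_plane_chart[OF \<omega>] desingularization_birational[OF ringed_quotient_variety[OF ringed_Bl3] _ chazy_polyfun(3)
          chazy_homogeneous(3) plane_field_VI d] by metis
  qed
qed

end
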